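(* Let $m\ge 1$, $\omega=(\omega_1,\dots,\omega_m)\in\mathbb{R}^m$, $\gamma_0\in\mathbb{R}$, and consider the mapping $$M:\quad \theta_1=\theta+\gamma_0+f(\theta,r),\qquad r_1=r+g(\theta,r),$$ where $f(\theta,r)$ and $g(\theta,r)$ are real analytic in a neighborhood of $r=0$, quasi-periodic in $\theta$ with frequency $\omega$, and $f(\theta,0)=g(\theta,0)=0$. Assume that $M$ is reversible with respect to the involution $G:(\theta,r)\mapsto(-\theta,r)$, i.e. $GMG=M^{-1}$, and that there are constants $c_0>0$, $\sigma>0$ such that $$\left|\frac{\langle k,\omega\rangle\gamma_0}{2\pi}-j\right|\ge\frac{c_0}{|k|^\sigma}\qquad\text{for all }k\in\mathbb{Z}^m\setminus\{0\},\ j\in\mathbb{Z}.$$ If there exists a formal change of variables $$U:\quad \theta=\xi+u(\xi,\eta),\qquad r=\eta+v(\xi,\eta),$$ with $u,v$ quasi-periodic in $\xi$, which transforms $M$ into the linearized form $$U^{-1}MU:\quad \xi_1=\xi+\gamma_0,\qquad \eta_1=\eta,$$ then there exists a real analytic convergent change of variables which transforms $M$ into the linearized form $(\xi,\eta)\mapsto(\xi+\gamma_0,\eta)$ and which commutes with $G$.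
   Context: Quasi-periodicity: a real analytic function $f(\theta,r)$ is quasi-periodic in $\theta$ with frequency $\omega=(\omega_1,\dots,\omega_m)$ if $f(\theta,r)=F(\omega_1\theta,\dots,\omega_m\theta,r)$ for a real analytic function $F(\theta_1,\dots,\theta_m,r)$ that is $2\pi$-periodic in each $\theta_i$; equivalently $f=\sum_{k}\sum_{j\in\mathbb{Z}^m}f_{kj}e^{i\langle j,\omega\rangle\theta}r^k$ with $\overline{f_{kj}}=f_{k(-j)}$. Formal change of variables: an invertible transformation $\theta=\xi+u(\xi,\eta)$, $r=\eta+v(\xi,\eta)$ in which $u,v$ are formal power series $\sum_{k\ge1}\Phi_k(\xi)\eta^k$ in $\eta$, the coefficients $\Phi_k(\xi)=\sum_{j\in\mathbb{Z}^m}\chi_{kj}e^{i\langle j,\omega\rangle\xi}$ (with $\overline{\chi_{kj}}=\chi_{k(-j)}$) being real analytic and quasi-periodic in $\xi$ with frequency $\omega$; no convergence of the series in $\eta$ is required. The identity $U^{-1}MU=(\xi+\gamma_0,\eta)$ is understood as an identity of formal series in $\eta$. Real analytic convergent change of variables: a transformation of the same form for which $u,v$ are convergent, i.e. real analytic functions in a neighborhood of $\eta=0$, quasi-periodic in $\xi$ with frequency $\omega$. A transformation $T$ commutes with $G$ if $GT=TG$. *)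

theory Defs
  imports "HOL-Analysis.Analysis"
begin

section \<open>Real analytic functions of several variables\<close>

text \<open>
  A multi-index assigns an exponent to each vector of the standard basis (extensionally, so that
  every monomial occurs exactly once). The unordered sum \<^const>\<open>has_sum\<close> expresses
  unconditional, equivalently absolute, convergence of the power series.
\<close>

definition real_analytic_at :: "('a::euclidean_space \<Rightarrow> real) \<Rightarrow> 'a \<Rightarrow> bool" where
  "real_analytic_at F a \<longleftrightarrow>
     (\<exists>(c :: ('a \<Rightarrow> nat) \<Rightarrow> real) e. e > 0 \<and>
        (\<forall>x. dist x a < e \<longrightarrow>
           ((\<lambda>\<alpha>. c \<alpha> * (\<Prod>b\<in>Basis. ((x - a) \<bullet> b) ^ \<alpha> b)) has_sum F x)
             (Basis \<rightarrow>\<^sub>E UNIV)))"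

definition real_analytic_on :: "('a::euclidean_space \<Rightarrow> real) \<Rightarrow> 'a set \<Rightarrow> bool" where
  "real_analytic_on F S \<longleftrightarrow> (\<forall>a\<in>S. real_analytic_at F a)"

section \<open>Quasi-periodicity\<close>

definition quasi_periodic :: "real ^ 'm \<Rightarrow> (real \<Rightarrow> real) \<Rightarrow> bool" where
  "quasi_periodic \<omega> \<phi> \<longleftrightarrow>
     (\<exists>\<Phi> :: real ^ 'm \<Rightarrow> real.
        real_analytic_on \<Phi> UNIV \<and>
        (\<forall>x i. \<Phi> (x + axis i (2 * pi)) = \<Phi> x) \<and>
        (\<forall>\<theta>. \<phi> \<theta> = \<Phi> (\<theta> *\<^sub>R \<omega>)))"

text \<open>
  Functions of \<open>(\<theta>, r)\<close>, real analytic in a neighbourhood of \<open>r = 0\<close>. The first argument of \<open>F\<close>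
  lives on a compact torus, so a neighbourhood of \<open>r = 0\<close> may be taken to be a strip \<open>\<bar>r\<bar> < \<rho>\<close>;
  values outside the strip are irrelevant.
\<close>

definition quasi_periodic_near0 :: "real ^ 'm \<Rightarrow> (real \<times> real \<Rightarrow> real) \<Rightarrow> bool" where
  "quasi_periodic_near0 \<omega> f \<longleftrightarrow>
     (\<exists>(F :: (real ^ 'm) \<times> real \<Rightarrow> real) \<rho>. \<rho> > 0 \<and>
        real_analytic_on F (UNIV \<times> {-\<rho><..<\<rho>}) \<and>
        (\<forall>x i r. \<bar>r\<bar> < \<rho> \<longrightarrow> F (x + axis i (2 * pi), r) = F (x, r)) \<and>
        (\<forall>\<theta> r. \<bar>r\<bar> < \<rho> \<longrightarrow> f (\<theta>, r) = F (\<theta> *\<^sub>R \<omega>, r)))"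

section \<open>Mappings near \<open>r = 0\<close>\<close>

type_synonym planar_map = "real \<times> real \<Rightarrow> real \<times> real"

definition perturbed_rotation ::
    "real \<Rightarrow> (real \<times> real \<Rightarrow> real) \<Rightarrow> (real \<times> real \<Rightarrow> real) \<Rightarrow> planar_map" where
  "perturbed_rotation \<gamma> f g = (\<lambda>(\<theta>, r). (\<theta> + \<gamma> + f (\<theta>, r), r + g (\<theta>, r)))"

definition rotation :: "real \<Rightarrow> planar_map" where
  "rotation \<gamma> = (\<lambda>(\<xi>, \<eta>). (\<xi> + \<gamma>, \<eta>))"

definition involution_G :: planar_map where
  "involution_G = (\<lambda>(\<theta>, r). (- \<theta>, r))"

text \<open>
  The maps in question are only defined near \<open>r = 0\<close>, so identities between them hold on some
  strip around \<open>r = 0\<close>. As all of them preserve \<open>r = 0\<close>, the strip can be shrunk until every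
  intermediate point of a composition lies where the maps are analytic.
\<close>

definition eq_near0 :: "planar_map \<Rightarrow> planar_map \<Rightarrow> bool" where
  "eq_near0 A B \<longleftrightarrow> (\<exists>\<rho>>0. \<forall>\<theta> r. \<bar>r\<bar> < \<rho> \<longrightarrow> A (\<theta>, r) = B (\<theta>, r))"

definition inverse_near0 :: "planar_map \<Rightarrow> planar_map \<Rightarrow> bool" where
  "inverse_near0 A B \<longleftrightarrow> eq_near0 (A \<circ> B) id \<and> eq_near0 (B \<circ> A) id"

definition reversible :: "planar_map \<Rightarrow> planar_map \<Rightarrow> bool" where
  "reversible G M \<longleftrightarrow> inverse_near0 M (G \<circ> M \<circ> G)"

definition analytic_near_id :: "real ^ 'm \<Rightarrow> planar_map \<Rightarrow> bool" where
  "analytic_near_id \<omega> T \<longleftrightarrow>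
     (\<exists>u v. T = perturbed_rotation 0 u v \<and>
        quasi_periodic_near0 \<omega> u \<and> quasi_periodic_near0 \<omega> v \<and>
        (\<forall>\<xi>. u (\<xi>, 0) = 0) \<and> (\<forall>\<xi>. v (\<xi>, 0) = 0))"

text \<open>\<open>T\<close> is a convergent change of variables with inverse \<open>W\<close>.\<close>

definition analytic_change :: "real ^ 'm \<Rightarrow> planar_map \<Rightarrow> planar_map \<Rightarrow> bool" where
  "analytic_change \<omega> T W \<longleftrightarrow>
     analytic_near_id \<omega> T \<and> analytic_near_id \<omega> W \<and> inverse_near0 T W"

section \<open>Formal mappings\<close>

text \<open>
  A formal series in \<open>\<eta>\<close> whose coefficients are functions of \<open>\<xi>\<close> is given by the power series
  obtained for each \<open>\<xi>\<close>. A pair \<open>(a, b)\<close> of such series stands for the formal mapping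
  \<open>(\<xi>, \<eta>) \<mapsto> (\<xi> + a(\<xi>, \<eta>), b(\<xi>, \<eta>))\<close>: the first component is the displacement of the angle,
  the second one is the new radius itself.
\<close>

type_synonym formal_series = "real \<Rightarrow> real fps"
type_synonym formal_map = "formal_series \<times> formal_series"

definition angle_deriv :: "nat \<Rightarrow> formal_series \<Rightarrow> formal_series" where
  "angle_deriv n h \<theta> = Abs_fps (\<lambda>k. (deriv ^^ n) (\<lambda>t. fps_nth (h t) k) \<theta>)"

text \<open>
  The formal series \<open>h(\<xi> + a(\<xi>, \<eta>), b(\<xi>, \<eta>))\<close>, assuming \<open>b(\<xi>, 0) = 0\<close>: with \<open>a = a\<^sub>0 + a'\<close>,
  where \<open>a\<^sub>0 = a(\<xi>, 0)\<close>, it is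
  \<open>\<Sum>n. (\<partial>\<^sup>n h / \<partial>\<theta>\<^sup>n)(\<xi> + a\<^sub>0, b) \<cdot> a'\<^sup>n / n!\<close>. As \<open>a'\<^sup>n\<close> is divisible by \<open>\<eta>\<^sup>n\<close>, only the terms
  with \<open>n \<le> N\<close> contribute to the coefficient of \<open>\<eta>\<^sup>N\<close>.
\<close>

definition formal_subst :: "formal_series \<Rightarrow> formal_map \<Rightarrow> formal_series" where
  "formal_subst h B \<xi> =
     (let a = fst B \<xi>; b = snd B \<xi>; a0 = fps_nth a 0
      in Abs_fps (\<lambda>N. \<Sum>n\<le>N.
           fps_nth (fps_const (1 / fact n) * fps_compose (angle_deriv n h (\<xi> + a0)) b
                      * (a - fps_const a0) ^ n) N))"

text \<open>The composition \<open>A \<circ> B\<close>.\<close>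

definition formal_comp :: "formal_map \<Rightarrow> formal_map \<Rightarrow> formal_map" where
  "formal_comp A B =
     ((\<lambda>\<xi>. fst B \<xi> + formal_subst (fst A) B \<xi>), formal_subst (snd A) B)"

definition formal_rotation :: "real \<Rightarrow> formal_map" where
  "formal_rotation \<gamma> = ((\<lambda>\<xi>. fps_const \<gamma>), (\<lambda>\<xi>. fps_X))"

abbreviation formal_id :: formal_map where
  "formal_id \<equiv> formal_rotation 0"

definition taylor_r :: "(real \<times> real \<Rightarrow> real) \<Rightarrow> formal_series" where
  "taylor_r f \<theta> = Abs_fps (\<lambda>k. (deriv ^^ k) (\<lambda>r. f (\<theta>, r)) 0 / fact k)"

text \<open>The formal mapping given by the expansion of \<^term>\<open>perturbed_rotation \<gamma> f g\<close> at \<open>r = 0\<close>.\<close>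

definition formal_perturbed_rotation ::
    "real \<Rightarrow> (real \<times> real \<Rightarrow> real) \<Rightarrow> (real \<times> real \<Rightarrow> real) \<Rightarrow> formal_map" where
  "formal_perturbed_rotation \<gamma> f g =
     ((\<lambda>\<theta>. fps_const \<gamma> + taylor_r f \<theta>), (\<lambda>\<theta>. fps_X + taylor_r g \<theta>))"

definition formal_quasi_periodic :: "real ^ 'm \<Rightarrow> formal_series \<Rightarrow> bool" where
  "formal_quasi_periodic \<omega> u \<longleftrightarrow>
     (\<forall>\<xi>. fps_nth (u \<xi>) 0 = 0) \<and> (\<forall>k\<ge>1. quasi_periodic \<omega> (\<lambda>\<xi>. fps_nth (u \<xi>) k))"

definition formal_near_id :: "real ^ 'm \<Rightarrow> formal_map \<Rightarrow> bool" where
  "formal_near_id \<omega> U \<longleftrightarrow>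
     (\<exists>u v. U = (u, \<lambda>\<xi>. fps_X + v \<xi>) \<and>
        formal_quasi_periodic \<omega> u \<and> formal_quasi_periodic \<omega> v)"

text \<open>\<open>U\<close> is a formal change of variables with inverse \<open>V\<close>.\<close>

definition formal_change :: "real ^ 'm \<Rightarrow> formal_map \<Rightarrow> formal_map \<Rightarrow> bool" where
  "formal_change \<omega> U V \<longleftrightarrow>
     formal_near_id \<omega> U \<and> formal_near_id \<omega> V \<and>
     formal_comp U V = formal_id \<and> formal_comp V U = formal_id"

section \<open>The Diophantine condition\<close>

definition int_inner :: "int ^ 'm \<Rightarrow> real ^ 'm \<Rightarrow> real" where
  "int_inner k \<omega> = (\<Sum>i\<in>UNIV. of_int (k $ i) * \<omega> $ i)"

definition l1_norm :: "int ^ 'm \<Rightarrow> real" where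
  "l1_norm k = (\<Sum>i\<in>UNIV. \<bar>of_int (k $ i)\<bar>)"

definition diophantine :: "real ^ 'm \<Rightarrow> real \<Rightarrow> real \<Rightarrow> real \<Rightarrow> bool" where
  "diophantine \<omega> \<gamma> c \<sigma> \<longleftrightarrow>
     (\<forall>k j. k \<noteq> 0 \<longrightarrow>
        \<bar>int_inner k \<omega> * \<gamma> / (2 * pi) - of_int j\<bar> \<ge> c / l1_norm k powr \<sigma>)"

end

(*
The linearization is obtained by a Newton (KAM) scheme whose homological equations are solved with
the Diophantine condition. At each step the known part agrees with the rotation up to O(r^d), and a
step doubles d; since the means of the error terms would obstruct the step, they have to vanish to
the required order. This is where the formal linearization enters: truncating it at high order gives
an analytic conjugacy of M to the rotation modulo O(r^N) for every N, and this property is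
inherited by every map analytically conjugate to M, so that the means vanish at every step.
The doubling of d pays for the small divisors and the loss of domain, and the scheme converges.

Reversibility: if T linearizes M, so does G T G, hence the two differ by a transformation that
commutes with the irrational rotation, that is, one depending on r only. Normalizing T by such a
factor makes it commute with G.

To apply the scheme, a quasi-periodic analytic function is written as an absolutely convergent
Fourier-Taylor series: derivatives of a periodic analytic function grow like l!/t^l uniformly on the
torus, which gives exponentially decaying Fourier coefficients, and a continuous function on the
torus is determined by its Fourier coefficients. Conversely such series are real analytic.
*)
theory Submission
  imports Defs "HOL-Real_Asymp.Real_Asymp"
begin

text \<open>All estimates use weighted l1 norms of Fourier-Taylor coefficients on a real strip, so
  products, exponentials and compositions are bounded term by term and no complex extension enters.
  Two notions are kept apart: \<open>bnd\<close> measures size, \<open>small\<close> the order in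
  \<open>r\<close>, uniformly in the angle. As the rotation is nonresonant, orbit averages recover
  the coefficients from the values, so order of growth and vanishing of coefficients agree, and
  analytic maps that agree to every order agree on a strip. Hence inverses and the final conjugacy
  are limits in which coefficients stabilise degree by degree under a uniform bound, and identities
  are checked modulo \<open>O(r^N)\<close> for all \<open>N\<close>. Raising the order needs
  \<open>d >= 2\<close>, whereas \<open>M\<close> is the rotation only up to \<open>O(r)\<close>; a
  truncation of the formal change modulo \<open>O(r^2)\<close> supplies the start. In the reversible
  step the factor depending on \<open>r\<close> has two components: the radial one is an involution
  preserving \<open>r > 0\<close> and turns out to be the identity, the angular one is split into
  halves.\<close>

section \<open>Norms on the frequency lattice\<close>

lemma l1_norm_nonneg: "l1_norm k \<ge> 0"
  by (simp add: l1_norm_def sum_nonneg)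

lemma l1_norm_triangle: "l1_norm (k + k') \<le> l1_norm k + l1_norm k'"
  unfolding l1_norm_def sum.distrib[symmetric] by (intro sum_mono) simp

lemma l1_norm_zero [simp]: "l1_norm 0 = 0"
  by (simp add: l1_norm_def)

lemma l1_norm_uminus [simp]: "l1_norm (- k) = l1_norm k"
  by (simp add: l1_norm_def)

lemma int_inner_zero [simp]: "int_inner 0 \<omega> = 0"
  by (simp add: int_inner_def)

lemma int_inner_add: "int_inner (k + k') \<omega> = int_inner k \<omega> + int_inner k' \<omega>"
  by (simp add: int_inner_def sum.distrib algebra_simps)

lemma int_inner_uminus [simp]: "int_inner (- k) \<omega> = - int_inner k \<omega>"
  by (simp add: int_inner_def sum_negf)

definition freq_norm :: "real ^ 'm \<Rightarrow> real" where
  "freq_norm \<omega> = (\<Sum>i\<in>UNIV. \<bar>\<omega> $ i\<bar>)"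

lemma freq_norm_nonneg: "freq_norm \<omega> \<ge> 0"
  by (simp add: freq_norm_def sum_nonneg)

lemma abs_int_inner_le: "\<bar>int_inner k \<omega>\<bar> \<le> freq_norm \<omega> * l1_norm k"
proof -
  have "\<bar>int_inner k \<omega>\<bar> \<le> (\<Sum>i\<in>UNIV. \<bar>of_int (k $ i) * \<omega> $ i\<bar>)"
    unfolding int_inner_def by (rule sum_abs)
  also have "\<dots> = (\<Sum>i\<in>UNIV. \<bar>of_int (k $ i)\<bar> * \<bar>\<omega> $ i\<bar>)"
    by (simp add: abs_mult)
  also have "\<dots> \<le> (\<Sum>i\<in>UNIV. l1_norm k * \<bar>\<omega> $ i\<bar>)"
    unfolding l1_norm_def by (intro sum_mono mult_right_mono member_le_sum) auto
  finally show ?thesis by (simp add: freq_norm_def sum_distrib_left mult.commute)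
qed

section \<open>Weighted Fourier--Taylor series\<close>

definition chi :: "real ^ 'm \<Rightarrow> (int ^ 'm) \<times> nat \<Rightarrow> real \<times> real \<Rightarrow> complex" where
  "chi \<omega> z p = cis (int_inner (fst z) \<omega> * fst p) * of_real (snd p ^ snd z)"

text \<open>Known object: the supremum of \<open>exp (i <k, x>) r^n\<close> over the complex domain
  \<open>|Im x_j| <= s\<close>, \<open>|r| <= \<rho>\<close>. A finite weighted sum therefore
  encodes a bounded analytic extension without mentioning it.\<close>

definition wt :: "real \<Rightarrow> real \<Rightarrow> (int ^ 'm) \<times> nat \<Rightarrow> real" where
  "wt s \<rho> z = exp (s * l1_norm (fst z)) * \<rho> ^ snd z"

text \<open>\<open>C\<close> is any upper bound of the weighted norm, so estimates can be loosened
  freely, and \<open>F\<close> is free off the strip \<open>|snd p| <= \<rho>\<close>, so that germs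
  are carried by total functions. The order \<open>d\<close> is a condition on the coefficients;
  that it can be read off from the values of \<open>F\<close> is proved later under
  nonresonance.\<close>

definition brep :: "real ^ 'm \<Rightarrow> real \<Rightarrow> real \<Rightarrow> nat \<Rightarrow> ((int ^ 'm) \<times> nat \<Rightarrow> complex) \<Rightarrow>
    (real \<times> real \<Rightarrow> complex) \<Rightarrow> real \<Rightarrow> bool" where
  "brep \<omega> s \<rho> d c F C \<longleftrightarrow> 0 \<le> s \<and> 0 < \<rho> \<and> (\<forall>k n. n < d \<longrightarrow> c (k, n) = 0) \<and>
     (\<exists>S\<le>C. ((\<lambda>z. norm (c z) * wt s \<rho> z) has_sum S) UNIV) \<and>
     (\<forall>p. \<bar>snd p\<bar> \<le> \<rho> \<longrightarrow> ((\<lambda>z. c z * chi \<omega> z p) has_sum F p) UNIV)"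

definition bnd :: "real ^ 'm \<Rightarrow> real \<Rightarrow> real \<Rightarrow> nat \<Rightarrow> (real \<times> real \<Rightarrow> complex) \<Rightarrow> real \<Rightarrow> bool" where
  "bnd \<omega> s \<rho> d F C \<longleftrightarrow> (\<exists>c. brep \<omega> s \<rho> d c F C)"

lemma wt_pos: "\<rho> > 0 \<Longrightarrow> wt s \<rho> z > 0"
  by (simp add: wt_def)

lemma wt_nonneg: "\<rho> > 0 \<Longrightarrow> wt s \<rho> z \<ge> 0"
  by (simp add: wt_def)

lemma wt_add_le: 
  assumes "0 \<le> s" "0 < \<rho>"
  shows "wt s \<rho> (z + z') \<le> wt s \<rho> z * wt s \<rho> z'"
proof -
  have "exp (s * l1_norm (fst z + fst z')) \<le> exp (s * l1_norm (fst z)) * exp (s * l1_norm (fst z'))"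
    unfolding exp_add[symmetric] using mult_left_mono[OF l1_norm_triangle \<open>0 \<le> s\<close>]
    by (auto simp: algebra_simps)
  then show ?thesis unfolding wt_def using assms(2)
    by (auto simp: power_add algebra_simps intro!: mult_left_mono)
qed

lemma chi_add: "chi \<omega> (z + z') p = chi \<omega> z p * chi \<omega> z' p"
  by (simp add: chi_def int_inner_add power_add cis_mult[symmetric] algebra_simps)

lemma norm_chi: "norm (chi \<omega> z p) = \<bar>snd p\<bar> ^ snd z"
  by (simp add: chi_def norm_mult norm_power)

lemma norm_chi_le:
  assumes "0 \<le> s" "\<bar>snd p\<bar> \<le> \<rho>"
  shows "norm (chi \<omega> z p) \<le> wt s \<rho> z"
proof -
  have "1 * \<bar>snd p\<bar> ^ snd z \<le> exp (s * l1_norm (fst z)) * \<rho> ^ snd z"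
    using assms by (intro mult_mono power_mono) (auto simp: l1_norm_nonneg)
  then show ?thesis by (simp add: norm_chi wt_def)
qed

lemma brepD:
  assumes "brep \<omega> s \<rho> d c F C"
  shows "0 \<le> s" "0 < \<rho>" "\<And>k n. n < d \<Longrightarrow> c (k, n) = 0"
    "(\<lambda>z. norm (c z) * wt s \<rho> z) summable_on UNIV"
    "\<And>p. \<bar>snd p\<bar> \<le> \<rho> \<Longrightarrow> ((\<lambda>z. c z * chi \<omega> z p) has_sum F p) UNIV"
  using assms unfolding brep_def by (auto simp: summable_on_def)

lemma bndD: "bnd \<omega> s \<rho> d F C \<Longrightarrow> 0 \<le> s \<and> 0 < \<rho>"
  by (auto simp: bnd_def brep_def)

lemma bnd_const_nonneg: "bnd \<omega> s \<rho> d F C \<Longrightarrow> 0 \<le> C"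
  unfolding bnd_def brep_def 
  by (meson has_sum_nonneg norm_ge_zero order_trans mult_nonneg_nonneg wt_nonneg)

lemma bnd_norm_le:
  assumes "bnd \<omega> s \<rho> d F C" "\<bar>snd p\<bar> \<le> \<rho>"
  shows "norm (F p) \<le> C"
proof -
  obtain c S where c: "brep \<omega> s \<rho> d c F C" and S: "S \<le> C" "((\<lambda>z. norm (c z) * wt s \<rho> z) has_sum S) UNIV"
    using assms(1) unfolding bnd_def brep_def by blast
  have "norm (F p) \<le> S"
    by (rule norm_infsum_le[OF brepD(5)[OF c assms(2)] S(2)])
       (auto simp: norm_mult intro!: mult_left_mono norm_chi_le brepD(1)[OF c] assms(2))
  with S show ?thesis by simp
qed

section \<open>Algebra and composition in the weighted norm\<close>

text \<open>Fubini over the fibres of \<open>z\<close>: weight and multiplier depend on the index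
  through \<open>z i\<close> alone, so a fibre may be summed first, and the triangle inequality
  inside it does not increase the weighted norm. Products, reflections \<open>k \<mapsto> -k\<close>
  and re-expansions are instances.\<close>

lemma collect_fibres:
  fixes a :: "'i \<Rightarrow> 'c :: {real_normed_field, banach}" and z :: "'i \<Rightarrow> 'y"
  assumes w: "\<And>y. 0 < w y" and S: "((\<lambda>i. norm (a i) * w (z i)) has_sum S) I"
  defines "c \<equiv> \<lambda>y. infsum a {i \<in> I. z i = y}"
  shows "\<exists>S'\<le>S. ((\<lambda>y. norm (c y) * w y) has_sum S') UNIV"
    and "((\<lambda>i. a i * m (z i)) has_sum T) I \<Longrightarrow> ((\<lambda>y. c y * m y) has_sum T) UNIV"
proof -
  define Z where "Z y = {i \<in> I. z i = y}" for y
  have re: "((\<lambda>(y, i). f y i) has_sum T) (Sigma UNIV Z) \<longleftrightarrow> ((\<lambda>i. f (z i) i) has_sum T) I"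
    for f :: "'y \<Rightarrow> 'i \<Rightarrow> 'b :: {comm_monoid_add,topological_space}" and T
    by (rule has_sum_reindex_bij_witness[of _ "\<lambda>i. (z i, i)" snd]) (auto simp: Z_def)
  have A: "((\<lambda>(y, i). norm (a i) * w y) has_sum S) (Sigma UNIV Z)"
    using S by (subst re)
  have sm: "(\<lambda>i. norm (a i)) summable_on Z y" for y
  proof -
    have "(\<lambda>i. norm (a i) * w y) summable_on Z y"
      using summable_on_SigmaD1[OF has_sum_imp_summable[OF A], of y] by simp
    then show ?thesis using w[of y] by (subst (asm) summable_on_cmult_left') auto
  qed
  have sa: "(a has_sum c y) (Z y)" for y
    using abs_summable_summable[OF sm] by (simp add: c_def Z_def)
  have B: "((\<lambda>y. infsum (\<lambda>i. norm (a i)) (Z y) * w y) has_sum S) UNIV"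
    by (rule has_sum_SigmaD[OF A]) (auto intro!: has_sum_cmult_left has_sum_infsum sm)
  have le: "norm (c y) * w y \<le> infsum (\<lambda>i. norm (a i)) (Z y) * w y" for y
    unfolding c_def Z_def using norm_infsum_bound[OF sm[of y]] w[of y]
    by (intro mult_right_mono) (auto simp: Z_def)
  have sc: "(\<lambda>y. norm (c y) * w y) summable_on UNIV"
    by (rule summable_on_comparison_test[OF has_sum_imp_summable[OF B] le])
       (simp add: less_imp_le[OF w])
  show "\<exists>S'\<le>S. ((\<lambda>y. norm (c y) * w y) has_sum S') UNIV"
    using has_sum_mono[OF has_sum_infsum[OF sc] B le] has_sum_infsum[OF sc] by blast
  show "((\<lambda>y. c y * m y) has_sum T) UNIV" if "((\<lambda>i. a i * m (z i)) has_sum T) I"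
  proof -
    have "((\<lambda>(y, i). a i * m y) has_sum T) (Sigma UNIV Z)"
      using that by (subst re)
    then show ?thesis
      by (rule has_sum_SigmaD) (auto intro!: has_sum_cmult_left sa)
  qed
qed

text \<open>The index map \<open>z\<close> need not be injective.\<close>

lemma bnd_pushforward:
  fixes a :: "'i \<Rightarrow> complex" and z :: "'i \<Rightarrow> (int ^ 'm) \<times> nat"
  assumes s: "0 \<le> s" and \<rho>: "0 < \<rho>"
    and S: "((\<lambda>i. norm (a i) * wt s \<rho> (z i)) has_sum S) I" "S \<le> C"
    and d: "\<And>i. i \<in> I \<Longrightarrow> a i \<noteq> 0 \<Longrightarrow> d \<le> snd (z i)"
    and F: "\<And>p. \<bar>snd p\<bar> \<le> \<rho> \<Longrightarrow> ((\<lambda>i. a i * chi \<omega> (z i) p) has_sum F p) I"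
  shows "bnd \<omega> s \<rho> d F C"
proof -
  define c where "c y = infsum a {i \<in> I. z i = y}" for y
  have w: "\<And>y. 0 < wt s \<rho> y" by (rule wt_pos[OF \<rho>])
  obtain S' where S': "S' \<le> S" "((\<lambda>y. norm (c y) * wt s \<rho> y) has_sum S') UNIV"
    using collect_fibres(1)[where w = "wt s \<rho>", OF w S(1)] unfolding c_def by blast
  have "brep \<omega> s \<rho> d c F C"
    unfolding brep_def
  proof (intro conjI allI impI)
    show "\<exists>S\<le>C. ((\<lambda>y. norm (c y) * wt s \<rho> y) has_sum S) UNIV"
      using S'(2) order_trans[OF S'(1) S(2)] by blast
    show "((\<lambda>y. c y * chi \<omega> y p) has_sum F p) UNIV" if "\<bar>snd p\<bar> \<le> \<rho>" for p
      unfolding c_def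
      by (rule collect_fibres(2)[where w = "wt s \<rho>", OF w S(1), where m = "\<lambda>y. chi \<omega> y p"]) (rule F[OF that])
    show "c (k, n) = 0" if "n < d" for k n
      unfolding c_def by (rule infsum_0) (use d that in fastforce)
  qed (rule s \<rho>)+
  then show ?thesis unfolding bnd_def by blast
qed

text \<open>A series of functions is a double series over \<open>(j, z)\<close>, pushed forward
  along the projection to \<open>z\<close>. It reduces the exponential and the composition to their
  single terms.\<close>

lemma bnd_has_sum:
  fixes F :: "'j \<Rightarrow> real \<times> real \<Rightarrow> complex"
  assumes "0 \<le> s" "0 < \<rho>"
    and b: "\<And>j. j \<in> J \<Longrightarrow> bnd \<omega> s \<rho> d (F j) (C j)"
    and C: "(C has_sum S) J" "S \<le> C'"
    and F: "\<And>p. \<bar>snd p\<bar> \<le> \<rho> \<Longrightarrow> ((\<lambda>j. F j p) has_sum G p) J"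
  shows "bnd \<omega> s \<rho> d G C'"
proof -
  obtain c where c: "\<And>j. j \<in> J \<Longrightarrow> brep \<omega> s \<rho> d (c j) (F j) (C j)"
    using b unfolding bnd_def by metis
  have "\<exists>S. \<forall>j\<in>J. S j \<le> C j \<and> ((\<lambda>z. norm (c j z) * wt s \<rho> z) has_sum S j) UNIV"
    using c unfolding brep_def by (intro bchoice) blast
  then obtain N where N: "\<And>j. j \<in> J \<Longrightarrow> N j \<le> C j" 
      "\<And>j. j \<in> J \<Longrightarrow> ((\<lambda>z. norm (c j z) * wt s \<rho> z) has_sum N j) UNIV"
    by blast
  have Npos: "N j \<ge> 0" if "j \<in> J" for j
    using N(2)[OF that] by (rule has_sum_nonneg) (simp add: wt_nonneg assms(2))
  have sN: "N summable_on J"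
    by (rule summable_on_comparison_test[OF has_sum_imp_summable[OF C(1)]]) (auto intro: N Npos)
  have sm: "(\<lambda>(j, z). norm (c j z) * wt s \<rho> z) summable_on (J \<times> UNIV)"
    by (rule summable_on_SigmaI[where g = N]) (auto intro: N sN simp: wt_nonneg assms(2))
  have "((\<lambda>(j, z). norm (c j z) * wt s \<rho> z) has_sum (infsum N J)) (J \<times> UNIV)"
    by (rule has_sum_SigmaI[where g = N]) (auto intro: N has_sum_infsum sN sm)
  moreover have "infsum N J \<le> C'"
    using has_sum_mono[OF has_sum_infsum[OF sN] C(1) N(1)] C(2) by simp
  moreover have "((\<lambda>(j, z). c j z * chi \<omega> z p) has_sum G p) (J \<times> UNIV)" if "\<bar>snd p\<bar> \<le> \<rho>" for p
  proof (rule has_sum_SigmaI[where g = "\<lambda>j. F j p"])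
    show "(\<lambda>(j, z). c j z * chi \<omega> z p) summable_on J \<times> UNIV"
      by (rule abs_summable_summable[OF Infinite_Sum.abs_summable_on_comparison_test'[OF sm]])
         (auto simp: norm_mult intro!: mult_left_mono norm_chi_le assms(1) that)
  qed (use brepD(5)[OF c] that F in auto)
  moreover have "d \<le> snd z" if "j \<in> J" "c j z \<noteq> 0" for j z
    using brepD(3)[OF c[OF that(1)], of "snd z" "fst z"] that(2) by (auto simp: not_less[symmetric])
  ultimately show ?thesis
    by (intro bnd_pushforward[where a = "\<lambda>(j, z). c j z" and z = snd and I = "J \<times> UNIV"
          and S = "infsum N J"] assms)
       (auto simp: case_prod_unfold)
qed

text \<open>Every surviving term carries \<open>r^n\<close> with \<open>n >= d\<close>, so shrinking
  the radius gains \<open>(\<rho>' / \<rho>)^d\<close>. This factor is what turns order of vanishing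
  into smallness.\<close>

lemma brep_mono:
  assumes "brep \<omega> s \<rho> d c F C" "0 \<le> s'" "s' \<le> s" "0 < \<rho>'" "\<rho>' \<le> \<rho>"
  shows "brep \<omega> s' \<rho>' d c F (C * (\<rho>' / \<rho>) ^ d)"
proof -
  note c = brepD[OF assms(1)]
  obtain S where S: "S \<le> C" "((\<lambda>z. norm (c z) * wt s \<rho> z) has_sum S) UNIV"
    using assms(1) unfolding brep_def by blast
  have le: "norm (c z) * wt s' \<rho>' z \<le> norm (c z) * wt s \<rho> z * (\<rho>' / \<rho>) ^ d" for z
  proof (cases "snd z < d")
    case True
    then show ?thesis using c(3)[of "snd z" "fst z"] by simp
  next
    case False
    have "\<rho>' ^ snd z = \<rho> ^ snd z * (\<rho>' / \<rho>) ^ snd z"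
      using c(2) by (simp add: power_divide)
    also have "(\<rho>' / \<rho>) ^ snd z \<le> (\<rho>' / \<rho>) ^ d"
      using False assms c(2) by (intro power_decreasing) auto
    finally have "\<rho>' ^ snd z \<le> \<rho> ^ snd z * (\<rho>' / \<rho>) ^ d"
      using c(2) by simp
    moreover have "exp (s' * l1_norm (fst z)) \<le> exp (s * l1_norm (fst z))"
      using assms by (simp add: mult_right_mono l1_norm_nonneg)
    ultimately have "wt s' \<rho>' z \<le> wt s \<rho> z * (\<rho>' / \<rho>) ^ d"
      using mult_mono[of "exp (s' * l1_norm (fst z))" "exp (s * l1_norm (fst z))"
          "\<rho>' ^ snd z" "\<rho> ^ snd z * (\<rho>' / \<rho>) ^ d"] assms
      unfolding wt_def by (simp add: mult.assoc)
    then show ?thesis by (simp add: mult.assoc mult_left_mono)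
  qed
  have sr: "((\<lambda>z. norm (c z) * wt s \<rho> z * (\<rho>' / \<rho>) ^ d) has_sum S * (\<rho>' / \<rho>) ^ d) UNIV"
    by (rule has_sum_cmult_left[OF S(2)])
  have sl: "(\<lambda>z. norm (c z) * wt s' \<rho>' z) summable_on UNIV"
    by (rule summable_on_comparison_test[OF has_sum_imp_summable[OF sr] le])
       (simp add: wt_nonneg assms)
  have "infsum (\<lambda>z. norm (c z) * wt s' \<rho>' z) UNIV \<le> S * (\<rho>' / \<rho>) ^ d"
    by (rule has_sum_mono[OF has_sum_infsum[OF sl] sr le])
  also have "\<dots> \<le> C * (\<rho>' / \<rho>) ^ d"
    using S(1) assms c(2) by (intro mult_right_mono) auto
  finally show ?thesis
    using c(3,5) assms has_sum_infsum[OF sl] unfolding brep_def by auto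
qed

lemma bnd_scale:
  assumes "bnd \<omega> s \<rho> d F C" "0 \<le> s'" "s' \<le> s" "0 < \<rho>'" "\<rho>' \<le> \<rho>"
  shows "bnd \<omega> s' \<rho>' d F (C * (\<rho>' / \<rho>) ^ d)"
  using assms brep_mono unfolding bnd_def by blast

lemma brep_weaken: "brep \<omega> s \<rho> d c F C \<Longrightarrow> d' \<le> d \<Longrightarrow> C \<le> C' \<Longrightarrow> brep \<omega> s \<rho> d' c F C'"
  unfolding brep_def by (meson order_trans less_le_trans)

lemma bnd_mono:
  assumes "bnd \<omega> s \<rho> d F C" "0 \<le> s'" "s' \<le> s" "0 < \<rho>'" "\<rho>' \<le> \<rho>" "d' \<le> d" "C \<le> C'"
  shows "bnd \<omega> s' \<rho>' d' F C'"
proof -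
  have "bnd \<omega> s' \<rho>' d F (C * (\<rho>' / \<rho>) ^ d)"
    by (rule bnd_scale[OF assms(1-5)])
  moreover have "C * (\<rho>' / \<rho>) ^ d \<le> C * 1"
    using assms bnd_const_nonneg[OF assms(1)] bndD[OF assms(1)]
    by (intro mult_left_mono power_le_one) auto
  ultimately show ?thesis
    using brep_weaken assms unfolding bnd_def by (metis mult.right_neutral order_trans)
qed

lemma bnd_chi:
  assumes "0 \<le> s" "0 < \<rho>" "d \<le> snd z"
  shows "bnd \<omega> s \<rho> d (\<lambda>p. a * chi \<omega> z p) (norm a * wt s \<rho> z)"
  by (rule bnd_pushforward[where a = "\<lambda>_. a" and z = "\<lambda>_. z" and I = "{()}"
        and S = "norm a * wt s \<rho> z"])
     (use assms in \<open>auto intro!: has_sum_finiteI\<close>)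

lemma bnd_const:
  assumes "0 \<le> s" "0 < \<rho>"
  shows "bnd \<omega> s \<rho> 0 (\<lambda>p. a) (norm a)"
  using bnd_chi[OF assms, of 0 "(0, 0)" \<omega> a] by (simp add: chi_def wt_def)

lemma bnd_snd:
  assumes "0 \<le> s" "0 < \<rho>"
  shows "bnd \<omega> s \<rho> 1 (\<lambda>p. of_real (snd p)) \<rho>"
  using bnd_chi[OF assms, of 1 "(0, 1)" \<omega> 1] by (simp add: chi_def wt_def)

lemma bnd_add:
  assumes "bnd \<omega> s \<rho> d F C" "bnd \<omega> s \<rho> d G C'"
  shows "bnd \<omega> s \<rho> d (\<lambda>p. F p + G p) (C + C')"
  by (rule bnd_has_sum[where J = "UNIV :: bool set" and F = "\<lambda>b. if b then F else G"
        and C = "\<lambda>b. if b then C else C'" and S = "C + C'"])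
     (use assms bndD[OF assms(1)] in \<open>auto intro!: has_sum_finiteI simp: UNIV_bool\<close>)

lemma has_sum_times:
  fixes f :: "'a \<Rightarrow> 'c :: {real_normed_field, banach}"
  assumes "(\<lambda>x. norm (f x)) summable_on A" "(\<lambda>y. norm (g y)) summable_on B" "(f has_sum S) A" "(g has_sum T) B"
  shows "((\<lambda>(x, y). f x * g y) has_sum S * T) (A \<times> B)"
proof (rule has_sum_SigmaI[where g = "\<lambda>x. f x * T"])
  have "(\<lambda>(x, y). norm (f x) * norm (g y)) summable_on A \<times> B"
    by (rule summable_on_SigmaI[where g = "\<lambda>x. norm (f x) * infsum (\<lambda>y. norm (g y)) B"])
       (use assms(1,2) in \<open>auto intro!: has_sum_cmult_right has_sum_infsum summable_on_cmult_left\<close>)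
  then have "(\<lambda>p. norm (case p of (x, y) \<Rightarrow> f x * g y)) summable_on A \<times> B"
    by (simp add: case_prod_unfold norm_mult)
  then show "(\<lambda>(x, y). f x * g y) summable_on A \<times> B"
    by (rule abs_summable_summable)
qed (use assms in \<open>auto intro!: has_sum_cmult_right has_sum_cmult_left\<close>)

text \<open>The Banach algebra property: the weight is submultiplicative by the triangle inequality
  for \<open>l1_norm\<close>, and a product of characters is the character of the summed index, so
  the convolution of coefficients is a pushforward along addition.\<close>

lemma bnd_mult:
  assumes "bnd \<omega> s \<rho> d F C" "bnd \<omega> s \<rho> d' G C'"
  shows "bnd \<omega> s \<rho> (d + d') (\<lambda>p. F p * G p) (C * C')"
proof -
  obtain c S where c: "brep \<omega> s \<rho> d c F C" and S: "S \<le> C" "((\<lambda>z. norm (c z) * wt s \<rho> z) has_sum S) UNIV"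
    using assms(1) unfolding bnd_def brep_def by blast
  obtain c' S' where c': "brep \<omega> s \<rho> d' c' G C'"
    and S': "S' \<le> C'" "((\<lambda>z. norm (c' z) * wt s \<rho> z) has_sum S') UNIV"
    using assms(2) unfolding bnd_def brep_def by blast
  have sr: "0 \<le> s" "0 < \<rho>" using brepD[OF c] by auto
  note w = wt_nonneg[OF sr(2)]
  have pos: "0 \<le> S" "0 \<le> S'"
    by (rule has_sum_nonneg[OF S(2)] has_sum_nonneg[OF S'(2)]; simp add: w)+
  have prod: "((\<lambda>(z, z'). norm (c z) * wt s \<rho> z * (norm (c' z') * wt s \<rho> z')) has_sum S * S') (UNIV \<times> UNIV)"
    by (rule has_sum_times[OF _ _ S(2) S'(2)])
       (use brepD(4)[OF c] brepD(4)[OF c'] in \<open>simp_all add: norm_mult w\<close>)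
  have le: "norm (c z * c' z') * wt s \<rho> (z + z') \<le> norm (c z) * wt s \<rho> z * (norm (c' z') * wt s \<rho> z')" for z z'
    using mult_left_mono[OF wt_add_le[OF sr, of z z'], of "norm (c z) * norm (c' z')"]
    by (simp add: norm_mult algebra_simps)
  have sm: "(\<lambda>(z, z'). norm (c z * c' z') * wt s \<rho> (z + z')) summable_on (UNIV \<times> UNIV)"
    by (rule summable_on_comparison_test[OF has_sum_imp_summable[OF prod]])
       (use le in \<open>auto simp: w\<close>)
  have "infsum (\<lambda>(z, z'). norm (c z * c' z') * wt s \<rho> (z + z')) (UNIV \<times> UNIV) \<le> S * S'"
    by (rule has_sum_mono[OF has_sum_infsum[OF sm] prod]) (use le in auto)
  also have "\<dots> \<le> C * C'"
    using S(1) S'(1) pos by (intro mult_mono) auto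
  finally have le2: "infsum (\<lambda>(z, z'). norm (c z * c' z') * wt s \<rho> (z + z')) (UNIV \<times> UNIV) \<le> C * C'" .
  have abs: "(\<lambda>z. norm (a z * chi \<omega> z p)) summable_on UNIV"
    if "brep \<omega> s \<rho> e a H D" "\<bar>snd p\<bar> \<le> \<rho>" for a e H D p
    by (rule Infinite_Sum.abs_summable_on_comparison_test'[OF brepD(4)[OF that(1)]])
       (auto simp: norm_mult intro!: mult_left_mono norm_chi_le sr that(2))
  show ?thesis
  proof (rule bnd_pushforward[where a = "\<lambda>(z, z'). c z * c' z'" and z = "\<lambda>(z, z'). z + z'"
          and I = "UNIV \<times> UNIV", OF sr _ le2])
    show "((\<lambda>i. norm (case i of (z, z') \<Rightarrow> c z * c' z') * wt s \<rho> (case i of (z, z') \<Rightarrow> z + z')) has_sum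
        (\<Sum>\<^sub>\<infinity>(z, z')\<in>UNIV \<times> UNIV. norm (c z * c' z') * wt s \<rho> (z + z'))) (UNIV \<times> UNIV)"
      using has_sum_infsum[OF sm] by (simp add: case_prod_unfold)
    show "d + d' \<le> snd (case i of (z, z') \<Rightarrow> z + z')"
      if "(case i of (z, z') \<Rightarrow> c z * c' z') \<noteq> 0" for i
      using that brepD(3)[OF c, of "snd (fst i)" "fst (fst i)"]
        brepD(3)[OF c', of "snd (snd i)" "fst (snd i)"]
      by (cases i) (force simp: not_less[symmetric])
    show "((\<lambda>i. (case i of (z, z') \<Rightarrow> c z * c' z') * chi \<omega> (case i of (z, z') \<Rightarrow> z + z') p)
        has_sum F p * G p) (UNIV \<times> UNIV)" if "\<bar>snd p\<bar> \<le> \<rho>" for p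
      using has_sum_times[OF abs[OF c that] abs[OF c' that] brepD(5)[OF c that] brepD(5)[OF c' that]]
      by (simp add: chi_add case_prod_unfold algebra_simps)
  qed
qed

lemma bnd_cmult:
  assumes "bnd \<omega> s \<rho> d F C"
  shows "bnd \<omega> s \<rho> d (\<lambda>p. a * F p) (norm a * C)"
  using bnd_mult[OF bnd_const assms, of a] bndD[OF assms] by simp

lemma bnd_uminus: "bnd \<omega> s \<rho> d F C \<Longrightarrow> bnd \<omega> s \<rho> d (\<lambda>p. - F p) C"
  using bnd_cmult[of \<omega> s \<rho> d F C "-1"] by simp

lemma bnd_power:
  assumes "bnd \<omega> s \<rho> d F C"
  shows "bnd \<omega> s \<rho> (d * n) (\<lambda>p. F p ^ n) (C ^ n)"
proof (induction n)
  case 0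
  then show ?case using bnd_const[of s \<rho> \<omega> 1] bndD[OF assms] by simp
next
  case (Suc n)
  then show ?case using bnd_mult[OF assms Suc.IH] by simp
qed

lemma has_sum_exp:
  fixes x :: "'a :: {real_normed_field, banach}"
  shows "((\<lambda>n. x ^ n / fact n) has_sum exp x) UNIV"
proof (rule norm_summable_imp_has_sum)
  show "summable (\<lambda>n. norm (x ^ n / fact n))"
    using summable_norm_exp[of x] by (simp add: scaleR_conv_of_real field_simps)
  show "(\<lambda>n. x ^ n / fact n) sums exp x"
    using exp_converges[of x] by (simp add: scaleR_conv_of_real field_simps)
qed

lemma bnd_exp:
  assumes "bnd \<omega> s \<rho> d F C"
  shows "bnd \<omega> s \<rho> 0 (\<lambda>p. exp (F p)) (exp C)"
proof (rule bnd_has_sum[where J = UNIV and F = "\<lambda>n p. F p ^ n / fact n" and C = "\<lambda>n. C ^ n / fact n"])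
  show "bnd \<omega> s \<rho> 0 (\<lambda>p. F p ^ n / fact n) (C ^ n / fact n)" for n
    using bnd_mono[OF bnd_cmult[OF bnd_power[OF assms, of n], of "1 / fact n"]] bndD[OF assms]
    by (simp add: norm_divide)
qed (use bndD[OF assms] in \<open>auto intro: has_sum_exp\<close>)

text \<open>The composition estimate: the displacement of the angle costs width, that of the radius costs
  radius.\<close>

lemma bnd_comp:
  fixes u v :: "real \<times> real \<Rightarrow> real"
  assumes F: "bnd \<omega> s' \<rho>' d F C"
    and u: "bnd \<omega> s \<rho> d1 (\<lambda>p. of_real (u p)) a" and v: "bnd \<omega> s \<rho> d2 (\<lambda>p. of_real (v p)) b"
    and d2: "d2 \<ge> 1"
    and s': "s + freq_norm \<omega> * a \<le> s'" and \<rho>': "\<rho> + b \<le> \<rho>'"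
  shows "bnd \<omega> s \<rho> d (\<lambda>p. F (fst p + \<gamma> + u p, snd p + v p)) C"
proof -
  obtain c S where c: "brep \<omega> s' \<rho>' d c F C" 
    and S: "S \<le> C" "((\<lambda>z. norm (c z) * wt s' \<rho>' z) has_sum S) UNIV"
    using F unfolding bnd_def brep_def by blast
  have sr: "0 \<le> s" "0 < \<rho>" using bndD[OF u] by auto
  have ab: "0 \<le> a" "0 \<le> b" using u v by (auto dest: bnd_const_nonneg)
  define E where "E z p = c z * chi \<omega> z (fst p + \<gamma> + u p, snd p + v p)" for z and p :: "real \<times> real"
  have E: "bnd \<omega> s \<rho> d (E z) (norm (c z) * wt s' \<rho>' z)" for z
  proof (cases "c z = 0")
    \<comment> \<open>Here \<open>snd z\<close> may be below \<open>d\<close>; the zero function is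
      given order \<open>d\<close> through a zero multiple of a monomial of degree
      \<open>d\<close>.\<close>
    case True
    have "E z = (\<lambda>p. 0 * chi \<omega> (0, d) p)" using True by (auto simp: E_def)
    then show ?thesis 
      using True bnd_chi[OF sr, of d "(0,d)" \<omega> 0] by simp
  next
    case False
    define k n where "k = fst z" and "n = snd z"
    define l where "l = int_inner k \<omega>"
    have dn: "d \<le> n" using False brepD(3)[OF c, of n k] by (auto simp: k_def n_def not_less[symmetric])
    have "bnd \<omega> s \<rho> 1 (\<lambda>p. of_real (snd p) + of_real (v p)) (\<rho> + b)"
      by (intro bnd_add bnd_snd sr) (use bnd_mono[OF v, of s \<rho> 1 b] sr d2 in auto)
    from bnd_power[OF this, of n]
    have 1: "bnd \<omega> s \<rho> n (\<lambda>p. (of_real (snd p) + of_real (v p)) ^ n) ((\<rho> + b) ^ n)" by simp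
    \<comment> \<open>The displaced character splits off \<open>exp (i l u)\<close>, whose bound
      \<open>exp (|l| a)\<close> is paid for by the additional width
      \<open>freq_norm \<omega> * a\<close>; the shift by \<open>\<gamma>\<close> contributes a
      unimodular constant.\<close>
    have 2: "bnd \<omega> s \<rho> 0 (\<lambda>p. exp (\<i> * of_real l * of_real (u p))) (exp (norm (\<i> * of_real l) * a))"
      by (rule bnd_exp[OF bnd_cmult[OF u]])
    have 3: "bnd \<omega> s \<rho> 0 (\<lambda>p. c z * cis (l * \<gamma>) * chi \<omega> (k, 0) p) (norm (c z * cis (l * \<gamma>)) * wt s \<rho> (k, 0))"
      by (intro bnd_chi sr) auto
    have "bnd \<omega> s \<rho> (0 + 0 + n) (\<lambda>p. c z * cis (l * \<gamma>) * chi \<omega> (k, 0) p * exp (\<i> * of_real l * of_real (u p))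
        * (of_real (snd p) + of_real (v p)) ^ n) 
        (norm (c z * cis (l * \<gamma>)) * wt s \<rho> (k, 0) * exp (norm (\<i> * of_real l) * a) * (\<rho> + b) ^ n)"
      by (intro bnd_mult 1 2 3)
    also have "(\<lambda>p. c z * cis (l * \<gamma>) * chi \<omega> (k, 0) p * exp (\<i> * of_real l * of_real (u p))
        * (of_real (snd p) + of_real (v p)) ^ n) = E z"
    proof
      fix p
      have "cis (l * \<gamma>) * cis (l * fst p) * exp (\<i> * of_real l * of_real (u p)) = cis (l * (fst p + \<gamma> + u p))"
        unfolding cis_conv_exp by (simp add: exp_add[symmetric] algebra_simps)
      then show "c z * cis (l * \<gamma>) * chi \<omega> (k, 0) p * exp (\<i> * of_real l * of_real (u p))
        * (of_real (snd p) + of_real (v p)) ^ n = E z p"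
        by (simp add: E_def chi_def k_def[symmetric] n_def[symmetric] l_def[symmetric] mult.assoc)
    qed
    finally have "bnd \<omega> s \<rho> n (E z) (norm (c z * cis (l * \<gamma>)) * wt s \<rho> (k, 0) * exp (norm (\<i> * of_real l) * a) * (\<rho> + b) ^ n)"
      by simp
    moreover have "norm (c z * cis (l * \<gamma>)) * wt s \<rho> (k, 0) * exp (norm (\<i> * of_real l) * a) * (\<rho> + b) ^ n
        \<le> norm (c z) * wt s' \<rho>' z"
    proof -
      have "s * l1_norm k + \<bar>l\<bar> * a \<le> s * l1_norm k + freq_norm \<omega> * l1_norm k * a"
        using ab by (intro add_left_mono mult_right_mono) (auto simp: l_def abs_int_inner_le)
      also have "\<dots> = (s + freq_norm \<omega> * a) * l1_norm k" by (simp add: algebra_simps)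
      also have "\<dots> \<le> s' * l1_norm k" using s' by (intro mult_right_mono) (auto simp: l1_norm_nonneg)
      finally have "exp (s * l1_norm k) * exp (\<bar>l\<bar> * a) \<le> exp (s' * l1_norm k)"
        by (simp add: exp_add[symmetric])
      moreover have "(\<rho> + b) ^ n \<le> \<rho>' ^ n" using \<rho>' sr ab by (intro power_mono) auto
      ultimately have "exp (s * l1_norm k) * exp (\<bar>l\<bar> * a) * (\<rho> + b) ^ n \<le> exp (s' * l1_norm k) * \<rho>' ^ n"
        using sr ab by (intro mult_mono) auto
      then show ?thesis
        by (simp add: wt_def norm_mult k_def n_def mult.assoc mult_left_mono)
    qed
    ultimately show ?thesis using dn sr by (auto intro: bnd_mono)
  qed
  show ?thesis
  proof (rule bnd_has_sum[OF sr E S(2,1)])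
    fix p :: "real \<times> real" assume p: "\<bar>snd p\<bar> \<le> \<rho>"
    have "norm (of_real (v p) :: complex) \<le> b" by (rule bnd_norm_le[OF v p])
    then have "\<bar>snd p + v p\<bar> \<le> \<rho>'" using p \<rho>' by simp
    then show "((\<lambda>z. E z p) has_sum F (fst p + \<gamma> + u p, snd p + v p)) UNIV"
      unfolding E_def by (intro brepD(5)[OF c]) simp
  qed
qed

section \<open>Uniqueness of the coefficients\<close>

text \<open>Translation by \<open>\<gamma> \<omega>\<close> on the torus is ergodic. This makes
  Fourier coefficients computable from values along a single orbit.\<close>

definition nonres :: "real ^ 'm \<Rightarrow> real \<Rightarrow> bool" where
  "nonres \<omega> \<gamma> \<longleftrightarrow> (\<forall>k. k \<noteq> 0 \<longrightarrow> cis (int_inner k \<omega> * \<gamma>) \<noteq> 1)"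

lemma has_sum_minus:
  fixes f :: "'a \<Rightarrow> 'b :: real_normed_vector"
  assumes "(f has_sum a) A" "(g has_sum b) A"
  shows "((\<lambda>x. f x - g x) has_sum a - b) A"
  using has_sum_add[OF assms(1), of "\<lambda>x. - g x" "- b"] assms(2) by (simp add: has_sum_uminus)

lemma has_sum_sum':
  fixes f :: "'i \<Rightarrow> 'a \<Rightarrow> 'b :: real_normed_vector"
  assumes "\<And>i. i \<in> I \<Longrightarrow> (f i has_sum S i) A"
  shows "((\<lambda>x. \<Sum>i\<in>I. f i x) has_sum (\<Sum>i\<in>I. S i)) A"
  using assms by (induction I rule: infinite_finite_induct) (auto intro: has_sum_add)

text \<open>Dominated convergence for unordered sums: the limit in \<open>N\<close> is exchanged
  with the net of finite partial sums, which converges uniformly by the Weierstrass test.\<close>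

lemma has_sum_tannery:
  fixes f :: "nat \<Rightarrow> 'a \<Rightarrow> 'c :: banach"
  assumes "\<And>N. (f N has_sum S N) A" "\<And>x. x \<in> A \<Longrightarrow> (\<lambda>N. f N x) \<longlonglongrightarrow> g x"
    and le: "\<And>N x. x \<in> A \<Longrightarrow> norm (f N x) \<le> M x" and M: "M summable_on A"
  shows "S \<longlonglongrightarrow> infsum g A" "(\<lambda>x. norm (g x)) summable_on A"
proof -
  have "norm (g x) \<le> M x" if "x \<in> A" for x
    using LIMSEQ_le_const2[OF tendsto_norm[OF assms(2)[OF that]]] le[OF that] by blast
  then show sg: "(\<lambda>x. norm (g x)) summable_on A"
    by (rule Infinite_Sum.abs_summable_on_comparison_test'[OF M])
  have "uniform_limit UNIV (\<lambda>X N. \<Sum>x\<in>X. f N x) S (finite_subsets_at_top A)"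
    by (rule Weierstrass_m_test_general'[where M = M]) (use assms in auto)
  then show "S \<longlonglongrightarrow> infsum g A"
  proof (rule swap_uniform_limit'[rotated 2])
    show "(sum g \<longlongrightarrow> infsum g A) (finite_subsets_at_top A)"
      using has_sum_infsum[OF abs_summable_summable[OF sg]] by (simp add: has_sum_def)
    show "\<forall>\<^sub>F X in finite_subsets_at_top A. (\<lambda>N. sum (f N) X) \<longlonglongrightarrow> sum g X"
      by (rule eventually_finite_subsets_at_top_weakI) (auto intro!: tendsto_sum assms(2))
  qed auto
qed

definition cesaro :: "complex \<Rightarrow> nat \<Rightarrow> complex" where
  "cesaro q N = (\<Sum>j<N. q ^ j) / of_nat N"

lemma norm_cesaro_le: "norm q \<le> 1 \<Longrightarrow> norm (cesaro q N) \<le> 1"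
proof -
  assume q: "norm q \<le> 1"
  have "norm (\<Sum>j<N. q ^ j) \<le> (\<Sum>j<N. 1)"
    by (rule sum_norm_le) (auto simp: norm_power q power_le_one)
  then show ?thesis by (cases "N = 0") (auto simp: cesaro_def norm_divide divide_simps)
qed

lemma cesaro_tendsto:
  assumes "norm q = 1"
  shows "cesaro q \<longlonglongrightarrow> (if q = 1 then 1 else 0)"
proof (cases "q = 1")
  case True
  have "eventually (\<lambda>N. 1 = cesaro q N) sequentially"
    using eventually_gt_at_top[of 0] by eventually_elim (auto simp: cesaro_def True)
  then show ?thesis using True by (simp add: tendsto_eventually)
next
  case False
  have "norm (cesaro q N) \<le> 2 / norm (1 - q) * (1 / real N)" for N
  proof -
    have "norm (\<Sum>j<N. q ^ j) = norm (1 - q ^ N) / norm (1 - q)"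
      using False by (simp add: sum_gp_strict norm_divide)
    also have "\<dots> \<le> 2 / norm (1 - q)"
      using norm_triangle_ineq4[of 1 "q ^ N"] assms by (intro divide_right_mono) (auto simp: norm_power)
    finally show ?thesis
      by (cases "N = 0") (auto simp: cesaro_def norm_divide field_simps)
  qed
  moreover have "(\<lambda>N. 2 / norm (1 - q) * (1 / real N)) \<longlonglongrightarrow> 2 / norm (1 - q) * 0"
    by (intro tendsto_intros lim_1_over_n)
  ultimately have "cesaro q \<longlonglongrightarrow> 0"
    by (intro Lim_null_comparison[of "cesaro q" "\<lambda>N. 2 / norm (1 - q) * (1 / real N)"] always_eventually) simp_all
  then show ?thesis using False by simp
qed

text \<open>Averaging over the rotation \<open>\<theta> \<mapsto> \<theta> + \<gamma>\<close> isolates one frequency.\<close>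

definition orbit_mean :: "real ^ 'm \<Rightarrow> real \<Rightarrow> int ^ 'm \<Rightarrow> (real \<times> real \<Rightarrow> complex) \<Rightarrow> real \<Rightarrow> real \<Rightarrow> nat \<Rightarrow> complex" where
  "orbit_mean \<omega> \<gamma> k F \<theta> r N = (\<Sum>j<N. cis (- int_inner k \<omega> * (real j * \<gamma>)) * F (\<theta> + real j * \<gamma>, r)) / of_nat N"

lemma norm_orbit_mean_le:
  assumes "\<And>\<theta>. norm (F (\<theta>, r)) \<le> B"
  shows "norm (orbit_mean \<omega> \<gamma> k F \<theta> r N) \<le> B"
proof -
  have "norm (\<Sum>j<N. cis (- int_inner k \<omega> * (real j * \<gamma>)) * F (\<theta> + real j * \<gamma>, r)) \<le> (\<Sum>j<N. B)"
    by (rule sum_norm_le) (auto simp: norm_mult assms)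
  then show ?thesis 
    using order_trans[OF norm_ge_zero assms[of 0]]
    by (cases "N = 0") (auto simp: orbit_mean_def norm_divide divide_simps mult.commute)
qed

text \<open>Twisting by the conjugate character turns each term into a geometric progression in
  \<open>j\<close> with ratio \<open>q z\<close>. By nonresonance its Cesaro means tend to 1 for
  frequency \<open>k\<close> and to 0 otherwise, and dominated convergence sums them; the power
  series of frequency \<open>k\<close> is thus recovered from \<open>F\<close>.\<close>

lemma brep_orbit_mean:
  fixes \<omega> :: "real ^ 'm"
  assumes c: "brep \<omega> s \<rho> d c F C" and nr: "nonres \<omega> \<gamma>" and r: "\<bar>r\<bar> \<le> \<rho>"
  shows "\<exists>L. ((\<lambda>n. c (k, n) * of_real (r ^ n)) has_sum L) UNIV \<and>
    orbit_mean \<omega> \<gamma> k F \<theta> r \<longlonglongrightarrow> cis (int_inner k \<omega> * \<theta>) * L"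
proof -
  note b = brepD[OF c]
  define q where "q z = cis (int_inner (fst z - k) \<omega> * \<gamma>)" for z :: "(int ^ 'm) \<times> nat"
  have q1: "q z = 1 \<longleftrightarrow> fst z = k" for z
    using nr unfolding q_def nonres_def by (cases "fst z = k") auto
  define f where "f N z = c z * chi \<omega> z (\<theta>, r) * cesaro (q z) N" for N z
  define g where "g z = (if fst z = k then c z * chi \<omega> z (\<theta>, r) else 0)" for z
  have S: "(f N has_sum orbit_mean \<omega> \<gamma> k F \<theta> r N) UNIV" for N
  proof -
    have "((\<lambda>z. \<Sum>j<N. cis (- int_inner k \<omega> * (real j * \<gamma>)) * (c z * chi \<omega> z (\<theta> + real j * \<gamma>, r)))
       has_sum (\<Sum>j<N. cis (- int_inner k \<omega> * (real j * \<gamma>)) * F (\<theta> + real j * \<gamma>, r))) UNIV"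
      by (intro has_sum_sum' has_sum_cmult_right b(5)) (auto simp: r)
    from has_sum_divide_const[OF this, of "of_nat N"]
    have "((\<lambda>z. (\<Sum>j<N. cis (- int_inner k \<omega> * (real j * \<gamma>)) * (c z * chi \<omega> z (\<theta> + real j * \<gamma>, r))) / of_nat N)
       has_sum orbit_mean \<omega> \<gamma> k F \<theta> r N) UNIV"
      by (simp add: orbit_mean_def)
    also have "(\<lambda>z. (\<Sum>j<N. cis (- int_inner k \<omega> * (real j * \<gamma>)) * (c z * chi \<omega> z (\<theta> + real j * \<gamma>, r))) / of_nat N) = f N"
    proof
      fix z
      have "cis (- int_inner k \<omega> * (real j * \<gamma>)) * (c z * chi \<omega> z (\<theta> + real j * \<gamma>, r)) =
          c z * chi \<omega> z (\<theta>, r) * q z ^ j" for j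
      proof -
        define A where "A = int_inner (fst z - k) \<omega>"
        have A: "int_inner (fst z) \<omega> = int_inner k \<omega> + A"
          using int_inner_add[of k "fst z - k" \<omega>] by (simp add: A_def)
        have *: "cis (- int_inner k \<omega> * (real j * \<gamma>)) * cis (int_inner (fst z) \<omega> * (\<theta> + real j * \<gamma>)) =
            cis (int_inner (fst z) \<omega> * \<theta>) * cis (real j * (A * \<gamma>))"
          unfolding A by (simp add: cis_mult algebra_simps)
        have "cis (- int_inner k \<omega> * (real j * \<gamma>)) * (c z * chi \<omega> z (\<theta> + real j * \<gamma>, r)) =
            c z * of_real (r ^ snd z) * 
            (cis (- int_inner k \<omega> * (real j * \<gamma>)) * cis (int_inner (fst z) \<omega> * (\<theta> + real j * \<gamma>)))"
          by (simp add: chi_def)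
        also have "\<dots> = c z * of_real (r ^ snd z) * (cis (int_inner (fst z) \<omega> * \<theta>) * cis (real j * (A * \<gamma>)))"
          unfolding * ..
        also have "\<dots> = c z * chi \<omega> z (\<theta>, r) * q z ^ j"
          by (simp add: chi_def q_def A_def[symmetric] Complex.DeMoivre)
        finally show ?thesis .
      qed
      note eq = this
      show "(\<Sum>j<N. cis (- int_inner k \<omega> * (real j * \<gamma>)) * (c z * chi \<omega> z (\<theta> + real j * \<gamma>, r))) / of_nat N = f N z"
        unfolding eq by (simp add: f_def cesaro_def sum_distrib_left)
    qed
    finally show ?thesis .
  qed
  have lim: "(\<lambda>N. f N z) \<longlonglongrightarrow> g z" for z
  proof -
    have "(\<lambda>N. f N z) \<longlonglongrightarrow> c z * chi \<omega> z (\<theta>, r) * (if q z = 1 then 1 else 0)"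
      unfolding f_def by (intro tendsto_mult tendsto_const cesaro_tendsto) (simp add: q_def)
    then show ?thesis by (cases "fst z = k") (simp_all add: g_def q1)
  qed
  have le: "norm (f N z) \<le> norm (c z) * wt s \<rho> z" for N z
  proof -
    have "norm (f N z) \<le> norm (c z) * wt s \<rho> z * 1"
      unfolding f_def norm_mult
      by (intro mult_mono mult_left_mono norm_chi_le norm_cesaro_le b) (auto simp: r q_def wt_nonneg b(2))
    then show ?thesis by simp
  qed
  note T = has_sum_tannery[where f = f and g = g, OF S lim le b(4)]
  have "(g has_sum infsum g UNIV) UNIV"
    by (rule has_sum_infsum[OF abs_summable_summable[OF T(2)]])
  also have "?this \<longleftrightarrow> (g has_sum infsum g UNIV) (range (\<lambda>n. (k, n)))"
    by (rule has_sum_cong_neutral) (auto simp: g_def)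
  also have "\<dots> \<longleftrightarrow> ((\<lambda>n. g (k, n)) has_sum infsum g UNIV) UNIV"
    using has_sum_reindex[of "\<lambda>n. (k, n)" UNIV g "infsum g UNIV"] by (simp add: inj_on_def o_def)
  finally have "((\<lambda>n. cis (- int_inner k \<omega> * \<theta>) * g (k, n)) has_sum cis (- int_inner k \<omega> * \<theta>) * infsum g UNIV) UNIV"
    by (rule has_sum_cmult_right)
  also have "(\<lambda>n. cis (- int_inner k \<omega> * \<theta>) * g (k, n)) = (\<lambda>n. c (k, n) * of_real (r ^ n))"
  proof
    fix n
    have "cis (- int_inner k \<omega> * \<theta>) * cis (int_inner k \<omega> * \<theta>) = 1"
      by (simp add: cis_mult)
    moreover have "cis (- int_inner k \<omega> * \<theta>) * g (k, n) =
        c (k, n) * of_real (r ^ n) * (cis (- int_inner k \<omega> * \<theta>) * cis (int_inner k \<omega> * \<theta>))"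
      by (simp add: g_def chi_def)
    ultimately show "cis (- int_inner k \<omega> * \<theta>) * g (k, n) = c (k, n) * of_real (r ^ n)"
      by simp
  qed
  finally have *: "((\<lambda>n. c (k, n) * of_real (r ^ n)) has_sum cis (- int_inner k \<omega> * \<theta>) * infsum g UNIV) UNIV" .
  have "cis (int_inner k \<omega> * \<theta>) * (cis (- int_inner k \<omega> * \<theta>) * infsum g UNIV) = infsum g UNIV"
    unfolding mult.assoc[symmetric] by (simp add: cis_mult)
  then have "orbit_mean \<omega> \<gamma> k F \<theta> r \<longlonglongrightarrow>
      cis (int_inner k \<omega> * \<theta>) * (cis (- int_inner k \<omega> * \<theta>) * infsum g UNIV)"
    using T(1) by (simp only:)
  with * show ?thesis by (intro exI conjI)
qed

section \<open>Order of vanishing in \<open>r\<close>\<close>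

text \<open>The bound is asked for along a null sequence of nonzero radii and not on an interval,
  because some later uses have it at special radii: images of other radii, or zeros found by the
  intermediate value theorem. Coefficients vanish one after the other, since the lowest one left
  dominates near 0.\<close>

lemma powser_order:
  fixes a :: "nat \<Rightarrow> complex" and X :: "nat \<Rightarrow> real"
  assumes \<rho>: "0 < \<rho>" and sm: "(\<lambda>n. norm (a n) * \<rho> ^ n) summable_on UNIV"
    and P: "\<And>x. \<bar>x\<bar> \<le> \<rho> \<Longrightarrow> ((\<lambda>n. a n * of_real (x ^ n)) has_sum P x) UNIV"
    and X: "X \<longlonglongrightarrow> 0" "\<And>j. X j \<noteq> 0" and le: "\<And>j. norm (P (X j)) \<le> K * \<bar>X j\<bar> ^ N"
    and n: "n < N"
  shows "a n = 0"
  using n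
proof (induction n rule: less_induct)
  case (less n)
  \<comment> \<open>Bound for the tail beyond degree \<open>n\<close>, from
    \<open>(|x| / \<rho>)^m <= (|x| / \<rho>)^(Suc n)\<close> for \<open>m > n\<close> and
    \<open>|x| <= \<rho>\<close>; the lower coefficients are gone by induction.\<close>
  define K' where "K' = infsum (\<lambda>m. norm (a m) * \<rho> ^ m) UNIV / \<rho> ^ Suc n"
  have bd: "norm (P x - a n * of_real (x ^ n)) \<le> K' * \<bar>x\<bar> ^ Suc n" if "\<bar>x\<bar> \<le> \<rho>" for x
  proof -
    have h: "((\<lambda>m. a m * of_real (x ^ m) - (if m = n then a n * of_real (x ^ n) else 0)) 
        has_sum P x - a n * of_real (x ^ n)) UNIV"
      by (intro has_sum_minus P that has_sum_finite_neutralI[of "{n}"]) auto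
    have h2: "((\<lambda>m. norm (a m) * \<rho> ^ m * (\<bar>x\<bar> / \<rho>) ^ Suc n) has_sum
        infsum (\<lambda>m. norm (a m) * \<rho> ^ m) UNIV * (\<bar>x\<bar> / \<rho>) ^ Suc n) UNIV"
      by (intro has_sum_cmult_left has_sum_infsum sm)
    have "norm (P x - a n * of_real (x ^ n)) \<le> infsum (\<lambda>m. norm (a m) * \<rho> ^ m) UNIV * (\<bar>x\<bar> / \<rho>) ^ Suc n"
    proof (rule norm_infsum_le[OF h h2])
      fix m
      consider "m < n" | "m = n" | "m > n" by linarith
      then show "norm (a m * of_real (x ^ m) - (if m = n then a n * of_real (x ^ n) else 0)) \<le>
         norm (a m) * \<rho> ^ m * (\<bar>x\<bar> / \<rho>) ^ Suc n"
      proof cases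
        case 1
        then show ?thesis using less by simp
      next
        case 2
        then show ?thesis using \<rho> by simp
      next
        case 3
        have "\<bar>x\<bar> ^ m = \<rho> ^ m * (\<bar>x\<bar> / \<rho>) ^ m" using \<rho> by (simp add: power_divide)
        also have "\<dots> \<le> \<rho> ^ m * (\<bar>x\<bar> / \<rho>) ^ Suc n"
          using \<rho> that 3 by (intro mult_left_mono power_decreasing) auto
        finally have "norm (a m) * \<bar>x\<bar> ^ m \<le> norm (a m) * (\<rho> ^ m * (\<bar>x\<bar> / \<rho>) ^ Suc n)"
          by (rule mult_left_mono) simp
        then show ?thesis using 3
          by (simp add: norm_mult norm_power mult.assoc)
      qed
    qed
    then show ?thesis by (simp add: K'_def power_divide)
  qed
  have ev: "eventually (\<lambda>j. \<bar>X j\<bar> < min \<rho> 1) sequentially"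
    using tendstoD[OF X(1), of "min \<rho> 1"] \<rho> by simp
  have "eventually (\<lambda>j. norm (a n) \<le> (K' + \<bar>K\<bar>) * \<bar>X j\<bar>) sequentially"
    using ev
  proof eventually_elim
    case (elim j)
    have "norm (a n * of_real (X j ^ n)) \<le> norm (P (X j)) + norm (P (X j) - a n * of_real (X j ^ n))"
      by norm
    also have "\<dots> \<le> \<bar>K\<bar> * \<bar>X j\<bar> ^ N + K' * \<bar>X j\<bar> ^ Suc n"
    proof (rule add_mono)
      show "norm (P (X j)) \<le> \<bar>K\<bar> * \<bar>X j\<bar> ^ N"
        by (rule order_trans[OF le mult_right_mono]) auto
    qed (use bd elim in auto)
    also have "\<dots> \<le> \<bar>K\<bar> * \<bar>X j\<bar> ^ Suc n + K' * \<bar>X j\<bar> ^ Suc n"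
      using elim less.prems by (intro add_right_mono mult_left_mono power_decreasing) auto
    finally have "norm (a n) * \<bar>X j\<bar> ^ n \<le> (K' + \<bar>K\<bar>) * \<bar>X j\<bar> * \<bar>X j\<bar> ^ n"
      by (simp add: norm_mult norm_power algebra_simps)
    then show ?case using X(2)[of j] by simp
  qed
  moreover have "(\<lambda>j. (K' + \<bar>K\<bar>) * \<bar>X j\<bar>) \<longlonglongrightarrow> (K' + \<bar>K\<bar>) * 0"
    by (intro tendsto_intros tendsto_rabs_zero X)
  ultimately have "norm (a n) \<le> 0"
    using tendsto_lowerbound[of "\<lambda>j. (K' + \<bar>K\<bar>) * \<bar>X j\<bar>" 0 sequentially "norm (a n)"] by simp
  then show ?case by simp
qed

text \<open>\<open>O(r^d)\<close> at \<open>r = 0\<close>, uniformly in the angle. Values lie in any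
  normed space, so that maps and their components are treated alike.\<close>

definition small :: "nat \<Rightarrow> (real \<times> real \<Rightarrow> 'a :: real_normed_vector) \<Rightarrow> bool" where
  "small d F \<longleftrightarrow> (\<exists>K \<rho>. 0 < \<rho> \<and> (\<forall>p. \<bar>snd p\<bar> \<le> \<rho> \<longrightarrow> norm (F p) \<le> K * \<bar>snd p\<bar> ^ d))"

lemma brep_slice_summable:
  assumes "brep \<omega> s \<rho> d c F C"
  shows "(\<lambda>n. norm (c (k, n)) * \<rho> ^ n) summable_on UNIV"
proof -
  note b = brepD[OF assms]
  have "(\<lambda>z. norm (c z) * wt s \<rho> z) summable_on range (\<lambda>n. (k, n))"
    by (rule summable_on_subset_banach[OF b(4)]) simp
  then have "(\<lambda>n. norm (c (k, n)) * wt s \<rho> (k, n)) summable_on UNIV"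
    by (subst (asm) summable_on_reindex) (auto simp: inj_on_def o_def)
  then show ?thesis
  proof (rule summable_on_comparison_test)
    show "norm (c (k, n)) * \<rho> ^ n \<le> norm (c (k, n)) * wt s \<rho> (k, n)" for n
      using mult_right_mono[of 1 "exp (s * l1_norm k)" "\<rho> ^ n"] b(1,2)
      by (auto simp: wt_def l1_norm_nonneg intro!: mult_left_mono)
  qed (use b in auto)
qed

lemma brep_small_coeff:
  assumes c: "brep \<omega> s \<rho> d c F C" and nr: "nonres \<omega> \<gamma>" and sm: "small d' F" and n: "n < d'"
  shows "c (k, n) = 0"
proof -
  obtain K \<rho>' where K: "0 < \<rho>'" "\<And>p. \<bar>snd p\<bar> \<le> \<rho>' \<Longrightarrow> norm (F p) \<le> K * \<bar>snd p\<bar> ^ d'"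
    using sm unfolding small_def by blast
  note b = brepD[OF c]
  define P where "P r = infsum (\<lambda>n. c (k, n) * of_real (r ^ n)) UNIV" for r :: real
  have P: "((\<lambda>n. c (k, n) * of_real (r ^ n)) has_sum P r) UNIV"
    and Pm: "orbit_mean \<omega> \<gamma> k F 0 r \<longlonglongrightarrow> P r" if "\<bar>r\<bar> \<le> \<rho>" for r
    using brep_orbit_mean[OF c nr that, of k 0] unfolding P_def by (auto simp: has_sum_iff)
  define X where "X j = min \<rho> \<rho>' / real (Suc j)" for j
  have Xpos: "0 < X j" for j
    using b(2) K(1) by (simp add: X_def)
  have Xle: "X j \<le> min \<rho> \<rho>'" for j
    using divide_left_mono[of 1 "real (Suc j)" "min \<rho> \<rho>'"] b(2) K(1) unfolding X_def by simp
  show ?thesis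
  proof (rule powser_order[where a = "\<lambda>n. c (k, n)" and P = P and X = X, OF b(2) _ P _ _ _ n])
    show "(\<lambda>n. norm (c (k, n)) * \<rho> ^ n) summable_on UNIV"
      by (rule brep_slice_summable[OF c])
    show "X \<longlonglongrightarrow> 0" unfolding X_def
      using tendsto_mult[OF tendsto_const[of "min \<rho> \<rho>'"] LIMSEQ_inverse_real_of_nat] 
      by (simp add: divide_inverse)
    show "norm (P (X j)) \<le> K * \<bar>X j\<bar> ^ d'" for j
    proof (rule LIMSEQ_le_const2[OF tendsto_norm[OF Pm]])
      show "\<exists>N. \<forall>n\<ge>N. norm (orbit_mean \<omega> \<gamma> k F 0 (X j) n) \<le> K * \<bar>X j\<bar> ^ d'"
        using Xpos[of j] Xle[of j] by (intro exI allI impI norm_orbit_mean_le order_trans[OF K(2)]) auto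
    qed (use Xpos[of j] Xle[of j] in auto)
    show "X j \<noteq> 0" for j using Xpos[of j] by simp
  qed auto
qed

text \<open>Growth order forces the low coefficients to vanish, and the same coefficients still
  witness the same \<open>C\<close>: the order is raised at no cost in the estimate.\<close>

lemma bnd_order:
  assumes "bnd \<omega> s \<rho> d F C" "nonres \<omega> \<gamma>" "small d' F"
  shows "bnd \<omega> s \<rho> d' F C"
proof -
  obtain c where c: "brep \<omega> s \<rho> d c F C" using assms(1) unfolding bnd_def by blast
  then have "brep \<omega> s \<rho> d' c F C"
    using brep_small_coeff[OF c assms(2,3)] unfolding brep_def by blast
  then show ?thesis unfolding bnd_def by blast
qed

lemma bnd_norm_le_power:
  assumes "bnd \<omega> s \<rho> d F C" "\<bar>snd p\<bar> \<le> \<rho>"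
  shows "norm (F p) \<le> C * (\<bar>snd p\<bar> / \<rho>) ^ d"
proof (cases "snd p = 0")
  case False
  have "bnd \<omega> s \<bar>snd p\<bar> d F (C * (\<bar>snd p\<bar> / \<rho>) ^ d)"
    using bndD[OF assms(1)] assms(2) False by (intro bnd_scale[OF assms(1)]) simp_all
  from bnd_norm_le[OF this, of p] show ?thesis by simp
next
  \<comment> \<open>Rescaling needs a positive radius, so \<open>r = 0\<close> is read off the
    series: for \<open>d > 0\<close> every term vanishes there.\<close>
  case True
  show ?thesis
  proof (cases "d = 0")
    case True then show ?thesis using bnd_norm_le[OF assms] by simp
  next
    case d: False
    obtain c where c: "brep \<omega> s \<rho> d c F C" using assms(1) unfolding bnd_def by blast
    have z: "c z * chi \<omega> z p = 0" for z
    proof (cases "snd z = 0")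
      case True
      then show ?thesis using brepD(3)[OF c, of 0 "fst z"] d by (metis mult_zero_left not_gr_zero prod.collapse)
    next
      case False
      then show ?thesis using \<open>snd p = 0\<close> by (simp add: chi_def)
    qed
    have "F p = 0"
      using brepD(5)[OF c assms(2)] has_sum_0_simp unfolding z by (rule has_sum_unique)
    then show ?thesis using True d by (simp add: zero_power)
  qed
qed

lemma bnd_small:
  assumes "bnd \<omega> s \<rho> d F C"
  shows "small d F"
  unfolding small_def
proof (intro exI conjI allI impI)
  show "0 < \<rho>" using bndD[OF assms] by simp
  show "norm (F p) \<le> C / \<rho> ^ d * \<bar>snd p\<bar> ^ d" if "\<bar>snd p\<bar> \<le> \<rho>" for p
    using bnd_norm_le_power[OF assms that] by (simp add: power_divide)
qed

lemma bnd_small_all_zero: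
  fixes \<omega> :: "real ^ 'm"
  assumes "bnd \<omega> s \<rho> d F C" "nonres \<omega> \<gamma>" "\<And>N. small N F" "\<bar>snd p\<bar> \<le> \<rho>"
  shows "F p = 0"
proof -
  obtain c where c: "brep \<omega> s \<rho> d c F C" using assms(1) unfolding bnd_def by blast
  have "c z = 0" for z
    using brep_small_coeff[OF c assms(2,3), of "snd z" "Suc (snd z)" "fst z"] by simp
  then have "((\<lambda>z :: (int ^ 'm) \<times> nat. 0 :: complex) has_sum F p) UNIV"
    using brepD(5)[OF c assms(4)] by simp
  then show ?thesis using has_sum_0_simp by (rule has_sum_unique)
qed

lemma bnd_cnj:
  fixes \<omega> :: "real ^ 'm"
  assumes "bnd \<omega> s \<rho> d F C"
  shows "bnd \<omega> s \<rho> d (\<lambda>p. cnj (F p)) C"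
proof -
  obtain c S where c: "brep \<omega> s \<rho> d c F C" and S: "S \<le> C" "((\<lambda>z. norm (c z) * wt s \<rho> z) has_sum S) UNIV"
    using assms unfolding bnd_def brep_def by blast
  note b = brepD[OF c]
  show ?thesis
  proof (rule bnd_pushforward[where a = "\<lambda>z. cnj (c z)" and z = "\<lambda>(k, n). (- k, n)" and I = UNIV, OF b(1,2) _ S(1)])
    show "((\<lambda>i. cmod (cnj (c i)) * wt s \<rho> (case i of (k, n) \<Rightarrow> (- k, n))) has_sum S) UNIV"
      using S(2) by (simp add: wt_def case_prod_unfold)
    show "d \<le> snd (case i of (k, n) \<Rightarrow> (- k, n))" if "cnj (c i) \<noteq> 0" for i
      using that b(3)[of "snd i" "fst i"] by (cases i) (force simp: not_less[symmetric])
    show "((\<lambda>i. cnj (c i) * chi \<omega> (case i of (k, n) \<Rightarrow> (- k, n)) p) has_sum cnj (F p)) UNIV"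
      if "\<bar>snd p\<bar> \<le> \<rho>" for p
    proof -
      have "((\<lambda>i. cnj (c i * chi \<omega> i p)) has_sum cnj (F p)) UNIV"
        using b(5)[OF that] by (subst has_sum_cnj_iff)
      then show ?thesis by (simp add: chi_def case_prod_unfold cis_cnj)
    qed
  qed
qed

abbreviation rbnd :: "real ^ 'm \<Rightarrow> real \<Rightarrow> real \<Rightarrow> nat \<Rightarrow> (real \<times> real \<Rightarrow> real) \<Rightarrow> real \<Rightarrow> bool" where
  "rbnd \<omega> s \<rho> d f C \<equiv> bnd \<omega> s \<rho> d (\<lambda>p. complex_of_real (f p)) C"

lemma bnd_Re:
  assumes "bnd \<omega> s \<rho> d F C"
  shows "rbnd \<omega> s \<rho> d (\<lambda>p. Re (F p)) C"
proof -
  have "bnd \<omega> s \<rho> d (\<lambda>p. (1 / 2) * (F p + cnj (F p))) (norm (1 / 2 :: complex) * (C + C))"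
    by (intro bnd_cmult bnd_add assms bnd_cnj)
  then show ?thesis by (simp add: complex_add_cnj norm_divide)
qed

section \<open>Lipschitz bounds and coefficientwise limits\<close>

lemma norm_cis_diff_le: "norm (cis a - cis b) \<le> \<bar>a - b\<bar>"
proof -
  have "cis a - cis b = cis b * (exp (\<i> * of_real (a - b)) - 1)"
    by (simp add: cis_conv_exp right_diff_distrib exp_add[symmetric] algebra_simps)
  then have "norm (cis a - cis b) = 2 * \<bar>sin ((a - b) / 2)\<bar>"
    using dist_exp_i_1[of "a - b"] by (simp add: norm_mult)
  also have "\<dots> \<le> 2 * \<bar>(a - b) / 2\<bar>"
    by (intro mult_left_mono abs_sin_x_le_abs_x) auto
  finally show ?thesis by simp
qed

lemma abs_power_diff_le:
  fixes x y :: real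
  assumes "\<bar>x\<bar> \<le> R" "\<bar>y\<bar> \<le> R"
  shows "\<bar>x ^ n - y ^ n\<bar> \<le> real n * R ^ (n - 1) * \<bar>x - y\<bar>"
proof (induction n)
  case (Suc n)
  have R: "0 \<le> R" using assms by simp
  have "\<bar>x ^ Suc n - y ^ Suc n\<bar> = \<bar>x * (x ^ n - y ^ n) + y ^ n * (x - y)\<bar>"
    by (simp add: algebra_simps)
  also have "\<dots> \<le> \<bar>x\<bar> * \<bar>x ^ n - y ^ n\<bar> + \<bar>y\<bar> ^ n * \<bar>x - y\<bar>"
    using abs_triangle_ineq[of "x * (x ^ n - y ^ n)" "y ^ n * (x - y)"] by (simp add: abs_mult power_abs)
  also have "\<dots> \<le> R * (real n * R ^ (n - 1) * \<bar>x - y\<bar>) + R ^ n * \<bar>x - y\<bar>"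
    using assms R Suc by (intro add_mono mult_mono mult_right_mono power_mono) auto
  also have "R * (real n * R ^ (n - 1) * \<bar>x - y\<bar>) = real n * R ^ n * \<bar>x - y\<bar>"
    by (cases n) auto
  finally show ?case by (simp add: algebra_simps)
qed simp

lemma nat_le_two_power: "real n \<le> 2 ^ n"
  using of_nat_less_two_power[of n] by (rule less_imp_le)

text \<open>A mean value estimate without derivatives. An angular difference keeps the full order
  \<open>R^d\<close>, a radial one loses a power of \<open>R\<close>. The factors \<open>|l|\<close>
  and \<open>n\<close> that the two differences produce are absorbed by the positive width
  \<open>s\<close> and, via \<open>n <= 2^n\<close>, by halving the radius.\<close>

lemma bnd_lipschitz:
  assumes F: "bnd \<omega> s \<rho> d F C" and s: "0 < s" and d: "d \<ge> 1"
  shows "\<exists>K\<ge>0. \<forall>p p' R. \<bar>snd p\<bar> \<le> R \<longrightarrow> \<bar>snd p'\<bar> \<le> R \<longrightarrow> R \<le> \<rho> / 2 \<longrightarrow>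
    norm (F p - F p') \<le> K * R ^ (d - 1) * (R * \<bar>fst p - fst p'\<bar> + \<bar>snd p - snd p'\<bar>)"
proof -
  obtain c where c: "brep \<omega> s \<rho> d c F C" using F unfolding bnd_def by blast
  note b = brepD[OF c]
  define W where "W = freq_norm \<omega> / s + 1"
  have W: "0 \<le> W" using s freq_norm_nonneg[of \<omega>] by (simp add: W_def)
  define K where "K = infsum (\<lambda>z. norm (c z) * wt s \<rho> z) UNIV * W * (2 / \<rho>) ^ d"
  have K: "0 \<le> K" unfolding K_def using W b(2)
    by (intro mult_nonneg_nonneg infsum_nonneg) (auto simp: wt_nonneg)
  have "norm (F p - F p') \<le> K * R ^ (d - 1) * (R * \<bar>fst p - fst p'\<bar> + \<bar>snd p - snd p'\<bar>)"
    if p: "\<bar>snd p\<bar> \<le> R" "\<bar>snd p'\<bar> \<le> R" "R \<le> \<rho> / 2" for p p' R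
  proof -
    define B where "B = R ^ (d - 1) * (R * \<bar>fst p - fst p'\<bar> + \<bar>snd p - snd p'\<bar>)"
    have R: "0 \<le> R" "R \<le> \<rho>" using p b(2) by auto
    have B: "0 \<le> B" using R by (simp add: B_def)
    have "((\<lambda>z. c z * chi \<omega> z p - c z * chi \<omega> z p') has_sum F p - F p') UNIV"
      using p R by (intro has_sum_minus b(5)) auto
    moreover have "((\<lambda>z. norm (c z) * wt s \<rho> z * (W * (2 / \<rho>) ^ d * B)) has_sum
        infsum (\<lambda>z. norm (c z) * wt s \<rho> z) UNIV * (W * (2 / \<rho>) ^ d * B)) UNIV"
      by (intro has_sum_cmult_left has_sum_infsum b(4))
    moreover have "norm (c z * chi \<omega> z p - c z * chi \<omega> z p') \<le> norm (c z) * wt s \<rho> z * (W * (2 / \<rho>) ^ d * B)" for z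
    proof (cases "snd z < d")
      case True
      then show ?thesis using b(3)[of "snd z" "fst z"] by simp
    next
      case False
      define n l where "n = snd z" and "l = int_inner (fst z) \<omega>"
      have n: "d \<le> n" "n \<ge> 1" using False d by (auto simp: n_def)
      have Rn: "R ^ n = R ^ (n - d) * R ^ (d - 1) * R" "R ^ (n - 1) = R ^ (n - d) * R ^ (d - 1)"
        using n d by (simp_all add: power_add[symmetric] power_Suc2[symmetric] del: power_Suc)
      have "chi \<omega> z p - chi \<omega> z p' = (cis (l * fst p) - cis (l * fst p')) * of_real (snd p ^ n) +
          cis (l * fst p') * of_real (snd p ^ n - snd p' ^ n)"
        by (simp add: chi_def n_def l_def algebra_simps)
      also have "norm \<dots> \<le> \<bar>l * fst p - l * fst p'\<bar> * \<bar>snd p\<bar> ^ n + \<bar>snd p ^ n - snd p' ^ n\<bar>"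
        by (rule norm_triangle_le)
          (use norm_cis_diff_le[of "l * fst p" "l * fst p'"] in
            \<open>auto simp: norm_mult norm_power power_abs intro!: mult_right_mono simp del: of_real_power of_real_diff\<close>)
      also have "\<dots> \<le> \<bar>l\<bar> * \<bar>fst p - fst p'\<bar> * R ^ n + real n * R ^ (n - 1) * \<bar>snd p - snd p'\<bar>"
        using p R by (intro add_mono mult_mono power_mono abs_power_diff_le)
          (auto simp: right_diff_distrib[symmetric] abs_mult)
      also have "\<dots> \<le> (\<bar>l\<bar> + real n) * (\<bar>fst p - fst p'\<bar> * R ^ n) + (\<bar>l\<bar> + real n) * (R ^ (n - 1) * \<bar>snd p - snd p'\<bar>)"
        unfolding mult.assoc using R by (intro add_mono mult_right_mono) auto
      also have "\<dots> = (\<bar>l\<bar> + real n) * (R ^ (n - d) * B)"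
        unfolding Rn B_def by (simp add: algebra_simps)
      also have "\<dots> \<le> (\<bar>l\<bar> + real n) * ((\<rho> / 2) ^ (n - d) * B)"
        using p R B by (intro mult_left_mono mult_right_mono power_mono) auto
      also have "(\<rho> / 2) ^ (n - d) = \<rho> ^ n * (2 / \<rho>) ^ d / 2 ^ n"
        using b(2) n by (simp add: power_diff power_divide field_simps)
      also have "(\<bar>l\<bar> + real n) * (\<rho> ^ n * (2 / \<rho>) ^ d / 2 ^ n * B) =
          ((\<bar>l\<bar> + real n) / 2 ^ n) * \<rho> ^ n * ((2 / \<rho>) ^ d * B)"
        by simp
      also have "\<dots> \<le> (W * exp (s * l1_norm (fst z))) * \<rho> ^ n * ((2 / \<rho>) ^ d * B)"
      proof (intro mult_right_mono)
        have e: "s * l1_norm (fst z) \<le> exp (s * l1_norm (fst z))"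
          using exp_ge_add_one_self[of "s * l1_norm (fst z)"] by linarith
        have "\<bar>l\<bar> \<le> freq_norm \<omega> / s * (s * l1_norm (fst z))"
          using abs_int_inner_le[of "fst z" \<omega>] s by (simp add: l_def)
        also have "\<dots> \<le> freq_norm \<omega> / s * exp (s * l1_norm (fst z))"
          using e s freq_norm_nonneg[of \<omega>] by (intro mult_left_mono) auto
        finally have l: "\<bar>l\<bar> \<le> freq_norm \<omega> / s * exp (s * l1_norm (fst z))" .
        have "(\<bar>l\<bar> + real n) / 2 ^ n = \<bar>l\<bar> / 2 ^ n + real n / 2 ^ n" by (simp add: add_divide_distrib)
        also have "\<dots> \<le> \<bar>l\<bar> + 1"
          using nat_le_two_power[of n] divide_left_mono[of 1 "2 ^ n" "\<bar>l\<bar>"] by (intro add_mono) auto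
        also have "\<dots> \<le> freq_norm \<omega> / s * exp (s * l1_norm (fst z)) + exp (s * l1_norm (fst z))"
          using l s l1_norm_nonneg[of "fst z"] by (intro add_mono) auto
        finally show "(\<bar>l\<bar> + real n) / 2 ^ n \<le> W * exp (s * l1_norm (fst z))"
          by (simp add: W_def algebra_simps)
      qed (use b(2) B in auto)
      finally have "norm (chi \<omega> z p - chi \<omega> z p') \<le> wt s \<rho> z * (W * (2 / \<rho>) ^ d * B)"
        by (simp add: wt_def n_def mult_ac)
      then show ?thesis
        unfolding right_diff_distrib[symmetric] norm_mult mult.assoc by (intro mult_left_mono) auto
    qed
    ultimately have "norm (F p - F p') \<le> infsum (\<lambda>z. norm (c z) * wt s \<rho> z) UNIV * (W * (2 / \<rho>) ^ d * B)"
      by (rule norm_infsum_le)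
    then show ?thesis by (simp add: K_def B_def mult.assoc)
  qed
  with K show ?thesis by blast
qed

lemma brep_diff_coeff:
  assumes "brep \<omega> s \<rho> d c F C" "brep \<omega> s \<rho> d c' G C'"
  shows "brep \<omega> s \<rho> d (\<lambda>z. c z - c' z) (\<lambda>p. F p - G p) (C + C')"
proof -
  note a = brepD[OF assms(1)] and b = brepD[OF assms(2)]
  obtain S S' where S: "S \<le> C" "((\<lambda>z. norm (c z) * wt s \<rho> z) has_sum S) UNIV"
      "S' \<le> C'" "((\<lambda>z. norm (c' z) * wt s \<rho> z) has_sum S') UNIV"
    using assms unfolding brep_def by blast
  have sum: "((\<lambda>z. norm (c z) * wt s \<rho> z + norm (c' z) * wt s \<rho> z) has_sum S + S') UNIV"
    by (intro has_sum_add S)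
  have le: "norm (c z - c' z) * wt s \<rho> z \<le> norm (c z) * wt s \<rho> z + norm (c' z) * wt s \<rho> z" for z
    using mult_right_mono[OF norm_triangle_ineq4[of "c z" "c' z"], of "wt s \<rho> z"]
    by (simp add: wt_nonneg a(2) algebra_simps)
  have sm: "(\<lambda>z. norm (c z - c' z) * wt s \<rho> z) summable_on UNIV"
    by (rule summable_on_comparison_test[OF has_sum_imp_summable[OF sum] le]) (simp add: wt_nonneg a(2))
  have "infsum (\<lambda>z. norm (c z - c' z) * wt s \<rho> z) UNIV \<le> S + S'"
    by (rule has_sum_mono[OF has_sum_infsum[OF sm] sum le])
  then have "infsum (\<lambda>z. norm (c z - c' z) * wt s \<rho> z) UNIV \<le> C + C'" using S by simp
  moreover have "((\<lambda>z. (c z - c' z) * chi \<omega> z p) has_sum F p - G p) UNIV" if "\<bar>snd p\<bar> \<le> \<rho>" for p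
    using has_sum_minus[OF a(5)[OF that] b(5)[OF that]] by (simp add: left_diff_distrib)
  ultimately show ?thesis
    using a(1-3) b(3) has_sum_infsum[OF sm] unfolding brep_def by auto
qed

text \<open>Convergence is not in norm: consecutive functions agree to growing order, so each
  coefficient is eventually constant, and the uniform bound \<open>C\<close> passes to the limit
  through finite partial sums. Inverses and the accumulated change of variables are obtained in this
  way.\<close>

lemma bnd_limit:
  fixes F :: "nat \<Rightarrow> real \<times> real \<Rightarrow> complex" and \<omega> :: "real ^ 'm"
  assumes F: "\<And>n. bnd \<omega> s \<rho> d (F n) C" and nr: "nonres \<omega> \<gamma>"
    and sm: "\<And>n. small (Suc n) (\<lambda>p. F (Suc n) p - F n p)"
  shows "\<exists>G. bnd \<omega> s \<rho> d G C \<and> (\<forall>n. small (Suc n) (\<lambda>p. G p - F n p))"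
proof -
  obtain c where c: "\<And>n. brep \<omega> s \<rho> d (c n) (F n) C" using F unfolding bnd_def by metis
  note b = brepD[OF c]
  have sr: "0 \<le> s" "0 < \<rho>" using b(1,2) by auto
  have step: "c (Suc n) (k, m) = c n (k, m)" if "m \<le> n" for n m k
    using brep_small_coeff[OF brep_diff_coeff[OF c c] nr sm, of m n k] that by simp
  \<comment> \<open>Coefficients of degree \<open>m\<close> no longer change from index
    \<open>m\<close> on, so the diagonal choice is the limit.\<close>
  define e where "e z = c (snd z) z" for z
  have stable: "c n (k, m) = e (k, m)" if "m \<le> n" for n m k
    using that by (induction n rule: nat_induct_at_least) (auto simp: e_def step)
  have fin: "(\<Sum>z\<in>A. norm (e z) * wt s \<rho> z) \<le> C" if "finite A" for A
  proof -
    define n where "n = Max (insert 0 (snd ` A))"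
    have "snd z \<le> n" if "z \<in> A" for z using \<open>finite A\<close> that by (auto simp: n_def)
    then have "(\<Sum>z\<in>A. norm (e z) * wt s \<rho> z) = (\<Sum>z\<in>A. norm (c n z) * wt s \<rho> z)"
      by (intro sum.cong) (auto simp: stable)
    also obtain S where S: "S \<le> C" "((\<lambda>z. norm (c n z) * wt s \<rho> z) has_sum S) UNIV"
      using c[of n] unfolding brep_def by blast
    have "(\<Sum>z\<in>A. norm (c n z) * wt s \<rho> z) \<le> S"
      by (rule finite_sum_le_has_sum[OF S(2) that]) (auto simp: wt_nonneg sr)
    finally show ?thesis using S(1) by simp
  qed
  have sme: "(\<lambda>z. norm (e z) * wt s \<rho> z) summable_on UNIV"
    by (rule nonneg_bdd_above_summable_on) (auto intro!: bdd_aboveI[of _ C] simp: fin wt_nonneg sr)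
  have "infsum (\<lambda>z. norm (e z) * wt s \<rho> z) UNIV \<le> C"
    by (rule infsum_le_finite_sums[OF sme]) (use fin in auto)
  define G where "G p = infsum (\<lambda>z. e z * chi \<omega> z p) UNIV" for p
  have G: "((\<lambda>z. e z * chi \<omega> z p) has_sum G p) UNIV" if "\<bar>snd p\<bar> \<le> \<rho>" for p
    unfolding G_def
    by (rule has_sum_infsum, rule abs_summable_summable,
        rule Infinite_Sum.abs_summable_on_comparison_test'[OF sme])
       (auto simp: norm_mult sr that intro!: mult_left_mono norm_chi_le)
  have e: "brep \<omega> s \<rho> d e G C"
    unfolding brep_def using sr G has_sum_infsum[OF sme] \<open>infsum _ UNIV \<le> C\<close> b(3)
    by (auto simp: e_def)
  have "small (Suc n) (\<lambda>p. G p - F n p)" for n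
  proof (rule bnd_small)
    have d: "brep \<omega> s \<rho> d (\<lambda>z. e z - c n z) (\<lambda>p. G p - F n p) (C + C)"
      by (rule brep_diff_coeff[OF e c])
    then have "brep \<omega> s \<rho> (Suc n) (\<lambda>z. e z - c n z) (\<lambda>p. G p - F n p) (C + C)"
      unfolding brep_def using stable by auto
    then show "bnd \<omega> s \<rho> (Suc n) (\<lambda>p. G p - F n p) (C + C)" unfolding bnd_def by blast
  qed
  with e show ?thesis unfolding bnd_def by blast
qed

lemma small_mono:
  assumes "small d F" "d' \<le> d"
  shows "small d' F"
proof -
  obtain K \<rho> where K: "0 < \<rho>" "\<And>p. \<bar>snd p\<bar> \<le> \<rho> \<Longrightarrow> norm (F p) \<le> K * \<bar>snd p\<bar> ^ d"
    using assms unfolding small_def by blast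
  show ?thesis unfolding small_def
  proof (intro exI conjI allI impI)
    show "0 < min \<rho> 1" using K by simp
    fix p :: "real \<times> real" assume p: "\<bar>snd p\<bar> \<le> min \<rho> 1"
    have "norm (F p) \<le> K * \<bar>snd p\<bar> ^ d" using K p by simp
    also have "\<dots> \<le> \<bar>K\<bar> * \<bar>snd p\<bar> ^ d'"
      using p assms by (intro mult_mono power_decreasing) auto
    finally show "norm (F p) \<le> \<bar>K\<bar> * \<bar>snd p\<bar> ^ d'" .
  qed
qed

lemma small_dominated:
  assumes "small d F" "\<rho> > 0" "\<And>p. \<bar>snd p\<bar> \<le> \<rho> \<Longrightarrow> norm (G p) \<le> K * norm (F p)" "K \<ge> 0"
  shows "small d G"
proof -
  obtain K' \<rho>' where K': "0 < \<rho>'" "\<And>p. \<bar>snd p\<bar> \<le> \<rho>' \<Longrightarrow> norm (F p) \<le> K' * \<bar>snd p\<bar> ^ d"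
    using assms(1) unfolding small_def by blast
  show ?thesis unfolding small_def
  proof (intro exI conjI allI impI)
    show "0 < min \<rho> \<rho>'" using K' assms by simp
    fix p :: "real \<times> real" assume p: "\<bar>snd p\<bar> \<le> min \<rho> \<rho>'"
    then show "norm (G p) \<le> K * K' * \<bar>snd p\<bar> ^ d"
      using assms(3)[of p] mult_left_mono[OF K'(2)[of p] \<open>K \<ge> 0\<close>] by (simp add: mult.assoc)
  qed
qed

lemma small_add:
  assumes "small d F" "small d G"
  shows "small d (\<lambda>p. F p + G p)"
proof -
  obtain K \<rho> where K: "0 < \<rho>" "\<And>p. \<bar>snd p\<bar> \<le> \<rho> \<Longrightarrow> norm (F p) \<le> K * \<bar>snd p\<bar> ^ d"
    using assms(1) unfolding small_def by blast
  obtain K' \<rho>' where K': "0 < \<rho>'" "\<And>p. \<bar>snd p\<bar> \<le> \<rho>' \<Longrightarrow> norm (G p) \<le> K' * \<bar>snd p\<bar> ^ d"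
    using assms(2) unfolding small_def by blast
  show ?thesis unfolding small_def
  proof (intro exI conjI allI impI)
    show "0 < min \<rho> \<rho>'" using K K' by simp
    fix p :: "real \<times> real" assume "\<bar>snd p\<bar> \<le> min \<rho> \<rho>'"
    then show "norm (F p + G p) \<le> (K + K') * \<bar>snd p\<bar> ^ d"
      using K(2)[of p] K'(2)[of p] norm_triangle_ineq[of "F p" "G p"] by (simp add: algebra_simps)
  qed
qed

lemma small_cong:
  assumes "small d F" "\<rho> > 0" "\<And>p. \<bar>snd p\<bar> \<le> \<rho> \<Longrightarrow> G p = F p"
  shows "small d G"
  by (rule small_dominated[OF assms(1,2), of _ 1]) (use assms(3) in auto)

lemma small_uminus: "small d F \<Longrightarrow> small d (\<lambda>p. - F p)"
  by (simp add: small_def)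

lemma small_diff: "small d F \<Longrightarrow> small d G \<Longrightarrow> small d (\<lambda>p. F p - G p)"
  using small_add[OF _ small_uminus] by fastforce

lemma small_zero: "small d (\<lambda>p. 0)"
  unfolding small_def by (intro exI[of _ 0] exI[of _ 1]) auto

lemma small_Pair_iff: "small d (\<lambda>p. (a p, b p)) \<longleftrightarrow> small d a \<and> small d b"
proof safe
  assume h: "small d (\<lambda>p. (a p, b p))"
  show "small d a"
    by (rule small_dominated[OF h, of 1 _ 1]) (simp_all add: norm_fst_le)
  show "small d b"
    by (rule small_dominated[OF h, of 1 _ 1]) (simp_all add: norm_snd_le)
next
  assume "small d a" "small d b"
  then obtain K K' \<rho> \<rho>' where K: "0 < \<rho>" "\<And>p. \<bar>snd p\<bar> \<le> \<rho> \<Longrightarrow> norm (a p) \<le> K * \<bar>snd p\<bar> ^ d"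
    "0 < \<rho>'" "\<And>p. \<bar>snd p\<bar> \<le> \<rho>' \<Longrightarrow> norm (b p) \<le> K' * \<bar>snd p\<bar> ^ d"
    unfolding small_def by metis
  show "small d (\<lambda>p. (a p, b p))" unfolding small_def
  proof (intro exI conjI allI impI)
    show "0 < min \<rho> \<rho>'" using K by simp
    fix p :: "real \<times> real" assume "\<bar>snd p\<bar> \<le> min \<rho> \<rho>'"
    then show "norm (a p, b p) \<le> (K + K') * \<bar>snd p\<bar> ^ d"
      using K(2)[of p] K(4)[of p] norm_Pair_le[of "a p" "b p"] by (simp add: algebra_simps)
  qed
qed

lemma small_of_real_iff: "small d (\<lambda>p. complex_of_real (f p)) \<longleftrightarrow> small d f"
  by (simp add: small_def)

lemma rbnd_limit:
  fixes f :: "nat \<Rightarrow> real \<times> real \<Rightarrow> real" and \<omega> :: "real ^ 'm"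
  assumes "\<And>n. rbnd \<omega> s \<rho> d (f n) C" and "nonres \<omega> \<gamma>"
    and "\<And>n. small (Suc n) (\<lambda>p. f (Suc n) p - f n p)"
  shows "\<exists>g. rbnd \<omega> s \<rho> d g C \<and> (\<forall>n. small (Suc n) (\<lambda>p. g p - f n p))"
proof -
  have "small (Suc n) (\<lambda>p. complex_of_real (f (Suc n) p) - complex_of_real (f n p))" for n
    using assms(3)[of n] by (simp flip: small_of_real_iff)
  from bnd_limit[of \<omega> s \<rho> d "\<lambda>n p. of_real (f n p)", OF assms(1,2) this]
  obtain G where G: "bnd \<omega> s \<rho> d G C" "\<And>n. small (Suc n) (\<lambda>p. G p - complex_of_real (f n p))"
    by blast
  have "small (Suc n) (\<lambda>p. Re (G p) - f n p)" for n
  proof (rule small_dominated[OF G(2), of 1 _ 1 n])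
    show "norm (Re (G p) - f n p) \<le> 1 * cmod (G p - complex_of_real (f n p))" for p
      using abs_Re_le_cmod[of "G p - complex_of_real (f n p)"] by simp
  qed auto
  then show ?thesis using bnd_Re[OF G(1)] by (intro exI[of _ "\<lambda>p. Re (G p)"]) blast
qed

section \<open>Analytic germs and maps near \<open>r = 0\<close>\<close>

text \<open>The width is strictly positive here, while \<open>bnd\<close> also admits
  \<open>s = 0\<close>: positive width gives analyticity in the angle and leaves room for
  compositions.\<close>

definition cls :: "real ^ 'm \<Rightarrow> nat \<Rightarrow> (real \<times> real \<Rightarrow> real) \<Rightarrow> bool" where
  "cls \<omega> d f \<longleftrightarrow> (\<exists>s>0. \<exists>\<rho> C. rbnd \<omega> s \<rho> d f C)"

definition amap :: "real ^ 'm \<Rightarrow> real \<Rightarrow> nat \<Rightarrow> planar_map \<Rightarrow> bool" where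
  "amap \<omega> \<gamma> d A \<longleftrightarrow> (\<exists>u v. A = perturbed_rotation \<gamma> u v \<and> cls \<omega> d u \<and> cls \<omega> d v)"

text \<open>The substitution condition for germs: \<open>r = 0\<close> is preserved with a linear
  bound, so \<open>O(r^N)\<close> is stable under composition with \<open>A\<close> on the right.
  The angle is unrestricted, which lets \<open>involution_G\<close> qualify.\<close>

definition tame :: "planar_map \<Rightarrow> bool" where
  "tame A \<longleftrightarrow> (\<exists>K\<ge>0. \<exists>\<rho>>0. \<forall>p. \<bar>snd p\<bar> \<le> \<rho> \<longrightarrow> \<bar>snd (A p)\<bar> \<le> K * \<bar>snd p\<bar>)"

definition apx :: "nat \<Rightarrow> planar_map \<Rightarrow> planar_map \<Rightarrow> bool" where
  "apx N A B \<longleftrightarrow> small N (\<lambda>p. A p - B p)"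

lemma pr_apply: "perturbed_rotation \<gamma> u v p = (fst p + \<gamma> + u p, snd p + v p)"
  by (simp add: perturbed_rotation_def case_prod_unfold)

lemma pr_zero: "perturbed_rotation 0 (\<lambda>p. 0) (\<lambda>p. 0) = id"
  by (simp add: perturbed_rotation_def fun_eq_iff)

lemma pr_rotation: "perturbed_rotation \<gamma> (\<lambda>p. 0) (\<lambda>p. 0) = rotation \<gamma>"
  by (simp add: perturbed_rotation_def rotation_def fun_eq_iff)

lemma pr_comp: "perturbed_rotation \<gamma> u v \<circ> perturbed_rotation \<gamma>' u' v' =
   perturbed_rotation (\<gamma> + \<gamma>') (\<lambda>p. u' p + u (perturbed_rotation \<gamma>' u' v' p))
     (\<lambda>p. v' p + v (perturbed_rotation \<gamma>' u' v' p))"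
  by (simp add: perturbed_rotation_def fun_eq_iff)

lemma pr_eq_iff: "perturbed_rotation \<gamma> u v p = perturbed_rotation \<gamma> u' v' p \<longleftrightarrow> u p = u' p \<and> v p = v' p"
  by (simp add: pr_apply)

lemma apx_pr_iff: "apx N (perturbed_rotation \<gamma> u v) (perturbed_rotation \<gamma> u' v') \<longleftrightarrow>
   small N (\<lambda>p. u p - u' p) \<and> small N (\<lambda>p. v p - v' p)"
  unfolding apx_def pr_apply by (simp add: small_Pair_iff[symmetric])

lemma rbnd_zero: "0 \<le> s \<Longrightarrow> 0 < \<rho> \<Longrightarrow> 0 \<le> C \<Longrightarrow> rbnd \<omega> s \<rho> d (\<lambda>p. 0) C"
  using bnd_mono[OF bnd_chi[of s \<rho> d "(0, d)" \<omega> 0], of s \<rho> d C] by simp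

lemma rbnd_uminus: "rbnd \<omega> s \<rho> d f C \<Longrightarrow> rbnd \<omega> s \<rho> d (\<lambda>p. - f p) C"
  using bnd_uminus by fastforce

lemma rbnd_add: "rbnd \<omega> s \<rho> d f C \<Longrightarrow> rbnd \<omega> s \<rho> d g C' \<Longrightarrow> rbnd \<omega> s \<rho> d (\<lambda>p. f p + g p) (C + C')"
  using bnd_add[of \<omega> s \<rho> d "\<lambda>p. of_real (f p)" C "\<lambda>p. of_real (g p)" C'] by simp

lemma rbnd_comp:
  assumes "rbnd \<omega> s' \<rho>' d f C" "rbnd \<omega> s \<rho> d1 u a" "rbnd \<omega> s \<rho> d2 v b"
    "d2 \<ge> 1" "s + freq_norm \<omega> * a \<le> s'" "\<rho> + b \<le> \<rho>'"
  shows "rbnd \<omega> s \<rho> d (\<lambda>p. f (perturbed_rotation \<gamma> u v p)) C"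
  using bnd_comp[OF assms, of \<gamma>] by (simp add: pr_apply)

lemma clsI: "rbnd \<omega> s \<rho> d f C \<Longrightarrow> 0 < s \<Longrightarrow> cls \<omega> d f"
  unfolding cls_def by blast

lemma cls_shrink:
  assumes "cls \<omega> d f"
  obtains s \<rho>0 K where "0 < s" "0 < \<rho>0" "0 \<le> K"
    "\<And>\<rho> s'. 0 < \<rho> \<Longrightarrow> \<rho> \<le> \<rho>0 \<Longrightarrow> 0 \<le> s' \<Longrightarrow> s' \<le> s \<Longrightarrow> rbnd \<omega> s' \<rho> d f (K * \<rho> ^ d)"
proof -
  obtain s \<rho>0 C where f: "0 < s" "rbnd \<omega> s \<rho>0 d f C" using assms unfolding cls_def by blast
  have "0 < \<rho>0" "0 \<le> C" using bndD[OF f(2)] bnd_const_nonneg[OF f(2)] by auto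
  moreover have "rbnd \<omega> s' \<rho> d f ((C / \<rho>0 ^ d) * \<rho> ^ d)" if "0 < \<rho>" "\<rho> \<le> \<rho>0" "0 \<le> s'" "s' \<le> s" for \<rho> s'
    using bnd_scale[OF f(2) that(3,4,1,2)] by (simp add: power_divide)
  ultimately show thesis using that[of s \<rho>0 "C / \<rho>0 ^ d"] f(1) by simp
qed

lemma cls_mono: "cls \<omega> d f \<Longrightarrow> d' \<le> d \<Longrightarrow> cls \<omega> d' f"
  unfolding cls_def using bnd_mono[where d' = d'] by (meson bndD order_refl)

lemma cls_add:
  assumes "cls \<omega> d f" "cls \<omega> d g"
  shows "cls \<omega> d (\<lambda>p. f p + g p)"
proof -
  obtain s1 r1 K1 where 1: "0 < s1" "0 < r1" "0 \<le> K1"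
    "\<And>\<rho> s'. 0 < \<rho> \<Longrightarrow> \<rho> \<le> r1 \<Longrightarrow> 0 \<le> s' \<Longrightarrow> s' \<le> s1 \<Longrightarrow> rbnd \<omega> s' \<rho> d f (K1 * \<rho> ^ d)"
    using cls_shrink[OF assms(1)] by metis
  obtain s2 r2 K2 where 2: "0 < s2" "0 < r2" "0 \<le> K2"
    "\<And>\<rho> s'. 0 < \<rho> \<Longrightarrow> \<rho> \<le> r2 \<Longrightarrow> 0 \<le> s' \<Longrightarrow> s' \<le> s2 \<Longrightarrow> rbnd \<omega> s' \<rho> d g (K2 * \<rho> ^ d)"
    using cls_shrink[OF assms(2)] by metis
  show ?thesis
    by (rule clsI[OF rbnd_add[OF 1(4)[of "min r1 r2" "min s1 s2"] 2(4)[of "min r1 r2" "min s1 s2"]]])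
       (use 1 2 in auto)
qed

lemma cls_cmult:
  assumes "cls \<omega> d f"
  shows "cls \<omega> d (\<lambda>p. a * f p)"
proof -
  obtain s \<rho> C where "0 < s" "rbnd \<omega> s \<rho> d f C" using assms unfolding cls_def by blast
  then have "rbnd \<omega> s \<rho> d (\<lambda>p. a * f p) (norm (of_real a :: complex) * C)"
    using bnd_cmult[of \<omega> s \<rho> d "\<lambda>p. of_real (f p)" C "of_real a"] by simp
  then show ?thesis using \<open>0 < s\<close> by (rule clsI)
qed

lemma cls_uminus: "cls \<omega> d f \<Longrightarrow> cls \<omega> d (\<lambda>p. - f p)"
  using cls_cmult[of \<omega> d f "-1"] by simp

lemma cls_diff: "cls \<omega> d f \<Longrightarrow> cls \<omega> d g \<Longrightarrow> cls \<omega> d (\<lambda>p. f p - g p)"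
  using cls_add[OF _ cls_uminus] by fastforce

lemma cls_zero: "cls \<omega> d (\<lambda>p. 0)"
  using rbnd_zero[of 1 1 0 \<omega> d] by (auto intro: clsI)

lemma cls_small: "cls \<omega> d f \<Longrightarrow> small d f"
  unfolding cls_def using bnd_small small_of_real_iff by blast

lemma cls_order: "cls \<omega> d f \<Longrightarrow> nonres \<omega> \<gamma> \<Longrightarrow> small d' f \<Longrightarrow> cls \<omega> d' f"
  unfolding cls_def using bnd_order small_of_real_iff by blast

lemma cls_comp:
  assumes f: "cls \<omega> d f" and A: "amap \<omega> \<gamma> d' A" "1 \<le> d'"
  shows "cls \<omega> d (\<lambda>p. f (A p))"
proof -
  obtain u v where A_eq: "A = perturbed_rotation \<gamma> u v" and uv: "cls \<omega> 1 u" "cls \<omega> 1 v"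
    using A cls_mono unfolding amap_def by blast
  obtain s1 r1 K1 where 1: "0 < s1" "0 < r1" "0 \<le> K1"
    "\<And>\<rho> s'. 0 < \<rho> \<Longrightarrow> \<rho> \<le> r1 \<Longrightarrow> 0 \<le> s' \<Longrightarrow> s' \<le> s1 \<Longrightarrow> rbnd \<omega> s' \<rho> 1 u (K1 * \<rho> ^ 1)"
    using cls_shrink[OF uv(1)] by metis
  obtain s2 r2 K2 where 2: "0 < s2" "0 < r2" "0 \<le> K2"
    "\<And>\<rho> s'. 0 < \<rho> \<Longrightarrow> \<rho> \<le> r2 \<Longrightarrow> 0 \<le> s' \<Longrightarrow> s' \<le> s2 \<Longrightarrow> rbnd \<omega> s' \<rho> 1 v (K2 * \<rho> ^ 1)"
    using cls_shrink[OF uv(2)] by metis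
  obtain s3 r3 C where 3: "0 < s3" "rbnd \<omega> s3 r3 d f C" using f unfolding cls_def by blast
  have r3: "0 < r3" using bndD[OF 3(2)] by simp
  define W where "W = freq_norm \<omega>"
  have W: "0 \<le> W" by (simp add: W_def freq_norm_nonneg)
  define s where "s = min (s3 / 2) (min s1 s2)"
  \<comment> \<open>With displacements bounded by \<open>K1 * \<rho>\<close> and
    \<open>K2 * \<rho>\<close>, the first quotient spends at most half of the width
    \<open>s3\<close>, and the second keeps the image radius below \<open>r3\<close>.\<close>
  define \<rho> where "\<rho> = min (min r1 r2) (min (s3 / 2 / (W * K1 + 1)) (r3 / (1 + K2)))"
  have sr: "0 < s" "0 < \<rho>" "\<rho> \<le> r1" "\<rho> \<le> r2" "s \<le> s1" "s \<le> s2" "s \<le> s3 / 2"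
    using 1 2 3 r3 W by (auto simp: s_def \<rho>_def add_nonneg_pos)
  have "\<rho> \<le> s3 / 2 / (W * K1 + 1)" by (simp add: \<rho>_def)
  then have "\<rho> * (W * K1 + 1) \<le> s3 / 2" using W 1 by (subst (asm) pos_le_divide_eq) (auto simp: add_nonneg_pos)
  then have a: "s + W * (K1 * \<rho> ^ 1) \<le> s3" using sr by (simp add: algebra_simps)
  have "\<rho> \<le> r3 / (1 + K2)" by (simp add: \<rho>_def)
  then have b: "\<rho> + K2 * \<rho> ^ 1 \<le> r3" using 2 by (simp add: pos_le_divide_eq algebra_simps)
  have "rbnd \<omega> s \<rho> d (\<lambda>p. f (perturbed_rotation \<gamma> u v p)) C"
    by (rule rbnd_comp[OF 3(2) 1(4) 2(4) order_refl _ b]) (use sr a in \<open>auto simp: W_def\<close>)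
  then show ?thesis unfolding A_eq using sr(1) by (rule clsI)
qed

lemma amapI: "cls \<omega> d u \<Longrightarrow> cls \<omega> d v \<Longrightarrow> amap \<omega> \<gamma> d (perturbed_rotation \<gamma> u v)"
  unfolding amap_def by blast

lemma amapE:
  assumes "amap \<omega> \<gamma> d A"
  obtains u v where "A = perturbed_rotation \<gamma> u v" "cls \<omega> d u" "cls \<omega> d v"
  using assms unfolding amap_def by blast

lemma amap_mono: "amap \<omega> \<gamma> d A \<Longrightarrow> d' \<le> d \<Longrightarrow> amap \<omega> \<gamma> d' A"
  unfolding amap_def using cls_mono by blast

lemma amap_id: "amap \<omega> 0 d id"
  using amapI[OF cls_zero cls_zero] unfolding pr_zero[symmetric] .

lemma amap_rotation: "amap \<omega> \<gamma> d (rotation \<gamma>)"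
  using amapI[OF cls_zero cls_zero] unfolding pr_rotation[symmetric] .

lemma amap_comp:
  assumes "amap \<omega> \<gamma> d A" "amap \<omega> \<gamma>' d B" "1 \<le> d"
  shows "amap \<omega> (\<gamma> + \<gamma>') d (A \<circ> B)"
proof -
  obtain u v where A: "A = perturbed_rotation \<gamma> u v" "cls \<omega> d u" "cls \<omega> d v" using assms(1) by (rule amapE)
  obtain u' v' where B: "B = perturbed_rotation \<gamma>' u' v'" "cls \<omega> d u'" "cls \<omega> d v'" using assms(2) by (rule amapE)
  show ?thesis unfolding A(1) B(1) pr_comp
    by (intro amapI cls_add B A cls_comp[OF _ amapI[OF B(2,3)] assms(3)])
qed

lemma amap_comp0: "amap \<omega> \<gamma> 1 A \<Longrightarrow> amap \<omega> 0 1 B \<Longrightarrow> amap \<omega> \<gamma> 1 (A \<circ> B)"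
  using amap_comp[of \<omega> \<gamma> 1 A 0 B] by simp

lemma amap_comp0': "amap \<omega> 0 1 A \<Longrightarrow> amap \<omega> \<gamma> 1 B \<Longrightarrow> amap \<omega> \<gamma> 1 (A \<circ> B)"
  using amap_comp[of \<omega> 0 1 A \<gamma> B] by simp

lemma amap_tame:
  assumes "amap \<omega> \<gamma> 1 A"
  shows "tame A"
proof -
  obtain u v where A: "A = perturbed_rotation \<gamma> u v" "cls \<omega> 1 u" "cls \<omega> 1 v" using assms by (rule amapE)
  obtain K \<rho> where K: "0 < \<rho>" "\<And>p. \<bar>snd p\<bar> \<le> \<rho> \<Longrightarrow> \<bar>v p\<bar> \<le> K * \<bar>snd p\<bar>"
    using cls_small[OF A(3)] unfolding small_def power_one_right real_norm_def by blast
  have "\<bar>snd (A p)\<bar> \<le> (1 + \<bar>K\<bar>) * \<bar>snd p\<bar>" if "\<bar>snd p\<bar> \<le> \<rho>" for p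
  proof -
    have "\<bar>snd (A p)\<bar> \<le> \<bar>snd p\<bar> + \<bar>v p\<bar>" by (simp add: A(1) pr_apply)
    also have "\<bar>v p\<bar> \<le> \<bar>K\<bar> * \<bar>snd p\<bar>"
      by (rule order_trans[OF K(2)[OF that] mult_right_mono]) auto
    finally show ?thesis by (simp add: algebra_simps)
  qed
  then show ?thesis unfolding tame_def using K(1) by (intro exI[of _ "1 + \<bar>K\<bar>"]) auto
qed

lemma tameE:
  assumes "tame A" "0 < r"
  obtains K \<rho> where "0 \<le> K" "0 < \<rho>" "\<And>p. \<bar>snd p\<bar> \<le> \<rho> \<Longrightarrow> \<bar>snd (A p)\<bar> \<le> K * \<bar>snd p\<bar>"
    "\<And>p :: real \<times> real. \<bar>snd p\<bar> \<le> \<rho> \<Longrightarrow> K * \<bar>snd p\<bar> \<le> r"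
proof -
  obtain K \<rho> where K: "0 \<le> K" "0 < \<rho>" "\<And>p. \<bar>snd p\<bar> \<le> \<rho> \<Longrightarrow> \<bar>snd (A p)\<bar> \<le> K * \<bar>snd p\<bar>"
    using assms(1) unfolding tame_def by blast
  have "K * x \<le> r" if "0 \<le> x" "x \<le> r / (K + 1)" for x
  proof -
    have "K * x \<le> (K + 1) * x" using that K by (intro mult_right_mono) auto
    also have "\<dots> \<le> r" using that K by (simp add: pos_le_divide_eq mult.commute)
    finally show ?thesis .
  qed
  with K assms(2) show thesis by (intro that[of K "min \<rho> (r / (K + 1))"]) (auto simp: add_nonneg_pos)
qed

lemma small_comp:
  assumes "small N F" "tame A"
  shows "small N (\<lambda>p. F (A p))"
proof -
  obtain K \<rho> where K: "0 < \<rho>" "\<And>p. \<bar>snd p\<bar> \<le> \<rho> \<Longrightarrow> norm (F p) \<le> K * \<bar>snd p\<bar> ^ N"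
    using assms(1) unfolding small_def by blast
  obtain L \<rho>' where L: "0 \<le> L" "0 < \<rho>'" "\<And>p. \<bar>snd p\<bar> \<le> \<rho>' \<Longrightarrow> \<bar>snd (A p)\<bar> \<le> L * \<bar>snd p\<bar>"
    "\<And>p :: real \<times> real. \<bar>snd p\<bar> \<le> \<rho>' \<Longrightarrow> L * \<bar>snd p\<bar> \<le> \<rho>"
    using tameE[OF assms(2) K(1)] by metis
  have "norm (F (A p)) \<le> (\<bar>K\<bar> * L ^ N) * \<bar>snd p\<bar> ^ N" if p: "\<bar>snd p\<bar> \<le> \<rho>'" for p
  proof -
    have "norm (F (A p)) \<le> K * \<bar>snd (A p)\<bar> ^ N" using order_trans[OF L(3)[OF p] L(4)[OF p]] by (rule K(2))
    also have "\<dots> \<le> \<bar>K\<bar> * (L * \<bar>snd p\<bar>) ^ N"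
      using L(3)[OF p] by (intro mult_mono power_mono) auto
    finally show ?thesis by (simp add: power_mult_distrib)
  qed
  then show ?thesis unfolding small_def using L(2) by blast
qed

lemma apx_sym: "apx N A B \<Longrightarrow> apx N B A"
  unfolding apx_def using small_uminus by fastforce

lemma apx_trans: "apx N A B \<Longrightarrow> apx N B C \<Longrightarrow> apx N A C"
  unfolding apx_def using small_add[of N "\<lambda>p. A p - B p" "\<lambda>p. B p - C p"] by simp

lemma apx_mono: "apx N A B \<Longrightarrow> N' \<le> N \<Longrightarrow> apx N' A B"
  unfolding apx_def by (rule small_mono)

lemma apx_comp_right: "apx N A B \<Longrightarrow> tame C \<Longrightarrow> apx N (A \<circ> C) (B \<circ> C)"
  unfolding apx_def using small_comp[of N "\<lambda>p. A p - B p" C] by simp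

text \<open>The source of the quadratic gain: \<open>f\<close> of order \<open>d\<close> has
  Lipschitz constant \<open>O(r^(d-1))\<close>, so an error \<open>O(r^N)\<close> in the argument
  becomes \<open>O(r^(N+d-1))\<close>. With \<open>N = d\<close> this is the order
  \<open>2d-1\<close> of the Newton step.\<close>

lemma cls_apx:
  assumes f: "cls \<omega> d f" and d: "d \<ge> 1" and X: "tame X" and Y: "tame Y" and XY: "apx N X Y"
  shows "small (N + d - 1) (\<lambda>p. f (X p) - f (Y p))"
proof -
  obtain s \<rho> C where s: "0 < s" and b: "rbnd \<omega> s \<rho> d f C" using f unfolding cls_def by blast
  have \<rho>: "0 < \<rho>" using bndD[OF b] by simp
  obtain K where K: "K \<ge> 0" and lip: "\<And>p p' R. \<bar>snd p\<bar> \<le> R \<Longrightarrow> \<bar>snd p'\<bar> \<le> R \<Longrightarrow> R \<le> \<rho> / 2 \<Longrightarrow>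
    norm (f p - f p') \<le> K * R ^ (d - 1) * (R * \<bar>fst p - fst p'\<bar> + \<bar>snd p - snd p'\<bar>)"
    using bnd_lipschitz[OF b s d] by (auto simp flip: of_real_diff)
  obtain L1 r1 where 1: "0 \<le> L1" "0 < r1" "\<And>p. \<bar>snd p\<bar> \<le> r1 \<Longrightarrow> \<bar>snd (X p)\<bar> \<le> L1 * \<bar>snd p\<bar>"
    "\<And>p :: real \<times> real. \<bar>snd p\<bar> \<le> r1 \<Longrightarrow> L1 * \<bar>snd p\<bar> \<le> \<rho> / 2"
    using tameE[OF X, of "\<rho> / 2"] \<rho> by auto
  obtain L2 r2 where 2: "0 \<le> L2" "0 < r2" "\<And>p. \<bar>snd p\<bar> \<le> r2 \<Longrightarrow> \<bar>snd (Y p)\<bar> \<le> L2 * \<bar>snd p\<bar>"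
    "\<And>p :: real \<times> real. \<bar>snd p\<bar> \<le> r2 \<Longrightarrow> L2 * \<bar>snd p\<bar> \<le> \<rho> / 2"
    using tameE[OF Y, of "\<rho> / 2"] \<rho> by auto
  obtain L3 r3 where 3: "0 < r3" "\<And>p. \<bar>snd p\<bar> \<le> r3 \<Longrightarrow> norm (X p - Y p) \<le> L3 * \<bar>snd p\<bar> ^ N"
    using XY unfolding apx_def small_def by blast
  define L where "L = max L1 L2"
  have "norm (f (X p) - f (Y p)) \<le> (K * L ^ (d - 1) * ((\<rho> / 2 + 1) * L3)) * \<bar>snd p\<bar> ^ (N + d - 1)"
    if p: "\<bar>snd p\<bar> \<le> min r1 (min r2 r3)" for p
  proof -
    define R where "R = L * \<bar>snd p\<bar>"
    have R: "0 \<le> R" "\<bar>snd (X p)\<bar> \<le> R" "\<bar>snd (Y p)\<bar> \<le> R" "R \<le> \<rho> / 2"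
      using 1(1) 1(3)[of p] 1(4)[of p] 2(1) 2(3)[of p] 2(4)[of p] p
        mult_right_mono[of L1 L "\<bar>snd p\<bar>"] mult_right_mono[of L2 L "\<bar>snd p\<bar>"]
      by (auto simp: R_def L_def max_def split: if_splits)
    have "norm (f (X p) - f (Y p)) \<le> K * R ^ (d - 1) * (R * \<bar>fst (X p) - fst (Y p)\<bar> + \<bar>snd (X p) - snd (Y p)\<bar>)"
      by (rule lip) (use R in auto)
    also have "\<dots> \<le> K * R ^ (d - 1) * (\<rho> / 2 * norm (X p - Y p) + norm (X p - Y p))"
    proof (intro mult_left_mono add_mono mult_mono)
      show "\<bar>fst (X p) - fst (Y p)\<bar> \<le> norm (X p - Y p)"
        using norm_fst_le[of "fst (X p - Y p)" "snd (X p - Y p)"]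
        unfolding prod.collapse by simp
      show "\<bar>snd (X p) - snd (Y p)\<bar> \<le> norm (X p - Y p)"
        using norm_snd_le[of "snd (X p - Y p)" "fst (X p - Y p)"]
        unfolding prod.collapse by simp
    qed (use R K \<rho> in auto)
    also have "\<dots> = K * R ^ (d - 1) * ((\<rho> / 2 + 1) * norm (X p - Y p))" by (simp add: algebra_simps)
    also have "\<dots> \<le> K * R ^ (d - 1) * ((\<rho> / 2 + 1) * (L3 * \<bar>snd p\<bar> ^ N))"
      using 3(2)[of p] p R K \<rho> by (intro mult_left_mono) auto
    also have "\<dots> = (K * L ^ (d - 1) * ((\<rho> / 2 + 1) * L3)) * (\<bar>snd p\<bar> ^ (d - 1) * \<bar>snd p\<bar> ^ N)"
      by (simp add: R_def power_mult_distrib)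
    also have "\<bar>snd p\<bar> ^ (d - 1) * \<bar>snd p\<bar> ^ N = \<bar>snd p\<bar> ^ (N + d - 1)"
      using d by (simp add: power_add[symmetric] add.commute)
    finally show ?thesis .
  qed
  then show ?thesis unfolding small_def using 1(2) 2(2) 3(1)
    by (intro exI[of _ "K * L ^ (d - 1) * ((\<rho> / 2 + 1) * L3)"] exI[of _ "min r1 (min r2 r3)"]) auto
qed

text \<open>The left factor has to be Lipschitz, and this is where its analyticity enters; for exact
  identities on a strip left composition is free.\<close>

lemma apx_comp_left:
  assumes "amap \<omega> \<gamma> 1 A" "tame X" "tame Y" "apx N X Y"
  shows "apx N (A \<circ> X) (A \<circ> Y)"
proof -
  obtain u v where A: "A = perturbed_rotation \<gamma> u v" "cls \<omega> 1 u" "cls \<omega> 1 v" using assms(1) by (rule amapE)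
  have "small N (\<lambda>p. (u (X p) - u (Y p), v (X p) - v (Y p)))"
    unfolding small_Pair_iff using cls_apx[OF A(2) _ assms(2-4)] cls_apx[OF A(3) _ assms(2-4)] by simp
  from small_add[OF assms(4)[unfolded apx_def] this]
  show ?thesis
    by (simp add: apx_def A(1) pr_apply prod_eq_iff plus_prod_def minus_prod_def algebra_simps)
qed

lemma eq_near0_iff: "eq_near0 A B \<longleftrightarrow> (\<exists>\<rho>>0. \<forall>p. \<bar>snd p\<bar> \<le> \<rho> \<longrightarrow> A p = B p)"
proof
  assume "eq_near0 A B"
  then obtain \<rho> where "\<rho> > 0" "\<And>\<theta> r. \<bar>r\<bar> < \<rho> \<Longrightarrow> A (\<theta>, r) = B (\<theta>, r)" unfolding eq_near0_def by blast
  then show "\<exists>\<rho>>0. \<forall>p. \<bar>snd p\<bar> \<le> \<rho> \<longrightarrow> A p = B p"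
    by (intro exI[of _ "\<rho> / 2"]) auto
next
  assume "\<exists>\<rho>>0. \<forall>p. \<bar>snd p\<bar> \<le> \<rho> \<longrightarrow> A p = B p"
  then obtain \<rho> where "\<rho> > 0" "\<And>p. \<bar>snd p\<bar> \<le> \<rho> \<Longrightarrow> A p = B p" by blast
  then show "eq_near0 A B" unfolding eq_near0_def by (intro exI[of _ \<rho>]) auto
qed

lemma eq_near0_refl: "eq_near0 A A"
  unfolding eq_near0_def by (intro exI[of _ 1]) auto

lemma eq_near0_sym: "eq_near0 A B \<Longrightarrow> eq_near0 B A"
  unfolding eq_near0_def by fastforce

lemma eq_near0_trans:
  assumes "eq_near0 A B" "eq_near0 B C"
  shows "eq_near0 A C"
proof -
  obtain \<rho> \<rho>' where "\<rho> > 0" "\<And>p. \<bar>snd p\<bar> \<le> \<rho> \<Longrightarrow> A p = B p" "\<rho>' > 0" "\<And>p. \<bar>snd p\<bar> \<le> \<rho>' \<Longrightarrow> B p = C p"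
    using assms unfolding eq_near0_iff by metis
  then show ?thesis unfolding eq_near0_iff by (intro exI[of _ "min \<rho> \<rho>'"]) auto
qed

lemma eq_near0_comp_left: "eq_near0 A B \<Longrightarrow> eq_near0 (C \<circ> A) (C \<circ> B)"
  unfolding eq_near0_def by auto

lemma eq_near0_comp_right:
  assumes "eq_near0 A B" "tame C"
  shows "eq_near0 (A \<circ> C) (B \<circ> C)"
proof -
  obtain \<rho> where \<rho>: "\<rho> > 0" "\<And>p. \<bar>snd p\<bar> \<le> \<rho> \<Longrightarrow> A p = B p" using assms(1) unfolding eq_near0_iff by metis
  obtain L \<rho>' where L: "0 \<le> L" "0 < \<rho>'" "\<And>p. \<bar>snd p\<bar> \<le> \<rho>' \<Longrightarrow> \<bar>snd (C p)\<bar> \<le> L * \<bar>snd p\<bar>"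
    "\<And>p :: real \<times> real. \<bar>snd p\<bar> \<le> \<rho>' \<Longrightarrow> L * \<bar>snd p\<bar> \<le> \<rho>"
    using tameE[OF assms(2) \<rho>(1)] by metis
  show ?thesis unfolding eq_near0_iff
    using L by (intro exI[of _ \<rho>']) (auto intro!: \<rho>(2) order_trans[OF L(3) L(4)])
qed

lemma eq_near0_apx:
  assumes "eq_near0 A B"
  shows "apx N A B"
proof -
  obtain \<rho> where \<rho>: "\<rho> > 0" "\<And>p. \<bar>snd p\<bar> \<le> \<rho> \<Longrightarrow> A p = B p" using assms(1) unfolding eq_near0_iff by metis
  then show ?thesis unfolding apx_def
    by (intro small_cong[OF small_zero \<rho>(1)]) auto
qed

lemma cls_all_small_zero:
  assumes "cls \<omega> d f" "nonres \<omega> \<gamma>" "\<And>N. small N f"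
  shows "\<exists>\<rho>>0. \<forall>p. \<bar>snd p\<bar> \<le> \<rho> \<longrightarrow> f p = 0"
proof -
  obtain s \<rho> C where s: "0 < s" and b: "rbnd \<omega> s \<rho> d f C" using assms(1) unfolding cls_def by blast
  show ?thesis
    using bnd_small_all_zero[OF b assms(2)] assms(3) bndD[OF b]
    by (intro exI[of _ \<rho>]) (auto simp: small_of_real_iff)
qed

text \<open>Flatness principle: all coefficients of the difference vanish. Identities between
  analytic maps can therefore be proved one order at a time.\<close>

lemma apx_all_eq_near0:
  assumes "amap \<omega> \<gamma> d A" "amap \<omega> \<gamma> d B" "nonres \<omega> \<gamma>'" "\<And>N. apx N A B"
  shows "eq_near0 A B"
proof -
  obtain u v where A: "A = perturbed_rotation \<gamma> u v" "cls \<omega> d u" "cls \<omega> d v" using assms(1) by (rule amapE)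
  obtain u' v' where B: "B = perturbed_rotation \<gamma> u' v'" "cls \<omega> d u'" "cls \<omega> d v'" using assms(2) by (rule amapE)
  have s: "small N (\<lambda>p. u p - u' p)" "small N (\<lambda>p. v p - v' p)" for N
    using assms(4)[of N] unfolding A(1) B(1) apx_pr_iff by auto
  obtain \<rho>1 \<rho>2 where "\<rho>1 > 0" "\<And>p. \<bar>snd p\<bar> \<le> \<rho>1 \<Longrightarrow> u p - u' p = 0"
     "\<rho>2 > 0" "\<And>p. \<bar>snd p\<bar> \<le> \<rho>2 \<Longrightarrow> v p - v' p = 0"
    using cls_all_small_zero[OF cls_diff[OF A(2) B(2)] assms(3) s(1)]
      cls_all_small_zero[OF cls_diff[OF A(3) B(3)] assms(3) s(2)] by metis
  then show ?thesis unfolding eq_near0_iff A(1) B(1) pr_eq_iff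
    by (intro exI[of _ "min \<rho>1 \<rho>2"]) auto
qed

section \<open>Inversion of maps tangent to the identity\<close>

text \<open>Picard iteration for \<open>u' = - u (id + (u', v'))\<close>, and likewise for
  \<open>v'\<close>. The composition bound reproduces \<open>\<epsilon>\<close> at every stage, and
  order \<open>d >= 2\<close> makes consecutive iterates agree to one more power of \<open>r\<close>
  each time, so the limit exists coefficientwise with the same bound.\<close>

lemma right_inverse_near_id:
  fixes \<omega> :: "real ^ 'm"
  assumes u: "rbnd \<omega> s \<rho> d u \<epsilon>" and v: "rbnd \<omega> s \<rho> d v \<epsilon>" and d: "2 \<le> d" and nr: "nonres \<omega> \<gamma>"
    and s': "0 < s'" "s' + freq_norm \<omega> * \<epsilon> \<le> s" and \<rho>': "0 < \<rho>'" "\<rho>' + \<epsilon> \<le> \<rho>"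
  shows "\<exists>u' v'. rbnd \<omega> s' \<rho>' d u' \<epsilon> \<and> rbnd \<omega> s' \<rho>' d v' \<epsilon> \<and>
    eq_near0 (perturbed_rotation 0 u v \<circ> perturbed_rotation 0 u' v') id"
proof -
  have eps: "0 \<le> \<epsilon>" using u by (rule bnd_const_nonneg)
  have s: "0 < s" using s' freq_norm_nonneg[of \<omega>] eps by (smt (verit) mult_nonneg_nonneg)
  define w where "w = rec_nat (\<lambda>p. 0 :: real, \<lambda>p. 0 :: real) (\<lambda>_ (a, b).
     (\<lambda>p. - u (perturbed_rotation 0 a b p), \<lambda>p. - v (perturbed_rotation 0 a b p)))"
  define a where "a n = fst (w n)" for n
  define b where "b n = snd (w n)" for n
  have a0: "a 0 = (\<lambda>p. 0)" "b 0 = (\<lambda>p. 0)" by (simp_all add: a_def b_def w_def)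
  have aS: "a (Suc n) = (\<lambda>p. - u (perturbed_rotation 0 (a n) (b n) p))"
      "b (Suc n) = (\<lambda>p. - v (perturbed_rotation 0 (a n) (b n) p))" for n
    by (simp_all add: a_def b_def w_def case_prod_unfold)
  have ab: "rbnd \<omega> s' \<rho>' d (a n) \<epsilon> \<and> rbnd \<omega> s' \<rho>' d (b n) \<epsilon>" for n
  proof (induction n)
    case 0
    then show ?case using rbnd_zero[of s' \<rho>' \<epsilon> \<omega> d] s' \<rho>' eps unfolding a0 by auto
  next
    case (Suc n)
    have "rbnd \<omega> s' \<rho>' d (a (Suc n)) \<epsilon>" unfolding aS
      by (rule rbnd_uminus, rule rbnd_comp[OF u]) (use Suc d s' \<rho>' in auto)
    moreover have "rbnd \<omega> s' \<rho>' d (b (Suc n)) \<epsilon>" unfolding aS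
      by (rule rbnd_uminus, rule rbnd_comp[OF v]) (use Suc d s' \<rho>' in auto)
    ultimately show ?case ..
  qed
  have cab: "cls \<omega> 1 (a n)" "cls \<omega> 1 (b n)" for n
    using ab[of n] s'(1) d by (auto intro: clsI cls_mono[of \<omega> d])
  have am: "amap \<omega> 0 1 (perturbed_rotation 0 (a n) (b n))" for n
    by (intro amapI cab)
  have cuv: "cls \<omega> d u" "cls \<omega> d v" using u v s by (auto intro: clsI)
  have step: "small (Suc n) (\<lambda>p. a (Suc n) p - a n p) \<and> small (Suc n) (\<lambda>p. b (Suc n) p - b n p)" for n
  proof (induction n)
    case 0
    have "small 1 u" "small 1 v" using cls_small[OF cuv(1)] cls_small[OF cuv(2)] d by (auto intro: small_mono)
    then show ?case unfolding aS a0 pr_zero by (simp add: small_uminus)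
  next
    case (Suc n)
    have "apx (Suc n) (perturbed_rotation 0 (a n) (b n)) (perturbed_rotation 0 (a (Suc n)) (b (Suc n)))"
      using Suc by (intro apx_sym[of _ "perturbed_rotation 0 (a (Suc n)) (b (Suc n))"]) (simp add: apx_pr_iff)
    note * = cls_apx[OF _ _ amap_tame[OF am] amap_tame[OF am] this, of \<omega> d]
    have "small (Suc n + d - 1) (\<lambda>p. a (Suc (Suc n)) p - a (Suc n) p)"
      using *[OF cuv(1)] d by (simp add: aS(1)[of "Suc n"] aS(1)[of n])
    moreover have "small (Suc n + d - 1) (\<lambda>p. b (Suc (Suc n)) p - b (Suc n) p)"
      using *[OF cuv(2)] d by (simp add: aS(2)[of "Suc n"] aS(2)[of n])
    ultimately show ?case using d by (auto elim!: small_mono)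
  qed
  obtain u' where u': "rbnd \<omega> s' \<rho>' d u' \<epsilon>" "\<And>n. small (Suc n) (\<lambda>p. u' p - a n p)"
    using rbnd_limit[of \<omega> s' \<rho>' d a \<epsilon> \<gamma>] ab step nr by blast
  obtain v' where v': "rbnd \<omega> s' \<rho>' d v' \<epsilon>" "\<And>n. small (Suc n) (\<lambda>p. v' p - b n p)"
    using rbnd_limit[of \<omega> s' \<rho>' d b \<epsilon> \<gamma>] ab step nr by blast
  have cuv': "cls \<omega> 1 u'" "cls \<omega> 1 v'"
    using u' v' s'(1) d by (auto intro: clsI cls_mono[of \<omega> d])
  have am': "amap \<omega> 0 1 (perturbed_rotation 0 u' v')" by (intro amapI cuv')
  have "apx N (perturbed_rotation 0 u v \<circ> perturbed_rotation 0 u' v') id" for N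
  proof -
    have "apx (Suc N) (perturbed_rotation 0 u' v') (perturbed_rotation 0 (a N) (b N))"
      using u'(2) v'(2) by (simp add: apx_pr_iff)
    note * = cls_apx[OF _ _ amap_tame[OF am'] amap_tame[OF am] this, of \<omega> d]
    have 1: "small N (\<lambda>p. u (perturbed_rotation 0 u' v' p) + a (Suc N) p)"
      "small N (\<lambda>p. v (perturbed_rotation 0 u' v' p) + b (Suc N) p)"
      using *[OF cuv(1)] *[OF cuv(2)] d unfolding aS by (auto elim!: small_mono)
    have "small N (\<lambda>p. (u (perturbed_rotation 0 u' v' p) + a (Suc N) p) + (u' p - a (Suc N) p))"
      "small N (\<lambda>p. (v (perturbed_rotation 0 u' v' p) + b (Suc N) p) + (v' p - b (Suc N) p))"
      by (intro small_add 1 small_mono[OF u'(2)[of "Suc N"]] small_mono[OF v'(2)[of "Suc N"]]; simp)+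
    then show ?thesis
      unfolding pr_comp pr_zero[symmetric] by (simp add: apx_pr_iff add.commute)
  qed
  then have "eq_near0 (perturbed_rotation 0 u v \<circ> perturbed_rotation 0 u' v') id"
    using cuv d by (intro apx_all_eq_near0[OF amap_comp0[OF amapI am'] amap_id nr]) (auto elim!: cls_mono)
  with u' v' show ?thesis by blast
qed

lemma right_inverse_soft:
  fixes \<omega> :: "real ^ 'm"
  assumes "amap \<omega> 0 2 T" "nonres \<omega> \<gamma>"
  shows "\<exists>W. amap \<omega> 0 2 W \<and> eq_near0 (T \<circ> W) id"
proof -
  obtain u v where T: "T = perturbed_rotation 0 u v" "cls \<omega> 2 u" "cls \<omega> 2 v" using assms(1) by (rule amapE)
  obtain s1 r1 K1 where 1: "0 < s1" "0 < r1" "0 \<le> K1"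
    "\<And>\<rho> s'. 0 < \<rho> \<Longrightarrow> \<rho> \<le> r1 \<Longrightarrow> 0 \<le> s' \<Longrightarrow> s' \<le> s1 \<Longrightarrow> rbnd \<omega> s' \<rho> 2 u (K1 * \<rho> ^ 2)"
    using cls_shrink[OF T(2)] by metis
  obtain s2 r2 K2 where 2: "0 < s2" "0 < r2" "0 \<le> K2"
    "\<And>\<rho> s'. 0 < \<rho> \<Longrightarrow> \<rho> \<le> r2 \<Longrightarrow> 0 \<le> s' \<Longrightarrow> s' \<le> s2 \<Longrightarrow> rbnd \<omega> s' \<rho> 2 v (K2 * \<rho> ^ 2)"
    using cls_shrink[OF T(3)] by metis
  define W where "W = freq_norm \<omega>"
  have W: "0 \<le> W" by (simp add: W_def freq_norm_nonneg)
  define K where "K = max K1 K2 + 1"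
  define s where "s = min s1 s2"
  \<comment> \<open>The displacement is \<open>O(\<rho>^2)\<close>, so for small
    \<open>\<rho>\<close> it costs at most half of the width and half of the radius.\<close>
  define \<rho> where "\<rho> = min (min r1 r2) (min 1 (min (s / 2 / (W * K + 1)) (1 / (2 * K))))"
  have K: "0 < K" "K1 \<le> K" "K2 \<le> K" using 1 by (auto simp: K_def)
  have WK: "0 < W * K + 1" using W K by (simp add: add_nonneg_pos)
  have sr: "0 < s" "0 < \<rho>" "\<rho> \<le> r1" "\<rho> \<le> r2" "s \<le> s1" "s \<le> s2" "\<rho> \<le> 1"
    using 1 2 K WK by (auto simp: s_def \<rho>_def)
  have "\<rho> \<le> s / 2 / (W * K + 1)" "\<rho> \<le> 1 / (2 * K)" by (auto simp: \<rho>_def)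
  then have 3: "W * K * \<rho> \<le> s / 2" "K * \<rho> \<le> 1 / 2"
    using WK K sr(2) by (auto simp: pos_le_divide_eq algebra_simps)
  have rr: "\<rho> ^ 2 \<le> \<rho>" using sr by (simp add: power2_eq_square)
  have 4: "W * (K * \<rho> ^ 2) \<le> s / 2"
    using 3 mult_left_mono[OF rr, of "W * K"] W K by (simp add: mult.assoc)
  have 5: "K * \<rho> ^ 2 \<le> \<rho> / 2"
    using mult_right_mono[OF 3(2), of \<rho>] sr by (simp add: power2_eq_square)
  have "rbnd \<omega> s \<rho> 2 u (K * \<rho> ^ 2)" "rbnd \<omega> s \<rho> 2 v (K * \<rho> ^ 2)"
    using 1(4)[of \<rho> s] 2(4)[of \<rho> s] sr K by (auto elim!: bnd_mono intro: mult_right_mono)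
  moreover have "0 < s / 2" "s / 2 + freq_norm \<omega> * (K * \<rho> ^ 2) \<le> s" "0 < \<rho> / 2" "\<rho> / 2 + K * \<rho> ^ 2 \<le> \<rho>"
    using 4 5 sr by (auto simp: W_def)
  ultimately obtain u' v' where "rbnd \<omega> (s / 2) (\<rho> / 2) 2 u' (K * \<rho> ^ 2)" "rbnd \<omega> (s / 2) (\<rho> / 2) 2 v' (K * \<rho> ^ 2)"
    "eq_near0 (T \<circ> perturbed_rotation 0 u' v') id"
    unfolding T(1) using right_inverse_near_id[OF _ _ order_refl assms(2)] by blast
  moreover have "0 < s / 2" using sr(1) by simp
  ultimately show ?thesis by (intro exI[of _ "perturbed_rotation 0 u' v'"] conjI amapI) (auto intro: clsI)
qed

text \<open>Group argument: \<open>W\<close> has a right inverse \<open>T'\<close> of its own, and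
  \<open>T' = T W T' = T\<close> near \<open>r = 0\<close>.\<close>

lemma right_inverse_is_left_inverse:
  fixes \<omega> :: "real ^ 'm"
  assumes T: "amap \<omega> 0 2 T" and W: "amap \<omega> 0 2 W" and TW: "eq_near0 (T \<circ> W) id" and nr: "nonres \<omega> \<gamma>"
  shows "eq_near0 (W \<circ> T) id"
proof -
  have tame: "tame T" "tame W" using T W by (auto intro!: amap_tame elim!: amap_mono)
  obtain T' where T': "amap \<omega> 0 2 T'" "eq_near0 (W \<circ> T') id" using right_inverse_soft[OF W nr] by blast
  have "tame T'" using T' by (auto intro!: amap_tame elim!: amap_mono)
  have "eq_near0 ((T \<circ> W) \<circ> T') (id \<circ> T')"
    by (rule eq_near0_comp_right[OF TW \<open>tame T'\<close>])
  moreover have "eq_near0 (T \<circ> (W \<circ> T')) (T \<circ> id)"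
    by (rule eq_near0_comp_left[OF T'(2)])
  ultimately have "eq_near0 T' T"
    by (metis comp_assoc comp_id eq_near0_sym eq_near0_trans id_comp)
  then have "eq_near0 (W \<circ> T') (W \<circ> T)" by (rule eq_near0_comp_left)
  with T'(2) show ?thesis using eq_near0_sym eq_near0_trans by blast
qed

section \<open>The homological equation\<close>

text \<open>The terms of frequency zero and degree below \<open>D\<close> are absent. Quantifying
  over all representations avoids choosing one; under nonresonance they have the same
  coefficients.\<close>

definition mean0 :: "real ^ 'm \<Rightarrow> nat \<Rightarrow> (real \<times> real \<Rightarrow> real) \<Rightarrow> bool" where
  "mean0 \<omega> D f \<longleftrightarrow> (\<forall>s \<rho> d c C. brep \<omega> s \<rho> d c (\<lambda>p. complex_of_real (f p)) C \<longrightarrow> (\<forall>n<D. c (0, n) = 0))"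

text \<open>The cubic Taylor remainder costs at most two thirds of \<open>|y|\<close> for
  \<open>|y| <= 2\<close>. The constant 3 is chosen to cancel against \<open>pi > 3\<close> in the
  next estimate.\<close>

lemma abs_le_3_abs_sin:
  fixes y :: real
  assumes "\<bar>y\<bar> \<le> pi / 2"
  shows "\<bar>y\<bar> \<le> 3 * \<bar>sin y\<bar>"
proof -
  have "\<bar>sin y - (\<Sum>m<3. sin_coeff m * y ^ m)\<bar> \<le> inverse (fact 3) * \<bar>y\<bar> ^ 3"
    by (rule Maclaurin_sin_bound)
  then have "\<bar>sin y - y\<bar> \<le> \<bar>y\<bar> ^ 3 / 6"
    by (simp add: sin_coeff_def eval_nat_numeral field_simps)
  moreover have "\<bar>y\<bar> ^ 3 / 6 \<le> 2 / 3 * \<bar>y\<bar>"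
  proof -
    have "\<bar>y\<bar> \<le> 2" using assms pi_less_4 by simp
    then have "\<bar>y\<bar> ^ 2 \<le> 2 ^ 2" by (intro power_mono) auto
    from mult_right_mono[OF this, of "\<bar>y\<bar>"] show ?thesis by (simp add: eval_nat_numeral)
  qed
  ultimately show ?thesis by (simp add: abs_if split: if_splits)
qed

lemma norm_cis_minus_one_ge:
  assumes "\<And>j :: int. \<bar>\<alpha> / (2 * pi) - of_int j\<bar> \<ge> b"
  shows "norm (cis \<alpha> - 1) \<ge> 2 * b"
proof -
  define j where "j = round (\<alpha> / (2 * pi))"
  define x where "x = \<alpha> / (2 * pi) - of_int j"
  have x: "\<bar>x\<bar> \<le> 1 / 2" unfolding x_def j_def
    using of_int_round_abs_le[of "\<alpha> / (2 * pi)"] by (simp add: abs_minus_commute)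
  have \<alpha>: "\<alpha> = 2 * pi * x + 2 * pi * of_int j" by (simp add: x_def field_simps)
  have "cis \<alpha> = cis (2 * pi * x)"
    unfolding \<alpha> cis_mult[symmetric] using cis_multiple_2pi[of "of_int j"] by simp
  then have "norm (cis \<alpha> - 1) = 2 * \<bar>sin (pi * x)\<bar>"
    using dist_exp_i_1[of "2 * pi * x"] by (simp add: cis_conv_exp)
  moreover have "\<bar>pi * x\<bar> \<le> 3 * \<bar>sin (pi * x)\<bar>"
    using x by (intro abs_le_3_abs_sin) (simp add: abs_mult)
  moreover have "3 * \<bar>x\<bar> \<le> \<bar>pi * x\<bar>"
    using pi_gt3 by (simp add: abs_mult mult_right_mono)
  moreover have "b \<le> \<bar>x\<bar>" using assms[of j] by (simp add: x_def)
  ultimately show ?thesis by simp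
qed

text \<open>The maximum of \<open>x powr \<sigma> * exp (- \<delta> x)\<close> sits at
  \<open>x = \<sigma> / \<delta>\<close>; the inequality \<open>ln y <= y - 1\<close> at
  \<open>y = \<delta> x / \<sigma>\<close> gives it up to a discarded factor
  \<open>exp (- \<sigma>)\<close>. It trades powers of the frequency for width.\<close>

lemma powr_le_exp:
  fixes x \<sigma> \<delta> :: real
  assumes "0 < x" "0 < \<sigma>" "0 < \<delta>"
  shows "x powr \<sigma> \<le> (\<sigma> / \<delta>) powr \<sigma> * exp (\<delta> * x)"
proof -
  have "ln (\<delta> * x / \<sigma>) \<le> \<delta> * x / \<sigma> - 1" by (rule ln_le_minus_one) (use assms in simp)
  then have "\<sigma> * (ln x - ln (\<sigma> / \<delta>)) \<le> \<sigma> * (\<delta> * x / \<sigma>)"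
    using assms by (intro mult_left_mono) (simp_all add: ln_div ln_mult)
  then have "\<sigma> * ln x \<le> \<sigma> * ln (\<sigma> / \<delta>) + \<delta> * x" using assms by (simp add: algebra_simps)
  then show ?thesis using assms by (simp add: powr_def exp_add[symmetric])
qed

lemma l1_norm_pos:
  assumes "k \<noteq> 0"
  shows "l1_norm k > 0"
proof -
  obtain i where "k $ i \<noteq> 0" using assms by (auto simp: vec_eq_iff)
  then show ?thesis unfolding l1_norm_def by (intro sum_pos2[of UNIV i]) auto
qed

locale diophantine_rotation =
  fixes \<omega> :: "real ^ 'm" and \<gamma> c0 \<sigma> :: real
  assumes c0: "c0 > 0" and \<sigma>: "\<sigma> > 0" and dioph: "diophantine \<omega> \<gamma> c0 \<sigma>"
begin

abbreviation "W \<equiv> freq_norm \<omega>"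

text \<open>Price of the small divisors: bound for the solution of the homological equation relative
  to its right-hand side when the width drops by \<open>\<delta>\<close>.\<close>

definition \<kappa> :: "real \<Rightarrow> real" where
  "\<kappa> \<delta> = (\<sigma> / \<delta>) powr \<sigma> / (2 * c0)"

lemma small_divisor: "k \<noteq> 0 \<Longrightarrow> norm (cis (int_inner k \<omega> * \<gamma>) - 1) \<ge> 2 * (c0 / l1_norm k powr \<sigma>)"
  using dioph unfolding diophantine_def by (intro norm_cis_minus_one_ge) auto

lemma nonres: "nonres \<omega> \<gamma>"
proof -
  have "cis (int_inner k \<omega> * \<gamma>) \<noteq> 1" if "k \<noteq> 0" for k
    using small_divisor[OF that] l1_norm_pos[OF that] c0
    by (auto simp: zero_less_mult_iff zero_less_divide_iff powr_gt_zero not_le dest!: leD)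
  then show ?thesis by (simp add: nonres_def)
qed

lemma \<kappa>_pos: "0 < \<delta> \<Longrightarrow> 0 < \<kappa> \<delta>"
  using c0 \<sigma> by (simp add: \<kappa>_def)

text \<open>The divisor \<open>cis (int_inner k \<omega> * \<gamma>) - 1\<close> is inverted for
  \<open>k \<noteq> 0\<close> in degrees below \<open>D\<close>. Frequency zero has no divisor,
  hence the assumption on the means; degrees from \<open>D\<close> on are left in the error, where
  they count as \<open>O(r^D)\<close>.\<close>

lemma homological:
  assumes f: "rbnd \<omega> s \<rho> d f \<epsilon>" and m: "mean0 \<omega> D f" and \<delta>: "0 < \<delta>" "\<delta> \<le> s"
  shows "\<exists>u. rbnd \<omega> (s - \<delta>) \<rho> d u (\<kappa> \<delta> * \<epsilon>) \<and> small D (\<lambda>p. u (rotation \<gamma> p) - u p - f p)"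
proof -
  obtain c where c: "brep \<omega> s \<rho> d c (\<lambda>p. complex_of_real (f p)) \<epsilon>" using f unfolding bnd_def by blast
  note b = brepD[OF c]
  have c00: "c (0, n) = 0" if "n < D" for n using m c that unfolding mean0_def by blast
  obtain S where S: "S \<le> \<epsilon>" "((\<lambda>z. norm (c z) * wt s \<rho> z) has_sum S) UNIV"
    using c unfolding brep_def by blast
  define a where "a z = (if fst z \<noteq> 0 \<and> snd z < D then c z / (cis (int_inner (fst z) \<omega> * \<gamma>) - 1) else 0)" for z
  have le: "norm (a z) * wt (s - \<delta>) \<rho> z \<le> norm (c z) * wt s \<rho> z * \<kappa> \<delta>" for z
  proof (cases "fst z \<noteq> 0 \<and> snd z < D")
    case True
    define L where "L = l1_norm (fst z)"
    have L: "0 < L" using True by (simp add: L_def l1_norm_pos)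
    have q: "2 * (c0 / L powr \<sigma>) \<le> norm (cis (int_inner (fst z) \<omega> * \<gamma>) - 1)"
      using small_divisor True by (simp add: L_def)
    have pos: "0 < 2 * (c0 / L powr \<sigma>)" using c0 L by simp
    have "norm (a z) = norm (c z) / norm (cis (int_inner (fst z) \<omega> * \<gamma>) - 1)"
      using True by (simp add: a_def norm_divide)
    also have "\<dots> \<le> norm (c z) / (2 * (c0 / L powr \<sigma>))"
      by (rule divide_left_mono[OF q norm_ge_zero mult_pos_pos[OF order_less_le_trans[OF pos q] pos]])
    also have "\<dots> = norm (c z) * L powr \<sigma> / (2 * c0)" using L by simp
    also have "\<dots> \<le> norm (c z) * ((\<sigma> / \<delta>) powr \<sigma> * exp (\<delta> * L)) / (2 * c0)"
      using powr_le_exp[OF L \<sigma> \<delta>(1)] c0 by (intro divide_right_mono mult_left_mono) auto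
    also have "\<dots> = norm (c z) * exp (\<delta> * L) * \<kappa> \<delta>" by (simp add: \<kappa>_def)
    finally have "norm (a z) * wt (s - \<delta>) \<rho> z \<le> norm (c z) * exp (\<delta> * L) * \<kappa> \<delta> * wt (s - \<delta>) \<rho> z"
      using b(2) by (intro mult_right_mono) (auto simp: wt_nonneg)
    also have "exp (\<delta> * L) * wt (s - \<delta>) \<rho> z = wt s \<rho> z"
      by (simp add: wt_def L_def mult.assoc[symmetric] exp_add[symmetric] algebra_simps)
    then have "norm (c z) * exp (\<delta> * L) * \<kappa> \<delta> * wt (s - \<delta>) \<rho> z = norm (c z) * wt s \<rho> z * \<kappa> \<delta>"
      by (metis (no_types, opaque_lifting) mult.assoc mult.commute)
    finally show ?thesis .
  qed (use \<kappa>_pos[OF \<delta>(1)] b(2) in \<open>auto simp: a_def wt_nonneg\<close>)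
  have sr: "((\<lambda>z. norm (c z) * wt s \<rho> z * \<kappa> \<delta>) has_sum S * \<kappa> \<delta>) UNIV"
    by (rule has_sum_cmult_left[OF S(2)])
  have sl: "(\<lambda>z. norm (a z) * wt (s - \<delta>) \<rho> z) summable_on UNIV"
    by (rule summable_on_comparison_test[OF has_sum_imp_summable[OF sr] le]) (simp add: wt_nonneg b(2))
  have "infsum (\<lambda>z. norm (a z) * wt (s - \<delta>) \<rho> z) UNIV \<le> S * \<kappa> \<delta>"
    by (rule has_sum_mono[OF has_sum_infsum[OF sl] sr le])
  also have "\<dots> \<le> \<kappa> \<delta> * \<epsilon>" using S(1) \<kappa>_pos[OF \<delta>(1)] by (simp add: mult.commute)
  finally have norm_a: "infsum (\<lambda>z. norm (a z) * wt (s - \<delta>) \<rho> z) UNIV \<le> \<kappa> \<delta> * \<epsilon>" .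
  define U where "U p = infsum (\<lambda>z. a z * chi \<omega> z p) UNIV" for p
  have U: "((\<lambda>z. a z * chi \<omega> z p) has_sum U p) UNIV" if "\<bar>snd p\<bar> \<le> \<rho>" for p
    unfolding U_def
    by (rule has_sum_infsum, rule abs_summable_summable,
        rule Infinite_Sum.abs_summable_on_comparison_test'[OF sl])
       (use \<delta> in \<open>auto simp: norm_mult that intro!: mult_left_mono norm_chi_le\<close>)
  have "brep \<omega> (s - \<delta>) \<rho> d a U (\<kappa> \<delta> * \<epsilon>)"
    unfolding brep_def using \<delta> b(2,3) norm_a has_sum_infsum[OF sl] U by (auto simp: a_def)
  then have 1: "bnd \<omega> (s - \<delta>) \<rho> d U (\<kappa> \<delta> * \<epsilon>)" unfolding bnd_def by blast
  define G where "G p = U (rotation \<gamma> p) - U p - complex_of_real (f p)" for p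
  \<comment> \<open>What remains of the equation: nothing below degree \<open>D\<close>, and the
    untouched right-hand side from there on.\<close>
  define e where "e z = (if snd z < D then 0 else - c z)" for z
  have "brep \<omega> s \<rho> D e G \<epsilon>"
    unfolding brep_def
  proof (intro conjI allI impI)
    show "0 \<le> s" "0 < \<rho>" using b by auto
    show "e (k, n) = 0" if "n < D" for k n using that by (simp add: e_def)
    have e_le: "norm (e z) * wt s \<rho> z \<le> norm (c z) * wt s \<rho> z" for z
      using b(2) by (auto simp: e_def wt_nonneg)
    have se: "(\<lambda>z. norm (e z) * wt s \<rho> z) summable_on UNIV"
      by (rule summable_on_comparison_test[OF b(4) e_le]) (simp add: wt_nonneg b(2))
    have "infsum (\<lambda>z. norm (e z) * wt s \<rho> z) UNIV \<le> S"
      by (rule has_sum_mono[OF has_sum_infsum[OF se] S(2) e_le])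
    then show "\<exists>S\<le>\<epsilon>. ((\<lambda>z. norm (e z) * wt s \<rho> z) has_sum S) UNIV"
      using has_sum_infsum[OF se] S(1) by (meson order_trans)
    fix p :: "real \<times> real" assume p: "\<bar>snd p\<bar> \<le> \<rho>"
    have "((\<lambda>z. a z * chi \<omega> z (rotation \<gamma> p) - a z * chi \<omega> z p - c z * chi \<omega> z p) has_sum G p) UNIV"
      unfolding G_def using p by (intro has_sum_minus U b(5)) (auto simp: rotation_def case_prod_unfold)
    moreover have "a z * chi \<omega> z (rotation \<gamma> p) - a z * chi \<omega> z p - c z * chi \<omega> z p = e z * chi \<omega> z p" for z
    proof -
      define q where "q = cis (int_inner (fst z) \<omega> * \<gamma>)"
      have rot: "chi \<omega> z (rotation \<gamma> p) = q * chi \<omega> z p"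
        by (simp add: chi_def rotation_def case_prod_unfold q_def cis_mult distrib_left add.commute)
      have "q \<noteq> 1" if "fst z \<noteq> 0" using nonres that by (simp add: nonres_def q_def)
      moreover have "a z = (if fst z \<noteq> 0 \<and> snd z < D then c z / (q - 1) else 0)"
        by (simp add: a_def q_def)
      moreover have "c z = 0" if "fst z = 0" "snd z < D"
        using c00[OF that(2)] that(1) by (metis prod.collapse)
      ultimately have "(q - 1) * a z = c z + e z" by (auto simp: e_def)
      moreover have "a z * chi \<omega> z (rotation \<gamma> p) - a z * chi \<omega> z p - c z * chi \<omega> z p =
          ((q - 1) * a z - c z) * chi \<omega> z p"
        unfolding rot by (simp add: algebra_simps)
      ultimately show ?thesis by simp
    qed
    ultimately show "((\<lambda>z. e z * chi \<omega> z p) has_sum G p) UNIV" by simp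
  qed
  then have "bnd \<omega> s \<rho> D G \<epsilon>" unfolding bnd_def by blast
  from bnd_Re[OF this] have "small D (\<lambda>p. Re (G p))"
    using bnd_small small_of_real_iff by blast
  then show ?thesis
    using bnd_Re[OF 1] by (intro exI[of _ "\<lambda>p. Re (U p)"]) (simp add: G_def)
qed

section \<open>The Newton step\<close>

text \<open>Only crude bounds are needed: the gain comes from the doubling of the order of vanishing,
  which is turned into smallness by the loss of radius from \<open>\<rho> - 2 \<delta>'\<close> to \<open>\<rho> - 3 \<delta>'\<close>.\<close>

lemma newton_step:
  assumes f: "rbnd \<omega> s \<rho> d f \<epsilon>" and g: "rbnd \<omega> s \<rho> d g \<epsilon>" and d: "2 \<le> d"
    and m: "mean0 \<omega> (2 * d - 1) f" "mean0 \<omega> (2 * d - 1) g"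
    and \<delta>: "0 < \<delta>" "3 * \<delta> < s" and \<delta>': "0 < \<delta>'" "3 * \<delta>' < \<rho>"
    and sm: "W * ((\<kappa> \<delta> + 1) * \<epsilon>) \<le> \<delta>" "(\<kappa> \<delta> + 1) * \<epsilon> \<le> \<delta>'"
  shows "\<exists>u v u' v' f' g'.
    rbnd \<omega> (s - \<delta>) \<rho> d u (\<kappa> \<delta> * \<epsilon>) \<and> rbnd \<omega> (s - \<delta>) \<rho> d v (\<kappa> \<delta> * \<epsilon>) \<and>
    amap \<omega> 0 d (perturbed_rotation 0 u' v') \<and>
    eq_near0 (perturbed_rotation 0 u v \<circ> perturbed_rotation 0 u' v') id \<and>
    eq_near0 (perturbed_rotation 0 u' v' \<circ> perturbed_rotation 0 u v) id \<and>
    perturbed_rotation 0 u' v' \<circ> perturbed_rotation \<gamma> f g \<circ> perturbed_rotation 0 u v = perturbed_rotation \<gamma> f' g' \<and>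
    rbnd \<omega> (s - 3 * \<delta>) (\<rho> - 3 * \<delta>') (2 * d - 1) f' ((1 + 2 * \<kappa> \<delta>) * \<epsilon> * (1 - \<delta>' / \<rho>) ^ (2 * d - 1)) \<and>
    rbnd \<omega> (s - 3 * \<delta>) (\<rho> - 3 * \<delta>') (2 * d - 1) g' ((1 + 2 * \<kappa> \<delta>) * \<epsilon> * (1 - \<delta>' / \<rho>) ^ (2 * d - 1))"
proof -
  \<comment> \<open>\<open>2d - 1\<close> and not \<open>2d\<close>: substituting
    \<open>T = id + O(r^d)\<close> into \<open>f\<close> of order \<open>d\<close> gains
    \<open>d - 1\<close> powers.\<close>
  define D where "D = 2 * d - 1"
  define e where "e = \<kappa> \<delta> * \<epsilon>"
  define R where "R = rotation \<gamma>"
  have eps: "0 \<le> \<epsilon>" using f by (rule bnd_const_nonneg)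
  have W: "0 \<le> W" by (rule freq_norm_nonneg)
  have e: "0 \<le> e" using \<kappa>_pos[OF \<delta>(1)] eps by (simp add: e_def)
  have sm': "W * e + W * \<epsilon> \<le> \<delta>" "e + \<epsilon> \<le> \<delta>'" "W * e \<le> \<delta>" "W * \<epsilon> \<le> \<delta>" "e \<le> \<delta>'" "\<epsilon> \<le> \<delta>'"
  proof -
    show 1: "W * e + W * \<epsilon> \<le> \<delta>" "e + \<epsilon> \<le> \<delta>'" using sm by (simp_all add: e_def algebra_simps)
    show "W * e \<le> \<delta>" "W * \<epsilon> \<le> \<delta>" "e \<le> \<delta>'" "\<epsilon> \<le> \<delta>'"
      using 1 mult_nonneg_nonneg[OF W e] mult_nonneg_nonneg[OF W eps] e eps by linarith+
  qed
  obtain u where u: "rbnd \<omega> (s - \<delta>) \<rho> d u e" "small D (\<lambda>p. u (R p) - u p - f p)"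
    using homological[OF f m(1) \<delta>(1)] \<delta> unfolding D_def e_def R_def by auto
  obtain v where v: "rbnd \<omega> (s - \<delta>) \<rho> d v e" "small D (\<lambda>p. v (R p) - v p - g p)"
    using homological[OF g m(2) \<delta>(1)] \<delta> unfolding D_def e_def R_def by auto
  have "\<exists>u' v'. rbnd \<omega> (s - 2 * \<delta>) (\<rho> - \<delta>') d u' e \<and> rbnd \<omega> (s - 2 * \<delta>) (\<rho> - \<delta>') d v' e \<and>
    eq_near0 (perturbed_rotation 0 u v \<circ> perturbed_rotation 0 u' v') id"
    by (rule right_inverse_near_id[OF u(1) v(1) d nonres]) (use \<delta> \<delta>' sm' in auto)
  then obtain u' v' where u': "rbnd \<omega> (s - 2 * \<delta>) (\<rho> - \<delta>') d u' e"
    and v': "rbnd \<omega> (s - 2 * \<delta>) (\<rho> - \<delta>') d v' e"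
    and TW: "eq_near0 (perturbed_rotation 0 u v \<circ> perturbed_rotation 0 u' v') id" by blast
  define T where "T = perturbed_rotation 0 u v"
  define V where "V = perturbed_rotation 0 u' v'"
  define M where "M = perturbed_rotation \<gamma> f g"
  have cl: "cls \<omega> d f" "cls \<omega> d g" "cls \<omega> d u" "cls \<omega> d v" "cls \<omega> d u'" "cls \<omega> d v'"
    using f g u(1) v(1) u' v' \<delta> by (auto intro: clsI)
  have amd: "amap \<omega> 0 d T" "amap \<omega> 0 d V" "amap \<omega> \<gamma> d M"
    unfolding T_def V_def M_def by (intro amapI cl)+
  have am1: "amap \<omega> 0 1 T" "amap \<omega> 0 1 V" "amap \<omega> \<gamma> 1 M"
    using amd d by (auto elim!: amap_mono)
  have VT: "eq_near0 (V \<circ> T) id"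
    by (rule right_inverse_is_left_inverse[OF amap_mono[OF amd(1) d] amap_mono[OF amd(2) d] _ nonres])
       (use TW in \<open>simp add: T_def V_def\<close>)
  define h where "h p = u p + f (T p)" for p
  define k where "k p = v p + g (T p)" for p
  define f' where "f' p = h p + u' (perturbed_rotation \<gamma> h k p)" for p
  define g' where "g' p = k p + v' (perturbed_rotation \<gamma> h k p)" for p
  have MT: "M \<circ> T = perturbed_rotation \<gamma> h k"
    unfolding M_def T_def pr_comp h_def k_def by simp
  have M': "V \<circ> M \<circ> T = perturbed_rotation \<gamma> f' g'"
    unfolding comp_assoc MT unfolding V_def pr_comp f'_def g'_def by simp
  \<comment> \<open>Domain budget: solving the equation takes one \<open>\<delta>\<close>, inverting
    \<open>T\<close> a second \<open>\<delta>\<close> and one \<open>\<delta>'\<close>, composing a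
    third \<open>\<delta>\<close> and a second \<open>\<delta>'\<close>. The third
    \<open>\<delta>'\<close> is kept for the loss of radius that produces smallness.\<close>
  define s' \<rho>' where "s' = s - 3 * \<delta>" and "\<rho>' = \<rho> - 2 * \<delta>'"
  have sr: "0 < s'" "0 < \<rho>'" using \<delta> \<delta>' by (auto simp: s'_def \<rho>'_def)
  have u1: "rbnd \<omega> s' \<rho>' d u e" and v1: "rbnd \<omega> s' \<rho>' d v e"
    using sr \<delta> \<delta>' by (auto intro!: bnd_mono[OF u(1)] bnd_mono[OF v(1)] simp: s'_def \<rho>'_def)
  have h: "rbnd \<omega> s' \<rho>' d h (e + \<epsilon>)" unfolding h_def T_def
    by (intro rbnd_add u1 rbnd_comp[OF f u1 v1]) (use d sm' \<delta> \<delta>' in \<open>auto simp: s'_def \<rho>'_def\<close>)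
  have k: "rbnd \<omega> s' \<rho>' d k (e + \<epsilon>)" unfolding k_def T_def
    by (intro rbnd_add v1 rbnd_comp[OF g u1 v1]) (use d sm' \<delta> \<delta>' in \<open>auto simp: s'_def \<rho>'_def\<close>)
  have f': "rbnd \<omega> s' \<rho>' d f' (e + \<epsilon> + e)" unfolding f'_def
    by (intro rbnd_add h rbnd_comp[OF u' h k]) (use d sm' \<delta> \<delta>' in \<open>auto simp: s'_def \<rho>'_def algebra_simps\<close>)
  have g': "rbnd \<omega> s' \<rho>' d g' (e + \<epsilon> + e)" unfolding g'_def
    by (intro rbnd_add k rbnd_comp[OF v' h k]) (use d sm' \<delta> \<delta>' in \<open>auto simp: s'_def \<rho>'_def algebra_simps\<close>)
  have cl': "cls \<omega> d f'" "cls \<omega> d g'" using f' g' sr by (auto intro: clsI)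
  define M' where "M' = perturbed_rotation \<gamma> f' g'"
  have amM': "amap \<omega> \<gamma> 1 M'" unfolding M'_def using cl' d by (intro amapI) (auto elim!: cls_mono)
  have "eq_near0 (T \<circ> V \<circ> (M \<circ> T)) (id \<circ> (M \<circ> T))"
    using TW amap_tame[OF amap_comp0[OF am1(3,1)]] by (intro eq_near0_comp_right) (simp_all add: T_def V_def)
  then have "eq_near0 (T \<circ> M') (M \<circ> T)"
    unfolding M'_def M'[symmetric] by (simp add: comp_assoc)
  then obtain r where r: "r > 0" "\<And>p. \<bar>snd p\<bar> \<le> r \<Longrightarrow> T (M' p) = M (T p)"
    unfolding eq_near0_iff by auto
  \<comment> \<open>Read off from \<open>T M' = M T\<close> and not from \<open>V M T\<close>: this
    way \<open>u'\<close> and \<open>v'\<close> disappear, and the new error consists of a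
    difference in \<open>f\<close>, a difference in \<open>u\<close> and the defect of the
    homological equation, each of order \<open>D\<close>.\<close>
  have eqs: "f' p = (f (T p) - f (id p)) - (u (M' p) - u (R p)) - (u (R p) - u p - f p)"
      "g' p = (g (T p) - g (id p)) - (v (M' p) - v (R p)) - (v (R p) - v p - g p)" if "\<bar>snd p\<bar> \<le> r" for p
    using r(2)[OF that] by (simp_all add: T_def M'_def M_def pr_apply)
  have aT: "apx d T id" unfolding T_def pr_zero[symmetric] apx_pr_iff using cl by (simp add: cls_small)
  have aM': "apx d M' R" unfolding M'_def R_def pr_rotation[symmetric] apx_pr_iff using cl' by (simp add: cls_small)
  have tame: "tame T" "tame id" "tame M'" "tame R"
    using amap_tame[OF am1(1)] amap_tame[OF amap_id] amap_tame[OF amM'] amap_tame[OF amap_rotation] by (auto simp: R_def)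
  have dd: "d + d - 1 = D" "1 \<le> d" using d by (auto simp: D_def)
  have "small D (\<lambda>p. (f (T p) - f (id p)) - (u (M' p) - u (R p)) - (u (R p) - u p - f p))"
    using cls_apx[OF cl(1) dd(2) tame(1,2) aT] cls_apx[OF cl(3) dd(2) tame(3,4) aM'] u(2)
    unfolding dd by (rule small_diff[OF small_diff])
  then have sf: "small D f'" by (rule small_cong[OF _ r(1)]) (rule eqs)
  have "small D (\<lambda>p. (g (T p) - g (id p)) - (v (M' p) - v (R p)) - (v (R p) - v p - g p))"
    using cls_apx[OF cl(2) dd(2) tame(1,2) aT] cls_apx[OF cl(4) dd(2) tame(3,4) aM'] v(2)
    unfolding dd by (rule small_diff[OF small_diff])
  then have sg: "small D g'" by (rule small_cong[OF _ r(1)]) (rule eqs)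
  \<comment> \<open>The quotient of the last two radii is compared with the starting radius, so that
    the final bound refers to \<open>\<rho>\<close> alone.\<close>
  have frac: "(\<rho> - 3 * \<delta>') / \<rho>' \<le> 1 - \<delta>' / \<rho>"
  proof -
    have "\<delta>' / \<rho> \<le> \<delta>' / \<rho>'" using \<delta>' sr by (intro divide_left_mono) (auto simp: \<rho>'_def)
    then show ?thesis using sr by (simp add: diff_divide_distrib[symmetric] field_simps \<rho>'_def)
  qed
  have fin: "rbnd \<omega> (s - 3 * \<delta>) (\<rho> - 3 * \<delta>') D F ((1 + 2 * \<kappa> \<delta>) * \<epsilon> * (1 - \<delta>' / \<rho>) ^ D)"
    if F: "rbnd \<omega> s' \<rho>' d F (e + \<epsilon> + e)" "small D F" for F
  proof -
    have "rbnd \<omega> s' \<rho>' D F (e + \<epsilon> + e)"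
      using F by (intro bnd_order[OF F(1) nonres]) (simp add: small_of_real_iff)
    then have "rbnd \<omega> s' (\<rho> - 3 * \<delta>') D F ((e + \<epsilon> + e) * ((\<rho> - 3 * \<delta>') / \<rho>') ^ D)"
      using sr \<delta>' by (intro bnd_scale) (auto simp: \<rho>'_def)
    moreover have "(e + \<epsilon> + e) * ((\<rho> - 3 * \<delta>') / \<rho>') ^ D \<le> (1 + 2 * \<kappa> \<delta>) * \<epsilon> * (1 - \<delta>' / \<rho>) ^ D"
      using frac sr \<delta>' e eps
      by (intro mult_mono power_mono) (auto simp: e_def algebra_simps)
    ultimately show ?thesis using sr \<delta>' by (auto intro: bnd_mono simp: s'_def)
  qed
  show ?thesis
    using u(1) v(1) amd(2) TW VT M' fin[OF f' sf] fin[OF g' sg]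
    unfolding D_def e_def T_def V_def M_def by blast
qed

end

section \<open>Chains that mix exact and approximate identities\<close>

declare eq_near0_trans [trans] apx_trans [trans]

lemma apx_eq_near0_trans [trans]: "apx N A B \<Longrightarrow> eq_near0 B C \<Longrightarrow> apx N A C"
  using apx_trans eq_near0_apx by blast

lemma eq_near0_apx_trans [trans]: "eq_near0 A B \<Longrightarrow> apx N B C \<Longrightarrow> apx N A C"
  using apx_trans eq_near0_apx by blast

lemma amap_order:
  assumes "amap \<omega> \<gamma> 1 A" "apx d A (rotation \<gamma>)" "nonres \<omega> \<gamma>'"
  shows "amap \<omega> \<gamma> d A"
proof -
  obtain u v where A: "A = perturbed_rotation \<gamma> u v" "cls \<omega> 1 u" "cls \<omega> 1 v" using assms(1) by (rule amapE)
  have s: "small d u" "small d v"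
    using assms(2) unfolding A(1) pr_rotation[symmetric] apx_pr_iff by auto
  show ?thesis unfolding A(1)
    by (rule amapI[OF cls_order[OF A(2) assms(3) s(1)] cls_order[OF A(3) assms(3) s(2)]])
qed

section \<open>Vanishing of the means\<close>

lemma brep_rotation:
  assumes "brep \<omega> s \<rho> d c F C"
  shows "brep \<omega> s \<rho> d (\<lambda>z. cis (int_inner (fst z) \<omega> * \<gamma>) * c z) (\<lambda>p. F (rotation \<gamma> p)) C"
proof -
  note b = brepD[OF assms]
  have "((\<lambda>z. cis (int_inner (fst z) \<omega> * \<gamma>) * c z * chi \<omega> z p) has_sum F (rotation \<gamma> p)) UNIV"
    if "\<bar>snd p\<bar> \<le> \<rho>" for p
  proof -
    have "((\<lambda>z. c z * chi \<omega> z (rotation \<gamma> p)) has_sum F (rotation \<gamma> p)) UNIV"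
      using that by (intro b(5)) (simp add: rotation_def case_prod_unfold)
    moreover have "c z * chi \<omega> z (rotation \<gamma> p) = cis (int_inner (fst z) \<omega> * \<gamma>) * c z * chi \<omega> z p" for z
    proof -
      have "cis (int_inner (fst z) \<omega> * fst (rotation \<gamma> p)) =
          cis (int_inner (fst z) \<omega> * \<gamma>) * cis (int_inner (fst z) \<omega> * fst p)"
        by (simp add: rotation_def case_prod_unfold cis_mult distrib_left add.commute)
      then show ?thesis by (simp add: chi_def rotation_def case_prod_unfold)
    qed
    ultimately show ?thesis by simp
  qed
  then show ?thesis using assms unfolding brep_def by (simp add: norm_mult)
qed

lemma brep_restrict:
  assumes "brep \<omega> s \<rho> d c F C"
  shows "brep \<omega> s \<rho> d (\<lambda>z. if P z then c z else 0) (\<lambda>p. \<Sum>\<^sub>\<infinity>z. (if P z then c z else 0) * chi \<omega> z p) C"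
proof -
  note b = brepD[OF assms]
  obtain S where S: "S \<le> C" "((\<lambda>z. norm (c z) * wt s \<rho> z) has_sum S) UNIV"
    using assms unfolding brep_def by blast
  define e where "e z = (if P z then c z else 0)" for z
  have e_le: "norm (e z) * wt s \<rho> z \<le> norm (c z) * wt s \<rho> z" for z
    using b(2) by (auto simp: e_def wt_nonneg)
  have se: "(\<lambda>z. norm (e z) * wt s \<rho> z) summable_on UNIV"
    by (rule summable_on_comparison_test[OF b(4) e_le]) (simp add: wt_nonneg b(2))
  have "infsum (\<lambda>z. norm (e z) * wt s \<rho> z) UNIV \<le> S"
    by (rule has_sum_mono[OF has_sum_infsum[OF se] S(2) e_le])
  then have 1: "\<exists>S\<le>C. ((\<lambda>z. norm (e z) * wt s \<rho> z) has_sum S) UNIV"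
    using has_sum_infsum[OF se] S(1) by (meson order_trans)
  have 2: "((\<lambda>z. e z * chi \<omega> z p) has_sum (\<Sum>\<^sub>\<infinity>z. e z * chi \<omega> z p)) UNIV" if "\<bar>snd p\<bar> \<le> \<rho>" for p
    by (rule has_sum_infsum, rule abs_summable_summable,
        rule Infinite_Sum.abs_summable_on_comparison_test'[OF se])
       (use b in \<open>auto simp: norm_mult that intro!: mult_left_mono norm_chi_le\<close>)
  show ?thesis
    using b(1,2,3) 1 2 unfolding brep_def e_def[symmetric] by (simp add: e_def)
qed

text \<open>Invariance of \<open>a\<close> under the rotation up to \<open>O(r^D)\<close> kills its
  coefficients of nonzero frequency and degree below \<open>D\<close>, since their divisors are
  nonzero. The mean \<open>a0\<close> is chosen before \<open>D\<close>, so one function serves all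
  orders.\<close>

lemma cls_split_mean:
  assumes a: "cls \<omega> d a" and nr: "nonres \<omega> \<gamma>"
  shows "\<exists>a0. cls \<omega> d a0 \<and> (\<forall>\<theta> \<theta>' r. a0 (\<theta>, r) = a0 (\<theta>', r)) \<and>
    (\<forall>D. small D (\<lambda>p. a (rotation \<gamma> p) - a p) \<longrightarrow> small D (\<lambda>p. a p - a0 p))"
proof -
  obtain s \<rho> C c where s: "0 < s" and c: "brep \<omega> s \<rho> d c (\<lambda>p. complex_of_real (a p)) C"
    using a unfolding cls_def bnd_def by blast
  have z: "c (k, n) = 0" if sm: "small D (\<lambda>p. a (rotation \<gamma> p) - a p)" and "k \<noteq> 0" "n < D" for k n D
  proof -
    have "small D (\<lambda>p. complex_of_real (a (rotation \<gamma> p)) - complex_of_real (a p))"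
      using sm by (simp flip: small_of_real_iff)
    from brep_small_coeff[OF brep_diff_coeff[OF brep_rotation[OF c] c] nr this that(3), of k]
    have "(cis (int_inner k \<omega> * \<gamma>) - 1) * c (k, n) = 0" by (simp add: algebra_simps)
    then show ?thesis using nr that(2) by (simp add: nonres_def)
  qed
  define A where "A p = (\<Sum>\<^sub>\<infinity>z. (if fst z = 0 then c z else 0) * chi \<omega> z p)" for p
  have A: "brep \<omega> s \<rho> d (\<lambda>z. if fst z = 0 then c z else 0) A C"
    using brep_restrict[OF c, of "\<lambda>z. fst z = 0"] unfolding A_def .
  have AD: "brep \<omega> s \<rho> d (\<lambda>z. c z - (if fst z = 0 then c z else 0)) (\<lambda>p. complex_of_real (a p) - A p) (C + C)"
    by (rule brep_diff_coeff[OF c A])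
  have 1: "small D (\<lambda>p. a p - Re (A p))" if "small D (\<lambda>p. a (rotation \<gamma> p) - a p)" for D
  proof -
    have "brep \<omega> s \<rho> D (\<lambda>z. c z - (if fst z = 0 then c z else 0)) (\<lambda>p. complex_of_real (a p) - A p) (C + C)"
      using AD z[OF that] unfolding brep_def by auto
    then have "bnd \<omega> s \<rho> D (\<lambda>p. complex_of_real (a p) - A p) (C + C)" unfolding bnd_def by blast
    from bnd_small[OF bnd_Re[OF this]] show ?thesis by (simp flip: small_of_real_iff)
  qed
  have "bnd \<omega> s \<rho> d A C" using A unfolding bnd_def by blast
  from clsI[OF bnd_Re[OF this] s] have 2: "cls \<omega> d (\<lambda>p. Re (A p))" .
  have "(if fst z = 0 then c z else 0) * chi \<omega> z (\<theta>, r) = (if fst z = 0 then c z else 0) * chi \<omega> z (\<theta>', r)"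
    for z \<theta> \<theta>' r by (simp add: chi_def)
  then have "A (\<theta>, r) = A (\<theta>', r)" for \<theta> \<theta>' r unfolding A_def by (intro infsum_cong)
  with 1 2 show ?thesis by (intro exI[of _ "\<lambda>p. Re (A p)"]) metis
qed

text \<open>Summed along an orbit, the coboundary \<open>a - a R\<close> telescopes to a term of
  size \<open>2 Ca\<close>, so the average of \<open>f\<close> over the image of the orbit is
  \<open>O(r^N)\<close>. Since \<open>a0\<close> and \<open>b0\<close> depend on \<open>r\<close>
  only, that image is again an orbit, at radius \<open>X r\<close>, and the average tends to the
  mean of \<open>f\<close> there.\<close>

lemma mean0_aux:
  fixes \<omega> :: "real ^ 'm"
  assumes c: "brep \<omega> s \<rho> d c (\<lambda>p. complex_of_real (f p)) C" and nr: "nonres \<omega> \<gamma>"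
    and a: "cls \<omega> d' a" and Y: "tame (perturbed_rotation 0 a0 b0)"
    and a0: "\<And>\<theta> \<theta>' r. a0 (\<theta>, r) = a0 (\<theta>', r)" and b0: "\<And>\<theta> \<theta>' r. b0 (\<theta>, r) = b0 (\<theta>', r)"
    and low: "r0 > 0" "L > 0" "\<And>p. \<bar>snd p\<bar> \<le> r0 \<Longrightarrow> \<bar>snd p\<bar> \<le> L * \<bar>snd (perturbed_rotation 0 a0 b0 p)\<bar>"
    and sm: "small N (\<lambda>p. a p - a (rotation \<gamma> p) + f (perturbed_rotation 0 a0 b0 p))" and n: "n < N"
  shows "c (0, n) = 0"
proof -
  note b = brepD[OF c]
  obtain K r1 where K: "0 < r1" "\<And>p. \<bar>snd p\<bar> \<le> r1 \<Longrightarrow>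
      \<bar>a p - a (rotation \<gamma> p) + f (perturbed_rotation 0 a0 b0 p)\<bar> \<le> K * \<bar>snd p\<bar> ^ N"
    using sm unfolding small_def real_norm_def by blast
  obtain sa \<rho>a Ca where a': "rbnd \<omega> sa \<rho>a d' a Ca" using a unfolding cls_def by blast
  have \<rho>a: "0 < \<rho>a" using bndD[OF a'] by simp
  have a_le: "\<bar>a p\<bar> \<le> Ca" if "\<bar>snd p\<bar> \<le> \<rho>a" for p using bnd_norm_le[OF a' that] by simp
  obtain K2 r2 where K2: "0 \<le> K2" "0 < r2" "\<And>p. \<bar>snd p\<bar> \<le> r2 \<Longrightarrow> \<bar>snd (perturbed_rotation 0 a0 b0 p)\<bar> \<le> K2 * \<bar>snd p\<bar>"
    "\<And>p :: real \<times> real. \<bar>snd p\<bar> \<le> r2 \<Longrightarrow> K2 * \<bar>snd p\<bar> \<le> \<rho>"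
    using tameE[OF Y b(2)] by metis
  define P where "P r = (\<Sum>\<^sub>\<infinity>n. c (0, n) * of_real (r ^ n))" for r :: real
  have P: "((\<lambda>n. c (0, n) * of_real (r ^ n)) has_sum P r) UNIV"
    and Pm: "orbit_mean \<omega> \<gamma> 0 (\<lambda>p. complex_of_real (f p)) \<theta> r \<longlonglongrightarrow> P r" if "\<bar>r\<bar> \<le> \<rho>" for \<theta> r
    using brep_orbit_mean[OF c nr that, of 0 \<theta>] unfolding P_def by (auto simp: has_sum_iff)
  define m where "m = min (min r0 r1) (min r2 \<rho>a)"
  have m: "0 < m" using low K K2 \<rho>a by (simp add: m_def)
  define X where "X r = snd (perturbed_rotation 0 a0 b0 (0, r))" for r
  have bound: "norm (P (X r)) \<le> K * \<bar>r\<bar> ^ N" if r: "\<bar>r\<bar> \<le> m" for r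
  proof -
    have X: "\<bar>X r\<bar> \<le> \<rho>" using K2(3,4)[of "(0, r)"] r by (auto simp: X_def m_def)
    define t where "t j = (real j * \<gamma>, r)" for j
    have Rt: "rotation \<gamma> (t j) = t (Suc j)" for j by (simp add: t_def rotation_def algebra_simps)
    define Q where "Q n = (\<Sum>j<n. f (perturbed_rotation 0 a0 b0 (t j)))" for n
    have Qf: "orbit_mean \<omega> \<gamma> 0 (\<lambda>p. complex_of_real (f p)) (a0 (0, r)) (X r) n = of_real (Q n / real n)" for n
    proof -
      have "perturbed_rotation 0 a0 b0 (t j) = (a0 (0, r) + real j * \<gamma>, X r)" for j
        using a0[of "real j * \<gamma>" r 0] b0[of "real j * \<gamma>" r 0] by (simp add: t_def X_def pr_apply)
      then show ?thesis by (simp add: orbit_mean_def Q_def)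
    qed
    have Qb: "\<bar>Q n / real n\<bar> \<le> K * \<bar>r\<bar> ^ N + 2 * Ca / real n" if "n > 0" for n
    proof -
      have "Q n = (\<Sum>j<n. a (t j) - a (rotation \<gamma> (t j)) + f (perturbed_rotation 0 a0 b0 (t j))) - (a (t 0) - a (t n))"
        unfolding Q_def Rt sum.distrib using sum_lessThan_telescope'[of "\<lambda>j. a (t j)" n] by simp
      also have "\<bar>\<dots>\<bar> \<le> \<bar>\<Sum>j<n. a (t j) - a (rotation \<gamma> (t j)) + f (perturbed_rotation 0 a0 b0 (t j))\<bar> + (\<bar>a (t 0)\<bar> + \<bar>a (t n)\<bar>)"
        by linarith
      also have "\<dots> \<le> (\<Sum>j<n. K * \<bar>r\<bar> ^ N) + (Ca + Ca)"
      proof (intro add_mono order_trans[OF sum_abs] sum_mono)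
        show "\<bar>a (t j) - a (rotation \<gamma> (t j)) + f (perturbed_rotation 0 a0 b0 (t j))\<bar> \<le> K * \<bar>r\<bar> ^ N" for j
          using K(2)[of "t j"] r by (simp add: t_def m_def)
      qed (use r in \<open>auto intro!: a_le simp: t_def m_def\<close>)
      finally show ?thesis using that by (simp add: abs_divide divide_simps) (simp add: algebra_simps)
    qed
    have "(\<lambda>n. \<bar>Q n / real n\<bar>) \<longlonglongrightarrow> norm (P (X r))"
      using tendsto_norm[OF Pm[OF X, of "a0 (0, r)"]] unfolding Qf norm_of_real .
    moreover have "(\<lambda>n. K * \<bar>r\<bar> ^ N + 2 * Ca / real n) \<longlonglongrightarrow> K * \<bar>r\<bar> ^ N + 0"
      by (intro tendsto_add tendsto_const lim_const_over_n)
    ultimately show ?thesis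
      using Qb by (intro tendsto_le[of sequentially "\<lambda>n. K * \<bar>r\<bar> ^ N + 2 * Ca / real n" _ "\<lambda>n. \<bar>Q n / real n\<bar>"])
        (auto intro: eventually_mono[OF eventually_gt_at_top[of 0]])
  qed
  define r where "r j = m / real (Suc j)" for j
  have r: "0 < r j" "r j \<le> m" for j
    using m divide_left_mono[of 1 "real (Suc j)" m] by (simp_all add: r_def)
  have rlim: "r \<longlonglongrightarrow> 0" unfolding r_def
    using tendsto_mult[OF tendsto_const[of m] LIMSEQ_inverse_real_of_nat] by (simp add: divide_inverse)
  \<comment> \<open>The power series of the mean is evaluated at \<open>X r\<close>, so the bound
    \<open>O(r^N)\<close> has to be rewritten in \<open>X r\<close>; the lower bound does this and
    keeps \<open>X (r j)\<close> nonzero.\<close>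
  have Xlow: "\<bar>r j\<bar> \<le> L * \<bar>X (r j)\<bar>" for j
    using low(3)[of "(0, r j)"] r[of j] by (simp add: X_def m_def)
  have Xup: "\<bar>X (r j)\<bar> \<le> K2 * r j" for j
    using K2(3)[of "(0, r j)"] r[of j] by (simp add: X_def m_def)
  show ?thesis
  proof (rule powser_order[where a = "\<lambda>n. c (0, n)" and P = P and X = "\<lambda>j. X (r j)" and K = "\<bar>K\<bar> * L ^ N",
        OF b(2) brep_slice_summable[OF c] P _ _ _ n])
    have "(\<lambda>j. K2 * r j) \<longlonglongrightarrow> K2 * 0" by (intro tendsto_intros rlim)
    then show "(\<lambda>j. X (r j)) \<longlonglongrightarrow> 0"
      by (intro Lim_null_comparison[of "\<lambda>j. X (r j)" "\<lambda>j. K2 * r j"] always_eventually) (simp_all add: Xup)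
    show "X (r j) \<noteq> 0" for j using Xlow[of j] r(1)[of j] by auto
    show "norm (P (X (r j))) \<le> \<bar>K\<bar> * L ^ N * \<bar>X (r j)\<bar> ^ N" for j
    proof -
      have "norm (P (X (r j))) \<le> K * \<bar>r j\<bar> ^ N" using r[of j] by (intro bound) simp
      also have "\<dots> \<le> \<bar>K\<bar> * (L * \<bar>X (r j)\<bar>) ^ N"
        using Xlow[of j] by (intro mult_mono power_mono) auto
      finally show ?thesis by (simp add: power_mult_distrib)
    qed
  qed auto
qed

context diophantine_rotation
begin

text \<open>The convergent trace of the formal linearization. \<open>U\<close> and \<open>V\<close>
  may depend on \<open>N\<close>, and \<open>V\<close> inverts \<open>U\<close> modulo
  \<open>O(r^N)\<close>, because truncations of mutually inverse formal maps need not be inverse to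
  each other.\<close>

definition fconj :: "planar_map \<Rightarrow> bool" where
  "fconj M \<longleftrightarrow> (\<forall>N. \<exists>U V. amap \<omega> 0 1 U \<and> amap \<omega> 0 1 V \<and>
     apx N (M \<circ> U) (U \<circ> rotation \<gamma>) \<and> apx N (V \<circ> U) id \<and> apx N (U \<circ> V) id)"

text \<open>The conjugacy equation first gives \<open>a R - a = O(r^d)\<close>, and the same for
  \<open>b\<close>, so \<open>U\<close> is within \<open>O(r^d)\<close> of a map \<open>Y\<close>
  whose displacements depend on \<open>r\<close> alone. Replacing \<open>U\<close> by
  \<open>Y\<close> inside \<open>f\<close> and \<open>g\<close> costs \<open>O(r^(2d-1))\<close>,
  which is the order the Newton step asks for.\<close>

lemma mean0:
  assumes M: "fconj (perturbed_rotation \<gamma> f g)" and f: "cls \<omega> d f" and g: "cls \<omega> d g" and d: "2 \<le> d"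
  shows "mean0 \<omega> (2 * d - 1) f \<and> mean0 \<omega> (2 * d - 1) g"
proof -
  define N where "N = 2 * d - 1"
  have N: "d \<le> N" "2 \<le> N" "d + d - 1 = N" using d by (auto simp: N_def)
  obtain U V where U: "amap \<omega> 0 1 U" and V: "amap \<omega> 0 1 V"
    and MU: "apx N (perturbed_rotation \<gamma> f g \<circ> U) (U \<circ> rotation \<gamma>)" and VU: "apx N (V \<circ> U) id"
    using M unfolding fconj_def by blast
  obtain a b where Ue: "U = perturbed_rotation 0 a b" and ab: "cls \<omega> 1 a" "cls \<omega> 1 b" using U by (rule amapE)
  have UR: "U \<circ> rotation \<gamma> = perturbed_rotation \<gamma> (\<lambda>p. a (rotation \<gamma> p)) (\<lambda>p. b (rotation \<gamma> p))"
    unfolding pr_rotation[symmetric] Ue pr_comp by simp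
  have MUe: "perturbed_rotation \<gamma> f g \<circ> U = perturbed_rotation \<gamma> (\<lambda>p. a p + f (U p)) (\<lambda>p. b p + g (U p))"
    unfolding Ue pr_comp by simp
  have s: "small N (\<lambda>p. a p + f (U p) - a (rotation \<gamma> p))" "small N (\<lambda>p. b p + g (U p) - b (rotation \<gamma> p))"
    using MU unfolding UR MUe apx_pr_iff by auto
  have tU: "tame U" using U by (rule amap_tame)
  have fU: "small d (\<lambda>p. f (U p))" "small d (\<lambda>p. g (U p))"
    by (rule small_comp[OF cls_small[OF f] tU], rule small_comp[OF cls_small[OF g] tU])
  have "small d (\<lambda>p. f (U p) - (a p + f (U p) - a (rotation \<gamma> p)))"
    "small d (\<lambda>p. g (U p) - (b p + g (U p) - b (rotation \<gamma> p)))"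
    by (rule small_diff[OF fU(1) small_mono[OF s(1) N(1)]], rule small_diff[OF fU(2) small_mono[OF s(2) N(1)]])
  then have "small d (\<lambda>p. a (rotation \<gamma> p) - a p)" "small d (\<lambda>p. b (rotation \<gamma> p) - b p)" by simp_all
  with cls_split_mean[OF ab(1) nonres] cls_split_mean[OF ab(2) nonres]
  obtain a0 b0 where a0: "cls \<omega> 1 a0" "\<And>\<theta> \<theta>' r. a0 (\<theta>, r) = a0 (\<theta>', r)" "small d (\<lambda>p. a p - a0 p)"
    and b0: "cls \<omega> 1 b0" "\<And>\<theta> \<theta>' r. b0 (\<theta>, r) = b0 (\<theta>', r)" "small d (\<lambda>p. b p - b0 p)" by blast
  define Y where "Y = perturbed_rotation 0 a0 b0"
  have aY: "amap \<omega> 0 1 Y" unfolding Y_def by (intro amapI a0 b0)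
  have tY: "tame Y" using aY by (rule amap_tame)
  have UY: "apx d U Y" unfolding Ue Y_def apx_pr_iff using a0 b0 by simp
  have sY: "small N (\<lambda>p. a p - a (rotation \<gamma> p) + f (Y p))" "small N (\<lambda>p. b p - b (rotation \<gamma> p) + g (Y p))"
    using small_diff[OF s(1) cls_apx[OF f _ tU tY UY, unfolded N(3)]]
      small_diff[OF s(2) cls_apx[OF g _ tU tY UY, unfolded N(3)]] d by (simp_all add: algebra_simps)
  \<comment> \<open>\<open>Y\<close> is invertible to first order: \<open>V Y = id + O(r^2)\<close>,
    hence \<open>|r|\<close> is bounded by a multiple of the radius of \<open>Y p\<close>.\<close>
  have "apx 2 (V \<circ> Y) (V \<circ> U)"
    by (rule apx_mono[OF apx_comp_left[OF V tY tU apx_sym[OF UY]] d])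
  also have "apx 2 (V \<circ> U) id" by (rule apx_mono[OF VU N(2)])
  finally obtain K r1 where K: "0 < r1" "\<And>p. \<bar>snd p\<bar> \<le> r1 \<Longrightarrow> norm (V (Y p) - p) \<le> K * \<bar>snd p\<bar> ^ 2"
    unfolding apx_def small_def comp_apply id_apply by blast
  obtain L r2 where L: "L \<ge> 0" "0 < r2" "\<And>p. \<bar>snd p\<bar> \<le> r2 \<Longrightarrow> \<bar>snd (V p)\<bar> \<le> L * \<bar>snd p\<bar>"
    using amap_tame[OF V] unfolding tame_def by auto
  obtain L' r3 where L': "0 < r3" "\<And>p. \<bar>snd p\<bar> \<le> r3 \<Longrightarrow> \<bar>snd (Y p)\<bar> \<le> L' * \<bar>snd p\<bar>"
    "\<And>p :: real \<times> real. \<bar>snd p\<bar> \<le> r3 \<Longrightarrow> L' * \<bar>snd p\<bar> \<le> r2"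
    using tameE[OF tY L(2)] by metis
  define r0 where "r0 = min (min r1 r3) (1 / (2 * (\<bar>K\<bar> + 1)))"
  have r0: "0 < r0" using K L' by (simp add: r0_def)
  have low: "\<bar>snd p\<bar> \<le> (2 * (L + 1)) * \<bar>snd (Y p)\<bar>" if p: "\<bar>snd p\<bar> \<le> r0" for p
  proof -
    have "\<bar>snd p\<bar> \<le> 1 / (2 * (\<bar>K\<bar> + 1))" using p by (simp add: r0_def)
    then have "\<bar>K\<bar> * \<bar>snd p\<bar> \<le> 1 / 2" by (simp add: pos_le_divide_eq algebra_simps)
    then have "K * \<bar>snd p\<bar> \<le> 1 / 2" using mult_right_mono[OF abs_ge_self[of K] abs_ge_zero[of "snd p"]] by linarith
    from mult_right_mono[OF this abs_ge_zero[of "snd p"]]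
    have "norm (V (Y p) - p) \<le> \<bar>snd p\<bar> / 2"
      using K(2)[of p] p by (simp add: r0_def power2_eq_square mult.assoc)
    moreover have "\<bar>snd (V (Y p)) - snd p\<bar> \<le> norm (V (Y p) - p)"
      using norm_snd_le[of "snd (V (Y p) - p)" "fst (V (Y p) - p)"] unfolding prod.collapse by simp
    moreover have "\<bar>snd (V (Y p))\<bar> \<le> L * \<bar>snd (Y p)\<bar>"
      using L'(2)[of p] L'(3)[of p] p by (intro L(3)) (simp add: r0_def)
    ultimately show ?thesis unfolding distrib_right distrib_left mult.assoc by linarith
  qed
  have "mean0 \<omega> N f" unfolding mean0_def
  proof (intro allI impI)
    fix s \<rho> d' c C n
    assume c: "brep \<omega> s \<rho> d' c (\<lambda>p. complex_of_real (f p)) C" and n: "n < N"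
    show "c (0, n) = 0"
      by (rule mean0_aux[OF c nonres ab(1) tY[unfolded Y_def] a0(2) b0(2) r0 _ low[unfolded Y_def] sY(1)[unfolded Y_def] n])
         (use L in auto)
  qed
  moreover have "mean0 \<omega> N g" unfolding mean0_def
  proof (intro allI impI)
    fix s \<rho> d' c C n
    assume c: "brep \<omega> s \<rho> d' c (\<lambda>p. complex_of_real (g p)) C" and n: "n < N"
    show "c (0, n) = 0"
      by (rule mean0_aux[OF c nonres ab(2) tY[unfolded Y_def] a0(2) b0(2) r0 _ low[unfolded Y_def] sY(2)[unfolded Y_def] n])
         (use L in auto)
  qed
  ultimately show ?thesis by (simp add: N_def)
qed

text \<open>The approximants \<open>U\<close> and \<open>V\<close> of \<open>M\<close> become
  \<open>W' U\<close> and \<open>V T\<close> for the conjugate map; composition with exact analytic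
  changes preserves every order.\<close>

lemma fconj_conjugate:
  assumes M: "fconj M" "amap \<omega> \<gamma> 1 M" and T: "amap \<omega> 0 1 T" and W: "amap \<omega> 0 1 W'"
    and TW: "eq_near0 (T \<circ> W') id" and WT: "eq_near0 (W' \<circ> T) id"
  shows "fconj (W' \<circ> M \<circ> T)"
  unfolding fconj_def
proof
  fix N
  obtain U V where U: "amap \<omega> 0 1 U" and V: "amap \<omega> 0 1 V" and MU: "apx N (M \<circ> U) (U \<circ> rotation \<gamma>)"
    and VU: "apx N (V \<circ> U) id" and UV: "apx N (U \<circ> V) id" using M unfolding fconj_def by blast
  note tm = amap_tame[OF U] amap_tame[OF V] amap_tame[OF T] amap_tame[OF W] amap_tame[OF M(2)]
    amap_tame[OF amap_comp0[OF M(2) U]] amap_tame[OF amap_comp0'[OF U amap_rotation]]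
    amap_tame[OF amap_comp0[OF U V]] amap_tame[OF amap_id]
  have 1: "amap \<omega> 0 1 (W' \<circ> U)" by (rule amap_comp0[OF W U])
  have 2: "amap \<omega> 0 1 (V \<circ> T)" by (rule amap_comp0[OF V T])
  have "eq_near0 (T \<circ> W' \<circ> U) (id \<circ> U)" by (rule eq_near0_comp_right[OF TW tm(1)])
  then have TWU: "eq_near0 (T \<circ> (W' \<circ> U)) U" by (simp add: comp_assoc)
  have "eq_near0 (W' \<circ> M \<circ> T \<circ> (W' \<circ> U)) (W' \<circ> (M \<circ> U))"
    using eq_near0_comp_left[OF TWU, of "W' \<circ> M"] by (simp add: comp_assoc)
  also have "apx N (W' \<circ> (M \<circ> U)) (W' \<circ> (U \<circ> rotation \<gamma>))"
    by (rule apx_comp_left[OF W tm(6,7) MU])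
  finally have 3: "apx N (W' \<circ> M \<circ> T \<circ> (W' \<circ> U)) (W' \<circ> U \<circ> rotation \<gamma>)" by (simp add: comp_assoc)
  have "eq_near0 (V \<circ> T \<circ> (W' \<circ> U)) (V \<circ> U)"
    using eq_near0_comp_left[OF TWU, of V] by (simp add: comp_assoc)
  also note VU
  finally have 4: "apx N (V \<circ> T \<circ> (W' \<circ> U)) id" .
  have "apx N (W' \<circ> (U \<circ> V) \<circ> T) (W' \<circ> id \<circ> T)"
    by (intro apx_comp_right apx_comp_left[OF W] UV tm)
  then have "apx N (W' \<circ> U \<circ> (V \<circ> T)) (W' \<circ> T)" by (simp add: comp_assoc)
  also note WT
  finally have 5: "apx N (W' \<circ> U \<circ> (V \<circ> T)) id" .
  from 1 2 3 4 5 show "\<exists>U V. amap \<omega> 0 1 U \<and> amap \<omega> 0 1 V \<and> apx N (W' \<circ> M \<circ> T \<circ> U) (U \<circ> rotation \<gamma>) \<and>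
      apx N (V \<circ> U) id \<and> apx N (U \<circ> V) id" by blast
qed

end

section \<open>The iteration\<close>

lemma bounded_of_ratio_tendsto_zero:
  fixes x r :: "nat \<Rightarrow> real"
  assumes "\<And>n. 0 \<le> x n" "\<And>n. x (Suc n) \<le> r n * x n" "r \<longlonglongrightarrow> 0"
  shows "\<exists>B>0. \<forall>n. x n \<le> B"
proof -
  obtain n0 where n0: "\<And>n. n \<ge> n0 \<Longrightarrow> r n \<le> 1"
    using order_tendstoD(2)[OF assms(3), of 1] by (auto simp: eventually_sequentially intro: less_imp_le)
  have 1: "x n \<le> x n0" if "n \<ge> n0" for n
    using that
  proof (induction n rule: nat_induct_at_least)
    case (Suc n)
    then show ?case
      using assms(2)[of n] mult_right_mono[OF n0[OF Suc.hyps] assms(1)[of n]] by linarith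
  qed simp
  have "x n \<le> (\<Sum>i\<le>n0. x i) + 1" for n
  proof (cases "n \<le> n0")
    case True
    then have "x n \<le> (\<Sum>i\<le>n0. x i)" using assms(1) by (intro member_le_sum) auto
    then show ?thesis by simp
  next
    case False
    then have "x n \<le> x n0" by (intro 1) simp
    also have "\<dots> \<le> (\<Sum>i\<le>n0. x i)" using assms(1) by (intro member_le_sum) auto
    finally show ?thesis by simp
  qed
  moreover have "0 < (\<Sum>i\<le>n0. x i) + 1" using assms(1) by (simp add: add_nonneg_pos sum_nonneg)
  ultimately show ?thesis by blast
qed

lemma superexp_limit:
  fixes a b c k :: real
  assumes "0 < a" "0 < b" "0 < k" "1 < q"
  shows "(\<lambda>n. a * (1 + k * q ^ n) * exp (- (b * (4 / 3) ^ n))) \<longlonglongrightarrow> 0"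
  using assms by real_asymp

context diophantine_rotation
begin

text \<open>Factor by which step \<open>n\<close> multiplies the error. The width loss
  \<open>s/18 (2/3)^n\<close>, taken three times per step, sums to \<open>s/2\<close>. The
  exponential bounds the gain from shrinking the radius: an order of at least \<open>2^n\<close>
  times a relative loss of at least \<open>(2/3)^n / 18\<close> is at least
  \<open>(4/3)^n / 18\<close>.\<close>

definition damp :: "real \<Rightarrow> nat \<Rightarrow> real" where
  "damp s n = (1 + 2 * \<kappa> (s / 18 * (2 / 3) ^ n)) * exp (- ((4 / 3) ^ n / 18))"

lemma \<kappa>_geometric:
  assumes "0 < s"
  shows "\<kappa> (s / 18 * (2 / 3) ^ n) = \<kappa> (s / 18) * ((3 / 2) powr \<sigma>) ^ n"
proof -
  have *: "\<sigma> / (s / 18 * (2 / 3) ^ n) = \<sigma> / (s / 18) * (3 / 2) ^ n"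
    by (simp add: power_divide)
  have "(\<sigma> / (s / 18) * (3 / 2) ^ n) powr \<sigma> = (\<sigma> / (s / 18)) powr \<sigma> * ((3 / 2) ^ n) powr \<sigma>"
    by (rule powr_mult)
  also have "((3 / 2 :: real) ^ n) powr \<sigma> = ((3 / 2) powr \<sigma>) ^ n"
    by (simp add: powr_realpow[symmetric] powr_powr mult.commute)
  finally show ?thesis unfolding \<kappa>_def * by simp
qed

lemma damp_pos: "0 < s \<Longrightarrow> 0 < damp s n"
  unfolding damp_def using \<kappa>_pos[of "s / 18 * (2 / 3) ^ n"] by (intro mult_pos_pos) auto

text \<open>Up to constants this is \<open>(\<kappa> + 1) \<epsilon> / \<delta>'\<close> at step
  \<open>n\<close>, the factor \<open>(3/2)^n\<close> coming from the shrinking loss.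
  \<open>\<kappa>\<close> grows geometrically with ratio \<open>(3/2) powr \<sigma>\<close>, whereas
  \<open>damp\<close> decreases like the exponential of \<open>-(4/3)^n / 18\<close>, so quotients
  of consecutive terms are dominated by a null sequence.\<close>

lemma damp_bounded:
  assumes s: "0 < s"
  shows "\<exists>B>0. \<forall>n. (\<kappa> (s / 18 * (2 / 3) ^ n) + 1) * (3 / 2) ^ n * (\<Prod>i<n. damp s i) \<le> B"
proof -
  define q where "q = (3 / 2 :: real) powr \<sigma>"
  define k where "k = \<kappa> (s / 18)"
  have q: "1 < q" using \<sigma> unfolding q_def by (intro gr_one_powr) auto
  have k: "0 < k" using \<kappa>_pos s by (simp add: k_def)
  have K: "\<kappa> (s / 18 * (2 / 3) ^ n) = k * q ^ n" for n unfolding k_def q_def by (rule \<kappa>_geometric[OF s])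
  define x where "x n = (k * q ^ n + 1) * (3 / 2) ^ n * (\<Prod>i<n. damp s i)" for n
  have x0: "0 \<le> x n" for n unfolding x_def using k q damp_pos[OF s]
    by (intro mult_nonneg_nonneg prod_nonneg) (auto intro: less_imp_le add_nonneg_nonneg)
  have ratio: "x (Suc n) \<le> (3 / 2 * q) * (1 + 2 * k * q ^ n) * exp (- (1 / 18 * (4 / 3) ^ n)) * x n" for n
  proof -
    have "k * q ^ Suc n + 1 \<le> q * (k * q ^ n + 1)" using q by (simp add: algebra_simps)
    then have "x (Suc n) \<le> (q * (k * q ^ n + 1)) * (3 / 2) ^ Suc n * (\<Prod>i<Suc n. damp s i)"
      unfolding x_def using damp_pos[OF s]
      by (intro mult_right_mono prod_nonneg mult_nonneg_nonneg) (auto intro: less_imp_le)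
    also have "\<dots> = (3 / 2 * q) * damp s n * x n" by (simp add: x_def)
    also have "damp s n = (1 + 2 * k * q ^ n) * exp (- (1 / 18 * (4 / 3) ^ n))"
      unfolding damp_def K by simp
    finally show ?thesis by (simp add: mult.assoc)
  qed
  have "(\<lambda>n. (3 / 2 * q) * (1 + 2 * k * q ^ n) * exp (- (1 / 18 * (4 / 3) ^ n))) \<longlonglongrightarrow> 0"
    using q k by (intro superexp_limit) auto
  from bounded_of_ratio_tendsto_zero[of x, OF x0 ratio this] show ?thesis
    unfolding K x_def .
qed

text \<open>\<open>(f, g)\<close> is the current remainder and \<open>(p, q)\<close> the composite
  of all changes so far. Width and radius fall towards \<open>s / 2\<close> and
  \<open>\<rho> / 2\<close>; the order \<open>2^n + 1\<close> solves
  \<open>d \<mapsto> 2d - 1\<close> with start 2; \<open>\<rho>/6 (1 - (2/3)^n)\<close> is the sum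
  of the losses \<open>\<rho>/18 (2/3)^i\<close>. The remainder is scaled by \<open>\<rho>\<close>
  so that the choice of \<open>h\<close> does not involve \<open>\<rho>\<close>.\<close>

definition newton_state :: "planar_map \<Rightarrow> real \<Rightarrow> real \<Rightarrow> real \<Rightarrow> nat \<Rightarrow>
    (real \<times> real \<Rightarrow> real) \<times> (real \<times> real \<Rightarrow> real) \<times> (real \<times> real \<Rightarrow> real) \<times> (real \<times> real \<Rightarrow> real) \<Rightarrow> bool" where
  "newton_state M s \<rho> h n x = (case x of (f, g, p, q) \<Rightarrow>
     rbnd \<omega> (s / 2 * (1 + (2 / 3) ^ n)) (\<rho> / 2 * (1 + (2 / 3) ^ n)) (2 ^ n + 1) f (h * (\<Prod>i<n. damp s i) * \<rho>) \<and>
     rbnd \<omega> (s / 2 * (1 + (2 / 3) ^ n)) (\<rho> / 2 * (1 + (2 / 3) ^ n)) (2 ^ n + 1) g (h * (\<Prod>i<n. damp s i) * \<rho>) \<and>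
     rbnd \<omega> (s / 2 * (1 + (2 / 3) ^ n)) (\<rho> / 2 * (1 + (2 / 3) ^ n)) 2 p (\<rho> / 6 * (1 - (2 / 3) ^ n)) \<and>
     rbnd \<omega> (s / 2 * (1 + (2 / 3) ^ n)) (\<rho> / 2 * (1 + (2 / 3) ^ n)) 2 q (\<rho> / 6 * (1 - (2 / 3) ^ n)) \<and>
     fconj (perturbed_rotation \<gamma> f g) \<and>
     eq_near0 (M \<circ> perturbed_rotation 0 p q) (perturbed_rotation 0 p q \<circ> perturbed_rotation \<gamma> f g))"

lemma newton_state_Suc:
  assumes st: "newton_state M s \<rho> h n (f, g, p, q)" and s: "0 < s" and \<rho>: "0 < \<rho>" "\<rho> \<le> 1" and h: "0 < h"
    and B: "\<And>n. (\<kappa> (s / 18 * (2 / 3) ^ n) + 1) * (3 / 2) ^ n * (\<Prod>i<n. damp s i) \<le> B"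
    and hB: "h * B \<le> 1 / 18" "W * (h * B) \<le> s / 18"
  shows "\<exists>f' g' p' q'. newton_state M s \<rho> h (Suc n) (f', g', p', q') \<and>
    small (Suc n) (\<lambda>x. p' x - p x) \<and> small (Suc n) (\<lambda>x. q' x - q x)"
proof -
  define t where "t = (2 / 3 :: real) ^ n"
  have t: "0 < t" "t \<le> 1" by (auto simp: t_def power_le_one)
  define \<epsilon> where "\<epsilon> = h * (\<Prod>i<n. damp s i) * \<rho>"
  define sn \<rho>n where "sn = s / 2 * (1 + t)" and "\<rho>n = \<rho> / 2 * (1 + t)"
  define \<delta> \<delta>' where "\<delta> = s / 18 * t" and "\<delta>' = \<rho> / 18 * t"
  define d where "d = (2::nat) ^ n + 1"
  have d: "2 \<le> d" "Suc n \<le> d" "2 * d - 1 = 2 ^ Suc n + 1"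
    using less_exp[of n] by (auto simp: d_def)
  have \<delta>: "0 < \<delta>" "0 < \<delta>'" using s \<rho> t by (auto simp: \<delta>_def \<delta>'_def)
  have sn': "sn - 3 * \<delta> = s / 2 * (1 + (2 / 3) ^ Suc n)" "\<rho>n - 3 * \<delta>' = \<rho> / 2 * (1 + (2 / 3) ^ Suc n)"
    by (simp_all add: sn_def \<rho>n_def \<delta>_def \<delta>'_def t_def algebra_simps)
  have pos: "0 < sn - 3 * \<delta>" "0 < \<rho>n - 3 * \<delta>'"
    unfolding sn' using s \<rho> by (auto intro!: mult_pos_pos add_pos_pos)
  have st': "rbnd \<omega> sn \<rho>n d f \<epsilon>" "rbnd \<omega> sn \<rho>n d g \<epsilon>"
    "rbnd \<omega> sn \<rho>n 2 p (\<rho> / 6 * (1 - t))" "rbnd \<omega> sn \<rho>n 2 q (\<rho> / 6 * (1 - t))"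
    "fconj (perturbed_rotation \<gamma> f g)"
    "eq_near0 (M \<circ> perturbed_rotation 0 p q) (perturbed_rotation 0 p q \<circ> perturbed_rotation \<gamma> f g)"
    using st unfolding newton_state_def by (simp_all add: sn_def \<rho>n_def d_def t_def \<epsilon>_def)
  have eps: "0 \<le> \<epsilon>" using st'(1) by (rule bnd_const_nonneg)
  have \<kappa>: "0 < \<kappa> \<delta>" using \<kappa>_pos \<delta> by simp
  \<comment> \<open>The factor \<open>t\<close> released here is the one contained in
    \<open>\<delta>\<close> and \<open>\<delta>'\<close>, so the uniform bound \<open>B\<close>
    yields the smallness conditions at every \<open>n\<close>.\<close>
  have tinv: "(3 / 2 :: real) ^ n * t = 1" by (simp add: t_def power_mult_distrib[symmetric])
  have "(\<kappa> \<delta> + 1) * (\<Prod>i<n. damp s i) = (\<kappa> \<delta> + 1) * (3 / 2) ^ n * (\<Prod>i<n. damp s i) * t"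
    using tinv by (simp add: mult.assoc mult.left_commute[of "(3 / 2) ^ n"])
  also have "\<dots> \<le> B * t"
    using B[of n] t by (intro mult_right_mono) (auto simp: \<delta>_def t_def)
  finally have "(\<kappa> \<delta> + 1) * (\<Prod>i<n. damp s i) \<le> B * t" .
  from mult_left_mono[OF this, of "h * \<rho>"] have small: "(\<kappa> \<delta> + 1) * \<epsilon> \<le> h * B * t * \<rho>"
    using h \<rho> by (simp add: \<epsilon>_def algebra_simps)
  have sm2: "(\<kappa> \<delta> + 1) * \<epsilon> \<le> \<delta>'"
  proof -
    have "h * B * t * \<rho> \<le> 1 / 18 * t * \<rho>" using hB t \<rho> by (intro mult_right_mono) auto
    then show ?thesis using small by (simp add: \<delta>'_def mult.commute)
  qed
  have sm1: "W * ((\<kappa> \<delta> + 1) * \<epsilon>) \<le> \<delta>"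
  proof -
    have "W * ((\<kappa> \<delta> + 1) * \<epsilon>) \<le> W * (h * B * t * \<rho>)"
      using small by (intro mult_left_mono freq_norm_nonneg)
    also have "\<dots> = W * (h * B) * (t * \<rho>)" by simp
    also have "\<dots> \<le> s / 18 * (t * \<rho>)" using hB t \<rho> by (intro mult_right_mono) auto
    also have "\<dots> \<le> s / 18 * (t * 1)" using s t \<rho> by (intro mult_left_mono) auto
    finally show ?thesis by (simp add: \<delta>_def)
  qed
  have cf: "cls \<omega> d f" "cls \<omega> d g" "cls \<omega> 2 p" "cls \<omega> 2 q"
    using st' pos \<delta> by (auto intro: clsI)
  obtain u v u' v' f' g' where N: 
    "rbnd \<omega> (sn - \<delta>) \<rho>n d u (\<kappa> \<delta> * \<epsilon>)" "rbnd \<omega> (sn - \<delta>) \<rho>n d v (\<kappa> \<delta> * \<epsilon>)"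
    "amap \<omega> 0 d (perturbed_rotation 0 u' v')"
    "eq_near0 (perturbed_rotation 0 u v \<circ> perturbed_rotation 0 u' v') id"
    "eq_near0 (perturbed_rotation 0 u' v' \<circ> perturbed_rotation 0 u v) id"
    "perturbed_rotation 0 u' v' \<circ> perturbed_rotation \<gamma> f g \<circ> perturbed_rotation 0 u v = perturbed_rotation \<gamma> f' g'"
    "rbnd \<omega> (sn - 3 * \<delta>) (\<rho>n - 3 * \<delta>') (2 * d - 1) f' ((1 + 2 * \<kappa> \<delta>) * \<epsilon> * (1 - \<delta>' / \<rho>n) ^ (2 * d - 1))"
    "rbnd \<omega> (sn - 3 * \<delta>) (\<rho>n - 3 * \<delta>') (2 * d - 1) g' ((1 + 2 * \<kappa> \<delta>) * \<epsilon> * (1 - \<delta>' / \<rho>n) ^ (2 * d - 1))"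
    using newton_step[OF st'(1,2) d(1) conjunct1[OF mean0] conjunct2[OF mean0] \<delta>(1) _ \<delta>(2) _ sm1 sm2]
      st'(5) cf(1,2) d(1) pos by (metis diff_gt_0_iff_gt)
  define T where "T = perturbed_rotation 0 u v"
  define V where "V = perturbed_rotation 0 u' v'"
  define F where "F = perturbed_rotation \<gamma> f g"
  define Q where "Q = perturbed_rotation 0 p q"
  have cuv: "cls \<omega> d u" "cls \<omega> d v" using N pos \<delta> by (auto intro: clsI)
  have am: "amap \<omega> 0 1 T" "amap \<omega> 0 1 V" "amap \<omega> \<gamma> 1 F" "amap \<omega> 0 1 Q"
    unfolding T_def V_def F_def Q_def using cuv cf N(3) d
    by (auto intro!: amapI elim!: cls_mono amap_mono)
  note tm = am[THEN amap_tame]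
  \<comment> \<open>\<open>1 - \<delta>'/\<rho>n <= 1 - t/18 <= exp (-t/18)\<close>, raised to the
    power \<open>2d - 1 >= 2^n\<close>.\<close>
  have damp_le: "(1 + 2 * \<kappa> \<delta>) * \<epsilon> * (1 - \<delta>' / \<rho>n) ^ (2 * d - 1) \<le> h * (\<Prod>i<Suc n. damp s i) * \<rho>"
  proof -
    have r: "\<rho>n \<le> \<rho>" "0 < \<rho>n" using \<rho> t by (auto simp: \<rho>n_def intro!: mult_pos_pos)
    have "t / 18 = \<delta>' / \<rho>" using \<rho> by (simp add: \<delta>'_def)
    also have "\<dots> \<le> \<delta>' / \<rho>n" using r \<delta> \<rho> by (intro divide_left_mono) auto
    finally have "1 - \<delta>' / \<rho>n \<le> 1 + (- (t / 18))" by simp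
    also have "\<dots> \<le> exp (- (t / 18))" by (rule exp_ge_add_one_self)
    finally have "(1 - \<delta>' / \<rho>n) ^ (2 * d - 1) \<le> exp (- (t / 18)) ^ (2 * d - 1)"
      using pos \<delta> r by (intro power_mono) (auto simp: field_simps)
    also have "\<dots> = exp (- (real (2 * d - 1) * (t / 18)))" by (simp add: exp_of_nat_mult[symmetric])
    also have "\<dots> \<le> exp (- ((4 / 3) ^ n / 18))"
    proof -
      have "(4 / 3) ^ n = 2 ^ n * t" by (simp add: t_def power_mult_distrib[symmetric])
      also have "\<dots> \<le> real (2 * d - 1) * t"
        unfolding d(3) using t by (intro mult_right_mono) auto
      finally show ?thesis by simp
    qed
    finally have "(1 + 2 * \<kappa> \<delta>) * \<epsilon> * (1 - \<delta>' / \<rho>n) ^ (2 * d - 1) \<le> (1 + 2 * \<kappa> \<delta>) * \<epsilon> * exp (- ((4 / 3) ^ n / 18))"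
      using \<kappa> eps by (intro mult_left_mono) auto
    also have "\<dots> = h * (\<Prod>i<Suc n. damp s i) * \<rho>"
      by (simp add: damp_def[of s n] \<epsilon>_def \<delta>_def t_def)
    finally show ?thesis .
  qed
  define p' where "p' x = u x + p (T x)" for x
  define q' where "q' x = v x + q (T x)" for x
  have e: "\<kappa> \<delta> * \<epsilon> \<le> \<delta>'" "W * (\<kappa> \<delta> * \<epsilon>) \<le> \<delta>"
    using sm1 sm2 eps mult_nonneg_nonneg[OF freq_norm_nonneg[of \<omega>] eps] by (auto simp: algebra_simps)
  have u1: "rbnd \<omega> (sn - 3 * \<delta>) (\<rho>n - 3 * \<delta>') 2 u (\<kappa> \<delta> * \<epsilon>)" "rbnd \<omega> (sn - 3 * \<delta>) (\<rho>n - 3 * \<delta>') 2 v (\<kappa> \<delta> * \<epsilon>)"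
    using N(1,2) pos \<delta> d by (auto elim!: bnd_mono)
  have fin: "\<kappa> \<delta> * \<epsilon> + \<rho> / 6 * (1 - t) \<le> \<rho> / 6 * (1 - (2 / 3) ^ Suc n)"
    using e(1) by (simp add: \<delta>'_def t_def algebra_simps)
  have "rbnd \<omega> (sn - 3 * \<delta>) (\<rho>n - 3 * \<delta>') 2 p' (\<kappa> \<delta> * \<epsilon> + \<rho> / 6 * (1 - t))"
    unfolding p'_def T_def by (intro rbnd_add u1 rbnd_comp[OF st'(3) u1]) (use e \<delta> in auto)
  then have p': "rbnd \<omega> (sn - 3 * \<delta>) (\<rho>n - 3 * \<delta>') 2 p' (\<rho> / 6 * (1 - (2 / 3) ^ Suc n))"
    by (rule bnd_mono) (use pos fin in auto)
  have "rbnd \<omega> (sn - 3 * \<delta>) (\<rho>n - 3 * \<delta>') 2 q' (\<kappa> \<delta> * \<epsilon> + \<rho> / 6 * (1 - t))"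
    unfolding q'_def T_def by (intro rbnd_add u1 rbnd_comp[OF st'(4) u1]) (use e \<delta> in auto)
  then have q': "rbnd \<omega> (sn - 3 * \<delta>) (\<rho>n - 3 * \<delta>') 2 q' (\<rho> / 6 * (1 - (2 / 3) ^ Suc n))"
    by (rule bnd_mono) (use pos fin in auto)
  have f'': "rbnd \<omega> (sn - 3 * \<delta>) (\<rho>n - 3 * \<delta>') (2 ^ Suc n + 1) f' (h * (\<Prod>i<Suc n. damp s i) * \<rho>)"
    using N(7) unfolding d(3)[symmetric] by (rule bnd_mono) (use pos damp_le in auto)
  have g'': "rbnd \<omega> (sn - 3 * \<delta>) (\<rho>n - 3 * \<delta>') (2 ^ Suc n + 1) g' (h * (\<Prod>i<Suc n. damp s i) * \<rho>)"
    using N(8) unfolding d(3)[symmetric] by (rule bnd_mono) (use pos damp_le in auto)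
  have QT: "Q \<circ> T = perturbed_rotation 0 p' q'"
    unfolding Q_def T_def pr_comp p'_def q'_def by simp
  have TV: "eq_near0 (T \<circ> V) id" "eq_near0 (V \<circ> T) id" using N by (simp_all add: T_def V_def)
  have fc: "fconj (perturbed_rotation \<gamma> f' g')"
    using fconj_conjugate[OF st'(5) am(3)[unfolded F_def] am(1,2) TV] N(6) by (simp add: T_def V_def)
  have "eq_near0 (M \<circ> Q \<circ> T) (Q \<circ> F \<circ> T)"
    using st'(6) tm by (intro eq_near0_comp_right) (simp_all add: Q_def F_def)
  also have "Q \<circ> F \<circ> T = Q \<circ> (id \<circ> (F \<circ> T))" by (simp add: comp_assoc)
  also have "eq_near0 \<dots> (Q \<circ> ((T \<circ> V) \<circ> (F \<circ> T)))"
    using TV tm am by (intro eq_near0_comp_left eq_near0_comp_right eq_near0_sym[OF TV(1)] amap_tame[OF amap_comp0])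
  also have "Q \<circ> ((T \<circ> V) \<circ> (F \<circ> T)) = Q \<circ> T \<circ> (V \<circ> F \<circ> T)" by (simp add: comp_assoc)
  finally have con: "eq_near0 (M \<circ> (Q \<circ> T)) (Q \<circ> T \<circ> (V \<circ> F \<circ> T))" by (simp only: comp_assoc)
  have "newton_state M s \<rho> h (Suc n) (f', g', p', q')"
    unfolding newton_state_def prod.case sn'[symmetric]
    using f'' g'' p' q' fc con[unfolded QT] N(6) unfolding F_def V_def T_def by simp
  moreover have "small d u" "small d v" using cuv by (auto intro: cls_small)
  moreover have aT: "apx d T id"
    unfolding T_def pr_zero[symmetric] apx_pr_iff using cuv by (simp add: cls_small)
  \<comment> \<open>Consecutive composites agree to order \<open>d >= Suc n\<close>, the agreement
    that makes their coefficients stabilise.\<close>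
  have "small (d + 2 - 1) (\<lambda>x. p (T x) - p (id x))" "small (d + 2 - 1) (\<lambda>x. q (T x) - q (id x))"
    using cls_apx[OF cf(3) _ tm(1) amap_tame[OF amap_id] aT] cls_apx[OF cf(4) _ tm(1) amap_tame[OF amap_id] aT] by auto
  then have "small d (\<lambda>x. p (T x) - p x)" "small d (\<lambda>x. q (T x) - q x)" by (auto elim!: small_mono)
  ultimately have "newton_state M s \<rho> h (Suc n) (f', g', p', q')"
     "small d (\<lambda>x. u x + (p (T x) - p x))" "small d (\<lambda>x. v x + (q (T x) - q x))"
    by (auto intro: small_add)
  then show ?thesis using d(2) unfolding p'_def q'_def
    by (intro exI[of _ f'] exI[of _ g'] exI[of _ "\<lambda>x. u x + p (T x)"] exI[of _ "\<lambda>x. v x + q (T x)"])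
       (auto simp: algebra_simps elim!: small_mono)
qed

text \<open>The conjugacy of the limit is checked modulo \<open>O(r^N)\<close> against state
  \<open>N\<close>, whose remainder has order \<open>2^N + 1 >= N\<close>; flatness then makes it
  exact.\<close>

lemma linearization_order_two:
  assumes M: "amap \<omega> \<gamma> 2 M" "fconj M"
  shows "\<exists>T. amap \<omega> 0 2 T \<and> eq_near0 (M \<circ> T) (T \<circ> rotation \<gamma>)"
proof -
  obtain f g where Me: "M = perturbed_rotation \<gamma> f g" and fg: "cls \<omega> 2 f" "cls \<omega> 2 g" using M(1) by (rule amapE)
  obtain s1 r1 K1 where 1: "0 < s1" "0 < r1" "0 \<le> K1"
    "\<And>\<rho> s'. 0 < \<rho> \<Longrightarrow> \<rho> \<le> r1 \<Longrightarrow> 0 \<le> s' \<Longrightarrow> s' \<le> s1 \<Longrightarrow> rbnd \<omega> s' \<rho> 2 f (K1 * \<rho> ^ 2)"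
    using cls_shrink[OF fg(1)] by metis
  obtain s2 r2 K2 where 2: "0 < s2" "0 < r2" "0 \<le> K2"
    "\<And>\<rho> s'. 0 < \<rho> \<Longrightarrow> \<rho> \<le> r2 \<Longrightarrow> 0 \<le> s' \<Longrightarrow> s' \<le> s2 \<Longrightarrow> rbnd \<omega> s' \<rho> 2 g (K2 * \<rho> ^ 2)"
    using cls_shrink[OF fg(2)] by metis
  define s where "s = min s1 s2"
  have s: "0 < s" using 1 2 by (simp add: s_def)
  obtain B where B: "B > 0" "\<And>n. (\<kappa> (s / 18 * (2 / 3) ^ n) + 1) * (3 / 2) ^ n * (\<Prod>i<n. damp s i) \<le> B"
    using damp_bounded[OF s] by blast
  \<comment> \<open>\<open>B\<close> depends on \<open>s\<close> alone, so \<open>h\<close> is fixed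
    before the radius.\<close>
  define h where "h = min (1 / (18 * B)) (s / (18 * B * (W + 1)))"
  have W: "0 \<le> W" by (rule freq_norm_nonneg)
  have h: "0 < h" using s B W by (simp add: h_def)
  have hB: "h * B \<le> 1 / 18" "W * (h * B) \<le> s / 18"
  proof -
    have "h \<le> 1 / (18 * B)" by (simp add: h_def)
    then show "h * B \<le> 1 / 18" using B by (simp add: field_simps)
    have "h \<le> s / (18 * B * (W + 1))" by (simp add: h_def)
    then have "h * (18 * B * (W + 1)) \<le> s" using B(1) W by (subst (asm) pos_le_divide_eq) auto
    then have "(W + 1) * (h * B) \<le> s / 18" by (simp add: algebra_simps)
    moreover have "W * (h * B) \<le> (W + 1) * (h * B)" using h B by (intro mult_right_mono) auto
    ultimately show "W * (h * B) \<le> s / 18" by simp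
  qed
  define K where "K = max K1 K2 + 1"
  have K: "0 < K" "K1 \<le> K" "K2 \<le> K" using 1 by (auto simp: K_def)
  \<comment> \<open>A remainder of order 2 has norm at most \<open>K \<rho>^2\<close>, which is at
    most \<open>h \<rho>\<close> once \<open>\<rho> <= h / K\<close>: an initial order of 2 makes
    the start small relative to the radius.\<close>
  define \<rho> where "\<rho> = min (min r1 r2) (min 1 (h / K))"
  have \<rho>: "0 < \<rho>" "\<rho> \<le> 1" "\<rho> \<le> r1" "\<rho> \<le> r2" using 1 2 K h by (auto simp: \<rho>_def)
  have "\<rho> \<le> h / K" by (simp add: \<rho>_def)
  then have "K * \<rho> \<le> h" using K by (simp add: pos_le_divide_eq mult.commute)
  then have eps: "K * \<rho> ^ 2 \<le> h * \<rho>" using \<rho> by (simp add: power2_eq_square mult.assoc[symmetric])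
  have K12: "K1 * \<rho> ^ 2 \<le> h * \<rho>" "K2 * \<rho> ^ 2 \<le> h * \<rho>"
    by (rule order_trans[OF mult_right_mono eps]; use K in simp)+
  have init: "rbnd \<omega> s \<rho> 2 f (h * \<rho>)" "rbnd \<omega> s \<rho> 2 g (h * \<rho>)"
    using K12 \<rho> s by (auto intro!: bnd_mono[OF 1(4)[of \<rho> s]] bnd_mono[OF 2(4)[of \<rho> s]] simp: s_def)
  define R where "R n x y \<longleftrightarrow> small (Suc n) (\<lambda>z. fst (snd (snd y)) z - fst (snd (snd x)) z) \<and>
     small (Suc n) (\<lambda>z. snd (snd (snd y)) z - snd (snd (snd x)) z)"
    for n and x y :: "(real \<times> real \<Rightarrow> real) \<times> (real \<times> real \<Rightarrow> real) \<times> (real \<times> real \<Rightarrow> real) \<times> (real \<times> real \<Rightarrow> real)"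
  have "newton_state M s \<rho> h 0 (f, g, (\<lambda>x. 0), (\<lambda>x. 0))"
    unfolding newton_state_def using init M(2) s \<rho> rbnd_zero[of s \<rho> 0 \<omega> 2]
    by (simp add: Me pr_zero eq_near0_refl numeral_2_eq_2)
  moreover have "\<exists>y. newton_state M s \<rho> h (Suc n) y \<and> R n x y" if x: "newton_state M s \<rho> h n x" for n x
  proof -
    obtain f g p q where xe: "x = (f, g, p, q)" by (cases x) auto
    obtain f' g' p' q' where "newton_state M s \<rho> h (Suc n) (f', g', p', q')"
      "small (Suc n) (\<lambda>x. p' x - p x)" "small (Suc n) (\<lambda>x. q' x - q x)"
      using newton_state_Suc[OF x[unfolded xe] s \<rho>(1,2) h B(2) hB] by blast
    then show ?thesis by (intro exI[of _ "(f', g', p', q')"]) (simp add: xe R_def)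
  qed
  ultimately obtain x where x: "\<And>n. newton_state M s \<rho> h n (x n)" "\<And>n. R n (x n) (x (Suc n))"
    using dependent_nat_choice[of "newton_state M s \<rho> h" R] by blast
  define fn where "fn n = fst (x n)" for n
  define gn where "gn n = fst (snd (x n))" for n
  define pn where "pn n = fst (snd (snd (x n)))" for n
  define qn where "qn n = snd (snd (snd (x n)))" for n
  have st: "newton_state M s \<rho> h n (fn n, gn n, pn n, qn n)" for n
    using x(1)[of n] by (simp add: fn_def gn_def pn_def qn_def)
  have step: "small (Suc n) (\<lambda>x. pn (Suc n) x - pn n x)" "small (Suc n) (\<lambda>x. qn (Suc n) x - qn n x)" for n
    using x(2)[of n] by (simp_all add: pn_def qn_def R_def)
  have t: "0 < (2 / 3 :: real) ^ n" "(2 / 3 :: real) ^ n \<le> 1" for n by (auto simp: power_le_one)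
  have pq: "rbnd \<omega> (s / 2) (\<rho> / 2) 2 (pn n) (\<rho> / 6)" "rbnd \<omega> (s / 2) (\<rho> / 2) 2 (qn n) (\<rho> / 6)" for n
  proof -
    have "rbnd \<omega> (s / 2 * (1 + (2 / 3) ^ n)) (\<rho> / 2 * (1 + (2 / 3) ^ n)) 2 (pn n) (\<rho> / 6 * (1 - (2 / 3) ^ n))"
      "rbnd \<omega> (s / 2 * (1 + (2 / 3) ^ n)) (\<rho> / 2 * (1 + (2 / 3) ^ n)) 2 (qn n) (\<rho> / 6 * (1 - (2 / 3) ^ n))"
      using st[of n] unfolding newton_state_def by simp_all
    moreover have "s / 2 \<le> s / 2 * (1 + (2 / 3) ^ n)" "\<rho> / 2 \<le> \<rho> / 2 * (1 + (2 / 3) ^ n)" "\<rho> / 6 * (1 - (2 / 3) ^ n) \<le> \<rho> / 6"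
      using s \<rho> by (auto simp: algebra_simps)
    ultimately show "rbnd \<omega> (s / 2) (\<rho> / 2) 2 (pn n) (\<rho> / 6)" "rbnd \<omega> (s / 2) (\<rho> / 2) 2 (qn n) (\<rho> / 6)"
      using s \<rho> by (auto elim!: bnd_mono)
  qed
  obtain p where p: "rbnd \<omega> (s / 2) (\<rho> / 2) 2 p (\<rho> / 6)" "\<And>n. small (Suc n) (\<lambda>x. p x - pn n x)"
    using rbnd_limit[OF pq(1) nonres step(1)] by blast
  obtain q where q: "rbnd \<omega> (s / 2) (\<rho> / 2) 2 q (\<rho> / 6)" "\<And>n. small (Suc n) (\<lambda>x. q x - qn n x)"
    using rbnd_limit[OF pq(2) nonres step(2)] by blast
  define T where "T = perturbed_rotation 0 p q"
  define Q where "Q n = perturbed_rotation 0 (pn n) (qn n)" for n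
  define F where "F n = perturbed_rotation \<gamma> (fn n) (gn n)" for n
  have T: "amap \<omega> 0 2 T" unfolding T_def using p q s by (intro amapI) (auto intro: clsI)
  have Q: "amap \<omega> 0 2 (Q n)" for n unfolding Q_def using s by (intro amapI clsI[OF pq(1)] clsI[OF pq(2)]) auto
  have T1: "amap \<omega> 0 1 T" and Q1: "amap \<omega> 0 1 (Q n)" and M1: "amap \<omega> \<gamma> 1 M" for n
    using amap_mono[OF T] amap_mono[OF Q] amap_mono[OF M(1)] by auto
  have "apx N (M \<circ> T) (T \<circ> rotation \<gamma>)" for N
  proof -
    have cF: "cls \<omega> (2 ^ N + 1) (fn N)" "cls \<omega> (2 ^ N + 1) (gn N)"
      using st[of N] s t(1)[of N] unfolding newton_state_def by (auto intro!: clsI mult_pos_pos add_pos_pos)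
    have F1: "amap \<omega> \<gamma> 1 (F N)" unfolding F_def using cF by (intro amapI) (auto elim!: cls_mono)
    have TQ: "apx N T (Q N)"
      unfolding T_def Q_def apx_pr_iff using small_mono[OF p(2)[of N]] small_mono[OF q(2)[of N]] by simp
    have "N \<le> 2 ^ N + 1" using less_imp_le[OF less_exp[of N]] by (rule trans_le_add1)
    then have FR: "apx N (F N) (rotation \<gamma>)"
      unfolding F_def pr_rotation[symmetric] apx_pr_iff using cF cls_small small_mono by (auto simp: numeral_2_eq_2 intro: small_mono[OF cls_small])
    have "apx N (M \<circ> T) (M \<circ> Q N)"
      by (rule apx_comp_left[OF M1 amap_tame[OF T1] amap_tame[OF Q1] TQ])
    also have "eq_near0 (M \<circ> Q N) (Q N \<circ> F N)"
      using st[of N] unfolding newton_state_def Q_def F_def by simp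
    also have "apx N (Q N \<circ> F N) (Q N \<circ> rotation \<gamma>)"
      by (rule apx_comp_left[OF Q1 amap_tame[OF F1] amap_tame[OF amap_rotation] FR])
    also have "apx N (Q N \<circ> rotation \<gamma>) (T \<circ> rotation \<gamma>)"
      by (rule apx_comp_right[OF apx_sym[OF TQ] amap_tame[OF amap_rotation]])
    finally show ?thesis .
  qed
  then have "eq_near0 (M \<circ> T) (T \<circ> rotation \<gamma>)"
    by (rule apx_all_eq_near0[OF amap_comp0[OF M1 T1] amap_comp0'[OF T1 amap_rotation] nonres])
  with T show ?thesis by blast
qed

end

section \<open>Reversibility\<close>

lemma bnd_G:
  fixes \<omega> :: "real ^ 'm"
  assumes "bnd \<omega> s \<rho> d F C"
  shows "bnd \<omega> s \<rho> d (\<lambda>p. F (involution_G p)) C"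
proof -
  obtain c S where c: "brep \<omega> s \<rho> d c F C" and S: "S \<le> C" "((\<lambda>z. norm (c z) * wt s \<rho> z) has_sum S) UNIV"
    using assms unfolding bnd_def brep_def by blast
  note b = brepD[OF c]
  show ?thesis
  proof (rule bnd_pushforward[where a = c and z = "\<lambda>(k, n). (- k, n)" and I = UNIV, OF b(1,2) _ S(1)])
    show "((\<lambda>i. cmod (c i) * wt s \<rho> (case i of (k, n) \<Rightarrow> (- k, n))) has_sum S) UNIV"
      using S(2) by (simp add: wt_def case_prod_unfold)
    show "d \<le> snd (case i of (k, n) \<Rightarrow> (- k, n))" if "c i \<noteq> 0" for i
      using that b(3)[of "snd i" "fst i"] by (cases i) (force simp: not_less[symmetric])
    show "((\<lambda>i. c i * chi \<omega> (case i of (k, n) \<Rightarrow> (- k, n)) p) has_sum F (involution_G p)) UNIV"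
      if "\<bar>snd p\<bar> \<le> \<rho>" for p
      using b(5)[of "involution_G p"] that by (simp add: chi_def involution_G_def case_prod_unfold)
  qed
qed

lemma cls_G: "cls \<omega> d f \<Longrightarrow> cls \<omega> d (\<lambda>p. f (involution_G p))"
  unfolding cls_def using bnd_G by blast

lemma pr_G: "involution_G \<circ> perturbed_rotation \<gamma> u v \<circ> involution_G =
    perturbed_rotation (- \<gamma>) (\<lambda>p. - u (involution_G p)) (\<lambda>p. v (involution_G p))"
  by (simp add: fun_eq_iff involution_G_def perturbed_rotation_def)

lemma amap_G:
  assumes "amap \<omega> \<gamma> d A"
  shows "amap \<omega> (- \<gamma>) d (involution_G \<circ> A \<circ> involution_G)"
proof -
  obtain u v where A: "A = perturbed_rotation \<gamma> u v" "cls \<omega> d u" "cls \<omega> d v" using assms(1) by (rule amapE)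
  show ?thesis unfolding A(1) pr_G by (intro amapI cls_uminus cls_G A)
qed

lemma G_G: "involution_G \<circ> involution_G = id" "involution_G \<circ> (involution_G \<circ> A) = A"
  by (simp_all add: fun_eq_iff involution_G_def case_prod_unfold)

lemma G_rotation: "involution_G \<circ> rotation \<gamma> = rotation (- \<gamma>) \<circ> involution_G"
  by (simp add: fun_eq_iff involution_G_def rotation_def)

lemma rotation_rotation: "rotation \<gamma> \<circ> rotation (- \<gamma>) = id"
  by (simp add: fun_eq_iff rotation_def)

lemma tame_G: "tame involution_G"
  unfolding tame_def by (intro exI[of _ 1] conjI exI[of _ 1]) (auto simp: involution_G_def)

lemma cls_continuous:
  assumes "cls \<omega> d f" "d \<ge> 1"
  shows "\<exists>\<rho>>0. continuous_on {p. \<bar>snd p\<bar> \<le> \<rho>} f"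
proof -
  obtain s \<rho> C where s: "0 < s" and b: "rbnd \<omega> s \<rho> d f C" using assms(1) unfolding cls_def by blast
  have \<rho>: "0 < \<rho>" using bndD[OF b] by simp
  obtain K where K: "K \<ge> 0" and lip: "\<And>p p' R. \<bar>snd p\<bar> \<le> R \<Longrightarrow> \<bar>snd p'\<bar> \<le> R \<Longrightarrow> R \<le> \<rho> / 2 \<Longrightarrow>
    norm (f p - f p') \<le> K * R ^ (d - 1) * (R * \<bar>fst p - fst p'\<bar> + \<bar>snd p - snd p'\<bar>)"
    using bnd_lipschitz[OF b s assms(2)] by (auto simp flip: of_real_diff)
  define R where "R = \<rho> / 2"
  define L where "L = K * R ^ (d - 1) * (R + 1)"
  have "L-lipschitz_on {p. \<bar>snd p\<bar> \<le> R} f"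
  proof (rule lipschitz_onI)
    show "0 \<le> L" using K \<rho> by (simp add: L_def R_def)
    fix p p' :: "real \<times> real" assume p: "p \<in> {p. \<bar>snd p\<bar> \<le> R}" "p' \<in> {p. \<bar>snd p\<bar> \<le> R}"
    have "\<bar>fst p - fst p'\<bar> \<le> norm (p - p')"
      using norm_fst_le[of "fst (p - p')" "snd (p - p')"] unfolding prod.collapse by simp
    moreover have "\<bar>snd p - snd p'\<bar> \<le> norm (p - p')"
      using norm_snd_le[of "snd (p - p')" "fst (p - p')"] unfolding prod.collapse by simp
    ultimately have "R * \<bar>fst p - fst p'\<bar> + \<bar>snd p - snd p'\<bar> \<le> R * norm (p - p') + norm (p - p')"
      using \<rho> by (intro add_mono mult_left_mono) (auto simp: R_def)
    then have "K * R ^ (d - 1) * (R * \<bar>fst p - fst p'\<bar> + \<bar>snd p - snd p'\<bar>) \<le> K * R ^ (d - 1) * ((R + 1) * norm (p - p'))"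
      using K \<rho> by (intro mult_left_mono) (auto simp: R_def algebra_simps)
    with lip[of p R p'] p show "dist (f p) (f p') \<le> L * dist p p'"
      by (simp add: dist_norm L_def R_def mult.assoc)
  qed
  then have "continuous_on {p. \<bar>snd p\<bar> \<le> R} f" by (rule lipschitz_on_continuous_on)
  then show ?thesis using \<rho> by (intro exI[of _ R]) (simp add: R_def)
qed

text \<open>Identity theorem in the radius: orbit means of a function independent of the angle are
  constant, so its power series of frequency zero is the function itself, and zeros accumulating at
  0 annihilate it.\<close>

lemma radial_zero:
  fixes \<omega> :: "real ^ 'm"
  assumes b: "cls \<omega> d b" and rad: "\<And>\<theta> \<theta>' r. b (\<theta>, r) = b (\<theta>', r)" and nr: "nonres \<omega> \<gamma>"
    and X: "X \<longlonglongrightarrow> 0" "\<And>j. X j \<noteq> 0" "\<And>j. b (0, X j) = 0"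
  shows "\<exists>\<rho>>0. \<forall>p. \<bar>snd p\<bar> \<le> \<rho> \<longrightarrow> b p = 0"
proof -
  obtain s \<rho> C c where s: "0 < s" and c: "brep \<omega> s \<rho> d c (\<lambda>p. complex_of_real (b p)) C"
    using b unfolding cls_def bnd_def by blast
  note br = brepD[OF c]
  define P where "P r = complex_of_real (b (0, r))" for r :: real
  have P: "((\<lambda>n. c (0, n) * of_real (r ^ n)) has_sum P r) UNIV" if r: "\<bar>r\<bar> \<le> \<rho>" for r
  proof -
    obtain L where L: "((\<lambda>n. c (0, n) * of_real (r ^ n)) has_sum L) UNIV"
      "orbit_mean \<omega> \<gamma> 0 (\<lambda>p. complex_of_real (b p)) 0 r \<longlonglongrightarrow> L"
      using brep_orbit_mean[OF c nr r, of 0 0] by auto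
    have om: "orbit_mean \<omega> \<gamma> 0 (\<lambda>p. complex_of_real (b p)) 0 r N = P r" if "N > 0" for N
    proof -
      have "b (0 + real j * \<gamma>, r) = b (0, r)" for j by (rule rad)
      then show ?thesis using that by (simp add: orbit_mean_def P_def)
    qed
    then have "orbit_mean \<omega> \<gamma> 0 (\<lambda>p. complex_of_real (b p)) 0 r \<longlonglongrightarrow> P r"
      by (intro tendsto_eventually eventually_mono[OF eventually_gt_at_top[of 0]] om)
    with L show ?thesis using LIMSEQ_unique by blast
  qed
  have "c (0, n) = 0" for n
    by (rule powser_order[where a = "\<lambda>n. c (0, n)" and P = P and X = X and K = 0 and N = "Suc n",
        OF br(2) brep_slice_summable[OF c] P X(1,2)]) (auto simp: P_def X(3))
  then have "P r = 0" if "\<bar>r\<bar> \<le> \<rho>" for r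
    using P[OF that] has_sum_unique[OF _ has_sum_0_simp] by simp
  then have "b p = 0" if "\<bar>snd p\<bar> \<le> \<rho>" for p
    using that rad[of "fst p" "snd p" 0] by (simp add: P_def)
  then show ?thesis using br(2) by blast
qed

text \<open>If \<open>r\<close> goes to \<open>r' = r + b r\<close>, then
  \<open>b r' = - b r\<close>, so \<open>b\<close> vanishes between \<open>r\<close> and
  \<open>r'\<close>; as \<open>r' <= L r\<close>, these zeros accumulate at 0. Positivity rules out
  the involution \<open>r \<mapsto> -r\<close>, which fixes 0 alone.\<close>

lemma radial_involution:
  fixes \<omega> :: "real ^ 'm"
  assumes b: "cls \<omega> 1 b" and rad: "\<And>\<theta> \<theta>' r. b (\<theta>, r) = b (\<theta>', r)" and nr: "nonres \<omega> \<gamma>"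
    and r0: "0 < r0" "\<And>r. \<bar>r\<bar> \<le> r0 \<Longrightarrow> r + b (0, r) + b (0, r + b (0, r)) = r"
    and pos: "\<And>r. 0 < r \<Longrightarrow> r \<le> r0 \<Longrightarrow> 0 < r + b (0, r)"
  shows "\<exists>\<rho>>0. \<forall>p. \<bar>snd p\<bar> \<le> \<rho> \<longrightarrow> b p = 0"
proof -
  obtain r1 where r1: "0 < r1" "continuous_on {p. \<bar>snd p\<bar> \<le> r1} b" using cls_continuous[OF b] by auto
  have cont: "continuous_on {-r1..r1} (\<lambda>r. b (0, r))"
    by (rule continuous_on_compose2[OF r1(2)]) (auto intro!: continuous_intros)
  have tb: "tame (perturbed_rotation 0 (\<lambda>p. 0) b)" by (intro amap_tame[of \<omega> 0] amapI cls_zero b)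
  obtain L r2 where L: "0 \<le> L" "0 < r2"
    "\<And>p. \<bar>snd p\<bar> \<le> r2 \<Longrightarrow> \<bar>snd (perturbed_rotation 0 (\<lambda>p. 0) b p)\<bar> \<le> L * \<bar>snd p\<bar>"
    "\<And>p :: real \<times> real. \<bar>snd p\<bar> \<le> r2 \<Longrightarrow> L * \<bar>snd p\<bar> \<le> r1"
    by (rule tameE[OF tb r1(1)]) blast
  define m where "m = min r0 (min r1 r2)"
  have m: "0 < m" using r0 r1 L by (simp add: m_def)
  have fix_exists: "\<exists>x. 0 < x \<and> x \<le> (L + 1) * r \<and> b (0, x) = 0" if r: "0 < r" "r \<le> m" for r
  proof -
    define r' where "r' = r + b (0, r)"
    have r': "0 < r'" "r' \<le> L * r" "r' \<le> r1" "b (0, r') = - b (0, r)"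
      using pos[of r] r0(2)[of r] L(3)[of "(0, r)"] L(4)[of "(0, r)"] r
      by (auto simp: r'_def m_def pr_apply)
    have rr: "r \<le> r1" using r by (simp add: m_def)
    have "\<exists>x. min r r' \<le> x \<and> x \<le> max r r' \<and> b (0, x) = 0"
    proof (cases "b (0, min r r') \<le> 0")
      case True
      then have "0 \<le> b (0, max r r')" using r'(4) by (auto simp: min_def max_def split: if_splits)
      with True show ?thesis
        using r r' rr by (intro IVT') (auto intro!: continuous_on_subset[OF cont])
    next
      case False
      then have "b (0, max r r') \<le> 0" using r'(4) by (auto simp: min_def max_def split: if_splits)
      with False show ?thesis
        using r r' rr by (intro IVT2') (auto intro!: continuous_on_subset[OF cont])
    qed
    then obtain x where "min r r' \<le> x" "x \<le> max r r'" "b (0, x) = 0" by blast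
    moreover have "max r r' \<le> (L + 1) * r"
      using r r' L(1) by (simp add: algebra_simps)
    moreover have "0 < min r r'" using r r' by simp
    ultimately have "0 < x" "x \<le> (L + 1) * r" "b (0, x) = 0" by linarith+
    then show ?thesis by blast
  qed
  define r where "r j = m / real (Suc j)" for j
  have r: "0 < r j" "r j \<le> m" for j
    using m divide_left_mono[of 1 "real (Suc j)" m] by (simp_all add: r_def)
  have rlim: "r \<longlonglongrightarrow> 0" unfolding r_def
    using tendsto_mult[OF tendsto_const[of m] LIMSEQ_inverse_real_of_nat] by (simp add: divide_inverse)
  obtain X where X: "\<And>j. 0 < X j \<and> X j \<le> (L + 1) * r j \<and> b (0, X j) = 0"
    using fix_exists[OF r] by metis
  have "(\<lambda>j. (L + 1) * r j) \<longlonglongrightarrow> (L + 1) * 0" by (intro tendsto_intros rlim)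
  then have "X \<longlonglongrightarrow> 0"
    by (intro Lim_null_comparison[of X "\<lambda>j. (L + 1) * r j"] always_eventually) (use X in \<open>auto simp: less_imp_le\<close>)
  moreover have "X j \<noteq> 0" "b (0, X j) = 0" for j using X[of j] by auto
  ultimately show ?thesis by (intro radial_zero[OF b rad nr])
qed

context diophantine_rotation
begin

section \<open>Starting the scheme, and the symmetric choice of the linearization\<close>

text \<open>\<open>M\<close> differs from the rotation at first order, too much for the scheme;
  conjugation by the approximant \<open>U\<close> with \<open>N = 2\<close> removes that part.
  \<open>U\<close> itself is known to be of order 1 only, which is too low for inversion by
  iteration, but \<open>V U\<close> and \<open>U V\<close> are the identity up to
  \<open>O(r^2)\<close>, and their inverses yield an exact inverse of \<open>U\<close>.\<close>

lemma linearization: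
  assumes M: "amap \<omega> \<gamma> 1 M" "fconj M"
  shows "\<exists>T V. amap \<omega> 0 1 T \<and> amap \<omega> 0 1 V \<and> eq_near0 (T \<circ> V) id \<and> eq_near0 (V \<circ> T) id \<and>
    eq_near0 (M \<circ> T) (T \<circ> rotation \<gamma>)"
proof -
  define R where "R = rotation \<gamma>"
  have R: "amap \<omega> \<gamma> 1 R" unfolding R_def by (rule amap_rotation)
  obtain U V where U: "amap \<omega> 0 1 U" and V: "amap \<omega> 0 1 V" and MU: "apx 2 (M \<circ> U) (U \<circ> R)"
    and VU: "apx 2 (V \<circ> U) id" and UV: "apx 2 (U \<circ> V) id"
    using M(2) unfolding fconj_def R_def by blast
  have id0: "rotation 0 = id" by (simp add: rotation_def fun_eq_iff)
  have VU2: "amap \<omega> 0 2 (V \<circ> U)" "amap \<omega> 0 2 (U \<circ> V)"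
    by (rule amap_order[OF amap_comp0[OF V U] VU[folded id0] nonres],
        rule amap_order[OF amap_comp0[OF U V] UV[folded id0] nonres])
  obtain J where J: "amap \<omega> 0 2 J" "eq_near0 (V \<circ> U \<circ> J) id" using right_inverse_soft[OF VU2(1) nonres] by blast
  have JVU: "eq_near0 (J \<circ> (V \<circ> U)) id" by (rule right_inverse_is_left_inverse[OF VU2(1) J nonres])
  obtain J' where J': "amap \<omega> 0 2 J'" "eq_near0 (U \<circ> V \<circ> J') id" using right_inverse_soft[OF VU2(2) nonres] by blast
  have J1: "amap \<omega> 0 1 J" "amap \<omega> 0 1 J'" using amap_mono[OF J(1)] amap_mono[OF J'(1)] by auto
  define W0 where "W0 = J \<circ> V"
  have W0: "amap \<omega> 0 1 W0" unfolding W0_def by (rule amap_comp0[OF J1(1) V])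
  have W0U: "eq_near0 (W0 \<circ> U) id" using JVU by (simp add: W0_def comp_assoc)
  note tm = amap_tame[OF U] amap_tame[OF V] amap_tame[OF J1(1)] amap_tame[OF J1(2)] amap_tame[OF W0] amap_tame[OF R]
  \<comment> \<open>\<open>W0\<close> is a left inverse of \<open>U\<close> and \<open>V J'\<close>
    a right inverse, hence they agree near \<open>r = 0\<close>.\<close>
  have UW0: "eq_near0 (U \<circ> W0) id"
  proof -
    have "eq_near0 (U \<circ> W0 \<circ> id) (U \<circ> W0 \<circ> (U \<circ> V \<circ> J'))"
      by (rule eq_near0_comp_left[OF eq_near0_sym[OF J'(2)]])
    also have "U \<circ> W0 \<circ> (U \<circ> V \<circ> J') = U \<circ> ((W0 \<circ> U) \<circ> (V \<circ> J'))" by (simp only: comp_assoc)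
    also have "eq_near0 \<dots> (U \<circ> (id \<circ> (V \<circ> J')))"
      by (intro eq_near0_comp_left eq_near0_comp_right W0U amap_tame[OF amap_comp0[OF V J1(2)]])
    also have "U \<circ> (id \<circ> (V \<circ> J')) = U \<circ> V \<circ> J'" by (simp add: comp_assoc)
    also note J'(2)
    finally show ?thesis by (simp only: comp_id id_comp)
  qed
  define M0 where "M0 = W0 \<circ> M \<circ> U"
  have M0: "amap \<omega> \<gamma> 1 M0" unfolding M0_def by (intro amap_comp0[OF _ U] amap_comp0'[OF W0] M)
  have fc: "fconj M0" unfolding M0_def by (rule fconj_conjugate[OF M(2,1) U W0 UW0 W0U])
  have "apx 2 (W0 \<circ> (M \<circ> U)) (W0 \<circ> (U \<circ> R))"
    by (rule apx_comp_left[OF W0 amap_tame[OF amap_comp0[OF M(1) U]] amap_tame[OF amap_comp0'[OF U R]] MU])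
  also have "W0 \<circ> (U \<circ> R) = W0 \<circ> U \<circ> R" by (simp only: comp_assoc)
  also have "eq_near0 (W0 \<circ> U \<circ> R) (id \<circ> R)" by (rule eq_near0_comp_right[OF W0U tm(6)])
  finally have "apx 2 M0 R" by (simp only: M0_def comp_assoc comp_id id_comp)
  then have "amap \<omega> \<gamma> 2 M0" using amap_order[OF M0 _ nonres] by (simp add: R_def)
  then obtain T where T: "amap \<omega> 0 2 T" "eq_near0 (M0 \<circ> T) (T \<circ> R)"
    using linearization_order_two[OF _ fc] unfolding R_def by blast
  obtain S where S: "amap \<omega> 0 2 S" "eq_near0 (T \<circ> S) id" using right_inverse_soft[OF T(1) nonres] by blast
  have ST: "eq_near0 (S \<circ> T) id" by (rule right_inverse_is_left_inverse[OF T(1) S nonres])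
  have T1: "amap \<omega> 0 1 T" "amap \<omega> 0 1 S" using amap_mono[OF T(1)] amap_mono[OF S(1)] by auto
  note tm' = amap_tame[OF T1(1)] amap_tame[OF T1(2)]
  have 1: "eq_near0 ((U \<circ> T) \<circ> (S \<circ> W0)) id"
  proof -
    have "eq_near0 (U \<circ> (T \<circ> S \<circ> W0)) (U \<circ> (id \<circ> W0))"
      by (intro eq_near0_comp_left eq_near0_comp_right S tm)
    also have "U \<circ> (id \<circ> W0) = U \<circ> W0" by simp
    also note UW0
    finally show ?thesis by (simp only: comp_assoc)
  qed
  have 2: "eq_near0 ((S \<circ> W0) \<circ> (U \<circ> T)) id"
  proof -
    have "eq_near0 (S \<circ> (W0 \<circ> U \<circ> T)) (S \<circ> (id \<circ> T))"
      by (intro eq_near0_comp_left eq_near0_comp_right W0U tm')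
    also have "S \<circ> (id \<circ> T) = S \<circ> T" by simp
    also note ST
    finally show ?thesis by (simp only: comp_assoc)
  qed
  have 3: "eq_near0 (M \<circ> (U \<circ> T)) ((U \<circ> T) \<circ> R)"
  proof -
    have MUT: "amap \<omega> \<gamma> 1 (M \<circ> U \<circ> T)" by (intro amap_comp0 M U T1)
    have "eq_near0 (id \<circ> (M \<circ> U \<circ> T)) ((U \<circ> W0) \<circ> (M \<circ> U \<circ> T))"
      by (rule eq_near0_comp_right[OF eq_near0_sym[OF UW0] amap_tame[OF MUT]])
    also have "(U \<circ> W0) \<circ> (M \<circ> U \<circ> T) = U \<circ> (M0 \<circ> T)" by (simp add: M0_def comp_assoc)
    also have "eq_near0 \<dots> (U \<circ> (T \<circ> R))" by (rule eq_near0_comp_left[OF T(2)])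
    finally show ?thesis by (simp only: comp_assoc comp_id id_comp)
  qed
  show ?thesis
    using 1 2 3 amap_comp0[OF U T1(1)] amap_comp0[OF T1(2) W0] unfolding R_def by blast
qed

text \<open>\<open>K = V G T G\<close> compares the two linearizations. It commutes with the
  rotation, so nonzero frequencies disappear and \<open>G T G = T K0\<close>, where the
  displacements of \<open>K0\<close> depend on \<open>r\<close> alone. Once \<open>K0\<close> is
  known to be a pure angular shift, it is the square of half the shift, and one half goes to each
  side.\<close>

lemma reversible_linearization:
  assumes M: "amap \<omega> \<gamma> 1 M" "fconj M" and rev: "reversible involution_G M"
  shows "\<exists>T V. amap \<omega> 0 1 T \<and> amap \<omega> 0 1 V \<and> eq_near0 (T \<circ> V) id \<and> eq_near0 (V \<circ> T) id \<and>
    eq_near0 (M \<circ> T) (T \<circ> rotation \<gamma>) \<and> eq_near0 (involution_G \<circ> T) (T \<circ> involution_G)"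
proof -
  let ?G = "involution_G"
  define R where "R = rotation \<gamma>"
  define R' where "R' = rotation (- \<gamma>)"
  have RR': "R \<circ> R' = id" by (simp add: R_def R'_def rotation_rotation)
  have GR: "?G \<circ> R = R' \<circ> ?G" by (simp add: R_def R'_def G_rotation)
  have R: "amap \<omega> \<gamma> 1 R" and R': "amap \<omega> (- \<gamma>) 1 R'" unfolding R_def R'_def by (rule amap_rotation)+
  obtain T V where T: "amap \<omega> 0 1 T" and V: "amap \<omega> 0 1 V" and TV: "eq_near0 (T \<circ> V) id" and VT: "eq_near0 (V \<circ> T) id"
    and MT: "eq_near0 (M \<circ> T) (T \<circ> R)" using linearization[OF M] unfolding R_def by blast
  define TG where "TG = ?G \<circ> T \<circ> ?G"
  have TG: "amap \<omega> 0 1 TG" unfolding TG_def using amap_G[OF T] by simp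
  define K where "K = V \<circ> TG"
  have K: "amap \<omega> 0 1 K" unfolding K_def by (rule amap_comp0[OF V TG])
  note tm = amap_tame[OF T] amap_tame[OF V] amap_tame[OF R] amap_tame[OF R'] amap_tame[OF TG] amap_tame[OF K]
    amap_tame[OF M(1)] tame_G
  have MinvM: "eq_near0 (?G \<circ> M \<circ> ?G \<circ> M) id"
    using rev by (simp add: reversible_def inverse_near0_def)
  have VM: "eq_near0 (V \<circ> M) (R \<circ> V)"
  proof -
    have "eq_near0 (V \<circ> M \<circ> id) (V \<circ> M \<circ> (T \<circ> V))" by (rule eq_near0_comp_left[OF eq_near0_sym[OF TV]])
    also have "V \<circ> M \<circ> (T \<circ> V) = V \<circ> ((M \<circ> T) \<circ> V)" by (simp only: comp_assoc)
    also have "eq_near0 \<dots> (V \<circ> ((T \<circ> R) \<circ> V))" by (intro eq_near0_comp_left eq_near0_comp_right MT tm)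
    also have "V \<circ> ((T \<circ> R) \<circ> V) = (V \<circ> T) \<circ> (R \<circ> V)" by (simp only: comp_assoc)
    also have "eq_near0 \<dots> (id \<circ> (R \<circ> V))" by (intro eq_near0_comp_right VT amap_tame[OF amap_comp0[OF R V]])
    finally show ?thesis by (simp only: comp_id id_comp)
  qed
  \<comment> \<open>The relation \<open>M T = T R\<close> is inverted: the inverse of
    \<open>M\<close> is \<open>G M G\<close> by reversibility, the inverse of \<open>R\<close> is
    \<open>R'\<close>.\<close>
  have TR': "eq_near0 (T \<circ> R') (?G \<circ> M \<circ> ?G \<circ> T)"
  proof -
    have TR'm: "amap \<omega> (- \<gamma>) 1 (T \<circ> R')" by (rule amap_comp0'[OF T R'])
    have "eq_near0 (id \<circ> (T \<circ> R')) ((?G \<circ> M \<circ> ?G \<circ> M) \<circ> (T \<circ> R'))"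
      by (intro eq_near0_comp_right eq_near0_sym[OF MinvM] amap_tame[OF TR'm])
    also have "(?G \<circ> M \<circ> ?G \<circ> M) \<circ> (T \<circ> R') = ?G \<circ> M \<circ> ?G \<circ> ((M \<circ> T) \<circ> R')" by (simp only: comp_assoc)
    also have "eq_near0 \<dots> (?G \<circ> M \<circ> ?G \<circ> ((T \<circ> R) \<circ> R'))" by (intro eq_near0_comp_left eq_near0_comp_right MT tm)
    also have "?G \<circ> M \<circ> ?G \<circ> ((T \<circ> R) \<circ> R') = ?G \<circ> M \<circ> ?G \<circ> T" by (simp only: comp_assoc RR' comp_id)
    finally show ?thesis by (simp only: comp_id id_comp)
  qed
  have KR: "eq_near0 (K \<circ> R) (R \<circ> K)"
  proof -
    have e: "K \<circ> R = V \<circ> (?G \<circ> ((T \<circ> R') \<circ> ?G))" by (simp only: K_def TG_def comp_assoc GR)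
    have "eq_near0 (K \<circ> R) (V \<circ> (?G \<circ> ((?G \<circ> M \<circ> ?G \<circ> T) \<circ> ?G)))"
      unfolding e by (intro eq_near0_comp_left eq_near0_comp_right TR' tm)
    also have "V \<circ> (?G \<circ> ((?G \<circ> M \<circ> ?G \<circ> T) \<circ> ?G)) = (V \<circ> M) \<circ> TG" by (simp only: TG_def comp_assoc G_G comp_id id_comp)
    also have "eq_near0 \<dots> ((R \<circ> V) \<circ> TG)" by (intro eq_near0_comp_right VM tm)
    finally show ?thesis by (simp only: K_def comp_assoc comp_id id_comp)
  qed
  obtain a b where Ke: "K = perturbed_rotation 0 a b" and ab: "cls \<omega> 1 a" "cls \<omega> 1 b" using K by (rule amapE)
  have "apx N (K \<circ> R) (R \<circ> K)" for N by (rule eq_near0_apx[OF KR])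
  then have sm: "small N (\<lambda>p. a (rotation \<gamma> p) - a p)" "small N (\<lambda>p. b (rotation \<gamma> p) - b p)" for N
    unfolding Ke R_def pr_rotation[symmetric] pr_comp by (simp_all add: apx_pr_iff)
  obtain a0 where a0: "cls \<omega> 1 a0" "\<And>\<theta> \<theta>' r. a0 (\<theta>, r) = a0 (\<theta>', r)" "\<And>D. small D (\<lambda>p. a p - a0 p)"
    using cls_split_mean[OF ab(1) nonres] sm(1) by blast
  obtain b0 where b0: "cls \<omega> 1 b0" "\<And>\<theta> \<theta>' r. b0 (\<theta>, r) = b0 (\<theta>', r)" "\<And>D. small D (\<lambda>p. b p - b0 p)"
    using cls_split_mean[OF ab(2) nonres] sm(2) by blast
  define K0 where "K0 = perturbed_rotation 0 a0 b0"
  have K0: "amap \<omega> 0 1 K0" unfolding K0_def by (intro amapI a0 b0)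
  have KK0: "eq_near0 K K0"
    by (rule apx_all_eq_near0[OF K K0 nonres]) (simp add: Ke K0_def apx_pr_iff a0 b0)
  have TK: "eq_near0 TG (T \<circ> K0)"
  proof -
    have "eq_near0 (id \<circ> TG) (T \<circ> V \<circ> TG)" by (intro eq_near0_comp_right eq_near0_sym[OF TV] tm)
    also have "T \<circ> V \<circ> TG = T \<circ> K" by (simp add: K_def comp_assoc)
    also have "eq_near0 \<dots> (T \<circ> K0)" by (intro eq_near0_comp_left KK0)
    finally show ?thesis by (simp only: comp_id id_comp)
  qed
  \<comment> \<open>\<open>K G\<close> is \<open>V G T\<close>, a conjugate of \<open>G\<close> and
    hence an involution; \<open>K0 G\<close> inherits this.\<close>
  have inv: "eq_near0 (K0 \<circ> (?G \<circ> K0 \<circ> ?G)) id"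
  proof -
    have GK0: "amap \<omega> 0 1 (?G \<circ> K0 \<circ> ?G)" using amap_G[OF K0] by simp
    have "eq_near0 (K0 \<circ> (?G \<circ> K0 \<circ> ?G)) (K \<circ> (?G \<circ> K0 \<circ> ?G))"
      by (intro eq_near0_comp_right eq_near0_sym[OF KK0] amap_tame[OF GK0])
    also have "K \<circ> (?G \<circ> K0 \<circ> ?G) = K \<circ> ?G \<circ> (K0 \<circ> ?G)" by (simp only: comp_assoc)
    also have "eq_near0 \<dots> (K \<circ> ?G \<circ> (K \<circ> ?G))"
      by (intro eq_near0_comp_left eq_near0_comp_right eq_near0_sym[OF KK0] tm)
    also have "K \<circ> ?G \<circ> (K \<circ> ?G) = V \<circ> (?G \<circ> ((T \<circ> V) \<circ> (?G \<circ> T)))" by (simp only: K_def TG_def comp_assoc G_G comp_id id_comp)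
    also have "eq_near0 \<dots> (V \<circ> (?G \<circ> (id \<circ> (?G \<circ> T))))"
    proof (intro eq_near0_comp_left eq_near0_comp_right TV)
      have "tame (TG \<circ> ?G)" using tm(5) unfolding tame_def involution_G_def by fastforce
      then show "tame (?G \<circ> T)" by (simp add: TG_def comp_assoc G_G comp_id id_comp)
    qed
    also have "V \<circ> (?G \<circ> (id \<circ> (?G \<circ> T))) = V \<circ> T" by (simp add: G_G)
    also note VT
    finally show ?thesis .
  qed
  obtain ri where ri: "0 < ri" "\<And>p. \<bar>snd p\<bar> \<le> ri \<Longrightarrow> K0 (?G (K0 (?G p))) = p"
    using inv unfolding eq_near0_iff by auto
  have involb: "r + b0 (0, r) + b0 (0, r + b0 (0, r)) = r" if "\<bar>r\<bar> \<le> ri" for r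
    using arg_cong[OF ri(2)[of "(0, r)"], of snd] that b0(2)[of "- a0 (0, r)" "r + b0 (0, r)" 0]
    by (simp add: K0_def pr_apply involution_G_def)
  obtain ve we where Ve: "V = perturbed_rotation 0 ve we" and vw: "cls \<omega> 1 ve" "cls \<omega> 1 we" using V by (rule amapE)
  obtain rc where rc: "0 < rc" "continuous_on {p. \<bar>snd p\<bar> \<le> rc} we" using cls_continuous[OF vw(2)] by auto
  obtain rt where rt: "0 < rt" "\<And>p. \<bar>snd p\<bar> \<le> rt \<Longrightarrow> T (V p) = p"
    using TV unfolding eq_near0_iff by auto
  obtain rv where rv: "0 < rv" "\<And>p. \<bar>snd p\<bar> \<le> rv \<Longrightarrow> V (T p) = p"
    using VT unfolding eq_near0_iff by auto
  obtain rk where rk: "0 < rk" "\<And>p. \<bar>snd p\<bar> \<le> rk \<Longrightarrow> K p = K0 p"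
    using KK0 unfolding eq_near0_iff by auto
  obtain LT rT where LT: "0 \<le> LT" "0 < rT" "\<And>p. \<bar>snd p\<bar> \<le> rT \<Longrightarrow> \<bar>snd (T p)\<bar> \<le> LT * \<bar>snd p\<bar>"
    "\<And>p :: real \<times> real. \<bar>snd p\<bar> \<le> rT \<Longrightarrow> LT * \<bar>snd p\<bar> \<le> min rt rc"
    using tameE[OF tm(1), of "min rt rc"] rt(1) rc(1) by auto
  define m where "m = min (min ri rv) (min rk rT)"
  have m: "0 < m" "m \<le> ri" using ri rv rk LT by (auto simp: m_def)
  text \<open>\<open>x \<mapsto> snd (V (x, t))\<close> has no zero for \<open>t \<noteq> 0\<close>, hence constant sign.\<close>
  have posb: "0 < r + b0 (0, r)" if r: "0 < r" "r \<le> m" for r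
  proof -
    define x t where "x = fst (T (0, r))" and "t = snd (T (0, r))"
    have t: "\<bar>t\<bar> \<le> rt" "\<bar>t\<bar> \<le> rc"
      using LT(3)[of "(0, r)"] LT(4)[of "(0, r)"] r by (auto simp: t_def m_def)
    have V1: "V (x, t) = (0, r)" using rv(2)[of "(0, r)"] r by (simp add: x_def t_def m_def)
    \<comment> \<open>\<open>G T G\<close> sends \<open>(0, r)\<close> to \<open>(-x, t)\<close>, so
      \<open>r\<close> and \<open>r + b0 r\<close> are the values at \<open>x\<close> and
      \<open>-x\<close> of one function of the angle, at the same height \<open>t\<close>.\<close>
    have "K (0, r) = V (- x, t)"
      by (simp add: K_def TG_def involution_G_def x_def t_def case_prod_unfold)
    moreover have "K (0, r) = K0 (0, r)" using rk(2)[of "(0, r)"] r by (simp add: m_def)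
    ultimately have "V (- x, t) = K0 (0, r)" by simp
    then have V2: "snd (V (- x, t)) = r + b0 (0, r)" by (simp add: K0_def pr_apply)
    have nz: "snd (V (y, t)) \<noteq> 0" for y
    proof
      assume z: "snd (V (y, t)) = 0"
      have "T (V (y, t)) = (y, t)" using t by (intro rt) simp
      moreover have "\<bar>snd (T (V (y, t)))\<bar> \<le> LT * \<bar>snd (V (y, t))\<bar>" using z LT(2) by (intro LT(3)) simp
      ultimately have "t = 0" using z by simp
      moreover have "T (V (x, t)) = (x, t)" using t by (intro rt) simp
      moreover obtain u' v' where "V = perturbed_rotation 0 u' v'" "cls \<omega> 1 v'" using V by (rule amapE)
      moreover have "v' p = 0" if z0: "snd p = 0" and cl: "cls \<omega> 1 v'" for v' :: "real \<times> real \<Rightarrow> real" and p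
      proof -
        obtain K \<rho> where "0 < \<rho>" "\<And>p. \<bar>snd p\<bar> \<le> \<rho> \<Longrightarrow> norm (v' p) \<le> K * \<bar>snd p\<bar> ^ 1"
          using cls_small[OF cl] unfolding small_def by blast
        from this(2)[of p] this(1) z0 show ?thesis by simp
      qed
      ultimately have "snd (V (x, t)) = 0" by (simp add: pr_apply)
      with V1 r show False by simp
    qed
    have cont: "continuous_on UNIV (\<lambda>y. snd (V (y, t)))"
      unfolding Ve pr_apply snd_conv fst_conv
      by (intro continuous_intros continuous_on_compose2[OF rc(2)]) (use t in auto)
    show ?thesis
    proof (rule ccontr)
      assume "\<not> 0 < r + b0 (0, r)"
      then have neg: "snd (V (- x, t)) \<le> 0" using V2 by simp
      have p: "0 \<le> snd (V (x, t))" using V1 r by simp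
      have "\<exists>y. snd (V (y, t)) = 0"
      proof (cases "- x \<le> x")
        case True
        then show ?thesis using IVT'[of "\<lambda>y. snd (V (y, t))" "- x" 0 x] neg p continuous_on_subset[OF cont] by auto
      next
        case False
        then show ?thesis using IVT2'[of "\<lambda>y. snd (V (y, t))" "- x" 0 x] neg p continuous_on_subset[OF cont] by auto
      qed
      with nz show False by blast
    qed
  qed
  obtain rb where rb: "0 < rb" "\<And>p. \<bar>snd p\<bar> \<le> rb \<Longrightarrow> b0 p = 0"
    using radial_involution[OF b0(1,2) nonres m(1) involb posb] m(2) by auto
  \<comment> \<open>Half of the angular shift. As \<open>b0 = 0\<close> near \<open>r = 0\<close>,
    \<open>K0 S' = S\<close> there, and \<open>G S = S' G\<close>; hence
    \<open>G T S = T K0 S' G = T S G\<close>. Shifts depending on \<open>r\<close> commute with the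
    rotation, so \<open>T S\<close> still linearizes.\<close>
  define S where "S = perturbed_rotation 0 (\<lambda>p. (1 / 2) * a0 p) (\<lambda>p. 0)"
  define S' where "S' = perturbed_rotation 0 (\<lambda>p. (- 1 / 2) * a0 p) (\<lambda>p. 0)"
  have S: "amap \<omega> 0 1 S" "amap \<omega> 0 1 S'" unfolding S_def S'_def by (intro amapI cls_cmult a0 cls_zero)+
  define \<alpha> where "\<alpha> r = a0 (0, r)" for r
  have radial: "a0 (x, y) = \<alpha> y" for x y unfolding \<alpha>_def by (rule a0(2))
  have SS': "S \<circ> S' = id" "S' \<circ> S = id"
    by (simp_all add: fun_eq_iff S_def S'_def perturbed_rotation_def radial)
  have RS: "R \<circ> S = S \<circ> R"
    by (simp add: fun_eq_iff S_def R_def rotation_def perturbed_rotation_def radial)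
  have GS: "?G \<circ> S = S' \<circ> ?G"
    by (simp add: fun_eq_iff S_def S'_def involution_G_def perturbed_rotation_def radial)
  have KS: "eq_near0 (K0 \<circ> S') S"
    unfolding eq_near0_iff using rb
    by (intro exI[of _ rb]) (auto simp: K0_def S_def S'_def perturbed_rotation_def radial)
  note tmS = amap_tame[OF S(1)] amap_tame[OF S(2)]
  have 1: "eq_near0 ((T \<circ> S) \<circ> (S' \<circ> V)) id"
  proof -
    have "(T \<circ> S) \<circ> (S' \<circ> V) = T \<circ> (S \<circ> S') \<circ> V" by (simp only: comp_assoc)
    then show ?thesis using TV by (simp add: SS')
  qed
  have 2: "eq_near0 ((S' \<circ> V) \<circ> (T \<circ> S)) id"
  proof -
    have e: "(S' \<circ> V) \<circ> (T \<circ> S) = S' \<circ> ((V \<circ> T) \<circ> S)" by (simp only: comp_assoc)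
    have "eq_near0 (S' \<circ> ((V \<circ> T) \<circ> S)) (S' \<circ> (id \<circ> S))" by (intro eq_near0_comp_left eq_near0_comp_right VT tmS)
    then show ?thesis unfolding e by (simp only: SS' id_comp)
  qed
  have 3: "eq_near0 (M \<circ> (T \<circ> S)) ((T \<circ> S) \<circ> R)"
    using eq_near0_comp_right[OF MT tmS(1)] by (simp add: comp_assoc RS)
  have 4: "eq_near0 (?G \<circ> (T \<circ> S)) ((T \<circ> S) \<circ> ?G)"
  proof -
    have e: "?G \<circ> (T \<circ> S) = TG \<circ> (S' \<circ> ?G)" by (simp only: TG_def comp_assoc GS[symmetric] G_G)
    have "eq_near0 (?G \<circ> (T \<circ> S)) (T \<circ> K0 \<circ> (S' \<circ> ?G))"
      unfolding e
    proof (rule eq_near0_comp_right[OF TK])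
      show "tame (S' \<circ> ?G)" using tmS(2) unfolding tame_def involution_G_def by fastforce
    qed
    also have "T \<circ> K0 \<circ> (S' \<circ> ?G) = T \<circ> ((K0 \<circ> S') \<circ> ?G)" by (simp only: comp_assoc)
    also have "eq_near0 \<dots> (T \<circ> (S \<circ> ?G))" by (intro eq_near0_comp_left eq_near0_comp_right KS tm)
    finally show ?thesis by (simp only: comp_assoc comp_id id_comp)
  qed
  show ?thesis
    using 1 2 3 4 amap_comp0[OF T S(1)] amap_comp0[OF S(2) V] unfolding R_def by blast
qed

end

section \<open>Quasi-periodic functions of one variable\<close>

text \<open>Quasi-periodicity in the form of exponentially decaying Fourier coefficients, the
  one-variable counterpart of \<open>cls\<close>, suited to termwise differentiation.\<close>

definition qp :: "real ^ 'm \<Rightarrow> (real \<Rightarrow> real) \<Rightarrow> bool" where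
  "qp \<omega> \<phi> \<longleftrightarrow> (\<exists>s>0. \<exists>c. (\<lambda>k. norm (c k) * exp (s * l1_norm k)) summable_on UNIV \<and>
     (\<forall>\<theta>. ((\<lambda>k. c k * cis (int_inner k \<omega> * \<theta>)) has_sum complex_of_real (\<phi> \<theta>)) UNIV))"

text \<open>The coefficients are symmetrised to \<open>(c k + cnj (c (- k))) / 2\<close>; the decay
  survives because the weight is even in \<open>k\<close>.\<close>

lemma qp_Re:
  fixes \<omega> :: "real ^ 'm"
  assumes s: "0 < s" and c: "(\<lambda>k. norm (c k) * exp (s * l1_norm k)) summable_on UNIV"
    and A: "\<And>\<theta>. ((\<lambda>k. c k * cis (int_inner k \<omega> * \<theta>)) has_sum A \<theta>) UNIV"
  shows "qp \<omega> (\<lambda>\<theta>. Re (A \<theta>))"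
proof -
  have bij: "bij_betw uminus (UNIV :: (int ^ 'm) set) UNIV"
    by (rule bij_betwI[of _ _ _ uminus]) auto
  define e where "e k = (c k + cnj (c (- k))) / 2" for k
  have 1: "(\<lambda>k. norm (c (- k)) * exp (s * l1_norm k)) summable_on UNIV"
    using summable_on_reindex_bij_betw[OF bij, of "\<lambda>k. norm (c k) * exp (s * l1_norm k)"] c by simp
  have "(\<lambda>k. norm (e k) * exp (s * l1_norm k)) summable_on UNIV"
  proof (rule summable_on_comparison_test[OF summable_on_add[OF c 1]])
    fix k
    have "norm (c k + cnj (c (- k))) \<le> norm (c k) + norm (c (- k))"
      using norm_triangle_ineq[of "c k" "cnj (c (- k))"] by simp
    then have "norm (e k) \<le> norm (c k) + norm (c (- k))"
      using norm_ge_zero[of "c k"] norm_ge_zero[of "c (- k)"]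
      unfolding e_def norm_divide norm_numeral by linarith
    then show "norm (e k) * exp (s * l1_norm k) \<le> norm (c k) * exp (s * l1_norm k) + norm (c (- k)) * exp (s * l1_norm k)"
      by (simp flip: distrib_right)
  qed auto
  moreover have "((\<lambda>k. e k * cis (int_inner k \<omega> * \<theta>)) has_sum complex_of_real (Re (A \<theta>))) UNIV" for \<theta>
  proof -
    have "((\<lambda>k. cnj (c k * cis (int_inner k \<omega> * \<theta>))) has_sum cnj (A \<theta>)) UNIV"
      using A[of \<theta>] by (subst has_sum_cnj_iff)
    then have "((\<lambda>k. cnj (c (- k) * cis (int_inner (- k) \<omega> * \<theta>))) has_sum cnj (A \<theta>)) UNIV"
      using has_sum_reindex_bij_betw[OF bij, of "\<lambda>k. cnj (c k * cis (int_inner k \<omega> * \<theta>))"] by simp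
    then have "((\<lambda>k. cnj (c (- k)) * cis (int_inner k \<omega> * \<theta>)) has_sum cnj (A \<theta>)) UNIV"
      by (simp add: cis_cnj)
    from has_sum_divide_const[OF has_sum_add[OF A[of \<theta>] this], of 2]
    show ?thesis by (simp add: complex_add_cnj e_def ring_distribs)
  qed
  ultimately show ?thesis unfolding qp_def using s by blast
qed

lemma qp_const: "qp \<omega> (\<lambda>\<theta>. a)"
  unfolding qp_def
  by (intro exI[of _ 1] conjI exI[of _ "\<lambda>k. if k = 0 then complex_of_real a else 0"] allI
      has_sum_imp_summable[OF has_sum_finite_neutralI[of "{0}"]] has_sum_finite_neutralI[of "{0}"]) auto

lemma qp_add:
  fixes \<omega> :: "real ^ 'm"
  assumes "qp \<omega> \<phi>" "qp \<omega> \<psi>"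
  shows "qp \<omega> (\<lambda>\<theta>. \<phi> \<theta> + \<psi> \<theta>)"
proof -
  obtain s c where 1: "0 < s" "(\<lambda>k. norm (c k) * exp (s * l1_norm k)) summable_on UNIV"
    "\<And>\<theta>. ((\<lambda>k. c k * cis (int_inner k \<omega> * \<theta>)) has_sum complex_of_real (\<phi> \<theta>)) UNIV"
    using assms(1) unfolding qp_def by blast
  obtain t e where 2: "0 < t" "(\<lambda>k. norm (e k) * exp (t * l1_norm k)) summable_on UNIV"
    "\<And>\<theta>. ((\<lambda>k. e k * cis (int_inner k \<omega> * \<theta>)) has_sum complex_of_real (\<psi> \<theta>)) UNIV"
    using assms(2) unfolding qp_def by blast
  have "(\<lambda>k. norm (c k + e k) * exp (min s t * l1_norm k)) summable_on UNIV"
  proof (rule summable_on_comparison_test[OF summable_on_add[OF 1(2) 2(2)]])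
    fix k :: "int ^ 'm"
    have "norm (c k + e k) * exp (min s t * l1_norm k) \<le> (norm (c k) + norm (e k)) * exp (min s t * l1_norm k)"
      by (intro mult_right_mono norm_triangle_ineq) auto
    also have "\<dots> \<le> norm (c k) * exp (s * l1_norm k) + norm (e k) * exp (t * l1_norm k)"
      unfolding distrib_right
      by (intro add_mono mult_left_mono) (auto intro!: mult_right_mono l1_norm_nonneg)
    finally show "norm (c k + e k) * exp (min s t * l1_norm k) \<le> \<dots>" .
  qed auto
  moreover have "((\<lambda>k. (c k + e k) * cis (int_inner k \<omega> * \<theta>)) has_sum complex_of_real (\<phi> \<theta> + \<psi> \<theta>)) UNIV" for \<theta>
    using has_sum_add[OF 1(3)[of \<theta>] 2(3)[of \<theta>]] by (simp add: distrib_right)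
  ultimately show ?thesis unfolding qp_def using 1(1) 2(1)
    by (intro exI[of _ "min s t"] conjI exI[of _ "\<lambda>k. c k + e k"]) auto
qed

lemma qp_cls:
  assumes "qp \<omega> \<phi>"
  shows "cls \<omega> n (\<lambda>p. \<phi> (fst p) * snd p ^ n)"
proof -
  obtain s c where 1: "0 < s" "(\<lambda>k. norm (c k) * exp (s * l1_norm k)) summable_on UNIV"
    "\<And>\<theta>. ((\<lambda>k. c k * cis (int_inner k \<omega> * \<theta>)) has_sum complex_of_real (\<phi> \<theta>)) UNIV"
    using assms(1) unfolding qp_def by blast
  have "rbnd \<omega> s 1 n (\<lambda>p. \<phi> (fst p) * snd p ^ n) (\<Sum>\<^sub>\<infinity>k. norm (c k) * exp (s * l1_norm k))"
  proof (rule bnd_pushforward[where a = c and z = "\<lambda>k. (k, n)" and I = UNIV, OF _ _ _ order_refl])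
    show "((\<lambda>i. cmod (c i) * wt s 1 (i, n)) has_sum (\<Sum>\<^sub>\<infinity>k. cmod (c k) * exp (s * l1_norm k))) UNIV"
      using has_sum_infsum[OF 1(2)] by (simp add: wt_def)
    show "((\<lambda>i. c i * chi \<omega> (i, n) p) has_sum complex_of_real (\<phi> (fst p) * snd p ^ n)) UNIV" for p
      using has_sum_cmult_left[OF 1(3)[of "fst p"], of "of_real (snd p ^ n)"] by (simp add: chi_def mult.assoc)
  qed (use 1(1) in auto)
  then show ?thesis using 1(1) by (rule clsI)
qed

lemma qp_bounded:
  assumes "qp \<omega> \<phi>"
  shows "\<exists>B\<ge>0. \<forall>\<theta>. \<bar>\<phi> \<theta>\<bar> \<le> B"
proof -
  obtain s \<rho> C where b: "rbnd \<omega> s \<rho> 0 (\<lambda>p. \<phi> (fst p) * snd p ^ 0) C"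
    using qp_cls[OF assms, of 0] unfolding cls_def by blast
  have "\<bar>\<phi> \<theta>\<bar> \<le> C" for \<theta> using bnd_norm_le[OF b, of "(\<theta>, 0)"] bndD[OF b] by simp
  then show ?thesis using bnd_const_nonneg[OF b] by blast
qed

lemma norm_cis_taylor2: "norm (cis x - 1 - \<i> * of_real x) \<le> x\<^sup>2"
proof -
  have 1: "\<bar>cos x - 1\<bar> \<le> x\<^sup>2 / 2"
    using cos_double_sin[of "x / 2"] power_mono[OF abs_sin_x_le_abs_x[of "x / 2"], of 2]
    by (simp add: power_divide)
  have 2: "\<bar>sin x - x\<bar> \<le> x\<^sup>2 / 2"
    using Maclaurin_sin_bound[of x 2] by (simp add: sin_coeff_def eval_nat_numeral)
  have "norm (cis x - 1 - \<i> * of_real x) \<le> \<bar>cos x - 1\<bar> + \<bar>sin x - x\<bar>"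
    using cmod_le[of "cis x - 1 - \<i> * of_real x"] by simp
  with 1 2 show ?thesis by simp
qed

lemma power_le_exp_linear:
  fixes x :: real
  assumes "0 \<le> x" "0 < \<delta>"
  shows "x ^ n \<le> fact n / \<delta> ^ n * exp (\<delta> * x)"
proof -
  have "(\<delta> * x) ^ n / fact n \<le> exp (\<delta> * x)"
  proof -
    have "((\<lambda>m. (\<delta> * x) ^ m / fact m) has_sum exp (\<delta> * x)) UNIV" by (rule has_sum_exp)
    from finite_sum_le_has_sum[OF this, of "{n}"] show ?thesis using assms by simp
  qed
  then show ?thesis using assms by (simp add: field_simps power_mult_distrib)
qed

text \<open>Termwise differentiation. Half of the width absorbs the powers of the frequency, both in
  the derived series and in the sum \<open>Q\<close> of second-order terms; a remainder bounded by
  \<open>Q h^2\<close> makes the difference quotients converge.\<close>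

lemma qp_has_derivative:
  fixes \<omega> :: "real ^ 'm"
  assumes "qp \<omega> \<phi>"
  shows "\<exists>\<psi>. qp \<omega> \<psi> \<and> (\<forall>\<theta>. (\<phi> has_real_derivative \<psi> \<theta>) (at \<theta>))"
proof -
  obtain s c where 1: "0 < s" "(\<lambda>k. norm (c k) * exp (s * l1_norm k)) summable_on UNIV"
    "\<And>\<theta>. ((\<lambda>k. c k * cis (int_inner k \<omega> * \<theta>)) has_sum complex_of_real (\<phi> \<theta>)) UNIV"
    using assms(1) unfolding qp_def by blast
  define l where "l k = int_inner k \<omega>" for k :: "int ^ 'm"
  define W where "W = freq_norm \<omega>"
  have W: "0 \<le> W" by (simp add: W_def freq_norm_nonneg)
  have l: "\<bar>l k\<bar> \<le> W * l1_norm k" for k unfolding l_def W_def by (rule abs_int_inner_le)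
  have lpow: "\<bar>l k\<bar> ^ n \<le> W ^ n * (fact n / (s / 2) ^ n) * exp (s / 2 * l1_norm k)" for k n
  proof -
    have "\<bar>l k\<bar> ^ n \<le> W ^ n * l1_norm k ^ n"
      using power_mono[OF l abs_ge_zero, of k n] by (simp add: power_mult_distrib)
    also have "\<dots> \<le> W ^ n * (fact n / (s / 2) ^ n * exp (s / 2 * l1_norm k))"
      using 1(1) W by (intro mult_left_mono power_le_exp_linear l1_norm_nonneg) auto
    finally show ?thesis by (simp add: mult.assoc)
  qed
  define e where "e k = c k * (\<i> * of_real (l k))" for k
  have half: "exp (s / 2 * l1_norm k) * exp (s / 2 * l1_norm k) = exp (s * l1_norm k)" for k :: "int ^ 'm"
    by (simp add: exp_add[symmetric])
  have e: "(\<lambda>k. norm (e k) * exp (s / 2 * l1_norm k)) summable_on UNIV"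
  proof (rule summable_on_comparison_test[OF summable_on_cmult_right[OF 1(2)]])
    fix k :: "int ^ 'm"
    have "norm (e k) * exp (s / 2 * l1_norm k) = norm (c k) * (\<bar>l k\<bar> ^ 1 * exp (s / 2 * l1_norm k))"
      by (simp add: e_def norm_mult)
    also have "\<dots> \<le> norm (c k) * ((W ^ 1 * (fact 1 / (s / 2) ^ 1) * exp (s / 2 * l1_norm k)) * exp (s / 2 * l1_norm k))"
      by (intro mult_left_mono mult_right_mono lpow) auto
    also have "\<dots> = W ^ 1 * (fact 1 / (s / 2) ^ 1) * (norm (c k) * exp (s * l1_norm k))"
      unfolding half[symmetric] by simp
    finally show "norm (e k) * exp (s / 2 * l1_norm k) \<le> W ^ 1 * (fact 1 / (s / 2) ^ 1) * (norm (c k) * exp (s * l1_norm k))" .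
  qed auto
  define E where "E \<theta> = (\<Sum>\<^sub>\<infinity>k. e k * cis (l k * \<theta>))" for \<theta>
  have E: "((\<lambda>k. e k * cis (l k * \<theta>)) has_sum E \<theta>) UNIV" for \<theta>
    unfolding E_def
  proof (rule has_sum_infsum, rule abs_summable_summable, rule Infinite_Sum.abs_summable_on_comparison_test'[OF e])
    fix k :: "int ^ 'm"
    show "norm (e k * cis (l k * \<theta>)) \<le> norm (e k) * exp (s / 2 * l1_norm k)"
      using mult_left_mono[of 1 "exp (s / 2 * l1_norm k)" "norm (e k)"] 1(1) l1_norm_nonneg[of k] by (simp add: norm_mult)
  qed
  define K where "K = W ^ 2 * (fact 2 / (s / 2) ^ 2)"
  have sq: "(\<lambda>k. norm (c k) * \<bar>l k\<bar> ^ 2) summable_on UNIV"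
  proof (rule summable_on_comparison_test[OF summable_on_cmult_right[OF 1(2), of K]])
    fix k :: "int ^ 'm"
    have "exp (s / 2 * l1_norm k) \<le> exp (s * l1_norm k)"
      using 1(1) l1_norm_nonneg[of k] by simp
    then have "\<bar>l k\<bar> ^ 2 \<le> K * exp (s * l1_norm k)"
      using lpow[of k 2] mult_left_mono[of "exp (s / 2 * l1_norm k)" "exp (s * l1_norm k)" K] 1(1) W
      by (simp add: K_def)
    then show "norm (c k) * \<bar>l k\<bar> ^ 2 \<le> K * (norm (c k) * exp (s * l1_norm k))"
      using mult_left_mono[of "\<bar>l k\<bar> ^ 2" "K * exp (s * l1_norm k)" "norm (c k)"] by (simp add: mult.left_commute)
  qed auto
  define Q where "Q = (\<Sum>\<^sub>\<infinity>k. norm (c k) * \<bar>l k\<bar> ^ 2)"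
  have quad: "norm (complex_of_real (\<phi> (\<theta> + h)) - complex_of_real (\<phi> \<theta>) - E \<theta> * of_real h) \<le> Q * h\<^sup>2" for \<theta> h
  proof (rule norm_infsum_le)
    show "((\<lambda>k. c k * cis (l k * (\<theta> + h)) - c k * cis (l k * \<theta>) - e k * cis (l k * \<theta>) * of_real h) has_sum
        complex_of_real (\<phi> (\<theta> + h)) - complex_of_real (\<phi> \<theta>) - E \<theta> * of_real h) UNIV"
      using 1(3) by (intro has_sum_minus has_sum_cmult_left E) (auto simp: l_def)
    show "((\<lambda>k. norm (c k) * \<bar>l k\<bar> ^ 2 * h\<^sup>2) has_sum Q * h\<^sup>2) UNIV"
      unfolding Q_def by (intro has_sum_cmult_left has_sum_infsum sq)
    fix k
    have "c k * cis (l k * (\<theta> + h)) - c k * cis (l k * \<theta>) - e k * cis (l k * \<theta>) * of_real h =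
        c k * cis (l k * \<theta>) * (cis (l k * h) - 1 - \<i> * of_real (l k * h))"
      by (simp add: e_def distrib_left cis_mult[symmetric] algebra_simps)
    then show "norm (c k * cis (l k * (\<theta> + h)) - c k * cis (l k * \<theta>) - e k * cis (l k * \<theta>) * of_real h) \<le> norm (c k) * \<bar>l k\<bar> ^ 2 * h\<^sup>2"
      using mult_left_mono[OF norm_cis_taylor2[of "l k * h"] norm_ge_zero[of "c k"]]
      by (simp add: norm_mult power_mult_distrib mult.assoc)
  qed
  have "(\<phi> has_real_derivative Re (E \<theta>)) (at \<theta>)" for \<theta>
    unfolding DERIV_def
  proof (rule Lim_null[THEN iffD2], rule Lim_null_comparison)
    have "(\<lambda>h. \<bar>Q\<bar> * \<bar>h\<bar>) \<midarrow>0\<rightarrow> \<bar>Q\<bar> * \<bar>0\<bar>" by (intro tendsto_intros)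
    then show "(\<lambda>h. \<bar>Q\<bar> * \<bar>h\<bar>) \<midarrow>0\<rightarrow> 0" by simp
    have "norm ((\<phi> (\<theta> + h) - \<phi> \<theta>) / h - Re (E \<theta>)) \<le> \<bar>Q\<bar> * \<bar>h\<bar>" if "h \<noteq> 0" for h
    proof -
      have "\<bar>\<phi> (\<theta> + h) - \<phi> \<theta> - Re (E \<theta>) * h\<bar> \<le> Q * h\<^sup>2"
        using order_trans[OF abs_Re_le_cmod quad[of \<theta> h]] by simp
      also have "\<dots> \<le> \<bar>Q\<bar> * \<bar>h\<bar> * \<bar>h\<bar>"
        by (auto simp: power2_eq_square mult.assoc abs_mult[symmetric] intro!: mult_right_mono)
      finally have "\<bar>\<phi> (\<theta> + h) - \<phi> \<theta> - Re (E \<theta>) * h\<bar> / \<bar>h\<bar> \<le> \<bar>Q\<bar> * \<bar>h\<bar>"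
        using that by (simp add: divide_le_eq)
      moreover have "(\<phi> (\<theta> + h) - \<phi> \<theta>) / h - Re (E \<theta>) = (\<phi> (\<theta> + h) - \<phi> \<theta> - Re (E \<theta>) * h) / h"
        using that by (simp add: field_simps)
      ultimately show ?thesis by simp
    qed
    then show "\<forall>\<^sub>F h in at 0. norm ((\<phi> (\<theta> + h) - \<phi> \<theta>) / h - Re (E \<theta>)) \<le> \<bar>Q\<bar> * \<bar>h\<bar>"
      by (auto simp: eventually_at intro!: exI[of _ 1])
  qed
  moreover have "qp \<omega> (\<lambda>\<theta>. Re (E \<theta>))"
    by (rule qp_Re[OF _ e]) (use E 1(1) in \<open>auto simp: l_def\<close>)
  ultimately show ?thesis by blast
qed

lemma qp_higher_deriv:
  assumes "qp \<omega> \<phi>"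
  shows "qp \<omega> ((deriv ^^ n) \<phi>)"
proof (induction n)
  case (Suc n)
  obtain \<psi> where \<psi>: "qp \<omega> \<psi>" "\<And>\<theta>. ((deriv ^^ n) \<phi> has_real_derivative \<psi> \<theta>) (at \<theta>)"
    using qp_has_derivative[OF Suc.IH] by blast
  then have "(deriv ^^ Suc n) \<phi> = \<psi>" by (auto intro: DERIV_imp_deriv)
  with \<psi>(1) show ?case by simp
qed (use assms in simp)

lemma qp_has_higher_deriv:
  assumes "qp \<omega> \<phi>"
  shows "((deriv ^^ n) \<phi> has_real_derivative (deriv ^^ Suc n) \<phi> \<theta>) (at \<theta>)"
proof -
  obtain \<psi> where "\<And>\<theta>. ((deriv ^^ n) \<phi> has_real_derivative \<psi> \<theta>) (at \<theta>)"
    using qp_has_derivative[OF qp_higher_deriv[OF assms, of n]] by blast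
  then show ?thesis using DERIV_imp_deriv by (metis comp_apply funpow.simps(2))
qed

text \<open>Uniform in the base point, because the \<open>N\<close>-th derivative is quasi-periodic
  as well and therefore bounded.\<close>

lemma qp_taylor:
  assumes "qp \<omega> \<phi>" "0 < N"
  shows "\<exists>B\<ge>0. \<forall>x h. \<bar>\<phi> (x + h) - (\<Sum>n<N. (deriv ^^ n) \<phi> x / fact n * h ^ n)\<bar> \<le> B * \<bar>h\<bar> ^ N"
proof -
  obtain B where B: "B \<ge> 0" "\<And>\<theta>. \<bar>(deriv ^^ N) \<phi> \<theta>\<bar> \<le> B"
    using qp_bounded[OF qp_higher_deriv[OF assms(1), of N]] by blast
  have "\<bar>\<phi> (x + h) - (\<Sum>n<N. (deriv ^^ n) \<phi> x / fact n * h ^ n)\<bar> \<le> B * \<bar>h\<bar> ^ N" for x h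
  proof (cases "h = 0")
    case True
    have "(\<Sum>n<N. (deriv ^^ n) \<phi> x / fact n * (0::real) ^ n) = (\<Sum>n\<in>{0}. (deriv ^^ n) \<phi> x / fact n * (0::real) ^ n)"
      using assms(2) by (intro sum.mono_neutral_right) auto
    then show ?thesis using True B(1) assms(2) by simp
  next
    case False
    have "\<exists>t. (if x + h < x then x + h < t \<and> t < x else x < t \<and> t < x + h) \<and>
      \<phi> (x + h) = (\<Sum>m<N. (deriv ^^ m) \<phi> x / fact m * (x + h - x) ^ m) + (deriv ^^ N) \<phi> t / fact N * (x + h - x) ^ N"
      using assms(2) False qp_has_higher_deriv[OF assms(1)]
      by (intro Taylor[where a = "min x (x + h)" and b = "max x (x + h)"]) auto
    then obtain t where "\<phi> (x + h) = (\<Sum>m<N. (deriv ^^ m) \<phi> x / fact m * h ^ m) + (deriv ^^ N) \<phi> t / fact N * h ^ N"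
      by auto
    then have "\<bar>\<phi> (x + h) - (\<Sum>n<N. (deriv ^^ n) \<phi> x / fact n * h ^ n)\<bar> = \<bar>(deriv ^^ N) \<phi> t\<bar> / fact N * \<bar>h\<bar> ^ N"
      by (simp add: abs_mult power_abs)
    also have "\<dots> \<le> B * \<bar>h\<bar> ^ N"
    proof (intro mult_right_mono)
      have "\<bar>(deriv ^^ N) \<phi> t\<bar> / fact N \<le> \<bar>(deriv ^^ N) \<phi> t\<bar> / 1"
        by (intro divide_left_mono) (auto simp: fact_ge_1)
      then show "\<bar>(deriv ^^ N) \<phi> t\<bar> / fact N \<le> B" using B(2)[of t] by simp
    qed auto
    finally show ?thesis .
  qed
  with B(1) show ?thesis by blast
qed

lemma higher_deriv_powser:
  fixes a :: "nat \<Rightarrow> real"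
  assumes "0 < \<rho>" "\<And>x. \<bar>x\<bar> < \<rho> \<Longrightarrow> (\<lambda>n. a n * x ^ n) sums f x"
  shows "(deriv ^^ n) f 0 = fact n * a n"
  using assms(2)
proof (induction n arbitrary: a f)
  case 0
  from 0[of 0] assms(1) have "(\<lambda>n. a n * 0 ^ n) sums f 0" by simp
  then show ?case using sums_unique2[OF _ powser_sums_zero] by fastforce
next
  case (Suc n)
  have sm: "summable (\<lambda>n. a n * x ^ n)" if "norm x < \<rho>" for x
    using Suc.prems[of x] that by (auto simp: sums_iff)
  have "(\<lambda>n. diffs a n * x ^ n) sums deriv f x" if x: "\<bar>x\<bar> < \<rho>" for x
  proof -
    have "DERIV (\<lambda>x. \<Sum>n. a n * x ^ n) x :> (\<Sum>n. diffs a n * x ^ n)"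
      by (rule termdiffs_strong'[of \<rho>]) (use sm x in auto)
    then have "DERIV f x :> (\<Sum>n. diffs a n * x ^ n)"
      by (rule has_field_derivative_transform_within_open[of _ _ _ "{-\<rho><..<\<rho>}"])
         (use x Suc.prems in \<open>auto simp: sums_iff abs_less_iff\<close>)
    then have "deriv f x = (\<Sum>n. diffs a n * x ^ n)" by (rule DERIV_imp_deriv)
    moreover have "summable (\<lambda>n. diffs a n * x ^ n)"
      by (rule termdiff_converges[of _ \<rho>]) (use sm x in auto)
    ultimately show ?thesis by (simp add: sums_iff)
  qed
  from Suc.IH[OF this] have "(deriv ^^ n) (deriv f) 0 = fact n * diffs a n" .
  then show ?case by (simp add: funpow_Suc_right diffs_def algebra_simps del: funpow.simps)
qed

text \<open>The double series is summed over the frequencies first, which gives coefficient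
  functions \<open>F n\<close> of the angle; the row sums \<open>g n\<close> dominate the tail and
  make the remainder \<open>O(r^N)\<close> uniform in the angle.\<close>

lemma cls_expansion:
  fixes \<omega> :: "real ^ 'm"
  assumes "cls \<omega> 0 f"
  shows "\<exists>F \<rho>. \<rho> > 0 \<and> (\<forall>n. qp \<omega> (F n)) \<and> (\<forall>\<theta> r. \<bar>r\<bar> \<le> \<rho> \<longrightarrow> ((\<lambda>n. F n \<theta> * r ^ n) has_sum f (\<theta>, r)) UNIV) \<and>
    (\<forall>N. small N (\<lambda>p. f p - (\<Sum>n<N. F n (fst p) * snd p ^ n)))"
proof -
  obtain s \<rho> C c where s: "0 < s" and c: "brep \<omega> s \<rho> 0 c (\<lambda>p. complex_of_real (f p)) C"
    using assms unfolding cls_def bnd_def by blast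
  note b = brepD[OF c]
  have sw: "((\<lambda>(n, k). g (k, n)) has_sum S) (UNIV \<times> UNIV) \<longleftrightarrow> (g has_sum S) UNIV"
    for g :: "(int ^ 'm) \<times> nat \<Rightarrow> 'b :: {comm_monoid_add, topological_space}" and S
    using has_sum_swap[where f = g and S = S and A = UNIV and B = UNIV] by simp
  define S where "S = (\<Sum>\<^sub>\<infinity>z. norm (c z) * wt s \<rho> z)"
  have tot: "((\<lambda>(n, k). norm (c (k, n)) * wt s \<rho> (k, n)) has_sum S) (UNIV \<times> UNIV)"
    using has_sum_infsum[OF b(4)] unfolding S_def by (subst sw)
  have row: "(\<lambda>k. norm (c (k, n)) * wt s \<rho> (k, n)) summable_on UNIV" for n
    using summable_on_SigmaD1[OF has_sum_imp_summable[OF tot], of n] by simp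
  define g where "g n = (\<Sum>\<^sub>\<infinity>k. norm (c (k, n)) * wt s \<rho> (k, n))" for n
  have gS: "(g has_sum S) UNIV"
    by (rule has_sum_SigmaD[OF tot]) (use has_sum_infsum[OF row] in \<open>auto simp: g_def\<close>)
  have rowe: "(\<lambda>k. norm (c (k, n)) * exp (s * l1_norm k)) summable_on UNIV" for n
  proof -
    have "(\<lambda>k. norm (c (k, n)) * exp (s * l1_norm k) * \<rho> ^ n) summable_on UNIV"
      using row[of n] by (simp add: wt_def mult.assoc)
    then show ?thesis using b(2) by (subst (asm) summable_on_cmult_left') auto
  qed
  define A where "A n \<theta> = (\<Sum>\<^sub>\<infinity>k. c (k, n) * cis (int_inner k \<omega> * \<theta>))" for n \<theta>
  have A: "((\<lambda>k. c (k, n) * cis (int_inner k \<omega> * \<theta>)) has_sum A n \<theta>) UNIV" for n \<theta>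
    unfolding A_def
  proof (rule has_sum_infsum, rule abs_summable_summable, rule Infinite_Sum.abs_summable_on_comparison_test'[OF rowe[of n]])
    fix k :: "int ^ 'm"
    show "norm (c (k, n) * cis (int_inner k \<omega> * \<theta>)) \<le> norm (c (k, n)) * exp (s * l1_norm k)"
      using mult_left_mono[of 1 "exp (s * l1_norm k)" "norm (c (k, n))"] s l1_norm_nonneg[of k] by (simp add: norm_mult)
  qed
  have Ag: "norm (A n \<theta>) * \<rho> ^ n \<le> g n" for n \<theta>
  proof -
    have "norm (A n \<theta> * of_real (\<rho> ^ n)) \<le> g n" unfolding g_def
    proof (rule norm_infsum_le[OF has_sum_cmult_left[OF A] has_sum_infsum[OF row]])
      fix k :: "int ^ 'm"
      show "norm (c (k, n) * cis (int_inner k \<omega> * \<theta>) * of_real (\<rho> ^ n)) \<le> norm (c (k, n)) * wt s \<rho> (k, n)"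
        using mult_right_mono[of 1 "exp (s * l1_norm k)" "\<rho> ^ n"] s l1_norm_nonneg[of k] b(2)
        by (auto simp: norm_mult norm_power wt_def mult.assoc intro!: mult_left_mono)
    qed
    then show ?thesis using b(2) by (simp add: norm_mult norm_power)
  qed
  define F where "F n \<theta> = Re (A n \<theta>)" for n \<theta>
  have qpF: "qp \<omega> (F n)" for n unfolding F_def by (rule qp_Re[OF s rowe A])
  have exp_sum: "((\<lambda>n. F n \<theta> * r ^ n) has_sum f (\<theta>, r)) UNIV" if r: "\<bar>r\<bar> \<le> \<rho>" for \<theta> r
  proof -
    have S1: "((\<lambda>(n, k). c (k, n) * chi \<omega> (k, n) (\<theta>, r)) has_sum complex_of_real (f (\<theta>, r))) (UNIV \<times> UNIV)"
      using b(5)[of "(\<theta>, r)"] r by (subst sw) simp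
    have S2: "((\<lambda>k. c (k, n) * chi \<omega> (k, n) (\<theta>, r)) has_sum A n \<theta> * of_real (r ^ n)) UNIV" for n
      using has_sum_cmult_left[OF A[of n \<theta>], of "of_real (r ^ n)"] by (simp add: chi_def mult.assoc)
    have "((\<lambda>n. A n \<theta> * of_real (r ^ n)) has_sum complex_of_real (f (\<theta>, r))) UNIV"
      by (rule has_sum_SigmaD[OF S1]) (use S2 in simp)
    from has_sum_Re[OF this] show ?thesis by (simp add: F_def)
  qed
  have "small N (\<lambda>p. f p - (\<Sum>n<N. F n (fst p) * snd p ^ n))" for N
    unfolding small_def
  proof (intro exI conjI allI impI)
    show "0 < \<rho>" by (rule b)
    fix p :: "real \<times> real" assume p: "\<bar>snd p\<bar> \<le> \<rho>"
    have "((\<lambda>n. if n < N then F n (fst p) * snd p ^ n else 0) has_sum (\<Sum>n<N. F n (fst p) * snd p ^ n)) UNIV"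
      by (intro has_sum_finite_neutralI[of "{..<N}"]) auto
    from has_sum_minus[OF exp_sum[OF p, of "fst p"] this]
    have h: "((\<lambda>n. F n (fst p) * snd p ^ n - (if n < N then F n (fst p) * snd p ^ n else 0)) has_sum
      f p - (\<Sum>n<N. F n (fst p) * snd p ^ n)) UNIV" by simp
    have "norm (f p - (\<Sum>n<N. F n (fst p) * snd p ^ n)) \<le> S * (\<bar>snd p\<bar> / \<rho>) ^ N"
    proof (rule norm_infsum_le[OF h has_sum_cmult_left[OF gS]])
      fix n
      have g0: "0 \<le> g n" using order_trans[OF _ Ag[of n 0]] b(2) by simp
      show "norm (F n (fst p) * snd p ^ n - (if n < N then F n (fst p) * snd p ^ n else 0)) \<le> g n * (\<bar>snd p\<bar> / \<rho>) ^ N"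
      proof (cases "n < N")
        case True
        then show ?thesis using g0 b(2) by simp
      next
        case False
        have "\<bar>F n (fst p)\<bar> * \<bar>snd p\<bar> ^ n \<le> norm (A n (fst p)) * (\<rho> ^ n * (\<bar>snd p\<bar> / \<rho>) ^ n)"
          using b(2) abs_Re_le_cmod[of "A n (fst p)"] by (simp add: F_def power_divide mult_right_mono)
        also have "\<dots> \<le> norm (A n (fst p)) * (\<rho> ^ n * (\<bar>snd p\<bar> / \<rho>) ^ N)"
          using False b(2) p by (intro mult_left_mono power_decreasing) auto
        also have "\<dots> \<le> g n * (\<bar>snd p\<bar> / \<rho>) ^ N"
          unfolding mult.assoc[symmetric] using b(2) by (intro mult_right_mono Ag) auto
        finally show ?thesis using False by (simp add: abs_mult power_abs)
      qed
    qed
    then show "norm (f p - (\<Sum>n<N. F n (fst p) * snd p ^ n)) \<le> S / \<rho> ^ N * \<bar>snd p\<bar> ^ N"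
      by (simp add: power_divide)
  qed
  then show ?thesis using b(2) qpF exp_sum by blast
qed

text \<open>Connects the iterated derivatives in \<open>taylor_r\<close> with the Fourier-Taylor
  coefficients: a convergent power series is the Taylor series of its sum.\<close>

lemma taylor_r_cls:
  fixes \<omega> :: "real ^ 'm"
  assumes "cls \<omega> 0 f"
  shows "qp \<omega> (\<lambda>\<theta>. fps_nth (taylor_r f \<theta>) n)"
    and "small N (\<lambda>p. f p - (\<Sum>n<N. fps_nth (taylor_r f (fst p)) n * snd p ^ n))"
    and "fps_nth (taylor_r f \<theta>) 0 = f (\<theta>, 0)"
proof -
  obtain F \<rho> where F: "\<rho> > 0" "\<And>n. qp \<omega> (F n)"
    "\<And>\<theta> r. \<bar>r\<bar> \<le> \<rho> \<Longrightarrow> ((\<lambda>n. F n \<theta> * r ^ n) has_sum f (\<theta>, r)) UNIV"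
    "\<And>N. small N (\<lambda>p. f p - (\<Sum>n<N. F n (fst p) * snd p ^ n))"
    using cls_expansion[OF assms] by blast
  have "(deriv ^^ n) (\<lambda>r. f (\<theta>, r)) 0 = fact n * F n \<theta>" for n \<theta>
    by (rule higher_deriv_powser[OF F(1)]) (use F(3) has_sum_imp_sums in \<open>auto intro: less_imp_le\<close>)
  then have eq: "fps_nth (taylor_r f \<theta>) n = F n \<theta>" for n \<theta>
    by (simp add: taylor_r_def)
  show "qp \<omega> (\<lambda>\<theta>. fps_nth (taylor_r f \<theta>) n)" unfolding eq using F(2)[of n] .
  show "small N (\<lambda>p. f p - (\<Sum>n<N. fps_nth (taylor_r f (fst p)) n * snd p ^ n))"
    unfolding eq by (rule F)
  show "fps_nth (taylor_r f \<theta>) 0 = f (\<theta>, 0)" by (simp add: taylor_r_def)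
qed

section \<open>Formal mappings and their truncations\<close>

lemma small_mult:
  fixes F G :: "real \<times> real \<Rightarrow> real"
  assumes "small a F" "small b G"
  shows "small (a + b) (\<lambda>p. F p * G p)"
proof -
  obtain K \<rho> where K: "0 < \<rho>" "\<And>p. \<bar>snd p\<bar> \<le> \<rho> \<Longrightarrow> norm (F p) \<le> K * \<bar>snd p\<bar> ^ a"
    using assms(1) unfolding small_def by blast
  obtain L \<rho>' where L: "0 < \<rho>'" "\<And>p. \<bar>snd p\<bar> \<le> \<rho>' \<Longrightarrow> norm (G p) \<le> L * \<bar>snd p\<bar> ^ b"
    using assms(2) unfolding small_def by blast
  show ?thesis unfolding small_def
  proof (intro exI conjI allI impI)
    show "0 < min \<rho> \<rho>'" using K L by simp
    fix p :: "real \<times> real" assume p: "\<bar>snd p\<bar> \<le> min \<rho> \<rho>'"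
    have "norm (F p * G p) \<le> (K * \<bar>snd p\<bar> ^ a) * (L * \<bar>snd p\<bar> ^ b)"
      unfolding norm_mult using p K(2)[of p] L(2)[of p] order_trans[OF norm_ge_zero K(2)[of p]]
      by (intro mult_mono) auto
    then show "norm (F p * G p) \<le> (K * L) * \<bar>snd p\<bar> ^ (a + b)"
      by (simp add: power_add algebra_simps)
  qed
qed

lemma small_sum: "(\<And>i. i \<in> I \<Longrightarrow> small d (F i)) \<Longrightarrow> small d (\<lambda>p. \<Sum>i\<in>I. F i p)"
  by (induction I rule: infinite_finite_induct) (auto intro: small_add small_zero)

lemma small_snd_power: "small n (\<lambda>p. snd p ^ n)"
  unfolding small_def by (intro exI[of _ 1] conjI) (auto simp: power_abs)

lemma small_fst_bounded:
  fixes c :: "real \<Rightarrow> real"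
  assumes "\<And>\<theta>. \<bar>c \<theta>\<bar> \<le> B"
  shows "small 0 (\<lambda>p. c (fst p))"
  unfolding small_def
proof (intro exI conjI allI impI)
  show "norm (c (fst p)) \<le> B * \<bar>snd p\<bar> ^ 0" for p :: "real \<times> real" using assms by simp
  show "0 < (1 :: real)" by simp
qed

text \<open>\<open>P\<close> is the expansion of \<open>f\<close> at \<open>r = 0\<close> modulo \<open>O(r\<^sup>N)\<close>, uniformly in the angle.\<close>

definition expands :: "nat \<Rightarrow> formal_series \<Rightarrow> (real \<times> real \<Rightarrow> real) \<Rightarrow> bool" where
  "expands N P f \<longleftrightarrow> small N (\<lambda>p. f p - (\<Sum>k<N. fps_nth (P (fst p)) k * snd p ^ k)) \<and>
     (\<forall>k<N. \<exists>B. \<forall>\<theta>. \<bar>fps_nth (P \<theta>) k\<bar> \<le> B)"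

lemma expands_cong:
  assumes "expands N P f" "small N (\<lambda>p. g p - f p)" "\<And>\<theta> k. k < N \<Longrightarrow> fps_nth (Q \<theta>) k = fps_nth (P \<theta>) k"
  shows "expands N Q g"
proof -
  have "small N (\<lambda>p. (g p - f p) + (f p - (\<Sum>k<N. fps_nth (P (fst p)) k * snd p ^ k)))"
    using assms(1,2) unfolding expands_def by (intro small_add) auto
  moreover have "(\<Sum>k<N. fps_nth (Q \<theta>) k * r ^ k) = (\<Sum>k<N. fps_nth (P \<theta>) k * r ^ k)" for \<theta> and r :: real
    using assms(3) by (intro sum.cong) auto
  ultimately show ?thesis using assms(1,3) unfolding expands_def by simp
qed

lemma expands_unique: "expands N P f \<Longrightarrow> expands N P g \<Longrightarrow> small N (\<lambda>p. f p - g p)"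
  unfolding expands_def
  using small_diff[of N "\<lambda>p. f p - (\<Sum>k<N. fps_nth (P (fst p)) k * snd p ^ k)" "\<lambda>p. g p - (\<Sum>k<N. fps_nth (P (fst p)) k * snd p ^ k)"]
  by simp

lemma expands_coeff_small: "expands N P f \<Longrightarrow> k < N \<Longrightarrow> small k (\<lambda>p. fps_nth (P (fst p)) k * snd p ^ k)"
  unfolding expands_def using small_mult[OF small_fst_bounded small_snd_power, of "\<lambda>\<theta>. fps_nth (P \<theta>) k"] by force

lemma expands_trunc_small0:
  assumes "expands N P f"
  shows "small 0 (\<lambda>p. \<Sum>k<N. fps_nth (P (fst p)) k * snd p ^ k)"
  by (intro small_sum) (auto intro: small_mono[OF expands_coeff_small[OF assms]])

lemma expands_small0:
  assumes "expands N P f"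
  shows "small 0 f"
  using small_add[OF small_mono[of N _ 0] expands_trunc_small0[OF assms], of "\<lambda>p. f p - (\<Sum>k<N. fps_nth (P (fst p)) k * snd p ^ k)"]
    assms unfolding expands_def by simp

lemma expands_small1:
  assumes "expands N P f" "0 < N" "\<And>\<theta>. fps_nth (P \<theta>) 0 = 0"
  shows "small 1 f"
proof -
  have "small 1 (\<lambda>p. \<Sum>k<N. fps_nth (P (fst p)) k * snd p ^ k)"
  proof (rule small_sum)
    fix k assume "k \<in> {..<N}"
    then show "small 1 (\<lambda>p. fps_nth (P (fst p)) k * snd p ^ k)"
      using small_mono[OF expands_coeff_small[OF assms(1), of k], of 1] assms(3)
      by (cases "k = 0") (auto simp: small_zero)
  qed
  moreover have "small 1 (\<lambda>p. f p - (\<Sum>k<N. fps_nth (P (fst p)) k * snd p ^ k))"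
    using assms(1,2) unfolding expands_def by (auto elim: small_mono)
  ultimately show ?thesis
    using small_add[of 1 "\<lambda>p. f p - (\<Sum>k<N. fps_nth (P (fst p)) k * snd p ^ k)"] by fastforce
qed

lemma expands_add:
  assumes "expands N P f" "expands N Q g"
  shows "expands N (\<lambda>\<theta>. P \<theta> + Q \<theta>) (\<lambda>p. f p + g p)"
  unfolding expands_def
proof (intro conjI allI impI)
  have "small N (\<lambda>p. (f p - (\<Sum>k<N. fps_nth (P (fst p)) k * snd p ^ k)) + (g p - (\<Sum>k<N. fps_nth (Q (fst p)) k * snd p ^ k)))"
    using assms unfolding expands_def by (intro small_add) auto
  then show "small N (\<lambda>p. f p + g p - (\<Sum>k<N. fps_nth (P (fst p) + Q (fst p)) k * snd p ^ k))"
    by (simp add: sum.distrib distrib_right algebra_simps)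
  fix k assume "k < N"
  then obtain B B' where "\<And>\<theta>. \<bar>fps_nth (P \<theta>) k\<bar> \<le> B" "\<And>\<theta>. \<bar>fps_nth (Q \<theta>) k\<bar> \<le> B'"
    using assms unfolding expands_def by meson
  then have "\<bar>fps_nth (P \<theta> + Q \<theta>) k\<bar> \<le> B + B'" for \<theta>
    by (metis abs_triangle_ineq add_mono fps_add_nth order_trans)
  then show "\<exists>B. \<forall>\<theta>. \<bar>fps_nth (P \<theta> + Q \<theta>) k\<bar> \<le> B" by blast
qed

lemma expands_const:
  assumes "\<And>\<theta>. \<bar>c \<theta>\<bar> \<le> B" "0 < N"
  shows "expands N (\<lambda>\<theta>. fps_const (c \<theta>)) (\<lambda>p. c (fst p))"
  unfolding expands_def
proof (intro conjI allI impI)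
  have "(\<Sum>k<N. fps_nth (fps_const (c \<theta>)) k * r ^ k) = c \<theta>" for \<theta> r
  proof -
    have "(\<Sum>k<N. fps_nth (fps_const (c \<theta>)) k * r ^ k) = (\<Sum>k\<in>{0}. fps_nth (fps_const (c \<theta>)) k * r ^ k)"
      using assms(2) by (intro sum.mono_neutral_right) auto
    then show ?thesis by simp
  qed
  then show "small N (\<lambda>p. c (fst p) - (\<Sum>k<N. fps_nth (fps_const (c (fst p))) k * snd p ^ k))"
    by (simp add: small_zero)
  show "\<exists>B. \<forall>\<theta>. \<bar>fps_nth (fps_const (c \<theta>)) k\<bar> \<le> B" for k
    using assms(1) order_trans[OF abs_ge_zero assms(1)] by (intro exI[of _ B]) auto
qed

lemma expands_mult:
  assumes P: "expands N P f" and Q: "expands N Q g"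
  shows "expands N (\<lambda>\<theta>. P \<theta> * Q \<theta>) (\<lambda>p. f p * g p)"
  unfolding expands_def
proof (intro conjI allI impI)
  define p' where "p' i p = fps_nth (P (fst p)) i * snd p ^ i" for i and p :: "real \<times> real"
  define q' where "q' i p = fps_nth (Q (fst p)) i * snd p ^ i" for i and p :: "real \<times> real"
  \<comment> \<open>Pairs of retained degrees whose product has degree at least \<open>N\<close>;
    the complement is the triangle of the Cauchy product.\<close>
  define D where "D = {..<N} \<times> {..<N} - {(i, j). i + j < N}"
  have e1: "small N (\<lambda>p. f p - (\<Sum>i<N. p' i p))" "small N (\<lambda>p. g p - (\<Sum>i<N. q' i p))"
    using P Q unfolding expands_def p'_def q'_def by auto
  have t0: "small 0 (\<lambda>p. \<Sum>i<N. p' i p)" using expands_trunc_small0[OF P] by (simp add: p'_def)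
  have "small N (\<lambda>p. (f p - (\<Sum>i<N. p' i p)) * g p)" "small N (\<lambda>p. (\<Sum>i<N. p' i p) * (g p - (\<Sum>i<N. q' i p)))"
    using small_mult[OF e1(1) expands_small0[OF Q]] small_mult[OF t0 e1(2)] by simp_all
  moreover have "small N (\<lambda>p. \<Sum>(i, j)\<in>D. p' i p * q' j p)"
  proof (rule small_sum, safe)
    fix i j assume ij: "(i, j) \<in> D"
    then have "small (i + j) (\<lambda>p. p' i p * q' j p)"
      unfolding p'_def q'_def D_def by (intro small_mult expands_coeff_small[OF P] expands_coeff_small[OF Q]) auto
    then show "small N (\<lambda>p. p' i p * q' j p)" by (rule small_mono) (use ij in \<open>auto simp: D_def\<close>)
  qed
  ultimately have "small N (\<lambda>p. (f p - (\<Sum>i<N. p' i p)) * g p + (\<Sum>i<N. p' i p) * (g p - (\<Sum>i<N. q' i p)) + (\<Sum>(i, j)\<in>D. p' i p * q' j p))"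
    by (intro small_add)
  moreover have "(f p - (\<Sum>i<N. p' i p)) * g p + (\<Sum>i<N. p' i p) * (g p - (\<Sum>i<N. q' i p)) + (\<Sum>(i, j)\<in>D. p' i p * q' j p)
      = f p * g p - (\<Sum>k<N. fps_nth (P (fst p) * Q (fst p)) k * snd p ^ k)" for p
  proof -
    have "(\<Sum>i<N. p' i p) * (\<Sum>j<N. q' j p) = (\<Sum>(i, j)\<in>{..<N} \<times> {..<N}. p' i p * q' j p)"
      by (simp add: sum_product sum.cartesian_product)
    also have "{..<N} \<times> {..<N} = D \<union> {(i, j). i + j < N}" by (auto simp: D_def)
    also have "(\<Sum>(i, j)\<in>D \<union> {(i, j). i + j < N}. p' i p * q' j p) =
        (\<Sum>(i, j)\<in>D. p' i p * q' j p) + (\<Sum>(i, j)\<in>{(i, j). i + j < N}. p' i p * q' j p)"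
    proof (rule sum.union_disjoint)
      show "finite {(i, j). i + j < N}"
        by (rule finite_subset[of _ "{..<N} \<times> {..<N}"]) auto
    qed (auto simp: D_def)
    also have "(\<Sum>(i, j)\<in>{(i, j). i + j < N}. p' i p * q' j p) = (\<Sum>k<N. \<Sum>i\<le>k. p' i p * q' (k - i) p)"
      by (rule sum.triangle_reindex)
    also have "\<dots> = (\<Sum>k<N. fps_nth (P (fst p) * Q (fst p)) k * snd p ^ k)"
    proof (rule sum.cong)
      fix k
      have "p' i p * q' (k - i) p = fps_nth (P (fst p)) i * fps_nth (Q (fst p)) (k - i) * snd p ^ k" if "i \<le> k" for i
        using that by (simp add: p'_def q'_def power_add[symmetric] mult.assoc mult.left_commute[of "snd p ^ i"])
      then show "(\<Sum>i\<le>k. p' i p * q' (k - i) p) = fps_nth (P (fst p) * Q (fst p)) k * snd p ^ k"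
        by (simp add: fps_mult_nth sum_distrib_right atMost_atLeast0)
    qed simp
    finally show ?thesis by (simp add: algebra_simps)
  qed
  ultimately show "small N (\<lambda>p. f p * g p - (\<Sum>k<N. fps_nth (P (fst p) * Q (fst p)) k * snd p ^ k))" by simp
next
  fix k assume k: "k < N"
  obtain B where B: "\<And>i \<theta>. i < N \<Longrightarrow> \<bar>fps_nth (P \<theta>) i\<bar> \<le> B i" using P unfolding expands_def by metis
  obtain B' where B': "\<And>i \<theta>. i < N \<Longrightarrow> \<bar>fps_nth (Q \<theta>) i\<bar> \<le> B' i" using Q unfolding expands_def by metis
  have "\<bar>fps_nth (P \<theta> * Q \<theta>) k\<bar> \<le> (\<Sum>i=0..k. B i * B' (k - i))" for \<theta>
    unfolding fps_mult_nth
  proof (rule order_trans[OF sum_abs], rule sum_mono)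
    fix i assume "i \<in> {0..k}"
    then show "\<bar>fps_nth (P \<theta>) i * fps_nth (Q \<theta>) (k - i)\<bar> \<le> B i * B' (k - i)"
      unfolding abs_mult using k order_trans[OF abs_ge_zero B[of i \<theta>]] by (intro mult_mono B B') auto
  qed
  then show "\<exists>B. \<forall>\<theta>. \<bar>fps_nth (P \<theta> * Q \<theta>) k\<bar> \<le> B" by blast
qed

lemma expands_power:
  assumes "expands N P f" "0 < N"
  shows "expands N (\<lambda>\<theta>. P \<theta> ^ n) (\<lambda>p. f p ^ n)"
proof (induction n)
  case 0
  show ?case using expands_const[of "\<lambda>_. 1" 1 N] assms(2) by simp
next
  case (Suc n)
  then show ?case using expands_mult[OF assms(1) Suc] by simp
qed

lemma expands_sum:
  assumes "finite I" "\<And>i. i \<in> I \<Longrightarrow> expands N (P i) (f i)" "0 < N"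
  shows "expands N (\<lambda>\<theta>. \<Sum>i\<in>I. P i \<theta>) (\<lambda>p. \<Sum>i\<in>I. f i p)"
  using assms(1,2)
proof (induction I)
  case empty
  show ?case using expands_const[of "\<lambda>_. 0" 0 N] assms(3) by simp
next
  case (insert i I)
  then show ?case by (simp add: expands_add)
qed

definition nice :: "real ^ 'm \<Rightarrow> formal_series \<Rightarrow> bool" where
  "nice \<omega> h \<longleftrightarrow> (\<forall>k. qp \<omega> (\<lambda>\<theta>. fps_nth (h \<theta>) k))"

lemma fps_compose_nth_less:
  assumes "fps_nth b 0 = (0 :: real)" "i < N"
  shows "fps_nth (P oo b) i = (\<Sum>l<N. fps_nth P l * fps_nth (b ^ l) i)"
proof -
  have "fps_nth (P oo b) i = (\<Sum>l=0..i. fps_nth P l * fps_nth (b ^ l) i)" by (simp add: fps_compose_nth)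
  also have "\<dots> = (\<Sum>l<N. fps_nth P l * fps_nth (b ^ l) i)"
    using assms startsby_zero_power_prefix[OF assms(1)] by (intro sum.mono_neutral_left) auto
  finally show ?thesis .
qed

text \<open>For a coefficient below \<open>N\<close> all sums may be extended to the fixed length
  \<open>N\<close>, as high powers of series without constant term contribute nothing in low degree.
  The substitution becomes one polynomial expression in the two series, to which the rules for sums
  and products of expansions apply.\<close>

lemma formal_subst_nth:
  assumes b0: "fps_nth (snd B \<xi>) 0 = 0" and j: "j < N"
  shows "fps_nth (formal_subst h B \<xi>) j = fps_nth (\<Sum>n<N. \<Sum>k<N.
     fps_const ((deriv ^^ n) (\<lambda>t. fps_nth (h t) k) (\<xi> + fps_nth (fst B \<xi>) 0) / fact n) *
       (snd B \<xi> ^ k * (fst B \<xi> - fps_const (fps_nth (fst B \<xi>) 0)) ^ n)) j"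
proof -
  define a0 where "a0 = fps_nth (fst B \<xi>) 0"
  define a where "a = fst B \<xi> - fps_const a0"
  define b where "b = snd B \<xi>"
  define X where "X n k = (deriv ^^ n) (\<lambda>t. fps_nth (h t) k) (\<xi> + a0)" for n k
  have az: "fps_nth a 0 = 0" by (simp add: a_def a0_def)
  have an: "fps_nth (a ^ n) i = 0" if "i < n" for i n using startsby_zero_power_prefix[OF az] that by blast
  define D where "D n = fps_const (1 / fact n) * (angle_deriv n h (\<xi> + a0) oo b) * a ^ n" for n
  have D0: "fps_nth (D n) j = 0" if "j < n" for n
    unfolding D_def fps_mult_nth[of _ "a ^ n"] using an that by (intro sum.neutral) auto
  have "fps_nth (formal_subst h B \<xi>) j = (\<Sum>n\<le>j. fps_nth (D n) j)"
    by (simp add: formal_subst_def Let_def D_def a_def a0_def b_def)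
  also have "\<dots> = (\<Sum>n<N. fps_nth (D n) j)"
    using j D0 by (intro sum.mono_neutral_left) auto
  also have "\<dots> = (\<Sum>n<N. \<Sum>k<N. fps_nth (fps_const (X n k / fact n) * (b ^ k * a ^ n)) j)"
  proof (rule sum.cong)
    fix n
    have "fps_nth (D n) j = (\<Sum>i=0..j. (1 / fact n) * (\<Sum>k<N. X n k * fps_nth (b ^ k) i) * fps_nth (a ^ n) (j - i))"
      unfolding D_def fps_mult_nth[of _ "a ^ n"]
      using j b0 by (intro sum.cong) (auto simp: fps_compose_nth_less[where N = N] b_def angle_deriv_def X_def)
    also have "\<dots> = (\<Sum>i=0..j. \<Sum>k<N. X n k / fact n * (fps_nth (b ^ k) i * fps_nth (a ^ n) (j - i)))"
      by (simp add: sum_distrib_left sum_distrib_right mult.assoc)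
    also have "\<dots> = (\<Sum>k<N. \<Sum>i=0..j. X n k / fact n * (fps_nth (b ^ k) i * fps_nth (a ^ n) (j - i)))"
      by (rule sum.swap)
    also have "\<dots> = (\<Sum>k<N. fps_nth (fps_const (X n k / fact n) * (b ^ k * a ^ n)) j)"
      by (simp add: fps_mult_nth[of "b ^ _"] sum_distrib_left)
    finally show "fps_nth (D n) j = (\<Sum>k<N. fps_nth (fps_const (X n k / fact n) * (b ^ k * a ^ n)) j)" .
  qed simp
  finally show ?thesis by (simp add: fps_sum_nth X_def a_def a0_def b_def)
qed

text \<open>Follows the encoding of formal maps: displacement for the angle, the value itself for
  the radius.\<close>

definition fexpands :: "nat \<Rightarrow> formal_map \<Rightarrow> planar_map \<Rightarrow> bool" where
  "fexpands N A A' \<longleftrightarrow> expands N (fst A) (\<lambda>p. fst (A' p) - fst p) \<and> expands N (snd A) (\<lambda>p. snd (A' p))"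

text \<open>\<open>h'\<close> is expanded in the radius first, then each coefficient in the angle
  about \<open>\<theta> + a0 \<theta>\<close>. Since the remaining displacement \<open>a\<close> is
  \<open>O(r)\<close>, the Taylor remainder \<open>a^N\<close> is \<open>O(r^N)\<close>, and what is
  left is the polynomial of the formal substitution.\<close>

lemma expands_subst:
  assumes N: "0 < N" and h: "nice \<omega> h" "expands N h h'" and B: "fexpands N B B'" and b0: "\<And>\<theta>. fps_nth (snd B \<theta>) 0 = 0"
  shows "expands N (formal_subst h B) (\<lambda>p. h' (B' p))"
proof -
  define a0 where "a0 \<theta> = fps_nth (fst B \<theta>) 0" for \<theta>
  define a where "a p = fst (B' p) - fst p - a0 (fst p)" for p
  define b where "b p = snd (B' p)" for p
  have B1: "expands N (fst B) (\<lambda>p. fst (B' p) - fst p)" and B2: "expands N (snd B) b"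
    using B by (simp_all add: fexpands_def b_def[abs_def])
  obtain Ba where Ba: "\<And>\<theta>. \<bar>a0 \<theta>\<bar> \<le> Ba" using B1 N unfolding expands_def a0_def by meson
  have ea: "expands N (\<lambda>\<theta>. fst B \<theta> - fps_const (a0 \<theta>)) a"
  proof (rule expands_cong[OF expands_add[OF B1 expands_const[of "\<lambda>\<theta>. - a0 \<theta>" Ba N]]])
    show "small N (\<lambda>p. a p - (fst (B' p) - fst p + - a0 (fst p)))" by (simp add: a_def small_zero)
    show "fps_nth (fst B \<theta> - fps_const (a0 \<theta>)) k = fps_nth (fst B \<theta> + fps_const (- a0 \<theta>)) k" for \<theta> k
      by (simp add: fps_const_neg[symmetric] del: fps_const_neg)
  qed (use Ba N in auto)
  have sa: "small 1 a" by (rule expands_small1[OF ea N]) (simp add: a0_def)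
  have sb: "small 1 b" by (rule expands_small1[OF B2 N b0])
  have tame: "tame B'"
  proof -
    obtain K \<rho> where K: "0 < \<rho>" "\<And>p. \<bar>snd p\<bar> \<le> \<rho> \<Longrightarrow> norm (b p) \<le> K * \<bar>snd p\<bar> ^ 1"
      using sb unfolding small_def by blast
    have "\<bar>snd (B' p)\<bar> \<le> \<bar>K\<bar> * \<bar>snd p\<bar>" if "\<bar>snd p\<bar> \<le> \<rho>" for p
      using K(2)[OF that] mult_right_mono[OF abs_ge_self[of K] abs_ge_zero[of "snd p"]] by (simp add: b_def)
    then show ?thesis unfolding tame_def using K(1) by (intro exI[of _ "\<bar>K\<bar>"]) auto
  qed
  define H where "H k = (\<lambda>\<theta>. fps_nth (h \<theta>) k)" for k
  have qH: "qp \<omega> (H k)" for k using h(1) by (simp add: nice_def H_def)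
  have 1: "small N (\<lambda>p. h' (B' p) - (\<Sum>k<N. H k (fst (B' p)) * b p ^ k))"
    using small_comp[OF _ tame, of N "\<lambda>p. h' p - (\<Sum>k<N. fps_nth (h (fst p)) k * snd p ^ k)"] h(2)
    by (simp add: expands_def H_def b_def)
  have 2: "small N (\<lambda>p. H k (fst (B' p)) - (\<Sum>n<N. (deriv ^^ n) (H k) (fst p + a0 (fst p)) / fact n * a p ^ n))" for k
  proof -
    obtain C where C: "C \<ge> 0" "\<And>x h. \<bar>H k (x + h) - (\<Sum>n<N. (deriv ^^ n) (H k) x / fact n * h ^ n)\<bar> \<le> C * \<bar>h\<bar> ^ N"
      using qp_taylor[OF qH N] by blast
    have pw: "small N (\<lambda>p. a p ^ N)"
    proof -
      have "small n (\<lambda>p. a p ^ n)" for n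
      proof (induction n)
        case 0
        show ?case using small_fst_bounded[of "\<lambda>_. 1" 1] by simp
      next
        case (Suc n)
        then show ?case using small_mult[OF sa Suc] by simp
      qed
      then show ?thesis .
    qed
    show ?thesis
    proof (rule small_dominated[OF pw, of 1 _ C])
      fix p :: "real \<times> real"
      show "norm (H k (fst (B' p)) - (\<Sum>n<N. (deriv ^^ n) (H k) (fst p + a0 (fst p)) / fact n * a p ^ n)) \<le> C * norm (a p ^ N)"
        using C(2)[of "fst p + a0 (fst p)" "a p"] by (simp add: a_def power_abs)
    qed (use C in auto)
  qed
  have b0s: "small 0 (\<lambda>p. b p ^ k)" for k by (rule expands_small0[OF expands_power[OF B2 N]])
  have 3: "small N (\<lambda>p. \<Sum>k<N. (H k (fst (B' p)) - (\<Sum>n<N. (deriv ^^ n) (H k) (fst p + a0 (fst p)) / fact n * a p ^ n)) * b p ^ k)"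
    using small_mult[OF 2 b0s] by (intro small_sum) simp
  have e: "expands N (\<lambda>\<theta>. \<Sum>n<N. \<Sum>k<N. fps_const ((deriv ^^ n) (H k) (\<theta> + a0 \<theta>) / fact n) *
       (snd B \<theta> ^ k * (fst B \<theta> - fps_const (a0 \<theta>)) ^ n))
     (\<lambda>p. \<Sum>n<N. \<Sum>k<N. (deriv ^^ n) (H k) (fst p + a0 (fst p)) / fact n * (b p ^ k * a p ^ n))"
  proof (intro expands_sum expands_mult expands_power B2 ea N finite_lessThan)
    fix n k
    obtain C where C: "\<And>\<theta>. \<bar>(deriv ^^ n) (H k) \<theta>\<bar> \<le> C" using qp_bounded[OF qp_higher_deriv[OF qH]] by blast
    have "\<bar>(deriv ^^ n) (H k) (\<theta> + a0 \<theta>) / fact n\<bar> \<le> C / fact n" for \<theta>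
      unfolding abs_divide using C by (simp add: divide_right_mono)
    from expands_const[of "\<lambda>\<theta>. (deriv ^^ n) (H k) (\<theta> + a0 \<theta>) / fact n", OF this N]
    show "expands N (\<lambda>\<theta>. fps_const ((deriv ^^ n) (H k) (\<theta> + a0 \<theta>) / fact n))
        (\<lambda>p. (deriv ^^ n) (H k) (fst p + a0 (fst p)) / fact n)" .
  qed
  show ?thesis
  proof (rule expands_cong[OF e])
    have "small N (\<lambda>p. (h' (B' p) - (\<Sum>k<N. H k (fst (B' p)) * b p ^ k)) +
      (\<Sum>k<N. (H k (fst (B' p)) - (\<Sum>n<N. (deriv ^^ n) (H k) (fst p + a0 (fst p)) / fact n * a p ^ n)) * b p ^ k))"
      by (intro small_add 1 3)
    moreover have "(\<Sum>k<N. (H k (fst (B' p)) - (\<Sum>n<N. (deriv ^^ n) (H k) (fst p + a0 (fst p)) / fact n * a p ^ n)) * b p ^ k) =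
        (\<Sum>k<N. H k (fst (B' p)) * b p ^ k) - (\<Sum>n<N. \<Sum>k<N. (deriv ^^ n) (H k) (fst p + a0 (fst p)) / fact n * (b p ^ k * a p ^ n))" for p
      by (subst sum.swap) (simp add: left_diff_distrib right_diff_distrib sum_subtractf sum_distrib_right sum_distrib_left mult_ac)
    ultimately show "small N (\<lambda>p. h' (B' p) - (\<Sum>n<N. \<Sum>k<N. (deriv ^^ n) (H k) (fst p + a0 (fst p)) / fact n * (b p ^ k * a p ^ n)))"
      by simp
    show "fps_nth (formal_subst h B \<theta>) j = fps_nth (\<Sum>n<N. \<Sum>k<N. fps_const ((deriv ^^ n) (H k) (\<theta> + a0 \<theta>) / fact n) *
       (snd B \<theta> ^ k * (fst B \<theta> - fps_const (a0 \<theta>)) ^ n)) j" if "j < N" for \<theta> j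
      using formal_subst_nth[OF b0 that] by (simp add: H_def a0_def)
  qed
qed

lemma fexpands_comp:
  assumes N: "0 < N" and A: "fexpands N A A'" "nice \<omega> (fst A)" "nice \<omega> (snd A)"
    and B: "fexpands N B B'" and b0: "\<And>\<theta>. fps_nth (snd B \<theta>) 0 = 0"
  shows "fexpands N (formal_comp A B) (A' \<circ> B')"
proof -
  have 1: "expands N (fst A) (\<lambda>p. fst (A' p) - fst p)" and 2: "expands N (snd A) (\<lambda>p. snd (A' p))"
    and 3: "expands N (fst B) (\<lambda>p. fst (B' p) - fst p)"
    using A(1) B by (auto simp: fexpands_def)
  have "expands N (\<lambda>\<xi>. fst B \<xi> + formal_subst (fst A) B \<xi>) (\<lambda>p. (fst (B' p) - fst p) + (fst (A' (B' p)) - fst (B' p)))"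
    by (rule expands_add[OF 3 expands_subst[OF N A(2) 1 B b0]])
  then show ?thesis
    using expands_subst[OF N A(3) 2 B b0] by (simp add: fexpands_def formal_comp_def)
qed

lemma formal_subst_nth_0: "fps_nth (formal_subst h B \<xi>) 0 = fps_nth (h (\<xi> + fps_nth (fst B \<xi>) 0)) 0"
  by (simp add: formal_subst_def Let_def angle_deriv_def)

lemma fexpands_unique:
  assumes "fexpands N A A'" "fexpands N A B'"
  shows "apx N A' B'"
proof -
  have "small N (\<lambda>p. (fst (A' p) - fst p) - (fst (B' p) - fst p))" "small N (\<lambda>p. snd (A' p) - snd (B' p))"
    using assms expands_unique unfolding fexpands_def by blast+
  then have "small N (\<lambda>p. (fst (A' p) - fst (B' p), snd (A' p) - snd (B' p)))"
    by (simp add: small_Pair_iff)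
  then show ?thesis by (simp add: apx_def minus_prod_def)
qed

lemma cls_sum: "(\<And>i. i \<in> I \<Longrightarrow> cls \<omega> d (f i)) \<Longrightarrow> cls \<omega> d (\<lambda>p. \<Sum>i\<in>I. f i p)"
  by (induction I rule: infinite_finite_induct) (auto intro: cls_add cls_zero)

lemma nice_truncation:
  assumes "nice \<omega> u" "\<And>\<xi>. fps_nth (u \<xi>) 0 = 0"
  shows "\<exists>u'. cls \<omega> 1 u' \<and> expands N u u'"
proof (intro exI conjI)
  show "cls \<omega> 1 (\<lambda>p. \<Sum>k<N. fps_nth (u (fst p)) k * snd p ^ k)"
  proof (rule cls_sum)
    fix k
    have "cls \<omega> k (\<lambda>p. fps_nth (u (fst p)) k * snd p ^ k)"
      using qp_cls[of \<omega> "\<lambda>\<theta>. fps_nth (u \<theta>) k" k] assms(1) by (simp add: nice_def)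
    then show "cls \<omega> 1 (\<lambda>p. fps_nth (u (fst p)) k * snd p ^ k)"
      by (cases "k = 0") (auto simp: assms(2) cls_zero elim: cls_mono)
  qed
  show "expands N u (\<lambda>p. \<Sum>k<N. fps_nth (u (fst p)) k * snd p ^ k)"
    unfolding expands_def using assms(1) qp_bounded unfolding nice_def by (fastforce simp: small_zero)
qed

lemma nice_X: "nice \<omega> (\<lambda>\<xi>. fps_X)"
  by (simp add: nice_def qp_const)

lemma nice_const: "nice \<omega> (\<lambda>\<xi>. fps_const c)"
  by (simp add: nice_def qp_const)

lemma nice_add: "nice \<omega> h \<Longrightarrow> nice \<omega> h' \<Longrightarrow> nice \<omega> (\<lambda>\<xi>. h \<xi> + h' \<xi>)"
  by (simp add: nice_def qp_add)

lemma expands_X: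
  assumes "2 \<le> N"
  shows "expands N (\<lambda>\<xi>. fps_X) snd"
proof -
  have "(\<Sum>k<N. fps_nth fps_X k * r ^ k) = r" for r :: real
  proof -
    have "(\<Sum>k<N. fps_nth fps_X k * r ^ k) = (\<Sum>k\<in>{1}. fps_nth fps_X k * r ^ k)"
      using assms by (intro sum.mono_neutral_right) auto
    then show ?thesis by simp
  qed
  then show ?thesis unfolding expands_def by (auto simp: small_zero intro!: exI[of _ 1])
qed

lemma fexpands_near_id:
  assumes N: "2 \<le> N" and u: "expands N u u'" and v: "expands N v v'"
  shows "fexpands N (\<lambda>\<xi>. fps_const \<gamma> + u \<xi>, \<lambda>\<xi>. fps_X + v \<xi>) (perturbed_rotation \<gamma> u' v')"
proof -
  have "expands N (\<lambda>\<xi>. fps_const \<gamma> + u \<xi>) (\<lambda>p. \<gamma> + u' p)"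
    using N by (intro expands_add u expands_const[of "\<lambda>_. \<gamma>" "\<bar>\<gamma>\<bar>"]) auto
  moreover have "expands N (\<lambda>\<xi>. fps_X + v \<xi>) (\<lambda>p. snd p + v' p)"
    by (intro expands_add v expands_X N)
  ultimately show ?thesis by (simp add: fexpands_def pr_apply add.assoc)
qed

lemma expands_zero: "expands N (\<lambda>\<xi>. 0) (\<lambda>p. 0)"
  by (auto simp: expands_def small_zero)

lemma fexpands_rotation: "2 \<le> N \<Longrightarrow> fexpands N (formal_rotation \<gamma>) (rotation \<gamma>)"
  using fexpands_near_id[OF _ expands_zero expands_zero, of N \<gamma>]
  by (simp add: pr_rotation formal_rotation_def)

text \<open>Truncation respects composition modulo \<open>O(r^N)\<close>, so the formal identities
  become approximate ones. Composing \<open>V' M U' = R + O(r^N)\<close> with \<open>U'\<close> on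
  the left gives the conjugacy.\<close>

lemma (in diophantine_rotation) fconj_of_formal:
  assumes f: "cls \<omega> 1 f" and g: "cls \<omega> 1 g"
    and U: "U = (u, \<lambda>\<xi>. fps_X + v \<xi>)" "nice \<omega> u" "nice \<omega> v" "\<And>\<xi>. fps_nth (u \<xi>) 0 = 0" "\<And>\<xi>. fps_nth (v \<xi>) 0 = 0"
    and V: "V = (u2, \<lambda>\<xi>. fps_X + v2 \<xi>)" "nice \<omega> u2" "nice \<omega> v2" "\<And>\<xi>. fps_nth (u2 \<xi>) 0 = 0" "\<And>\<xi>. fps_nth (v2 \<xi>) 0 = 0"
    and UV: "formal_comp U V = formal_id" and VU: "formal_comp V U = formal_id"
    and con: "formal_comp V (formal_comp (formal_perturbed_rotation \<gamma> f g) U) = formal_rotation \<gamma>"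
  shows "fconj (perturbed_rotation \<gamma> f g)"
  unfolding fconj_def
proof
  fix N0 :: nat
  \<comment> \<open>At least 2, so that the truncation keeps the linear term of the radius.\<close>
  define N where "N = max N0 2"
  have N: "2 \<le> N" "N0 \<le> N" "0 < N" by (auto simp: N_def)
  obtain u' where u': "cls \<omega> 1 u'" "expands N u u'" using nice_truncation[OF U(2,4)] by blast
  obtain v' where v': "cls \<omega> 1 v'" "expands N v v'" using nice_truncation[OF U(3,5)] by blast
  obtain u2' where u2': "cls \<omega> 1 u2'" "expands N u2 u2'" using nice_truncation[OF V(2,4)] by blast
  obtain v2' where v2': "cls \<omega> 1 v2'" "expands N v2 v2'" using nice_truncation[OF V(3,5)] by blast
  define U' where "U' = perturbed_rotation 0 u' v'"
  define V' where "V' = perturbed_rotation 0 u2' v2'"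
  define M where "M = perturbed_rotation \<gamma> f g"
  define F where "F = formal_perturbed_rotation \<gamma> f g"
  have aU: "amap \<omega> 0 1 U'" and aV: "amap \<omega> 0 1 V'" and aM: "amap \<omega> \<gamma> 1 M"
    unfolding U'_def V'_def M_def by (intro amapI u' v' u2' v2' f g)+
  have eU: "fexpands N U U'" using fexpands_near_id[OF N(1) u'(2) v'(2), of 0] by (simp add: U(1) U'_def)
  have eV: "fexpands N V V'" using fexpands_near_id[OF N(1) u2'(2) v2'(2), of 0] by (simp add: V(1) V'_def)
  have f0: "cls \<omega> 0 f" "cls \<omega> 0 g" using f g by (auto elim: cls_mono)
  have nf: "nice \<omega> (taylor_r f)" "nice \<omega> (taylor_r g)"
    using taylor_r_cls(1)[OF f0(1)] taylor_r_cls(1)[OF f0(2)] by (auto simp: nice_def)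
  have ef: "expands N (taylor_r f) f" "expands N (taylor_r g) g"
    unfolding expands_def using taylor_r_cls(2)[OF f0(1), of N] taylor_r_cls(2)[OF f0(2), of N] nf qp_bounded
    unfolding nice_def by metis+
  have eM: "fexpands N F M"
    using fexpands_near_id[OF N(1) ef] by (simp add: F_def M_def formal_perturbed_rotation_def)
  have g0: "fps_nth (taylor_r g \<theta>) 0 = 0" for \<theta>
  proof -
    obtain K \<rho> where "0 < \<rho>" "\<And>p. \<bar>snd p\<bar> \<le> \<rho> \<Longrightarrow> norm (g p) \<le> K * \<bar>snd p\<bar> ^ 1"
      using cls_small[OF g] unfolding small_def by blast
    from this(2)[of "(\<theta>, 0)"] this(1) show ?thesis unfolding taylor_r_cls(3)[OF f0(2)] by simp
  qed
  have sU: "fps_nth (snd U \<theta>) 0 = 0" "fps_nth (snd V \<theta>) 0 = 0" "fps_nth (snd (formal_comp F U) \<theta>) 0 = 0" for \<theta>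
    by (simp_all add: U V formal_comp_def formal_subst_nth_0 F_def formal_perturbed_rotation_def g0)
  have nM: "nice \<omega> (fst F)" "nice \<omega> (snd F)"
    unfolding F_def formal_perturbed_rotation_def fst_conv snd_conv by (intro nice_add nice_const nice_X nf)+
  have nU: "nice \<omega> (fst U)" "nice \<omega> (snd U)" "nice \<omega> (fst V)" "nice \<omega> (snd V)"
    using U V by (auto intro: nice_add nice_X)
  have e1: "fexpands N (formal_comp F U) (M \<circ> U')" by (rule fexpands_comp[OF N(3) eM nM eU sU(1)])
  have e2: "fexpands N (formal_comp V (formal_comp F U)) (V' \<circ> (M \<circ> U'))"
    by (rule fexpands_comp[OF N(3) eV nU(3,4) e1 sU(3)])
  have id0: "rotation 0 = id" by (simp add: rotation_def fun_eq_iff)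
  have 1: "apx N (V' \<circ> (M \<circ> U')) (rotation \<gamma>)"
    using fexpands_unique[OF e2[unfolded F_def con] fexpands_rotation[OF N(1)]] .
  have 2: "apx N (U' \<circ> V') id"
    using fexpands_unique[OF fexpands_comp[OF N(3) eU nU(1,2) eV sU(2), unfolded UV] fexpands_rotation[OF N(1)]] by (simp only: id0)
  have 3: "apx N (V' \<circ> U') id"
    using fexpands_unique[OF fexpands_comp[OF N(3) eV nU(3,4) eU sU(1), unfolded VU] fexpands_rotation[OF N(1)]] by (simp only: id0)
  have aMU: "amap \<omega> \<gamma> 1 (M \<circ> U')" by (rule amap_comp0[OF aM aU])
  have 4: "apx N (id \<circ> (M \<circ> U')) ((U' \<circ> V') \<circ> (M \<circ> U'))"
    by (rule apx_comp_right[OF apx_sym[OF 2] amap_tame[OF aMU]])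
  have 5: "apx N (U' \<circ> (V' \<circ> (M \<circ> U'))) (U' \<circ> rotation \<gamma>)"
    by (rule apx_comp_left[OF aU amap_tame[OF amap_comp0'[OF aV aMU]] amap_tame[OF amap_rotation] 1])
  have 6: "apx N (M \<circ> U') (U' \<circ> rotation \<gamma>)"
    using apx_trans[OF 4[unfolded comp_assoc[of U' V'] id_comp] 5] .
  show "\<exists>U V. amap \<omega> 0 1 U \<and> amap \<omega> 0 1 V \<and> apx N0 (perturbed_rotation \<gamma> f g \<circ> U) (U \<circ> rotation \<gamma>) \<and>
      apx N0 (V \<circ> U) id \<and> apx N0 (U \<circ> V) id"
    using aU aV apx_mono[OF 6 N(2)] apx_mono[OF 3 N(2)] apx_mono[OF 2 N(2)] unfolding M_def by blast
qed

section \<open>Real analyticity of convergent Fourier--Taylor series\<close>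

text \<open>A product of finitely many absolutely convergent series expands over all choices of one
  index per factor. Extensional choice functions match the multi-indices of
  \<open>real_analytic_at\<close>.\<close>

lemma has_sum_prod_PiE:
  fixes f :: "'a \<Rightarrow> 'b \<Rightarrow> 'c :: {real_normed_field, banach}"
  assumes "finite A" "\<And>x. x \<in> A \<Longrightarrow> (\<lambda>j. norm (f x j)) summable_on B x"
    and "\<And>x. x \<in> A \<Longrightarrow> (f x has_sum S x) (B x)"
  shows "((\<lambda>g. \<Prod>x\<in>A. f x (g x)) has_sum (\<Prod>x\<in>A. S x)) (PiE A B) \<and>
    (\<lambda>g. norm (\<Prod>x\<in>A. f x (g x))) summable_on PiE A B"
  using assms
proof (induction A)
  case empty
  then show ?case by (simp add: has_sum_finiteI)
next
  case (insert a A)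
  let ?h = "\<lambda>(y, g). g(a := y)"
  have IH: "((\<lambda>g. \<Prod>x\<in>A. f x (g x)) has_sum (\<Prod>x\<in>A. S x)) (PiE A B)"
    "(\<lambda>g. norm (\<Prod>x\<in>A. f x (g x))) summable_on PiE A B"
    using insert by auto
  have inj: "inj_on ?h (B a \<times> PiE A B)" using insert.hyps(2) by (rule inj_combinator)
  have img: "PiE (insert a A) B = ?h ` (B a \<times> PiE A B)" by (rule PiE_insert_eq)
  have eq: "(\<Prod>x\<in>insert a A. f x (?h p x)) = (case p of (y, g) \<Rightarrow> f a y * (\<Prod>x\<in>A. f x (g x)))"
    if "p \<in> B a \<times> PiE A B" for p
  proof -
    have "(\<Prod>x\<in>A. f x (((snd p)(a := fst p)) x)) = (\<Prod>x\<in>A. f x (snd p x))"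
      using insert.hyps(2) by (intro prod.cong) auto
    then show ?thesis using insert.hyps by (simp add: case_prod_unfold)
  qed
  have 1: "((\<lambda>(y, g). f a y * (\<Prod>x\<in>A. f x (g x))) has_sum S a * (\<Prod>x\<in>A. S x)) (B a \<times> PiE A B)"
    using insert.prems IH by (intro has_sum_times) auto
  have "((\<lambda>(y, g). norm (f a y) * norm (\<Prod>x\<in>A. f x (g x))) has_sum
     (\<Sum>\<^sub>\<infinity>y\<in>B a. norm (f a y)) * (\<Sum>\<^sub>\<infinity>g\<in>PiE A B. norm (\<Prod>x\<in>A. f x (g x)))) (B a \<times> PiE A B)"
    using insert.prems IH by (intro has_sum_times) auto
  then have 2: "(\<lambda>p. norm (case p of (y, g) \<Rightarrow> f a y * (\<Prod>x\<in>A. f x (g x)))) summable_on (B a \<times> PiE A B)"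
    by (simp add: case_prod_unfold norm_mult has_sum_imp_summable)
  have "((\<lambda>g. \<Prod>x\<in>insert a A. f x (g x)) has_sum S a * (\<Prod>x\<in>A. S x)) (?h ` (B a \<times> PiE A B))"
    unfolding has_sum_reindex[OF inj] o_def using 1 by (subst has_sum_cong[OF eq]) auto
  moreover have "(\<lambda>g. norm (\<Prod>x\<in>insert a A. f x (g x))) summable_on (?h ` (B a \<times> PiE A B))"
    unfolding summable_on_reindex[OF inj] o_def using 2 by (subst summable_on_cong[OF arg_cong[where f = norm, OF eq]]) auto
  ultimately show ?case unfolding img using insert.hyps by simp
qed

definition torus_chi :: "(int ^ 'm) \<times> nat \<Rightarrow> (real ^ 'm) \<times> real \<Rightarrow> complex" where
  "torus_chi z p = cis (int_inner (fst z) (fst p)) * of_real (snd p ^ snd z)"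

lemma int_inner_scaleR: "int_inner k (\<theta> *\<^sub>R \<omega>) = int_inner k \<omega> * \<theta>"
  by (simp add: int_inner_def sum_distrib_left sum_distrib_right mult_ac)

lemma int_inner_add_right: "int_inner k (x + y) = int_inner k x + int_inner k y"
  by (simp add: int_inner_def sum.distrib distrib_left)

lemma int_inner_axis: "int_inner k (axis i a) = of_int (k $ i) * a"
  by (simp add: int_inner_def axis_def if_distrib cong: if_cong)

lemma torus_chi_scaleR: "torus_chi z (\<theta> *\<^sub>R \<omega>, r) = chi \<omega> z (\<theta>, r)"
  by (simp add: torus_chi_def chi_def int_inner_scaleR)

lemma torus_chi_periodic: "torus_chi z (x + axis i (2 * pi), r) = torus_chi z (x, r)"
proof -
  have "cis (of_int (fst z $ i) * (2 * pi)) = 1"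
    using cis_multiple_2pi[of "of_int (fst z $ i)"] by (simp add: mult.commute)
  then show ?thesis by (simp add: torus_chi_def int_inner_add_right int_inner_axis cis_mult[symmetric])
qed

lemma norm_torus_chi_le:
  assumes "0 \<le> s" "\<bar>r\<bar> \<le> \<rho>"
  shows "norm (torus_chi z (x, r)) \<le> wt s \<rho> z"
proof -
  have "1 * \<bar>r\<bar> ^ snd z \<le> exp (s * l1_norm (fst z)) * \<rho> ^ snd z"
    using assms by (intro mult_mono power_mono) (auto simp: l1_norm_nonneg)
  then show ?thesis by (simp add: torus_chi_def norm_mult norm_power wt_def)
qed

text \<open>The Taylor coefficient in the direction of the basis vector \<open>b\<close>: the radial direction is
  the one with \<open>fst b = 0\<close>.\<close>

definition dir_coeff :: "real \<Rightarrow> (int ^ 'm) \<times> nat \<Rightarrow> (real ^ 'm) \<times> real \<Rightarrow> nat \<Rightarrow> complex" where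
  "dir_coeff r0 z b j = (if fst b = 0 then of_nat (snd z choose j) * of_real r0 ^ (snd z - j)
     else (\<i> * of_real (int_inner (fst z) (fst b))) ^ j / fact j)"

lemma Basis_prod_vec:
  "(Basis :: ((real ^ 'm) \<times> real) set) = (\<lambda>i. (axis i 1, 0)) ` UNIV \<union> {(0, 1)}"
  by (auto simp: Basis_prod_def Basis_vec_def axis_def)

lemma prod_Basis_prod_vec:
  fixes g :: "(real ^ 'm) \<times> real \<Rightarrow> 'b :: comm_monoid_mult"
  shows "(\<Prod>b\<in>Basis. g b) = (\<Prod>i\<in>UNIV. g (axis i 1, 0)) * g (0, 1)"
proof -
  have "(\<Prod>b\<in>Basis. g b) = (\<Prod>b\<in>(\<lambda>i. (axis i 1, 0)) ` UNIV. g b) * (\<Prod>b\<in>{(0, 1)}. g b)"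
    unfolding Basis_prod_vec by (rule prod.union_disjoint) auto
  also have "(\<Prod>b\<in>(\<lambda>i. (axis i 1, 0)) ` UNIV. g b) = (\<Prod>i\<in>UNIV. g (axis i 1, 0))"
    by (subst prod.reindex) (auto simp: inj_on_def axis_eq_axis)
  finally show ?thesis by simp
qed

lemma has_sum_binomial:
  fixes a x :: "'a :: real_normed_field"
  shows "((\<lambda>j. of_nat (n choose j) * a ^ (n - j) * x ^ j) has_sum (a + x) ^ n) UNIV"
proof -
  have "(a + x) ^ n = (\<Sum>j\<le>n. of_nat (n choose j) * a ^ (n - j) * x ^ j)"
    using binomial_ring[of x a n] by (simp add: add.commute mult_ac)
  then show ?thesis by (intro has_sum_finite_neutralI[of "{..n}"]) auto
qed

lemma dir_coeff_has_sum:
  fixes b :: "(real ^ 'm) \<times> real"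
  shows "((\<lambda>j. dir_coeff r0 z b j * of_real y ^ j) has_sum
    (if fst b = 0 then of_real (r0 + y) ^ snd z else exp (\<i> * of_real (int_inner (fst z) (fst b)) * of_real y))) UNIV"
proof (cases "fst b = 0")
  case True
  then show ?thesis using has_sum_binomial[of "snd z" "of_real r0 :: complex" "of_real y"] by (simp add: dir_coeff_def)
next
  case False
  then show ?thesis using has_sum_exp[of "\<i> * of_real (int_inner (fst z) (fst b)) * of_real y"]
    by (simp add: dir_coeff_def power_mult_distrib)
qed

lemma dir_coeff_norm_has_sum:
  fixes b :: "(real ^ 'm) \<times> real"
  shows "((\<lambda>j. norm (dir_coeff r0 z b j * of_real y ^ j)) has_sum
    (if fst b = 0 then (\<bar>r0\<bar> + \<bar>y\<bar>) ^ snd z else exp (\<bar>int_inner (fst z) (fst b)\<bar> * \<bar>y\<bar>))) UNIV"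
proof (cases "fst b = 0")
  case True
  then show ?thesis using has_sum_binomial[of "snd z" "\<bar>r0\<bar>" "\<bar>y\<bar>"] by (simp add: dir_coeff_def norm_mult norm_power)
next
  case False
  then show ?thesis using has_sum_exp[of "\<bar>int_inner (fst z) (fst b)\<bar> * \<bar>y\<bar>"]
    by (simp add: dir_coeff_def power_mult_distrib norm_mult norm_power norm_divide)
qed

text \<open>A monomial is a product over the coordinate directions: exponential series in the
  angles, a binomial in \<open>r\<close>. With absolute values the product keeps its form, with
  moduli in place of the frequencies and increments, and within the given distances it is at most
  the weight of the monomial.\<close>

lemma torus_chi_expansion:
  fixes a x :: "(real ^ 'm) \<times> real"
  assumes "\<And>i. \<bar>fst x $ i - fst a $ i\<bar> \<le> s" "\<bar>snd a\<bar> + \<bar>snd x - snd a\<bar> \<le> \<rho>"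
  shows "((\<lambda>\<alpha>. cis (int_inner (fst z) (fst a)) * (\<Prod>b\<in>Basis. dir_coeff (snd a) z b (\<alpha> b) * of_real ((x - a) \<bullet> b) ^ \<alpha> b))
      has_sum torus_chi z x) (Basis \<rightarrow>\<^sub>E UNIV)"
    and "\<exists>S \<le> wt s \<rho> z. ((\<lambda>\<alpha>. norm (\<Prod>b\<in>Basis. dir_coeff (snd a) z b (\<alpha> b) * of_real ((x - a) \<bullet> b) ^ \<alpha> b)) has_sum S) (Basis \<rightarrow>\<^sub>E UNIV)"
proof -
  define y where "y b = (x - a) \<bullet> b" for b
  have y: "y (axis i 1, 0) = fst x $ i - fst a $ i" "y (0, 1) = snd x - snd a" for i
    by (simp_all add: y_def inner_prod_def inner_axis)
  have ax: "(axis i (1::real) :: real ^ 'm) \<noteq> 0" for i by (simp add: axis_eq_0_iff)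
  have "((\<lambda>\<alpha>. \<Prod>b\<in>Basis. dir_coeff (snd a) z b (\<alpha> b) * of_real (y b) ^ \<alpha> b) has_sum
     (\<Prod>b\<in>Basis. (if fst b = 0 then of_real (snd a + y b) ^ snd z else exp (\<i> * of_real (int_inner (fst z) (fst b)) * of_real (y b)))))
     (Basis \<rightarrow>\<^sub>E UNIV)"
    by (rule conjunct1[OF has_sum_prod_PiE[OF finite_Basis has_sum_imp_summable[OF dir_coeff_norm_has_sum] dir_coeff_has_sum]])
  also have "(\<Prod>b\<in>Basis. (if fst b = 0 then of_real (snd a + y b) ^ snd z else exp (\<i> * of_real (int_inner (fst z) (fst b)) * of_real (y b)))) =
     (\<Prod>i\<in>UNIV. exp (\<i> * of_real (of_int (fst z $ i)) * of_real (fst x $ i - fst a $ i))) * of_real (snd x) ^ snd z"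
    by (simp add: prod_Basis_prod_vec ax y int_inner_axis)
  also have "(\<Prod>i\<in>UNIV. exp (\<i> * of_real (of_int (fst z $ i)) * of_real (fst x $ i - fst a $ i))) =
     cis (int_inner (fst z) (fst x) - int_inner (fst z) (fst a))"
    unfolding cis_conv_exp int_inner_def
    by (simp add: exp_sum[symmetric] sum_distrib_left sum_subtractf[symmetric] algebra_simps)
  finally have "((\<lambda>\<alpha>. \<Prod>b\<in>Basis. dir_coeff (snd a) z b (\<alpha> b) * of_real (y b) ^ \<alpha> b) has_sum
     cis (int_inner (fst z) (fst x) - int_inner (fst z) (fst a)) * of_real (snd x) ^ snd z) (Basis \<rightarrow>\<^sub>E UNIV)" .
  from has_sum_cmult_right[OF this, of "cis (int_inner (fst z) (fst a))"]
  show "((\<lambda>\<alpha>. cis (int_inner (fst z) (fst a)) * (\<Prod>b\<in>Basis. dir_coeff (snd a) z b (\<alpha> b) * of_real ((x - a) \<bullet> b) ^ \<alpha> b))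
      has_sum torus_chi z x) (Basis \<rightarrow>\<^sub>E UNIV)"
    by (simp add: y_def torus_chi_def mult.assoc[symmetric] cis_mult)
  have "((\<lambda>\<alpha>. \<Prod>b\<in>Basis. norm (dir_coeff (snd a) z b (\<alpha> b) * of_real (y b) ^ \<alpha> b)) has_sum
     (\<Prod>b\<in>Basis. (if fst b = 0 then (\<bar>snd a\<bar> + \<bar>y b\<bar>) ^ snd z else exp (\<bar>int_inner (fst z) (fst b)\<bar> * \<bar>y b\<bar>))))
     (Basis \<rightarrow>\<^sub>E UNIV)"
    by (rule conjunct1[OF has_sum_prod_PiE[OF finite_Basis _ dir_coeff_norm_has_sum]],
        simp only: real_norm_def abs_norm_cancel, rule has_sum_imp_summable[OF dir_coeff_norm_has_sum])
  moreover have "(\<Prod>b\<in>Basis. (if fst b = 0 then (\<bar>snd a\<bar> + \<bar>y b\<bar>) ^ snd z else exp (\<bar>int_inner (fst z) (fst b)\<bar> * \<bar>y b\<bar>))) \<le> wt s \<rho> z"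
  proof -
    have "(\<Prod>b\<in>Basis. (if fst b = 0 then (\<bar>snd a\<bar> + \<bar>y b\<bar>) ^ snd z else exp (\<bar>int_inner (fst z) (fst b)\<bar> * \<bar>y b\<bar>))) =
      (\<Prod>i\<in>UNIV. exp (\<bar>of_int (fst z $ i)\<bar> * \<bar>fst x $ i - fst a $ i\<bar>)) * (\<bar>snd a\<bar> + \<bar>snd x - snd a\<bar>) ^ snd z"
      by (simp add: prod_Basis_prod_vec ax y int_inner_axis)
    also have "(\<Prod>i\<in>UNIV. exp (\<bar>of_int (fst z $ i)\<bar> * \<bar>fst x $ i - fst a $ i\<bar>)) = exp (\<Sum>i\<in>UNIV. \<bar>of_int (fst z $ i)\<bar> * \<bar>fst x $ i - fst a $ i\<bar>)"
      by (simp add: exp_sum)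
    also have "\<dots> * (\<bar>snd a\<bar> + \<bar>snd x - snd a\<bar>) ^ snd z \<le> exp (\<Sum>i\<in>UNIV. \<bar>of_int (fst z $ i)\<bar> * s) * \<rho> ^ snd z"
      using assms by (intro mult_mono power_mono) (auto intro!: sum_mono mult_left_mono)
    also have "\<dots> = wt s \<rho> z" by (simp add: wt_def l1_norm_def sum_distrib_left mult.commute)
    finally show ?thesis .
  qed
  ultimately show "\<exists>S \<le> wt s \<rho> z. ((\<lambda>\<alpha>. norm (\<Prod>b\<in>Basis. dir_coeff (snd a) z b (\<alpha> b) * of_real ((x - a) \<bullet> b) ^ \<alpha> b)) has_sum S) (Basis \<rightarrow>\<^sub>E UNIV)"
    by (auto simp: prod_norm[symmetric] y_def)
qed

lemma norm_case: "(\<lambda>p. norm (case p of (x, y) \<Rightarrow> t x y)) = (\<lambda>(x, y). norm (t x y))"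
  by (simp add: fun_eq_iff)

lemma case_swap: "(\<lambda>(x, y). case (y, x) of (x, y) \<Rightarrow> t x y) = (\<lambda>(x, y). t y x)"
  by (simp add: fun_eq_iff)

text \<open>Each monomial is re-expanded at \<open>a\<close> and the two summations are exchanged;
  the absolute sums of the re-expansions are bounded by the weights, so the double family is
  absolutely summable.\<close>

lemma real_analytic_torus_series:
  fixes c :: "(int ^ 'm) \<times> nat \<Rightarrow> complex" and a :: "(real ^ 'm) \<times> real"
  assumes s: "0 < s" and sm: "(\<lambda>z. norm (c z) * wt s \<rho> z) summable_on UNIV" and a: "\<bar>snd a\<bar> < \<rho>"
  shows "real_analytic_at (\<lambda>p. Re (\<Sum>\<^sub>\<infinity>z. c z * torus_chi z p)) a"
proof -
  define I where "I = (Basis :: ((real ^ 'm) \<times> real) set) \<rightarrow>\<^sub>E (UNIV :: nat set)"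
  define g where "g z \<alpha> = c z * cis (int_inner (fst z) (fst a)) * (\<Prod>b\<in>Basis. dir_coeff (snd a) z b (\<alpha> b))" for z \<alpha>
  define C where "C \<alpha> = (\<Sum>\<^sub>\<infinity>z. g z \<alpha>)" for \<alpha>
  define mon where "mon x \<alpha> = (\<Prod>b\<in>Basis. ((x - a) \<bullet> b) ^ \<alpha> b)" for x \<alpha>
  define e where "e = min s (\<rho> - \<bar>snd a\<bar>)"
  have main: "((\<lambda>\<alpha>. Re (C \<alpha>) * mon x \<alpha>) has_sum Re (\<Sum>\<^sub>\<infinity>z. c z * torus_chi z x)) I"
    if x: "dist x a < e" for x
  proof -
    have d: "\<bar>fst x $ i - fst a $ i\<bar> \<le> dist x a" for i
      using component_le_norm_cart[of "fst x - fst a" i] dist_fst_le[of x a] by (simp add: dist_norm)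
    have d2: "\<bar>snd x - snd a\<bar> \<le> dist x a" using dist_snd_le[of x a] by (simp add: dist_norm)
    have h: "\<And>i. \<bar>fst x $ i - fst a $ i\<bar> \<le> s" "\<bar>snd a\<bar> + \<bar>snd x - snd a\<bar> \<le> \<rho>"
      using d d2 x by (auto simp: e_def intro: order_trans less_imp_le)
    note E = torus_chi_expansion[OF h]
    have t: "g z \<alpha> * of_real (mon x \<alpha>) = c z * (cis (int_inner (fst z) (fst a)) * (\<Prod>b\<in>Basis. dir_coeff (snd a) z b (\<alpha> b) * of_real ((x - a) \<bullet> b) ^ \<alpha> b))" for z \<alpha>
      by (simp add: g_def mon_def prod.distrib)
    have row: "((\<lambda>\<alpha>. g z \<alpha> * of_real (mon x \<alpha>)) has_sum c z * torus_chi z x) I" for z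
      unfolding t I_def by (intro has_sum_cmult_right E(1))
    have "\<forall>z. \<exists>S. S \<le> wt s \<rho> z \<and> ((\<lambda>\<alpha>. norm (\<Prod>b\<in>Basis. dir_coeff (snd a) z b (\<alpha> b) * of_real ((x - a) \<bullet> b) ^ \<alpha> b)) has_sum S) I"
      using E(2) unfolding I_def by blast
    from choice[OF this] obtain N where N: "\<And>z. N z \<le> wt s \<rho> z"
      "\<And>z. ((\<lambda>\<alpha>. norm (\<Prod>b\<in>Basis. dir_coeff (snd a) z b (\<alpha> b) * of_real ((x - a) \<bullet> b) ^ \<alpha> b)) has_sum N z) I"
      by blast
    have rown: "((\<lambda>\<alpha>. norm (g z \<alpha> * of_real (mon x \<alpha>))) has_sum norm (c z) * N z) I" for z
      using has_sum_cmult_right[OF N(2)[of z], of "norm (c z)"] unfolding t by (simp add: norm_mult)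
    have N0: "0 \<le> N z" for z by (rule has_sum_nonneg[OF N(2)]) simp
    have Ns: "(\<lambda>z. norm (c z) * N z) summable_on UNIV"
      by (rule summable_on_comparison_test[OF sm]) (simp_all add: mult_left_mono N N0)
    have "(\<lambda>(z, \<alpha>). norm (g z \<alpha> * of_real (mon x \<alpha>))) summable_on (UNIV \<times> I)"
      by (rule summable_on_SigmaI[where g = "\<lambda>z. norm (c z) * N z"], unfold case_prod_conv, rule rown, rule Ns, rule norm_ge_zero)
    then have sum: "(\<lambda>(z, \<alpha>). g z \<alpha> * of_real (mon x \<alpha>)) summable_on (UNIV \<times> I)"
      unfolding norm_case[symmetric] by (rule abs_summable_summable)
    have "\<bar>snd x\<bar> \<le> \<rho>" using h(2) by linarith
    then have nt: "norm (torus_chi z x) \<le> wt s \<rho> z" for z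
      using norm_torus_chi_le[of s "snd x" \<rho> z "fst x"] s by simp
    have sc: "(\<lambda>z. c z * torus_chi z x) summable_on UNIV"
      by (rule abs_summable_summable, rule Infinite_Sum.abs_summable_on_comparison_test'[OF sm])
         (unfold norm_mult, rule mult_left_mono[OF nt norm_ge_zero])
    have "((\<lambda>(z, \<alpha>). g z \<alpha> * of_real (mon x \<alpha>)) has_sum (\<Sum>\<^sub>\<infinity>z. c z * torus_chi z x)) (UNIV \<times> I)"
      by (rule has_sum_SigmaI[where g = "\<lambda>z. c z * torus_chi z x"]) (unfold case_prod_conv, rule row, rule has_sum_infsum[OF sc], rule sum)
    then have sw: "((\<lambda>(\<alpha>, z). g z \<alpha> * of_real (mon x \<alpha>)) has_sum (\<Sum>\<^sub>\<infinity>z. c z * torus_chi z x)) (I \<times> UNIV)"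
      unfolding has_sum_swap[where A = UNIV and B = I] case_swap .
    \<comment> \<open>If the monomial vanishes at \<open>x\<close>, it cannot be divided out to make
      the coefficients summable, but then both sides are 0.\<close>
    have "((\<lambda>z. g z \<alpha> * of_real (mon x \<alpha>)) has_sum C \<alpha> * of_real (mon x \<alpha>)) UNIV" if "\<alpha> \<in> I" for \<alpha>
    proof (cases "mon x \<alpha> = 0")
      case False
      have "(\<lambda>z. g z \<alpha> * of_real (mon x \<alpha>)) summable_on UNIV"
        using summable_on_SigmaD1[OF has_sum_imp_summable[OF sw] that] by simp
      then have "(\<lambda>z. g z \<alpha>) summable_on UNIV" using False by (subst (asm) summable_on_cmult_left') auto
      then show ?thesis unfolding C_def by (intro has_sum_cmult_left has_sum_infsum)
    qed simp
    then have "((\<lambda>\<alpha>. C \<alpha> * of_real (mon x \<alpha>)) has_sum (\<Sum>\<^sub>\<infinity>z. c z * torus_chi z x)) I"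
      by (intro has_sum_SigmaD[OF sw]) (simp only: case_prod_conv)
    from has_sum_Re[OF this] show ?thesis by simp
  qed
  show ?thesis unfolding real_analytic_at_def
    using main s a unfolding I_def mon_def by (intro exI[of _ "\<lambda>\<alpha>. Re (C \<alpha>)"] exI[of _ e]) (auto simp: e_def)
qed

lemma cls_quasi_periodic_near0:
  fixes \<omega> :: "real ^ 'm"
  assumes "cls \<omega> d f"
  shows "quasi_periodic_near0 \<omega> f"
proof -
  obtain s \<rho> C c where s: "0 < s" and c: "brep \<omega> s \<rho> d c (\<lambda>p. complex_of_real (f p)) C"
    using assms unfolding cls_def bnd_def by blast
  note b = brepD[OF c]
  define F where "F p = Re (\<Sum>\<^sub>\<infinity>z. c z * torus_chi z p)" for p
  have "F (x + axis i (2 * pi), r) = F (x, r)" for x i r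
    unfolding F_def torus_chi_periodic ..
  moreover have "f (\<theta>, r) = F (\<theta> *\<^sub>R \<omega>, r)" if "\<bar>r\<bar> < \<rho>" for \<theta> r
    using infsumI[OF b(5)[of "(\<theta>, r)"]] that by (simp add: F_def torus_chi_scaleR)
  moreover have "real_analytic_on F (UNIV \<times> {-\<rho><..<\<rho>})"
    unfolding real_analytic_on_def F_def by (auto intro!: real_analytic_torus_series[OF s b(4)])
  ultimately show ?thesis unfolding quasi_periodic_near0_def using b(2) by blast
qed

section \<open>Uniform expansions of periodic real analytic functions\<close>

text \<open>Unordered summability is absolute, so the series at the corner of a cube with half-side
  \<open>t\<close> dominates the series at every point of the cube.\<close>

lemma real_analytic_at_bound:
  fixes F :: "'a :: euclidean_space \<Rightarrow> real"
  assumes "real_analytic_at F a"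
  shows "\<exists>c t. 0 < t \<and> (\<lambda>\<alpha>. \<bar>c \<alpha>\<bar> * (\<Prod>b\<in>Basis. t ^ \<alpha> b)) summable_on (Basis \<rightarrow>\<^sub>E UNIV) \<and>
    (\<forall>x. (\<forall>b\<in>Basis. \<bar>(x - a) \<bullet> b\<bar> \<le> t) \<longrightarrow>
      ((\<lambda>\<alpha>. c \<alpha> * (\<Prod>b\<in>Basis. ((x - a) \<bullet> b) ^ \<alpha> b)) has_sum F x) (Basis \<rightarrow>\<^sub>E UNIV))"
proof -
  obtain c e where e: "e > 0" and c: "\<And>x. dist x a < e \<Longrightarrow>
      ((\<lambda>\<alpha>. c \<alpha> * (\<Prod>b\<in>Basis. ((x - a) \<bullet> b) ^ \<alpha> b)) has_sum F x) (Basis \<rightarrow>\<^sub>E UNIV)"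
    using assms unfolding real_analytic_at_def by blast
  define t where "t = e / (2 * real DIM('a))"
  have t: "0 < t" using e by (simp add: t_def)
  have near: "dist x a < e" if "\<forall>b\<in>Basis. \<bar>(x - a) \<bullet> b\<bar> \<le> t" for x
  proof -
    have "dist x a \<le> (\<Sum>b\<in>Basis. \<bar>(x - a) \<bullet> b\<bar>)" unfolding dist_norm by (rule norm_le_l1)
    also have "\<dots> \<le> (\<Sum>b\<in>(Basis :: 'a set). t)" using that by (intro sum_mono) auto
    also have "\<dots> < e" using e by (simp add: t_def)
    finally show ?thesis .
  qed
  define x where "x = a + (\<Sum>b\<in>Basis. t *\<^sub>R b)"
  have x: "(x - a) \<bullet> b = t" if "b \<in> Basis" for b using that by (simp add: x_def inner_sum_left_Basis)
  have "((\<lambda>\<alpha>. c \<alpha> * (\<Prod>b\<in>Basis. ((x - a) \<bullet> b) ^ \<alpha> b)) has_sum F x) (Basis \<rightarrow>\<^sub>E UNIV)"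
    using t by (intro c near) (auto simp: x)
  then have "(\<lambda>\<alpha>. c \<alpha> * (\<Prod>b\<in>Basis. t ^ \<alpha> b)) summable_on (Basis \<rightarrow>\<^sub>E UNIV)"
    using x by (auto dest: has_sum_imp_summable)
  then have "(\<lambda>\<alpha>. norm (c \<alpha> * (\<Prod>b\<in>Basis. t ^ \<alpha> b))) summable_on (Basis \<rightarrow>\<^sub>E UNIV)"
    by (subst (asm) summable_on_iff_abs_summable_on_real)
  then have "(\<lambda>\<alpha>. \<bar>c \<alpha>\<bar> * (\<Prod>b\<in>Basis. t ^ \<alpha> b)) summable_on (Basis \<rightarrow>\<^sub>E UNIV)"
    using t by (simp add: abs_mult abs_prod)
  with t c near show ?thesis by blast
qed

lemma real_analytic_at_isCont:
  fixes F :: "'a :: euclidean_space \<Rightarrow> real"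
  assumes "real_analytic_at F a"
  shows "isCont F a"
proof -
  obtain c t where t: "0 < t" and sm: "(\<lambda>\<alpha>. \<bar>c \<alpha>\<bar> * (\<Prod>b\<in>Basis. t ^ \<alpha> b)) summable_on (Basis \<rightarrow>\<^sub>E UNIV)"
    and c: "\<And>x. \<forall>b\<in>Basis. \<bar>(x - a) \<bullet> b\<bar> \<le> t \<Longrightarrow>
      ((\<lambda>\<alpha>. c \<alpha> * (\<Prod>b\<in>Basis. ((x - a) \<bullet> b) ^ \<alpha> b)) has_sum F x) (Basis \<rightarrow>\<^sub>E UNIV)"
    using real_analytic_at_bound[OF assms] by blast
  define Y where "Y = {x. \<forall>b\<in>Basis. \<bar>(x - a) \<bullet> b\<bar> \<le> t}"
  have "uniform_limit Y (\<lambda>X x. \<Sum>\<alpha>\<in>X. c \<alpha> * (\<Prod>b\<in>Basis. ((x - a) \<bullet> b) ^ \<alpha> b)) F (finite_subsets_at_top (Basis \<rightarrow>\<^sub>E UNIV))"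
  proof (rule Weierstrass_m_test_general'[OF _ _ sm])
    fix \<alpha> x assume "x \<in> Y"
    then show "norm (c \<alpha> * (\<Prod>b\<in>Basis. ((x - a) \<bullet> b) ^ \<alpha> b)) \<le> \<bar>c \<alpha>\<bar> * (\<Prod>b\<in>Basis. t ^ \<alpha> b)"
      unfolding real_norm_def abs_mult abs_prod power_abs
      by (intro mult_left_mono prod_mono) (auto simp: Y_def intro: power_mono)
  qed (use c in \<open>auto simp: Y_def\<close>)
  then have "continuous_on Y F"
    by (rule uniform_limit_theorem[rotated]) (auto intro!: always_eventually continuous_intros)
  moreover have "ball a t \<subseteq> Y"
  proof
    fix x assume "x \<in> ball a t"
    then have "norm (x - a) \<le> t" by (simp add: dist_norm norm_minus_commute)
    then show "x \<in> Y" unfolding Y_def using order_trans[OF Basis_le_norm] by blast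
  qed
  then have "a \<in> interior Y" using t by (meson centre_in_ball interior_maximal open_ball subsetD)
  ultimately show ?thesis by (rule continuous_on_interior)
qed

text \<open>Multi-indices with exponent 0 in the radial direction correspond to those on the torus,
  via restriction \<open>R\<close> and extension \<open>E\<close>; all others get coefficient
  0.\<close>

lemma real_analytic_at_fst:
  fixes \<Phi> :: "real ^ 'm \<Rightarrow> real"
  assumes "real_analytic_at \<Phi> (fst p)"
  shows "real_analytic_at (\<lambda>q :: (real ^ 'm) \<times> real. \<Phi> (fst q)) p"
proof -
  obtain c e where e: "e > 0" and c: "\<And>x. dist x (fst p) < e \<Longrightarrow>
      ((\<lambda>\<alpha>. c \<alpha> * (\<Prod>b\<in>Basis. ((x - fst p) \<bullet> b) ^ \<alpha> b)) has_sum \<Phi> x) (Basis \<rightarrow>\<^sub>E UNIV)"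
    using assms unfolding real_analytic_at_def by blast
  define B where "B = (Basis :: ((real ^ 'm) \<times> real) set)"
  define R where "R \<alpha> = restrict (\<lambda>u. \<alpha> (u, 0 :: real)) (Basis :: (real ^ 'm) set)" for \<alpha> :: "(real ^ 'm) \<times> real \<Rightarrow> nat"
  define E where "E \<beta> = restrict (\<lambda>b. if fst b = 0 then 0 else \<beta> (fst b)) B" for \<beta> :: "real ^ 'm \<Rightarrow> nat"
  define c' where "c' \<alpha> = (if \<alpha> (0, 1) = 0 then c (R \<alpha>) else 0)" for \<alpha>
  have ax: "(axis i (1::real) :: real ^ 'm) \<noteq> 0" for i by (simp add: axis_eq_0_iff)
  have B: "b \<in> B \<longleftrightarrow> (\<exists>i. b = (axis i 1, 0)) \<or> b = (0, 1)" for b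
    unfolding B_def Basis_prod_vec by auto
  have Bv: "u \<in> Basis \<longleftrightarrow> (\<exists>i. u = axis i 1)" for u :: "real ^ 'm" by (auto simp: Basis_vec_def)
  have "((\<lambda>\<alpha>. c' \<alpha> * (\<Prod>b\<in>B. ((x - p) \<bullet> b) ^ \<alpha> b)) has_sum \<Phi> (fst x)) (B \<rightarrow>\<^sub>E UNIV)" if x: "dist x p < e" for x
  proof -
    have "dist (fst x) (fst p) < e" using x dist_fst_le[of x p] by simp
    note h = c[OF this]
    have val: "c' \<alpha> * (\<Prod>b\<in>B. ((x - p) \<bullet> b) ^ \<alpha> b) = c (R \<alpha>) * (\<Prod>b\<in>Basis. ((fst x - fst p) \<bullet> b) ^ R \<alpha> b)"
      if "\<alpha> (0, 1) = 0" for \<alpha>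
    proof -
      have "(\<Prod>b\<in>Basis. ((fst x - fst p) \<bullet> b) ^ R \<alpha> b) = (\<Prod>i\<in>UNIV. ((fst x - fst p) \<bullet> axis i 1) ^ R \<alpha> (axis i 1))"
        unfolding Basis_vec_def
        by (subst prod.reindex_bij_betw[symmetric, of "\<lambda>i. axis i 1" UNIV])
           (auto simp: bij_betw_def inj_on_def axis_eq_axis)
      moreover have "R \<alpha> (axis i 1) = \<alpha> (axis i 1, 0)" for i using Bv by (auto simp: R_def)
      ultimately show ?thesis
        using that unfolding B_def prod_Basis_prod_vec by (simp add: c'_def inner_prod_def)
    qed
    have "((\<lambda>\<alpha>. c' \<alpha> * (\<Prod>b\<in>B. ((x - p) \<bullet> b) ^ \<alpha> b)) has_sum \<Phi> (fst x)) {\<alpha> \<in> B \<rightarrow>\<^sub>E UNIV. \<alpha> (0, 1) = 0} \<longleftrightarrow>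
      ((\<lambda>\<alpha>. c \<alpha> * (\<Prod>b\<in>Basis. ((fst x - fst p) \<bullet> b) ^ \<alpha> b)) has_sum \<Phi> (fst x)) (Basis \<rightarrow>\<^sub>E UNIV)"
    proof (rule has_sum_reindex_bij_witness[of _ E R])
      fix \<alpha> assume a: "\<alpha> \<in> {\<alpha> \<in> B \<rightarrow>\<^sub>E (UNIV :: nat set). \<alpha> (0, 1) = 0}"
      show "E (R \<alpha>) = \<alpha>"
      proof
        fix b show "E (R \<alpha>) b = \<alpha> b"
        proof (cases "b \<in> B")
          case True
          then consider i where "b = (axis i 1, 0)" | "b = (0, 1)" unfolding B by blast
          then show ?thesis
          proof cases
            case 1
            then have "fst b \<in> Basis" using Bv by auto
            then show ?thesis using 1 True ax by (simp add: E_def R_def)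
          next
            case 2
            then show ?thesis using a True by (simp add: E_def)
          qed
        next
          case False
          then have "\<alpha> b = undefined" using a by (intro PiE_arb[of \<alpha> B]) auto
          then show ?thesis using False by (simp add: E_def)
        qed
      qed
      show "R \<alpha> \<in> Basis \<rightarrow>\<^sub>E UNIV" by (simp add: R_def)
      show "c (R \<alpha>) * (\<Prod>b\<in>Basis. ((fst x - fst p) \<bullet> b) ^ R \<alpha> b) = c' \<alpha> * (\<Prod>b\<in>B. ((x - p) \<bullet> b) ^ \<alpha> b)"
        using val a by simp
    next
      fix \<beta> :: "real ^ 'm \<Rightarrow> nat" assume b: "\<beta> \<in> Basis \<rightarrow>\<^sub>E (UNIV :: nat set)"
      show "R (E \<beta>) = \<beta>"
      proof
        fix u show "R (E \<beta>) u = \<beta> u"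
        proof (cases "u \<in> Basis")
          case True
          then obtain i where u: "u = axis i 1" using Bv by auto
          then have "(u, 0) \<in> B" using B by auto
          then show ?thesis using True u ax by (simp add: E_def R_def)
        next
          case False
          then have "\<beta> u = undefined" using b by (intro PiE_arb[of \<beta> Basis]) auto
          then show ?thesis using False by (simp add: R_def)
        qed
      qed
      show "E \<beta> \<in> {\<alpha> \<in> B \<rightarrow>\<^sub>E UNIV. \<alpha> (0, 1) = 0}" by (auto simp: E_def B)
    qed (rule refl)
    with h have "((\<lambda>\<alpha>. c' \<alpha> * (\<Prod>b\<in>B. ((x - p) \<bullet> b) ^ \<alpha> b)) has_sum \<Phi> (fst x)) {\<alpha> \<in> B \<rightarrow>\<^sub>E UNIV. \<alpha> (0, 1) = 0}"
      by blast
    then show ?thesis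
      by (rule has_sum_cong_neutral[THEN iffD1, rotated -1]) (auto simp: c'_def)
  qed
  then show ?thesis unfolding real_analytic_at_def B_def using e by blast
qed

text \<open>Expansion along one angular direction and the radius, with \<open>t\<close> and
  \<open>C\<close> independent of the direction. Directions can be handled separately because the
  decay of a Fourier coefficient is obtained from the direction in which its frequency is
  largest.\<close>

definition loc_expansion :: "((real ^ 'm) \<times> real \<Rightarrow> real) \<Rightarrow> real \<Rightarrow> real \<Rightarrow> real ^ 'm \<Rightarrow> bool" where
  "loc_expansion F t C x \<longleftrightarrow> (\<forall>i. \<exists>A :: nat \<times> nat \<Rightarrow> real.
     (\<exists>S\<le>C. ((\<lambda>y. \<bar>A y\<bar> * (t ^ fst y * t ^ snd y)) has_sum S) UNIV) \<and>
     (\<forall>\<tau> r. \<bar>\<tau>\<bar> \<le> t \<longrightarrow> \<bar>r\<bar> \<le> t \<longrightarrow> ((\<lambda>y. A y * (\<tau> ^ fst y * r ^ snd y)) has_sum F (x + axis i \<tau>, r)) UNIV))"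

lemma loc_expansion_mono:
  assumes "loc_expansion F t C x" "0 < t'" "t' \<le> t" "C \<le> C'"
  shows "loc_expansion F t' C' x"
  unfolding loc_expansion_def
proof
  fix i
  obtain A S where A: "S \<le> C" "((\<lambda>y. \<bar>A y\<bar> * (t ^ fst y * t ^ snd y)) has_sum S) UNIV"
    "\<And>\<tau> r. \<bar>\<tau>\<bar> \<le> t \<Longrightarrow> \<bar>r\<bar> \<le> t \<Longrightarrow> ((\<lambda>y. A y * (\<tau> ^ fst y * r ^ snd y)) has_sum F (x + axis i \<tau>, r)) UNIV"
    using assms(1) unfolding loc_expansion_def by meson
  have le: "\<bar>A y\<bar> * (t' ^ fst y * t' ^ snd y) \<le> \<bar>A y\<bar> * (t ^ fst y * t ^ snd y)" for y
    using assms by (intro mult_left_mono mult_mono power_mono) auto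
  have sm: "(\<lambda>y. \<bar>A y\<bar> * (t' ^ fst y * t' ^ snd y)) summable_on UNIV"
    by (rule summable_on_comparison_test[OF has_sum_imp_summable[OF A(2)] le]) (use assms in auto)
  have "infsum (\<lambda>y. \<bar>A y\<bar> * (t' ^ fst y * t' ^ snd y)) UNIV \<le> S"
    by (rule has_sum_mono[OF has_sum_infsum[OF sm] A(2) le])
  then have "infsum (\<lambda>y. \<bar>A y\<bar> * (t' ^ fst y * t' ^ snd y)) UNIV \<le> C'" using A(1) assms(4) by simp
  with has_sum_infsum[OF sm] A(3) assms(3)
  show "\<exists>A. (\<exists>S\<le>C'. ((\<lambda>y. \<bar>A y\<bar> * (t' ^ fst y * t' ^ snd y)) has_sum S) UNIV) \<and>
     (\<forall>\<tau> r. \<bar>\<tau>\<bar> \<le> t' \<longrightarrow> \<bar>r\<bar> \<le> t' \<longrightarrow> ((\<lambda>y. A y * (\<tau> ^ fst y * r ^ snd y)) has_sum F (x + axis i \<tau>, r)) UNIV)"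
    by (intro exI[of _ A]) (meson order_trans)
qed

text \<open>Recentring from \<open>a\<close> to a nearby \<open>x\<close>: coordinates other than
  \<open>i\<close> are frozen into the coefficient, the power in direction \<open>i\<close> is
  expanded binomially, and terms with equal exponents of \<open>\<tau>\<close> and \<open>r\<close>
  are collected. Halving the polyradius gives \<open>|y i| + t <= t2\<close>, so absolute sums stay
  below the constant of \<open>a\<close>.\<close>

lemma real_analytic_loc_expansion:
  fixes F :: "(real ^ 'm) \<times> real \<Rightarrow> real"
  assumes "real_analytic_at F (a, 0)"
  shows "\<exists>t C. 0 < t \<and> (\<forall>x. (\<forall>j. \<bar>x $ j - a $ j\<bar> \<le> t) \<longrightarrow> loc_expansion F t C x)"
proof -
  obtain c t2 where t2: "0 < t2" and sm: "(\<lambda>\<alpha>. \<bar>c \<alpha>\<bar> * (\<Prod>b\<in>Basis. t2 ^ \<alpha> b)) summable_on (Basis \<rightarrow>\<^sub>E UNIV)"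
    and c: "\<And>x. \<forall>b\<in>Basis. \<bar>(x - (a, 0)) \<bullet> b\<bar> \<le> t2 \<Longrightarrow>
      ((\<lambda>\<alpha>. c \<alpha> * (\<Prod>b\<in>Basis. ((x - (a, 0)) \<bullet> b) ^ \<alpha> b)) has_sum F x) (Basis \<rightarrow>\<^sub>E UNIV)"
    using real_analytic_at_bound[OF assms] by blast
  define t where "t = t2 / 2"
  define I where "I = (Basis :: ((real ^ 'm) \<times> real) set) \<rightarrow>\<^sub>E (UNIV :: nat set)"
  define C where "C = (\<Sum>\<^sub>\<infinity>\<alpha>\<in>I. \<bar>c \<alpha>\<bar> * (\<Prod>b\<in>Basis. t2 ^ \<alpha> b))"
  have t: "0 < t" "t2 = t + t" using t2 by (auto simp: t_def)
  have "loc_expansion F t C x" if x: "\<forall>j. \<bar>x $ j - a $ j\<bar> \<le> t" for x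
    unfolding loc_expansion_def
  proof
    fix i
    define y where "y j = x $ j - a $ j" for j
    have y: "\<bar>y j\<bar> \<le> t" for j using x by (simp add: y_def)
    define P where "P \<alpha> = c \<alpha> * (\<Prod>j\<in>UNIV - {i}. y j ^ \<alpha> (axis j 1, 0))" for \<alpha>
    define n1 where "n1 \<alpha> = \<alpha> (axis i 1, 0)" for \<alpha> :: "(real ^ 'm) \<times> real \<Rightarrow> nat"
    define n2 where "n2 \<alpha> = \<alpha> (0, 1)" for \<alpha> :: "(real ^ 'm) \<times> real \<Rightarrow> nat"
    define T where "T = (\<lambda>(\<alpha>, l). P \<alpha> * (of_nat (n1 \<alpha> choose l) * y i ^ (n1 \<alpha> - l)))"
    define z where "z = (\<lambda>(\<alpha>, l :: nat). (l, n2 \<alpha>))"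
    define w where "w = (\<lambda>q :: nat \<times> nat. t ^ fst q * t ^ snd q)"
    have wpos: "0 < w q" for q using t by (simp add: w_def)
    have rowT: "((\<lambda>l. T (\<alpha>, l) * (\<tau> ^ l * r ^ n2 \<alpha>)) has_sum P \<alpha> * (y i + \<tau>) ^ n1 \<alpha> * r ^ n2 \<alpha>) UNIV" for \<alpha> \<tau> r
      using has_sum_cmult_right[OF has_sum_binomial[of "n1 \<alpha>" "y i" \<tau>], of "P \<alpha> * r ^ n2 \<alpha>"]
      by (simp add: T_def mult_ac)
    have rown: "((\<lambda>l. \<bar>T (\<alpha>, l)\<bar> * w (z (\<alpha>, l))) has_sum \<bar>P \<alpha>\<bar> * (\<bar>y i\<bar> + t) ^ n1 \<alpha> * t ^ n2 \<alpha>) UNIV" for \<alpha>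
      using has_sum_cmult_right[OF has_sum_binomial[of "n1 \<alpha>" "\<bar>y i\<bar>" t], of "\<bar>P \<alpha>\<bar> * t ^ n2 \<alpha>"]
      by (simp add: T_def w_def z_def mult_ac abs_mult power_abs)
    have yt: "\<bar>y j\<bar> \<le> t2" "\<bar>y j\<bar> + t \<le> t2" "t \<le> t2" "0 < t2" for j
      using y[of j] t by auto
    have tot: "\<bar>P \<alpha>\<bar> * (\<bar>y i\<bar> + t) ^ n1 \<alpha> * t ^ n2 \<alpha> \<le> \<bar>c \<alpha>\<bar> * (\<Prod>b\<in>Basis. t2 ^ \<alpha> b)" for \<alpha>
    proof -
      have "\<bar>P \<alpha>\<bar> * (\<bar>y i\<bar> + t) ^ n1 \<alpha> * t ^ n2 \<alpha> =
          \<bar>c \<alpha>\<bar> * ((\<bar>y i\<bar> + t) ^ n1 \<alpha> * (\<Prod>j\<in>UNIV - {i}. \<bar>y j\<bar> ^ \<alpha> (axis j 1, 0)) * t ^ n2 \<alpha>)"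
        by (simp add: P_def abs_mult abs_prod power_abs mult_ac)
      also have "\<dots> \<le> \<bar>c \<alpha>\<bar> * (t2 ^ n1 \<alpha> * (\<Prod>j\<in>UNIV - {i}. t2 ^ \<alpha> (axis j 1, 0)) * t2 ^ n2 \<alpha>)"
        using yt t(1) by (intro mult_left_mono mult_mono power_mono prod_mono mult_nonneg_nonneg prod_nonneg conjI) auto
      also have "t2 ^ n1 \<alpha> * (\<Prod>j\<in>UNIV - {i}. t2 ^ \<alpha> (axis j 1, 0)) = (\<Prod>j\<in>UNIV. t2 ^ \<alpha> (axis j 1, 0))"
        unfolding n1_def by (subst prod.remove[of UNIV i]) auto
      finally show ?thesis by (simp add: prod_Basis_prod_vec n2_def)
    qed
    have sP: "(\<lambda>\<alpha>. \<bar>P \<alpha>\<bar> * (\<bar>y i\<bar> + t) ^ n1 \<alpha> * t ^ n2 \<alpha>) summable_on I"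
      by (rule summable_on_comparison_test[OF sm[folded I_def] tot]) (use t in auto)
    have sumT: "(\<lambda>p. \<bar>T p\<bar> * w (z p)) summable_on (I \<times> UNIV)"
      by (rule summable_on_SigmaI[where g = "\<lambda>\<alpha>. \<bar>P \<alpha>\<bar> * (\<bar>y i\<bar> + t) ^ n1 \<alpha> * t ^ n2 \<alpha>"], rule rown, rule sP)
         (simp add: wpos less_imp_le)
    have hT: "((\<lambda>p. norm (T p) * w (z p)) has_sum (\<Sum>\<^sub>\<infinity>\<alpha>\<in>I. \<bar>P \<alpha>\<bar> * (\<bar>y i\<bar> + t) ^ n1 \<alpha> * t ^ n2 \<alpha>)) (I \<times> UNIV)"
      unfolding real_norm_def
      by (rule has_sum_SigmaI[where g = "\<lambda>\<alpha>. \<bar>P \<alpha>\<bar> * (\<bar>y i\<bar> + t) ^ n1 \<alpha> * t ^ n2 \<alpha>", OF rown has_sum_infsum[OF sP] sumT])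
    have leC: "(\<Sum>\<^sub>\<infinity>\<alpha>\<in>I. \<bar>P \<alpha>\<bar> * (\<bar>y i\<bar> + t) ^ n1 \<alpha> * t ^ n2 \<alpha>) \<le> C"
      unfolding C_def by (rule infsum_mono[OF sP sm[folded I_def] tot])
    define A where "A q = infsum T {p \<in> I \<times> UNIV. z p = q}" for q
    note col = collect_fibres[of w T z, OF wpos hT, folded A_def]
    have "((\<lambda>q. A q * (\<tau> ^ fst q * r ^ snd q)) has_sum F (x + axis i \<tau>, r)) UNIV" if \<tau>: "\<bar>\<tau>\<bar> \<le> t" and r: "\<bar>r\<bar> \<le> t" for \<tau> r
    proof (rule col(2))
      define X where "X = (x + axis i \<tau>, r)"
      have X1: "(X - (a, 0)) \<bullet> (axis j 1, 0) = (if j = i then y i + \<tau> else y j)" for j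
      proof -
        have "axis i \<tau> $ j = (if j = i then \<tau> else 0)" by (simp add: axis_def)
        then show ?thesis by (simp add: X_def inner_axis y_def)
      qed
      have X2: "(X - (a, 0)) \<bullet> (0, 1) = r" by (simp add: X_def)
      have near: "\<forall>b\<in>Basis. \<bar>(X - (a, 0)) \<bullet> b\<bar> \<le> t2"
      proof
        fix b :: "(real ^ 'm) \<times> real" assume "b \<in> Basis"
        then consider j where "b = (axis j 1, 0)" | "b = (0, 1)" unfolding Basis_prod_vec by auto
        then show "\<bar>(X - (a, 0)) \<bullet> b\<bar> \<le> t2"
        proof cases
          case 1
          then show ?thesis using X1[of j] y[of j] y[of i] \<tau> t by (auto split: if_splits)
        next
          case 2
          then show ?thesis using X2 r t by simp
        qed
      qed
      have mon: "c \<alpha> * (\<Prod>b\<in>Basis. ((X - (a, 0)) \<bullet> b) ^ \<alpha> b) = P \<alpha> * (y i + \<tau>) ^ n1 \<alpha> * r ^ n2 \<alpha>" for \<alpha>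
      proof -
        have "(\<Prod>j\<in>UNIV. (if j = i then y i + \<tau> else y j) ^ \<alpha> (axis j 1, 0)) =
            (y i + \<tau>) ^ n1 \<alpha> * (\<Prod>j\<in>UNIV - {i}. y j ^ \<alpha> (axis j 1, 0))"
          unfolding n1_def by (subst prod.remove[of UNIV i]) auto
        then show ?thesis unfolding prod_Basis_prod_vec X1 X2 by (simp add: P_def n2_def mult_ac)
      qed
      have F: "((\<lambda>\<alpha>. P \<alpha> * (y i + \<tau>) ^ n1 \<alpha> * r ^ n2 \<alpha>) has_sum F X) I"
        using c[OF near] unfolding mon I_def .
      have "(\<lambda>p. T p * (\<tau> ^ fst (z p) * r ^ snd (z p))) summable_on (I \<times> UNIV)"
      proof (rule abs_summable_summable, rule Infinite_Sum.abs_summable_on_comparison_test'[OF sumT])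
        fix p
        show "norm (T p * (\<tau> ^ fst (z p) * r ^ snd (z p))) \<le> \<bar>T p\<bar> * w (z p)"
          unfolding real_norm_def abs_mult power_abs w_def using \<tau> r t
          by (intro mult_left_mono mult_mono power_mono) auto
      qed
      then have "((\<lambda>p. T p * (\<tau> ^ fst (z p) * r ^ snd (z p))) has_sum F X) (I \<times> UNIV)"
        using rowT by (intro has_sum_SigmaI[where g = "\<lambda>\<alpha>. P \<alpha> * (y i + \<tau>) ^ n1 \<alpha> * r ^ n2 \<alpha>", OF _ F]) (simp_all add: z_def)
      then show "((\<lambda>p. T p * (\<tau> ^ fst (z p) * r ^ snd (z p))) has_sum F (x + axis i \<tau>, r)) (I \<times> UNIV)"
        by (simp only: X_def)
    qed
    moreover have "\<exists>S\<le>C. ((\<lambda>y. \<bar>A y\<bar> * (t ^ fst y * t ^ snd y)) has_sum S) UNIV"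
      using col(1) leC unfolding w_def real_norm_def by (meson order_trans)
    ultimately show "\<exists>A. (\<exists>S\<le>C. ((\<lambda>y. \<bar>A y\<bar> * (t ^ fst y * t ^ snd y)) has_sum S) UNIV) \<and>
       (\<forall>\<tau> r. \<bar>\<tau>\<bar> \<le> t \<longrightarrow> \<bar>r\<bar> \<le> t \<longrightarrow> ((\<lambda>y. A y * (\<tau> ^ fst y * r ^ snd y)) has_sum F (x + axis i \<tau>, r)) UNIV)"
      by blast
  qed
  with t(1) show ?thesis by blast
qed

section \<open>Uniformity over the torus\<close>

lemma lattice_periodic:
  fixes h :: "real ^ 'm \<Rightarrow> 'b"
  assumes "\<And>x i. h (x + axis i (2 * pi)) = h x"
  shows "h (x + (\<chi> i. 2 * pi * of_int (k i))) = h x"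
proof -
  have nat: "h (x + axis i (2 * pi * of_nat n)) = h x" for x i n
  proof (induction n arbitrary: x)
    case (Suc n)
    have "x + axis i (2 * pi * of_nat (Suc n)) = (x + axis i (2 * pi * of_nat n)) + axis i (2 * pi)"
      by (simp add: vec_eq_iff axis_def algebra_simps)
    then show ?case using assms Suc by metis
  qed (simp add: axis_eq_0_iff[of _ "0::real", THEN iffD2])
  have int: "h (x + axis i (2 * pi * of_int n)) = h x" for x i n
  proof (cases "n \<ge> 0")
    case True
    then show ?thesis using nat[of x i "nat n"] by simp
  next
    case False
    have "x = (x + axis i (2 * pi * of_int n)) + axis i (2 * pi * of_nat (nat (- n)))"
      using False by (simp add: vec_eq_iff axis_def)
    then show ?thesis using nat by metis
  qed
  have "h (x + (\<Sum>i\<in>J. axis i (2 * pi * of_int (k i)))) = h x" if "finite J" for J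
    using that
  proof (induction J)
    case (insert j J)
    have "x + (\<Sum>i\<in>insert j J. axis i (2 * pi * of_int (k i))) = (x + (\<Sum>i\<in>J. axis i (2 * pi * of_int (k i)))) + axis j (2 * pi * of_int (k j))"
      using insert.hyps by (simp add: algebra_simps)
    then show ?case using int insert.IH by metis
  qed simp
  moreover have "(\<Sum>i\<in>UNIV. axis i (2 * pi * of_int (k i))) = (\<chi> i. 2 * pi * of_int (k i))"
    by (simp add: vec_eq_iff axis_def if_distrib cong: if_cong)
  ultimately show ?thesis by (metis finite_class.finite_UNIV)
qed

lemma periodic_reduce:
  fixes x :: "real ^ 'm"
  obtains x' k where "x' \<in> cbox 0 (\<chi> i. 2 * pi)" "x = x' + (\<chi> i. 2 * pi * of_int (k i))"
proof
  define k where "k i = \<lfloor>x $ i / (2 * pi)\<rfloor>" for i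
  show "x - (\<chi> i. 2 * pi * of_int (k i)) \<in> cbox 0 (\<chi> i. 2 * pi)"
  proof -
    have "0 \<le> x $ i - 2 * pi * of_int (k i)" "x $ i - 2 * pi * of_int (k i) \<le> 2 * pi" for i
    proof -
      have "of_int (k i) \<le> x $ i / (2 * pi)" "x $ i / (2 * pi) \<le> of_int (k i) + 1"
        unfolding k_def by linarith+
      then show "0 \<le> x $ i - 2 * pi * of_int (k i)" "x $ i - 2 * pi * of_int (k i) \<le> 2 * pi"
        using pi_gt_zero by (simp_all add: pos_le_divide_eq pos_divide_le_eq algebra_simps)
    qed
    then show ?thesis by (simp add: mem_box_cart)
  qed
  show "x = x - (\<chi> i. 2 * pi * of_int (k i)) + (\<chi> i. 2 * pi * of_int (k i))" by simp
qed

text \<open>Finitely many cubes cover a period box, and translation by the period lattice transports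
  the expansion to every point, so one radius and one constant serve the whole torus.\<close>

lemma uniform_loc_expansion:
  fixes F :: "(real ^ 'm) \<times> real \<Rightarrow> real"
  assumes \<rho>: "0 < \<rho>" and an: "\<And>a. real_analytic_at F (a, 0)"
    and per: "\<And>x i r. \<bar>r\<bar> < \<rho> \<Longrightarrow> F (x + axis i (2 * pi), r) = F (x, r)"
  shows "\<exists>t C. 0 < t \<and> t < \<rho> \<and> (\<forall>x. loc_expansion F t C x)"
proof -
  have "\<forall>a. \<exists>t C. 0 < t \<and> (\<forall>x. (\<forall>j. \<bar>x $ j - a $ j\<bar> \<le> t) \<longrightarrow> loc_expansion F t C x)"
    using real_analytic_loc_expansion[OF an] by blast
  then obtain t C where tC: "\<And>a. 0 < t a" "\<And>a x. \<forall>j. \<bar>x $ j - a $ j\<bar> \<le> t a \<Longrightarrow> loc_expansion F (t a) (C a) x"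
    by metis
  define Q where "Q = cbox 0 (\<chi> i. 2 * pi :: real ^ 'm)"
  define U where "U a = {x :: real ^ 'm. \<forall>j. \<bar>x $ j - a $ j\<bar> < t a}" for a
  have "open (U a)" for a
  proof -
    have "U a = (\<Inter>j. {x. \<bar>x $ j - a $ j\<bar> < t a})" by (auto simp: U_def)
    then show ?thesis by (auto intro!: open_INT open_Collect_less continuous_intros)
  qed
  moreover have "Q \<subseteq> (\<Union>a\<in>Q. U a)" using tC(1) by (auto simp: U_def)
  moreover have "compact Q" by (simp add: Q_def compact_cbox)
  ultimately obtain D where D: "D \<subseteq> Q" "finite D" "Q \<subseteq> (\<Union>a\<in>D. U a)"
    using compactE_image[of Q Q U] by metis
  define t' where "t' = Min (insert (\<rho> / 2) (t ` D))"
  define C' where "C' = Max (insert 0 (C ` D))"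
  have t': "0 < t'" "t' < \<rho>" "\<And>a. a \<in> D \<Longrightarrow> t' \<le> t a"
  proof -
    show "0 < t'" using D(2) \<rho> tC(1) by (simp add: t'_def)
    have "t' \<le> \<rho> / 2" unfolding t'_def by (rule Min_le) (use D(2) in auto)
    then show "t' < \<rho>" using \<rho> by simp
    show "t' \<le> t a" if "a \<in> D" for a using D(2) that by (simp add: t'_def)
  qed
  have C': "C a \<le> C'" if "a \<in> D" for a using D(2) that by (simp add: C'_def)
  have inQ: "loc_expansion F t' C' x" if "x \<in> Q" for x
  proof -
    have "x \<in> (\<Union>a\<in>D. U a)" using D(3) that by (rule subsetD)
    then obtain a where a: "a \<in> D" "x \<in> U a" by blast
    then have "loc_expansion F (t a) (C a) x" by (intro tC(2)) (auto simp: U_def less_imp_le)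
    then show ?thesis by (rule loc_expansion_mono) (use t' C' a in auto)
  qed
  have "loc_expansion F t' C' x" for x
  proof -
    obtain x' k where x': "x' \<in> Q" "x = x' + (\<chi> i. 2 * pi * of_int (k i))"
      using periodic_reduce[of x] unfolding Q_def by metis
    have "F (x + v, r) = F (x' + v, r)" if "\<bar>r\<bar> \<le> t'" for v r
    proof -
      have "F ((x' + v) + (\<chi> i. 2 * pi * of_int (k i)), r) = F (x' + v, r)"
        using per that t'(2) by (intro lattice_periodic[of "\<lambda>x. F (x, r)"]) simp
      then show ?thesis by (simp add: x'(2) algebra_simps)
    qed
    then show ?thesis using inQ[OF x'(1)] unfolding loc_expansion_def by simp
  qed
  with t' show ?thesis by blast
qed

text \<open>\<open>B n\<close> is the \<open>n\<close>-th Taylor coefficient in \<open>r\<close> as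
  a function on the torus, and \<open>A i l n x\<close> the \<open>l\<close>-th Taylor coefficient
  of \<open>B n\<close> at \<open>x\<close> in direction \<open>i\<close>. The bounds are Cauchy
  estimates with constants uniform in \<open>x\<close>.\<close>

lemma periodic_analytic_expansion:
  fixes F :: "(real ^ 'm) \<times> real \<Rightarrow> real"
  assumes \<rho>: "0 < \<rho>" and an: "real_analytic_on F (UNIV \<times> {-\<rho><..<\<rho>})"
    and per: "\<And>x i r. \<bar>r\<bar> < \<rho> \<Longrightarrow> F (x + axis i (2 * pi), r) = F (x, r)"
  shows "\<exists>t C B A. 0 < t \<and> t < \<rho> \<and>
    (\<forall>r. \<bar>r\<bar> \<le> t \<longrightarrow> continuous_on UNIV (\<lambda>x. F (x, r))) \<and>
    (\<forall>x r. \<bar>r\<bar> \<le> t \<longrightarrow> ((\<lambda>n. B n x * r ^ n) has_sum F (x, r)) UNIV) \<and>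
    (\<forall>n x. \<bar>B n x\<bar> * t ^ n \<le> C) \<and> (\<forall>n x i. B n (x + axis i (2 * pi)) = B n x) \<and>
    (\<forall>i l n x. \<bar>A i l n x\<bar> * (t ^ l * t ^ n) \<le> C) \<and>
    (\<forall>i n x \<tau>. \<bar>\<tau>\<bar> \<le> t \<longrightarrow> ((\<lambda>l. A i l n x * \<tau> ^ l) has_sum B n (x + axis i \<tau>)) UNIV)"
proof -
  obtain t C where t: "0 < t" "t < \<rho>" and loc: "\<And>x. loc_expansion F t C x"
    using uniform_loc_expansion[OF \<rho> _ per] an \<rho> unfolding real_analytic_on_def by fastforce
  define P where "P x i A \<longleftrightarrow> (\<exists>S\<le>C. ((\<lambda>y. \<bar>A y\<bar> * (t ^ fst y * t ^ snd y)) has_sum S) UNIV) \<and>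
     (\<forall>\<tau> r. \<bar>\<tau>\<bar> \<le> t \<longrightarrow> \<bar>r\<bar> \<le> t \<longrightarrow> ((\<lambda>y. A y * (\<tau> ^ fst y * r ^ snd y)) has_sum F (x + axis i \<tau>, r)) UNIV)"
    for x i and A :: "nat \<times> nat \<Rightarrow> real"
  have "\<forall>x i. \<exists>A. P x i A" using loc unfolding loc_expansion_def P_def by blast
  then obtain A where A: "\<And>x i. P x i (A x i)" by metis
  have A1: "\<exists>S\<le>C. ((\<lambda>y. \<bar>A x i y\<bar> * (t ^ fst y * t ^ snd y)) has_sum S) UNIV" for x i
    using A[of x i] unfolding P_def by blast
  have A2: "((\<lambda>y. A x i y * (\<tau> ^ fst y * r ^ snd y)) has_sum F (x + axis i \<tau>, r)) UNIV"
    if "\<bar>\<tau>\<bar> \<le> t" "\<bar>r\<bar> \<le> t" for x i \<tau> r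
    using A[of x i] that unfolding P_def by blast
  have bound: "\<bar>A x i (l, n)\<bar> * (t ^ l * t ^ n) \<le> C" for x i l n
  proof -
    obtain S where S: "S \<le> C" "((\<lambda>y. \<bar>A x i y\<bar> * (t ^ fst y * t ^ snd y)) has_sum S) UNIV" using A1 by blast
    from finite_sum_le_has_sum[OF S(2), of "{(l, n)}"] S(1) t show ?thesis by simp
  qed
  \<comment> \<open>Defined by derivatives and not through \<open>A\<close>, so that it does not
    depend on the direction \<open>i\<close>; uniqueness of power series links the two.\<close>
  define B where "B n x = (deriv ^^ n) (\<lambda>r. F (x, r)) 0 / fact n" for n x
  have swap: "((\<lambda>(n, l). g (l, n)) has_sum S) (UNIV \<times> UNIV) \<longleftrightarrow> (g has_sum S) UNIV"
    for g :: "nat \<times> nat \<Rightarrow> real" and S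
    using has_sum_swap[where f = g and S = S and A = UNIV and B = UNIV] by simp
  have both: "((\<lambda>l. A x i (l, n) * \<tau> ^ l) has_sum B n (x + axis i \<tau>)) UNIV"
    "\<And>r. \<bar>r\<bar> \<le> t \<Longrightarrow> ((\<lambda>n. B n (x + axis i \<tau>) * r ^ n) has_sum F (x + axis i \<tau>, r)) UNIV"
    if \<tau>: "\<bar>\<tau>\<bar> \<le> t" for x i n \<tau>
  proof -
    have T: "((\<lambda>(n, l). A x i (l, n) * (\<tau> ^ l * r ^ n)) has_sum F (x + axis i \<tau>, r)) (UNIV \<times> UNIV)" if "\<bar>r\<bar> \<le> t" for r
      using A2[OF \<tau> that, of x i] swap[of "\<lambda>y. A x i y * (\<tau> ^ fst y * r ^ snd y)" "F (x + axis i \<tau>, r)"]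
      by (simp only: fst_conv snd_conv)
    define D where "D n = (\<Sum>\<^sub>\<infinity>l. A x i (l, n) * \<tau> ^ l)" for n
    have D: "((\<lambda>l. A x i (l, n) * \<tau> ^ l) has_sum D n) UNIV" for n
    proof -
      have "(\<lambda>l. A x i (l, n) * (\<tau> ^ l * t ^ n)) summable_on UNIV"
        using summable_on_SigmaD1[OF has_sum_imp_summable[OF T[of t]], of n] t by simp
      then have "(\<lambda>l. A x i (l, n) * \<tau> ^ l * t ^ n) summable_on UNIV" by (simp add: mult.assoc)
      then show ?thesis using t unfolding D_def
        by (subst (asm) summable_on_cmult_left') auto
    qed
    have sumD: "((\<lambda>n. D n * r ^ n) has_sum F (x + axis i \<tau>, r)) UNIV" if "\<bar>r\<bar> \<le> t" for r
    proof (rule has_sum_SigmaD[OF T[OF that]])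
      show "((\<lambda>l. case (n, l) of (n, l) \<Rightarrow> A x i (l, n) * (\<tau> ^ l * r ^ n)) has_sum D n * r ^ n) UNIV" for n
        using has_sum_cmult_left[OF D[of n], of "r ^ n"] by (simp add: mult.assoc)
    qed
    have DB: "D n = B n (x + axis i \<tau>)" for n
    proof -
      have "(deriv ^^ n) (\<lambda>r. F (x + axis i \<tau>, r)) 0 = fact n * D n"
        by (rule higher_deriv_powser[OF t(1)]) (use sumD has_sum_imp_sums in \<open>auto intro: less_imp_le\<close>)
      then show ?thesis by (simp add: B_def)
    qed
    show "((\<lambda>l. A x i (l, n) * \<tau> ^ l) has_sum B n (x + axis i \<tau>)) UNIV" using D[of n] unfolding DB .
    show "((\<lambda>n. B n (x + axis i \<tau>) * r ^ n) has_sum F (x + axis i \<tau>, r)) UNIV" if "\<bar>r\<bar> \<le> t" for r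
      using sumD[OF that] unfolding DB .
  qed
  have ax0: "x + axis i (0::real) = x" for x :: "real ^ 'm" and i by (simp add: vec_eq_iff axis_def)
  have B: "((\<lambda>n. B n x * r ^ n) has_sum F (x, r)) UNIV" if "\<bar>r\<bar> \<le> t" for x r
    using both(2)[of 0 r x] that t by (simp add: ax0)
  have Bbound: "\<bar>B n x\<bar> * t ^ n \<le> C" for n x
  proof -
    have "((\<lambda>l. A x i (l, n) * 0 ^ l) has_sum A x i (0, n)) UNIV" for i
      by (rule has_sum_finite_neutralI[of "{0}"]) auto
    moreover have "((\<lambda>l. A x i (l, n) * 0 ^ l) has_sum B n x) UNIV" for i
      using both(1)[of 0 x i n] t by (simp add: ax0)
    ultimately have "B n x = A x undefined (0, n)" using has_sum_unique by blast
    then show ?thesis using bound[of x undefined 0 n] by simp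
  qed
  have Bper: "B n (x + axis i (2 * pi)) = B n x" for n x i
  proof -
    have "(deriv ^^ n) (\<lambda>r. F (x + axis i (2 * pi), r)) 0 = fact n * B n x"
    proof (rule higher_deriv_powser[OF t(1)])
      show "(\<lambda>n. B n x * r ^ n) sums F (x + axis i (2 * pi), r)" if "\<bar>r\<bar> < t" for r
        using has_sum_imp_sums[OF B[of r x]] per[of r x i] t that by simp
    qed
    then show ?thesis by (simp add: B_def)
  qed
  have cont: "continuous_on UNIV (\<lambda>x. F (x, r))" if "\<bar>r\<bar> \<le> t" for r
  proof -
    have c: "isCont F (x, r)" for x
    proof (rule real_analytic_at_isCont)
      have "(x, r) \<in> UNIV \<times> {-\<rho><..<\<rho>}" using that t by (simp add: abs_le_iff)
      with an show "real_analytic_at F (x, r)" unfolding real_analytic_on_def by (rule bspec)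
    qed
    have "(\<lambda>x. (x, r)) \<midarrow>x\<rightarrow> (x, r)" for x by (intro tendsto_intros)
    then have "(\<lambda>x. F (x, r)) \<midarrow>x\<rightarrow> F (x, r)" for x
      by (rule isCont_tendsto_compose[OF c])
    then show ?thesis unfolding continuous_on_eq_continuous_at[OF open_UNIV] isCont_def by blast
  qed
  show ?thesis
  proof (rule exI[of _ t], rule exI[of _ C], rule exI[of _ B], rule exI[of _ "\<lambda>i l n x. A x i (l, n)"],
      intro conjI allI impI)
  qed (fact t(1) t(2) Bbound Bper bound | rule cont B both(1), assumption)+
qed

section \<open>Fourier coefficients of analytic functions on the torus\<close>

abbreviation period_box :: "(real ^ 'm) set" where
  "period_box \<equiv> cbox 0 (\<chi> i. 2 * pi)"

lemma mem_cbox_cart_split: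
  fixes x :: "real ^ 'm"
  shows "x \<in> cbox a b \<longleftrightarrow> (a $ i \<le> x $ i \<and> x $ i \<le> b $ i) \<and> (\<forall>j. j \<noteq> i \<longrightarrow> a $ j \<le> x $ j \<and> x $ j \<le> b $ j)"
  unfolding mem_box_cart by metis

text \<open>The shifted box is cut at \<open>x_i = 2 * pi\<close>; the part sticking out is moved
  back by one period and fills the slab \<open>x_i <= \<tau>\<close> that the shift has
  vacated.\<close>

lemma integral_period_box_shift_nonneg:
  fixes g :: "real ^ 'm \<Rightarrow> complex"
  assumes cont: "continuous_on UNIV g" and per: "\<And>x. g (x + axis i (2 * pi)) = g x"
    and \<tau>: "0 \<le> \<tau>" "\<tau> \<le> 2 * pi"
  shows "integral period_box (\<lambda>x. g (x + axis i \<tau>)) = integral period_box g"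
proof -
  define b :: "real ^ 'm" where "b = (\<chi> i. 2 * pi)"
  define b' :: "real ^ 'm" where "b' = (\<chi> j. if j = i then \<tau> else 2 * pi)"
  have int: "g integrable_on cbox x y" for x y
    by (intro integrable_continuous continuous_on_subset[OF cont]) auto
  have ip: "x \<bullet> axis i 1 = x $ i" for x :: "real ^ 'm" by (simp add: inner_axis)
  have axn: "axis i c $ j = (if j = i then c else 0)" for c :: real and j by (simp add: axis_def)
  have k: "axis i 1 \<in> (Basis :: (real ^ 'm) set)" by (auto simp: Basis_vec_def)
  have "integral (cbox 0 b) (\<lambda>x. g (x + axis i \<tau>)) = integral (cbox (0 + axis i \<tau>) (b + axis i \<tau>)) g"
    using integral_shift_cbox_plus[of 0 b g "axis i \<tau>"] by (simp add: comp_def add.commute)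
  also have "\<dots> = integral (cbox (0 + axis i \<tau>) (b + axis i \<tau>) \<inter> {x. x \<bullet> axis i 1 \<le> 2 * pi}) g +
      integral (cbox (0 + axis i \<tau>) (b + axis i \<tau>) \<inter> {x. x \<bullet> axis i 1 \<ge> 2 * pi}) g"
    by (rule integral_split[OF int k])
  also have "cbox (0 + axis i \<tau>) (b + axis i \<tau>) \<inter> {x. x \<bullet> axis i 1 \<le> 2 * pi} =
      cbox 0 b \<inter> {x. x \<bullet> axis i 1 \<ge> \<tau>}"
    by (rule set_eqI) (use \<tau> in \<open>auto simp: mem_cbox_cart_split[of _ _ _ i] b_def ip axn\<close>)
  also have "cbox (0 + axis i \<tau>) (b + axis i \<tau>) \<inter> {x. x \<bullet> axis i 1 \<ge> 2 * pi} =
      cbox (0 + axis i (2 * pi)) (b' + axis i (2 * pi))"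
    by (rule set_eqI) (use \<tau> in \<open>auto simp: mem_cbox_cart_split[of _ _ _ i] b_def b'_def ip axn\<close>)
  also have "integral (cbox (0 + axis i (2 * pi)) (b' + axis i (2 * pi))) g = integral (cbox 0 b') g"
    using integral_shift_cbox_plus[of 0 b' g "axis i (2 * pi)"] per by (simp add: comp_def add.commute)
  also have "cbox 0 b' = cbox 0 b \<inter> {x. x \<bullet> axis i 1 \<le> \<tau>}"
    by (rule set_eqI) (use \<tau> in \<open>auto simp: mem_cbox_cart_split[of _ _ _ i] b_def b'_def ip axn\<close>)
  also have "integral (cbox 0 b \<inter> {x. x \<bullet> axis i 1 \<ge> \<tau>}) g + integral (cbox 0 b \<inter> {x. x \<bullet> axis i 1 \<le> \<tau>}) g
      = integral (cbox 0 b) g"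
    using integral_split[OF int k, of 0 b \<tau>] by simp
  finally show ?thesis by (simp add: b_def)
qed

lemma integral_period_box_shift:
  fixes g :: "real ^ 'm \<Rightarrow> complex"
  assumes cont: "continuous_on UNIV g" and per: "\<And>x. g (x + axis i (2 * pi)) = g x"
    and \<tau>: "\<bar>\<tau>\<bar> \<le> 2 * pi"
  shows "integral period_box (\<lambda>x. g (x + axis i \<tau>)) = integral period_box g"
proof (cases "0 \<le> \<tau>")
  case True
  then show ?thesis using integral_period_box_shift_nonneg[OF cont per] \<tau> by simp
next
  case False
  have "integral period_box (\<lambda>x. g ((x + axis i (- \<tau>)) + axis i \<tau>)) = integral period_box (\<lambda>x. g (x + axis i \<tau>))"
  proof (rule integral_period_box_shift_nonneg)
    show "continuous_on UNIV (\<lambda>x. g (x + axis i \<tau>))"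
      by (intro continuous_on_compose2[OF cont] continuous_intros) auto
    show "g (x + axis i (2 * pi) + axis i \<tau>) = g (x + axis i \<tau>)" for x
      using per[of "x + axis i \<tau>"] by (simp add: algebra_simps)
  qed (use False \<tau> in auto)
  moreover have "x + axis i (- \<tau>) + axis i \<tau> = x" for x :: "real ^ 'm"
    by (simp add: vec_eq_iff axis_def)
  ultimately show ?thesis by simp
qed

lemma continuous_on_has_sum:
  fixes f :: "'i \<Rightarrow> 'a :: topological_space \<Rightarrow> complex"
  assumes "\<And>i x. x \<in> Y \<Longrightarrow> norm (f i x) \<le> M i" "M summable_on UNIV"
    and cont: "\<And>i. continuous_on Y (f i)"
    and "\<And>x. x \<in> Y \<Longrightarrow> ((\<lambda>i. f i x) has_sum S x) UNIV"
  shows "continuous_on Y S"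
proof (rule uniform_limit_theorem)
  show "uniform_limit Y (\<lambda>X y. \<Sum>i\<in>X. f i y) S (finite_subsets_at_top UNIV)"
    by (rule Weierstrass_m_test_general'[of UNIV _ f M]) (use assms in auto)
qed (auto intro!: continuous_on_sum cont)

lemma has_sum_integral_cbox:
  fixes f :: "'i \<Rightarrow> 'a :: euclidean_space \<Rightarrow> complex"
  assumes bd: "\<And>i x. x \<in> cbox a b \<Longrightarrow> norm (f i x) \<le> M i" and M: "M summable_on UNIV"
    and cont: "\<And>i. continuous_on (cbox a b) (f i)"
    and S: "\<And>x. x \<in> cbox a b \<Longrightarrow> ((\<lambda>i. f i x) has_sum S x) UNIV"
  shows "((\<lambda>i. integral (cbox a b) (f i)) has_sum integral (cbox a b) S) UNIV"
proof -
  have u: "uniform_limit (cbox a b) (\<lambda>X y. \<Sum>i\<in>X. f i y) S (finite_subsets_at_top UNIV)"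
    by (rule Weierstrass_m_test_general'[of UNIV _ f M]) (use bd M S in auto)
  have c: "continuous_on (cbox a b) (\<lambda>y. \<Sum>i\<in>X. f i y)" for X
    by (intro continuous_on_sum cont)
  obtain I J where IJ: "\<And>X. ((\<lambda>y. \<Sum>i\<in>X. f i y) has_integral I X) (cbox a b)"
    "(S has_integral J) (cbox a b)" "(I \<longlongrightarrow> J) (finite_subsets_at_top UNIV)"
    by (rule uniform_limit_integral_cbox[OF u c finite_subsets_at_top_neq_bot]) (rule that)
  have "I X = (\<Sum>i\<in>X. integral (cbox a b) (f i))" if "finite X" for X
  proof -
    have "((\<lambda>y. \<Sum>i\<in>X. f i y) has_integral (\<Sum>i\<in>X. integral (cbox a b) (f i))) (cbox a b)"
      by (intro has_integral_sum that integrable_integral integrable_continuous cont)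
    then show ?thesis using IJ(1) has_integral_unique by blast
  qed
  then have "eventually (\<lambda>X. I X = (\<Sum>i\<in>X. integral (cbox a b) (f i))) (finite_subsets_at_top UNIV)"
    by (simp add: eventually_finite_subsets_at_top_weakI)
  then have "((\<lambda>X. \<Sum>i\<in>X. integral (cbox a b) (f i)) \<longlongrightarrow> J) (finite_subsets_at_top UNIV)"
    using IJ(3) by (rule Lim_transform_eventually[rotated])
  then show "((\<lambda>i. integral (cbox a b) (f i)) has_sum integral (cbox a b) S) UNIV"
    using IJ(2) by (simp add: has_sum_def integral_unique)
qed

lemma has_sum_Suc_tail:
  fixes f :: "nat \<Rightarrow> 'a :: banach"
  assumes "(f has_sum S) UNIV"
  shows "((\<lambda>n. f (Suc n)) has_sum (S - f 0)) UNIV"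
proof -
  have "(\<lambda>n. f (Suc n)) sums (S - f 0)"
    using has_sum_imp_sums[OF assms] by (simp add: sums_Suc_iff)
  moreover have "f summable_on range Suc"
    by (rule summable_on_subset_banach[OF has_sum_imp_summable[OF assms]]) simp
  then have "(\<lambda>n. f (Suc n)) summable_on UNIV" by (simp add: summable_on_reindex comp_def)
  then have "((\<lambda>n. f (Suc n)) has_sum (\<Sum>\<^sub>\<infinity>n. f (Suc n))) UNIV" by simp
  ultimately show ?thesis using has_sum_imp_sums sums_unique2 by metis
qed

lemma has_sum_half_powers: "((\<lambda>n. (1 / 2 :: real) ^ n) has_sum 2) UNIV"
  using sums_nonneg_imp_has_sum[of "\<lambda>n. (1 / 2 :: real) ^ n" 2] geometric_sums[of "1 / 2 :: real"] by simp

section \<open>Continuity of Taylor coefficients in a parameter\<close>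

text \<open>The constant term is the uniform limit of \<open>G r\<close> as \<open>r\<close> tends
  to 0, because the tail is at most \<open>r * 2 C / t\<close>. Radii are positive so that the
  induction for higher coefficients may divide by \<open>r\<close>.\<close>

lemma powser_coeff0_continuous:
  fixes b :: "nat \<Rightarrow> 'a :: topological_space \<Rightarrow> real"
  assumes t: "0 < t" and bd: "\<And>n x. \<bar>b n x\<bar> * t ^ n \<le> C"
    and cont: "\<And>r. 0 < r \<Longrightarrow> r \<le> t \<Longrightarrow> continuous_on UNIV (G r)"
    and G: "\<And>r x. 0 < r \<Longrightarrow> r \<le> t \<Longrightarrow> ((\<lambda>n. b n x * r ^ n) has_sum G r x) UNIV"
  shows "continuous_on UNIV (b 0)"
proof -
  have C: "0 \<le> C" using bd[of 0 undefined] by simp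
  have est: "\<bar>G r x - b 0 x\<bar> \<le> r * (2 * C / t)" if r: "0 < r" "r \<le> t / 2" for r x
  proof -
    have rt: "r \<le> t" using r t by simp
    have 1: "((\<lambda>n. b (Suc n) x * r ^ Suc n) has_sum (G r x - b 0 x)) UNIV"
      using has_sum_Suc_tail[OF G[OF r(1) rt, of x]] by simp
    have 2: "((\<lambda>n. r * (C / t) * (1 / 2) ^ n) has_sum (r * (C / t) * 2)) UNIV"
      by (rule has_sum_cmult_right[OF has_sum_half_powers])
    have "norm (b (Suc n) x * r ^ Suc n) \<le> r * (C / t) * (1 / 2) ^ n" for n
    proof -
      have "\<bar>b (Suc n) x\<bar> \<le> C / t ^ Suc n" using bd[of "Suc n" x] t by (simp add: pos_le_divide_eq)
      then have "\<bar>b (Suc n) x\<bar> * r ^ Suc n \<le> C / t ^ Suc n * r ^ Suc n"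
        using r by (intro mult_right_mono) auto
      also have "\<dots> = r * (C / t) * (r / t) ^ n" by (simp add: power_divide)
      also have "\<dots> \<le> r * (C / t) * (1 / 2) ^ n"
        using r t C by (intro mult_left_mono power_mono) (auto simp: field_simps)
      finally show ?thesis using r by (simp add: abs_mult)
    qed
    then have "norm (G r x - b 0 x) \<le> r * (C / t) * 2"
      by (intro norm_infsum_le[OF 1 2]) auto
    then show ?thesis by (simp add: mult_ac)
  qed
  have tj: "0 < t / (real j + 2)" "t / (real j + 2) \<le> t / 2" "t / (real j + 2) \<le> t" for j
    using t by (auto simp: field_simps)
  have "uniform_limit UNIV (\<lambda>j x. G (t / (real j + 2)) x) (b 0) sequentially"
  proof (rule uniform_limitI)
    fix e :: real assume e: "e > 0"
    have "(\<lambda>j. t / (real j + 2) * (2 * C / t)) \<longlonglongrightarrow> 0" by real_asymp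
    then have "eventually (\<lambda>j. t / (real j + 2) * (2 * C / t) < e) sequentially"
      using e order_tendstoD(2) by blast
    then show "eventually (\<lambda>j. \<forall>x\<in>UNIV. dist (G (t / (real j + 2)) x) (b 0 x) < e) sequentially"
    proof eventually_elim
      case (elim j)
      show ?case using est[OF tj(1,2)[of j]] elim unfolding dist_real_def by (blast intro: le_less_trans)
    qed
  qed
  then show ?thesis
    by (rule uniform_limit_theorem[rotated]) (use cont tj in auto)
qed

lemma powser_coeff_continuous:
  fixes b :: "nat \<Rightarrow> 'a :: topological_space \<Rightarrow> real"
  assumes t: "0 < t" and bd: "\<And>n x. \<bar>b n x\<bar> * t ^ n \<le> C"
    and cont: "\<And>r. 0 < r \<Longrightarrow> r \<le> t \<Longrightarrow> continuous_on UNIV (G r)"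
    and G: "\<And>r x. 0 < r \<Longrightarrow> r \<le> t \<Longrightarrow> ((\<lambda>n. b n x * r ^ n) has_sum G r x) UNIV"
  shows "continuous_on UNIV (b n)"
  using bd cont G
proof (induction n arbitrary: b C G)
  case 0
  show ?case by (rule powser_coeff0_continuous[OF t 0])
next
  case (Suc n b C G)
  have b0: "continuous_on UNIV (b 0)" by (rule powser_coeff0_continuous[OF t Suc.prems])
  show ?case
  proof (rule Suc.IH[where C = "C / t" and G = "\<lambda>r x. (G r x - b 0 x) / r"])
    show "\<bar>b (Suc n) x\<bar> * t ^ n \<le> C / t" for n x
      using Suc.prems(1)[of "Suc n" x] t by (simp add: field_simps)
    show "continuous_on UNIV (\<lambda>x. (G r x - b 0 x) / r)" if "0 < r" "r \<le> t" for r
      using that by (intro continuous_intros b0 Suc.prems(2)) auto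
    show "((\<lambda>n. b (Suc n) x * r ^ n) has_sum (G r x - b 0 x) / r) UNIV" if r: "0 < r" "r \<le> t" for r x
    proof -
      have "((\<lambda>n. b (Suc n) x * r ^ Suc n * inverse r) has_sum (G r x - b 0 x) * inverse r) UNIV"
        using has_sum_cmult_left[OF has_sum_Suc_tail[OF Suc.prems(3)[OF r, of x]], of "inverse r"] by simp
      then show ?thesis using r(1) by (simp add: field_simps)
    qed
  qed
qed

section \<open>Fourier coefficients: orthogonality, decay and uniqueness\<close>

definition fourier :: "(int ^ 'm) \<Rightarrow> (real ^ 'm \<Rightarrow> complex) \<Rightarrow> complex" where
  "fourier k g = integral period_box (\<lambda>x. g x * cis (- int_inner k x)) / of_real ((2 * pi) ^ CARD('m))"

lemma content_period_box: "measure lborel (period_box :: (real ^ 'm) set) = (2 * pi) ^ CARD('m)"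
proof -
  have "(0 :: real ^ 'm) \<in> period_box" by (simp add: mem_box_cart)
  then have "(period_box :: (real ^ 'm) set) \<noteq> {}" by blast
  then show ?thesis by (simp add: content_cbox_cart)
qed

lemma continuous_on_int_inner [continuous_intros]:
  "continuous_on A g \<Longrightarrow> continuous_on A (\<lambda>x. int_inner k (g x))"
  unfolding int_inner_def by (intro continuous_intros)

lemma norm_fourier_le:
  fixes g :: "real ^ 'm \<Rightarrow> complex"
  assumes cont: "continuous_on UNIV g" and bd: "\<And>x. norm (g x) \<le> C"
  shows "norm (fourier k g) \<le> C"
proof -
  have C: "0 \<le> C" using bd[of 0] norm_ge_zero order_trans by blast
  have "continuous_on period_box (\<lambda>x. g x * cis (- int_inner k x))"
    by (intro continuous_intros continuous_on_subset[OF cont]) auto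
  then have "((\<lambda>x. g x * cis (- int_inner k x)) has_integral
      integral period_box (\<lambda>x. g x * cis (- int_inner k x))) period_box"
    by (intro integrable_integral integrable_continuous)
  from has_integral_bound[OF C this] bd
  have "norm (integral period_box (\<lambda>x. g x * cis (- int_inner k x))) \<le> C * (2 * pi) ^ CARD('m)"
    by (simp add: norm_mult content_period_box)
  moreover have "norm (complex_of_real ((2 * pi) ^ CARD('m))) = (2 * pi) ^ CARD('m)"
    by (simp only: norm_of_real) simp
  ultimately show ?thesis unfolding fourier_def norm_divide by (simp add: pos_divide_le_eq)
qed

lemma cis_int_inner_axis: "cis (int_inner k (x + axis i \<tau>)) = cis (int_inner k x) * cis (of_int (k $ i) * \<tau>)"
  by (simp add: int_inner_add_right int_inner_axis cis_mult)

lemma cis_int_inner_periodic: "cis (int_inner k (x + axis i (2 * pi))) = cis (int_inner k x)"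
  unfolding cis_int_inner_axis using cis_multiple_2pi[of "of_int (k $ i)"] by (simp add: mult.commute)

lemma fourier_shift:
  fixes g :: "real ^ 'm \<Rightarrow> complex"
  assumes cont: "continuous_on UNIV g" and per: "\<And>x i. g (x + axis i (2 * pi)) = g x"
    and \<tau>: "\<bar>\<tau>\<bar> \<le> 2 * pi"
  shows "fourier k (\<lambda>x. g (x + axis i \<tau>)) = cis (of_int (k $ i) * \<tau>) * fourier k g"
proof -
  let ?h = "\<lambda>x. g x * cis (- int_inner k x)"
  have e: "cis (- int_inner k x) = cis (int_inner (- k) x)" for x by simp
  have "integral period_box (\<lambda>x. ?h (x + axis i \<tau>)) = integral period_box ?h"
  proof (rule integral_period_box_shift[OF _ _ \<tau>])
    show "continuous_on UNIV ?h" by (intro continuous_intros cont)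
    show "?h (x + axis i (2 * pi)) = ?h x" for x unfolding e cis_int_inner_periodic by (simp add: per)
  qed
  moreover have "g (x + axis i \<tau>) * cis (- int_inner k x) = cis (of_int (k $ i) * \<tau>) * ?h (x + axis i \<tau>)" for x
  proof -
    have "cis (- int_inner k x) = cis (of_int (k $ i) * \<tau>) * cis (- int_inner k (x + axis i \<tau>))"
      unfolding int_inner_add_right int_inner_axis by (simp add: cis_mult)
    then show ?thesis by (simp only: mult.left_commute)
  qed
  ultimately show ?thesis unfolding fourier_def by (simp only: integral_mult_right times_divide_eq_right)
qed

lemma fourier_cmult: "fourier k (\<lambda>x. a * g x) = a * fourier k g"
  unfolding fourier_def mult.assoc by (simp only: integral_mult_right times_divide_eq_right)

lemma fourier_cis:
  fixes k l :: "int ^ 'm"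
  shows "fourier k (\<lambda>x. cis (int_inner l x)) = (if k = l then 1 else 0)"
proof (cases "k = l")
  case True
  have "((\<lambda>x :: real ^ 'm. 1 :: complex) has_integral measure lborel (period_box :: (real ^ 'm) set) *\<^sub>R 1) period_box"
    by (rule has_integral_const)
  then have "integral (period_box :: (real ^ 'm) set) (\<lambda>x. 1 :: complex) = of_real ((2 * pi) ^ CARD('m))"
    unfolding content_period_box scaleR_conv_of_real by (simp only: mult_1_right integral_unique)
  moreover have "complex_of_real ((2 * pi) ^ CARD('m)) \<noteq> 0" by simp
  ultimately show ?thesis using True unfolding fourier_def by (simp add: cis_mult del: of_real_power of_real_mult)
next
  case False
  then obtain i where i: "k $ i \<noteq> l $ i" by (auto simp: vec_eq_iff)
  define d where "d = real_of_int (l $ i - k $ i)"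
  have d: "\<bar>d\<bar> \<ge> 1" "d \<noteq> 0" using i by (auto simp: d_def)
  \<comment> \<open>Half a period of the frequency difference in direction \<open>i\<close>:
    shifting by it multiplies the coefficient by \<open>cis (k_i \<tau>)\<close> on one count and by
    the negative of this on the other, so the coefficient is 0.\<close>
  define \<tau> where "\<tau> = pi / d"
  have \<tau>: "\<bar>\<tau>\<bar> \<le> 2 * pi"
  proof -
    have "\<bar>\<tau>\<bar> = pi / \<bar>d\<bar>" by (simp add: \<tau>_def)
    also have "\<dots> \<le> pi / 1" using d by (intro divide_left_mono) auto
    finally show ?thesis using pi_gt_zero by linarith
  qed
  let ?g = "\<lambda>x :: real ^ 'm. cis (int_inner l x)"
  have "fourier k (\<lambda>x. ?g (x + axis i \<tau>)) = cis (of_int (k $ i) * \<tau>) * fourier k ?g"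
    by (rule fourier_shift[OF _ cis_int_inner_periodic \<tau>]) (intro continuous_intros)
  moreover have "fourier k (\<lambda>x. ?g (x + axis i \<tau>)) = cis (of_int (l $ i) * \<tau>) * fourier k ?g"
    unfolding cis_int_inner_axis by (simp add: mult.commute[of "cis (int_inner l _)"] fourier_cmult)
  moreover have "cis (of_int (l $ i) * \<tau>) = - cis (of_int (k $ i) * \<tau>)"
  proof -
    have "of_int (l $ i) * \<tau> = of_int (k $ i) * \<tau> + pi" using d by (simp add: \<tau>_def d_def field_simps)
    then show ?thesis by (simp add: cis_mult[symmetric])
  qed
  ultimately have "fourier k ?g = 0" using cis_neq_zero[of "of_int (k $ i) * \<tau>"] by (auto simp: eq_neg_iff_add_eq_0)
  then show ?thesis using False by simp
qed

lemma fourier_has_sum: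
  fixes f :: "'i \<Rightarrow> real ^ 'm \<Rightarrow> complex"
  assumes bd: "\<And>i x. norm (f i x) \<le> M i" and M: "M summable_on UNIV"
    and cont: "\<And>i. continuous_on UNIV (f i)"
    and S: "\<And>x. ((\<lambda>i. f i x) has_sum S x) UNIV"
  shows "((\<lambda>i. fourier k (f i)) has_sum fourier k S) UNIV"
proof -
  have "((\<lambda>i. integral period_box (\<lambda>x. f i x * cis (- int_inner k x))) has_sum
      integral period_box (\<lambda>x. S x * cis (- int_inner k x))) UNIV"
  proof (rule has_sum_integral_cbox[OF _ M])
    show "continuous_on period_box (\<lambda>x. f i x * cis (- int_inner k x))" for i
      by (intro continuous_intros continuous_on_subset[OF cont]) auto
    show "((\<lambda>i. f i x * cis (- int_inner k x)) has_sum S x * cis (- int_inner k x)) UNIV" for x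
      by (rule has_sum_cmult_left[OF S])
  qed (use bd in \<open>simp add: norm_mult\<close>)
  from has_sum_cmult_left[OF this, of "1 / of_real ((2 * pi) ^ CARD('m))"]
  show ?thesis by (simp add: fourier_def)
qed

text \<open>No integration by parts: the \<open>k\<close>-th coefficient of the translate by
  \<open>\<tau>\<close> in direction \<open>i\<close> is \<open>cis (k_i \<tau>)\<close> times that
  of \<open>h\<close>, and also a power series in \<open>\<tau>\<close> formed from the coefficients
  of \<open>A i l\<close>. Comparing powers gives \<open>|c| |k_i|^l t^l / l! <= K\<close>, and
  summation against \<open>(1/2)^l\<close> yields exponential decay in \<open>|k_i|\<close>.\<close>

lemma fourier_decay:
  fixes h :: "real ^ 'm \<Rightarrow> real" and A :: "'m \<Rightarrow> nat \<Rightarrow> real ^ 'm \<Rightarrow> real"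
  assumes t: "0 < t" and cont: "continuous_on UNIV h"
    and per: "\<And>x i. h (x + axis i (2 * pi)) = h x"
    and bd: "\<And>i l x. \<bar>A i l x\<bar> * t ^ l \<le> K"
    and ex: "\<And>i x \<tau>. \<bar>\<tau>\<bar> \<le> t \<Longrightarrow> ((\<lambda>l. A i l x * \<tau> ^ l) has_sum h (x + axis i \<tau>)) UNIV"
  shows "norm (fourier k (\<lambda>x. of_real (h x))) * exp (t / (2 * CARD('m)) * l1_norm k) \<le> 2 * K"
proof -
  let ?h = "\<lambda>x. complex_of_real (h x)"
  define c where "c = fourier k ?h"
  have K: "0 \<le> K" using bd[of undefined 0 undefined] by simp
  have ch: "continuous_on UNIV (\<lambda>x. h (x + axis i \<tau>))" for i \<tau>
    by (intro continuous_on_compose2[OF cont] continuous_intros) auto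
  have cA: "continuous_on UNIV (A i l)" for i l
    by (rule powser_coeff_continuous[OF t bd, where G = "\<lambda>\<tau> x. h (x + axis i \<tau>)"])
       (use ch ex t in auto)
  \<comment> \<open>\<open>t / 2\<close> gives a geometric majorant, and 1 keeps the shift within a
    period.\<close>
  define \<rho> where "\<rho> = min (t / 2) 1"
  have \<rho>: "0 < \<rho>" "\<rho> \<le> t / 2" "\<rho> \<le> 1" using t by (auto simp: \<rho>_def)
  define a where "a i l = fourier k (\<lambda>x. complex_of_real (A i l x)) -
    c * (\<i> * of_real (of_int (k $ i))) ^ l / fact l" for i l
  have sum_a: "((\<lambda>l. a i l * of_real (\<tau> ^ l)) has_sum 0) UNIV" if \<tau>: "\<bar>\<tau>\<bar> \<le> \<rho>" for i \<tau>
  proof -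
    have "((\<lambda>l. fourier k (\<lambda>x. complex_of_real (A i l x * \<tau> ^ l))) has_sum
        fourier k (\<lambda>x. ?h (x + axis i \<tau>))) UNIV"
    proof (rule fourier_has_sum)
      show "norm (complex_of_real (A i l x * \<tau> ^ l)) \<le> K * (1 / 2) ^ l" for l x
      proof -
        have "norm (complex_of_real (A i l x * \<tau> ^ l)) = \<bar>A i l x\<bar> * \<bar>\<tau>\<bar> ^ l"
          by (simp only: norm_of_real abs_mult power_abs)
        also have "\<dots> \<le> \<bar>A i l x\<bar> * (t / 2) ^ l"
          using \<tau> \<rho> by (intro mult_left_mono power_mono) auto
        also have "\<dots> = (\<bar>A i l x\<bar> * t ^ l) * (1 / 2) ^ l" by (simp add: power_divide)
        also have "\<dots> \<le> K * (1 / 2) ^ l" by (intro mult_right_mono bd) auto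
        finally show ?thesis .
      qed
      show "(\<lambda>l. K * (1 / 2) ^ l) summable_on (UNIV :: nat set)"
        using has_sum_cmult_right[OF has_sum_half_powers] has_sum_imp_summable by blast
      show "continuous_on UNIV (\<lambda>x. complex_of_real (A i l x * \<tau> ^ l))" for l
        by (intro continuous_intros cA)
      show "((\<lambda>l. complex_of_real (A i l x * \<tau> ^ l)) has_sum ?h (x + axis i \<tau>)) UNIV" for x
        by (rule has_sum_of_real[OF ex]) (use \<tau> \<rho> t in linarith)
    qed
    also have "fourier k (\<lambda>x. ?h (x + axis i \<tau>)) = cis (of_int (k $ i) * \<tau>) * c"
      unfolding c_def
    proof (rule fourier_shift)
      show "continuous_on UNIV ?h" by (intro continuous_intros cont)
      show "\<bar>\<tau>\<bar> \<le> 2 * pi" using \<tau> \<rho> pi_gt3 by linarith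
    qed (simp add: per)
    moreover have "fourier k (\<lambda>x. complex_of_real (A i l x * \<tau> ^ l)) =
        fourier k (\<lambda>x. complex_of_real (A i l x)) * of_real (\<tau> ^ l)" for l
      using fourier_cmult[of k "complex_of_real (\<tau> ^ l)" "\<lambda>x. complex_of_real (A i l x)"]
      by (simp only: of_real_mult mult.commute)
    ultimately have 1: "((\<lambda>l. fourier k (\<lambda>x. complex_of_real (A i l x)) * of_real (\<tau> ^ l)) has_sum
        cis (of_int (k $ i) * \<tau>) * c) UNIV"
      by simp
    have 2: "((\<lambda>l. (\<i> * of_real (of_int (k $ i) * \<tau>)) ^ l / fact l * c) has_sum
        cis (of_int (k $ i) * \<tau>) * c) UNIV"
      unfolding cis_conv_exp by (rule has_sum_cmult_left[OF has_sum_exp])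
    have 3: "(\<i> * of_real (of_int (k $ i) * \<tau>)) ^ l / fact l * c =
        c * (\<i> * of_real (of_int (k $ i))) ^ l / fact l * of_real (\<tau> ^ l)" for l
      by (simp add: power_mult_distrib)
    show ?thesis using has_sum_minus[OF 1 2] unfolding 3 a_def by (simp add: algebra_simps)
  qed
  have a0: "a i l = 0" for i l
  proof (rule powser_order[of \<rho> "a i" "\<lambda>_. 0" "\<lambda>j. \<rho> / (real j + 2)" 0 "Suc l"])
    have "(\<lambda>l. a i l * of_real (\<rho> ^ l)) summable_on UNIV"
      using sum_a[of \<rho> i] \<rho> has_sum_imp_summable by (metis abs_of_pos order_refl)
    then have "(\<lambda>l. norm (a i l * of_real (\<rho> ^ l))) summable_on UNIV"
      by (simp only: summable_on_iff_abs_summable_on_complex)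
    then show "(\<lambda>l. norm (a i l) * \<rho> ^ l) summable_on UNIV"
      using \<rho> by (simp add: norm_mult norm_power)
    show "(\<lambda>j. \<rho> / (real j + 2)) \<longlonglongrightarrow> 0" by real_asymp
    show "\<rho> / (real j + 2) \<noteq> 0" for j using \<rho> by simp
  qed (use sum_a \<rho> in auto)
  have cb: "norm c * (\<bar>of_int (k $ i)\<bar> ^ l / fact l) * t ^ l \<le> K" for i l
  proof -
    have "fourier k (\<lambda>x. complex_of_real (A i l x)) = c * (\<i> * of_real (of_int (k $ i))) ^ l / fact l"
      using a0[of i l] by (simp add: a_def)
    then have "norm c * (\<bar>of_int (k $ i)\<bar> ^ l / fact l) = norm (fourier k (\<lambda>x. complex_of_real (A i l x)))"
      by (simp add: norm_mult norm_divide norm_power)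
    also have "\<dots> \<le> K / t ^ l"
      by (rule norm_fourier_le)
         (use bd t in \<open>auto intro!: continuous_intros cA simp: pos_le_divide_eq\<close>)
    finally show ?thesis using t by (simp add: field_simps)
  qed
  \<comment> \<open>The largest component of \<open>k\<close> carries at least the fraction
    \<open>1 / CARD('m)\<close> of \<open>l1_norm k\<close>.\<close>
  have "Max (range (\<lambda>j. \<bar>k $ j\<bar>)) \<in> range (\<lambda>j. \<bar>k $ j\<bar>)" by (intro Max_in) auto
  then obtain i where "Max (range (\<lambda>j. \<bar>k $ j\<bar>)) = \<bar>k $ i\<bar>" by blast
  then have i: "\<bar>k $ j\<bar> \<le> \<bar>k $ i\<bar>" for j using Max_ge[of "range (\<lambda>j. \<bar>k $ j\<bar>)" "\<bar>k $ j\<bar>"] by simp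
  have l1: "l1_norm k \<le> CARD('m) * \<bar>real_of_int (k $ i)\<bar>"
  proof -
    have "\<bar>real_of_int (k $ j)\<bar> \<le> \<bar>real_of_int (k $ i)\<bar>" for j
      using i[of j] by (metis of_int_abs of_int_le_iff)
    then show ?thesis unfolding l1_norm_def using sum_bounded_above[of UNIV "\<lambda>j. \<bar>real_of_int (k $ j)\<bar>"] by simp
  qed
  have "((\<lambda>l. norm c * ((\<bar>of_int (k $ i)\<bar> * (t / 2)) ^ l / fact l)) has_sum
      norm c * exp (\<bar>of_int (k $ i)\<bar> * (t / 2))) UNIV"
    by (rule has_sum_cmult_right[OF has_sum_exp])
  moreover have "((\<lambda>l. K * (1 / 2) ^ l) has_sum K * 2) (UNIV :: nat set)"
    by (rule has_sum_cmult_right[OF has_sum_half_powers])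
  moreover have "norm c * ((\<bar>of_int (k $ i)\<bar> * (t / 2)) ^ l / fact l) \<le> K * (1 / 2) ^ l" for l
  proof -
    have "norm c * ((\<bar>of_int (k $ i)\<bar> * (t / 2)) ^ l / fact l) =
        (norm c * (\<bar>of_int (k $ i)\<bar> ^ l / fact l) * t ^ l) * (1 / 2) ^ l"
      by (simp add: power_mult_distrib power_divide mult_ac)
    also have "\<dots> \<le> K * (1 / 2) ^ l" by (intro mult_right_mono cb) auto
    finally show ?thesis .
  qed
  ultimately have "norm c * exp (\<bar>of_int (k $ i)\<bar> * (t / 2)) \<le> K * 2"
    by (rule has_sum_mono)
  moreover have "exp (t / (2 * CARD('m)) * l1_norm k) \<le> exp (\<bar>of_int (k $ i)\<bar> * (t / 2))"
  proof -
    have "t / (2 * CARD('m)) * l1_norm k \<le> t / (2 * CARD('m)) * (CARD('m) * \<bar>real_of_int (k $ i)\<bar>)"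
      using t l1 by (intro mult_left_mono) auto
    then show ?thesis by (simp add: field_simps)
  qed
  ultimately show ?thesis unfolding c_def[symmetric]
    by (smt (verit, best) mult_left_mono norm_ge_zero)
qed

text \<open>The sum factors into two-sided geometric series, one for each coordinate.\<close>

lemma summable_exp_l1_norm:
  assumes s: "0 < s"
  shows "(\<lambda>k :: int ^ 'm. exp (- s * l1_norm k)) summable_on UNIV"
proof -
  define q where "q = exp (- s)"
  have q: "0 < q" "q < 1" using s by (auto simp: q_def)
  have nat: "(\<lambda>n :: nat. q ^ n) summable_on UNIV"
    using summable_nonneg_imp_summable_on[of "\<lambda>n. q ^ n"] q by (simp add: summable_geometric)
  define f where "f z = q ^ nat \<bar>z\<bar>" for z :: int
  have "f summable_on (range int \<union> range (\<lambda>n. - int n))"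
  proof (rule summable_on_union)
    show "f summable_on range int" using nat by (subst summable_on_reindex) (auto simp: comp_def f_def)
    show "f summable_on range (\<lambda>n. - int n)"
      using nat by (subst summable_on_reindex) (auto simp: comp_def f_def inj_on_def)
  qed
  also have "range int \<union> range (\<lambda>n. - int n) = UNIV"
    by (auto intro: int_cases2)
  finally have f: "f summable_on UNIV" .
  have "(\<lambda>g. norm (\<Prod>i\<in>(UNIV :: 'm set). f (g i))) summable_on PiE UNIV (\<lambda>_. UNIV)"
  proof (rule has_sum_prod_PiE[THEN conjunct2])
    have "norm (f z) = f z" for z using q by (simp add: f_def)
    then show "(\<lambda>z. norm (f z)) summable_on UNIV" using f by simp
    show "(f has_sum infsum f UNIV) UNIV" using f by simp
  qed simp
  then have "(\<lambda>g. \<Prod>i\<in>(UNIV :: 'm set). f (g i)) summable_on UNIV"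
    using q by (simp add: f_def PiE_UNIV_domain abs_prod)
  then have "(\<lambda>k :: int ^ 'm. \<Prod>i\<in>(UNIV :: 'm set). f (k $ i)) summable_on UNIV"
    using summable_on_reindex_bij_betw[of "vec_nth" UNIV UNIV "\<lambda>g. \<Prod>i\<in>(UNIV :: 'm set). f (g i)"]
    by (simp add: bij_betw_def inj_on_def vec_nth_inject surj_def) (metis vec_lambda_beta ext)
  moreover have "(\<Prod>i\<in>(UNIV :: 'm set). f (k $ i)) = exp (- s * l1_norm k)" for k
  proof -
    have "f z = exp (- s * \<bar>real_of_int z\<bar>)" for z
      by (simp add: f_def q_def exp_of_nat_mult[symmetric] mult.commute)
    then show ?thesis by (simp add: l1_norm_def exp_sum sum_distrib_left flip: sum_negf)
  qed
  ultimately show ?thesis by simp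
qed

text \<open>Pairing with powers of a trigonometric polynomial that peaks at \<open>a\<close> isolates the value \<open>E a\<close>.\<close>

lemma fourier_unique_interior:
  fixes E :: "real ^ 'm \<Rightarrow> complex"
  assumes cont: "continuous_on UNIV E" and zero: "\<And>k. fourier k E = 0"
    and a: "\<And>j. 0 < a $ j" "\<And>j. a $ j < 2 * pi"
  shows "E a = 0"
proof (rule ccontr)
  assume nz: "E a \<noteq> 0"
  \<comment> \<open>Weights \<open>P\<close> for which all Fourier coefficients of
    \<open>E * P\<close> vanish. The constant 1 is one of them, and multiplication by the
    trigonometric polynomial \<open>w j\<close> preserves the property.\<close>
  define Z where "Z P \<longleftrightarrow> (\<forall>k. ((\<lambda>x. E x * of_real (P x) * cis (int_inner k x)) has_integral 0) period_box)"
    for P :: "real ^ 'm \<Rightarrow> real"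
  define w where "w j x = (1 + cos (x $ j - a $ j)) / 2" for j and x :: "real ^ 'm"
  have Z1: "Z (\<lambda>x. 1)"
    unfolding Z_def
  proof
    fix k
    have "integral period_box (\<lambda>x. E x * cis (- int_inner (- k) x)) = 0"
      using zero[of "- k"] by (simp add: fourier_def)
    moreover have "(\<lambda>x. E x * cis (- int_inner (- k) x)) integrable_on period_box"
      by (intro integrable_continuous continuous_intros continuous_on_subset[OF cont]) auto
    ultimately show "((\<lambda>x. E x * of_real 1 * cis (int_inner k x)) has_integral 0) period_box"
      by (simp add: has_integral_iff)
  qed
  have Zw: "Z (\<lambda>x. P x * w j x)" if "Z P" for P j
    unfolding Z_def
  proof
    fix k
    let ?I = "\<lambda>k x. E x * of_real (P x) * cis (int_inner k x)"
    have I: "(?I k has_integral 0) period_box" for k using that unfolding Z_def by blast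
    have "((\<lambda>x. 1 / 2 * ?I k x + cis (- (a $ j)) / 4 * ?I (k + axis j 1) x + cis (a $ j) / 4 * ?I (k + axis j (- 1)) x)
        has_integral 1 / 2 * 0 + cis (- (a $ j)) / 4 * 0 + cis (a $ j) / 4 * 0) period_box"
      by (intro has_integral_add has_integral_mult_right I)
    moreover have "1 / 2 * ?I k x + cis (- (a $ j)) / 4 * ?I (k + axis j 1) x + cis (a $ j) / 4 * ?I (k + axis j (- 1)) x
        = E x * of_real (P x * w j x) * cis (int_inner k x)" for x
    proof -
      have ia: "int_inner (axis j c) x = of_int c * x $ j" for c
        by (simp add: int_inner_def axis_def if_distrib[of "\<lambda>u. u * _"] if_distrib[of real_of_int] cong: if_cong)
      have 1: "cis (int_inner (k + axis j 1) x) = cis (int_inner k x) * cis (x $ j)"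
        "cis (int_inner (k + axis j (- 1)) x) = cis (int_inner k x) * cis (- (x $ j))"
        unfolding int_inner_add ia by (simp_all add: cis_mult)
      have 2: "complex_of_real (w j x) = 1 / 2 + cis (- (a $ j)) * cis (x $ j) / 4 + cis (a $ j) * cis (- (x $ j)) / 4"
        by (simp add: complex_eq_iff w_def cos_diff sin_diff field_simps)
      show ?thesis unfolding 1 of_real_mult 2 by (simp add: algebra_simps)
    qed
    ultimately show "((\<lambda>x. E x * of_real (P x * w j x) * cis (int_inner k x)) has_integral 0) period_box"
      by simp
  qed
  have Zpow: "Z (\<lambda>x. P x * w j x ^ N)" if "Z P" for P j N
  proof (induction N)
    case (Suc N)
    from Zw[OF this, of j] show ?case by (simp add: mult_ac)
  qed (use that in simp)
  have Zprod: "Z (\<lambda>x. \<Prod>j\<in>J. w j x ^ N)" if "finite J" for J N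
    using that
  proof (induction J)
    case (insert j J)
    from Zpow[OF insert.IH, of j N] insert.hyps show ?case by (simp add: mult_ac)
  qed (use Z1 in simp)
  define W where "W x = (\<Prod>j\<in>UNIV. w j x)" for x
  define d where "d x = Re (cnj (E a) * E x)" for x
  have int0: "((\<lambda>x. d x * W x ^ N) has_integral 0) period_box" for N
  proof -
    have "((\<lambda>x. E x * of_real (W x ^ N)) has_integral 0) period_box"
      using Zprod[of UNIV N] unfolding Z_def W_def prod_power_distrib
      by (metis (no_types, lifting) cis_zero finite has_integral_cong int_inner_zero mult_1_right)
    from has_integral_linear[OF has_integral_mult_right[OF this, of "cnj (E a)"] bounded_linear_Re]
    show ?thesis by (simp add: comp_def d_def algebra_simps)
  qed
  have cd: "continuous_on UNIV d" unfolding d_def by (intro continuous_intros cont)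
  have cW: "continuous_on UNIV W" unfolding W_def w_def by (intro continuous_intros) auto
  have "d a = (norm (E a))\<^sup>2" unfolding cmod_power2 by (simp add: d_def power2_eq_square)
  then have da: "0 < d a" using nz by simp
  have w: "w j x = (cos ((x $ j - a $ j) / 2))\<^sup>2" for j x
  proof -
    define y where "y = (x $ j - a $ j) / 2"
    have "x $ j - a $ j = 2 * y" by (simp add: y_def)
    then have "w j x = (cos y)\<^sup>2" unfolding w_def using cos_double_cos[of y] by simp
    then show ?thesis by (simp add: y_def)
  qed
  have w0: "0 \<le> w j x" and w1: "w j x \<le> 1" for j x
    unfolding w by (simp_all add: abs_square_le_1)
  have W0: "0 \<le> W x" for x unfolding W_def by (intro prod_nonneg w0 ballI)
  have Wle: "W x \<le> w j x" for x j
  proof -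
    have "W x = w j x * (\<Prod>j\<in>UNIV - {j}. w j x)" unfolding W_def by (subst prod.remove[of _ j]) auto
    also have "\<dots> \<le> w j x * 1" by (intro mult_left_mono prod_le_1 w0 w1 conjI)
    finally show ?thesis by simp
  qed
  have Wa: "W a = 1" by (simp add: W_def w_def)
  have cube: "\<exists>\<delta>>0. \<forall>x. (\<forall>j. \<bar>x $ j - a $ j\<bar> \<le> \<delta>) \<longrightarrow> x \<in> S" if S: "open S" "a \<in> S" for S
  proof -
    obtain e where e: "e > 0" "ball a e \<subseteq> S" using openE[OF S] by blast
    have "x \<in> S" if x: "\<forall>j. \<bar>x $ j - a $ j\<bar> \<le> e / (2 * CARD('m))" for x
    proof -
      have "norm (x - a) \<le> (\<Sum>j\<in>UNIV. \<bar>(x - a) $ j\<bar>)" by (rule norm_le_l1_cart)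
      also have "\<dots> \<le> (\<Sum>j\<in>(UNIV :: 'm set). e / (2 * CARD('m)))" using x by (intro sum_mono) simp
      also have "\<dots> = e / 2" by simp
      finally have "dist a x < e" using e(1) by (simp add: dist_norm norm_minus_commute)
      then show ?thesis using e(2) by auto
    qed
    then show ?thesis using e(1) by (intro exI[of _ "e / (2 * CARD('m))"]) simp
  qed
  define \<eta> where "\<eta> = d a / 2"
  have \<eta>: "0 < \<eta>" using da by (simp add: \<eta>_def)
  have "open (box 0 (\<chi> j. 2 * pi) \<inter> {x. \<eta> < d x})"
    by (intro open_Int open_box open_Collect_less continuous_intros cd)
  moreover have "a \<in> box 0 (\<chi> j. 2 * pi) \<inter> {x. \<eta> < d x}"
    using a da by (simp add: mem_box_cart \<eta>_def)
  ultimately obtain \<delta> where \<delta>: "\<delta> > 0"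
    "\<And>x. (\<forall>j. \<bar>x $ j - a $ j\<bar> \<le> \<delta>) \<Longrightarrow> x \<in> box 0 (\<chi> j. 2 * pi) \<inter> {x. \<eta> < d x}"
    using cube by metis
  \<comment> \<open>The cube keeps off the faces of the box. Otherwise a point of the box could be
    close to a translate of \<open>a\<close> by a period, where \<open>W\<close> peaks
    again.\<close>
  have \<delta>a: "\<delta> < a $ j" "\<delta> < 2 * pi - a $ j" for j
  proof -
    have "(a + axis j \<delta>) \<in> box 0 (\<chi> j. 2 * pi)" "(a - axis j \<delta>) \<in> box 0 (\<chi> j. 2 * pi)"
      using \<delta>(2)[of "a + axis j \<delta>"] \<delta>(2)[of "a - axis j \<delta>"] \<delta>(1) by (auto simp: axis_def)
    then have "(a + axis j \<delta>) $ j < (\<chi> j. 2 * pi) $ j" "0 $ j < (a - axis j \<delta>) $ j"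
      unfolding mem_box_cart by blast+
    then show "\<delta> < a $ j" "\<delta> < 2 * pi - a $ j" by (auto simp: axis_def)
  qed
  have \<delta>pi: "\<delta> < pi" using \<delta>a[of undefined] by linarith
  define q where "q = (1 + cos \<delta>) / 2"
  have q: "0 < q" "q < 1"
    using cos_monotone_0_pi[of \<delta> pi] cos_monotone_0_pi[of 0 \<delta>] \<delta>(1) \<delta>pi by (auto simp: q_def)
  \<comment> \<open>A value strictly between \<open>q\<close> and 1: \<open>W\<close> is at most
    \<open>q\<close> outside the cube and above \<open>p\<close> close to \<open>a\<close>, so the
    powers of \<open>p\<close> win.\<close>
  define p where "p = (1 + q) / 2"
  have p: "q < p" "p < 1" using q by (auto simp: p_def)
  have "open {x. p < W x}" by (intro open_Collect_less continuous_intros cW)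
  moreover have "a \<in> {x. p < W x}" using Wa p by simp
  ultimately obtain \<delta>' where \<delta>': "\<delta>' > 0" "\<And>x. (\<forall>j. \<bar>x $ j - a $ j\<bar> \<le> \<delta>') \<Longrightarrow> p < W x"
    using cube by (metis mem_Collect_eq)
  define r where "r = min \<delta> \<delta>'"
  have r: "r > 0" "r \<le> \<delta>" "r \<le> \<delta>'" using \<delta>(1) \<delta>'(1) by (auto simp: r_def)
  have outside: "W x \<le> q" if x: "x \<in> period_box" and j: "\<delta> < \<bar>x $ j - a $ j\<bar>" for x j
  proof -
    have xj: "0 \<le> x $ j" "x $ j \<le> 2 * pi" using x by (auto simp: mem_box_cart)
    have "cos \<bar>x $ j - a $ j\<bar> \<le> cos \<delta>"
    proof (cases "\<bar>x $ j - a $ j\<bar> \<le> pi")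
      case True
      then show ?thesis using j \<delta>(1) by (intro cos_monotone_0_pi_le) auto
    next
      case False
      have "cos \<bar>x $ j - a $ j\<bar> = cos (2 * pi - \<bar>x $ j - a $ j\<bar>)" by (simp add: cos_diff)
      also have "\<dots> \<le> cos \<delta>"
        using False \<delta>(1) xj \<delta>a[of j] by (intro cos_monotone_0_pi_le) auto
      finally show ?thesis .
    qed
    then have "w j x \<le> q" by (simp add: w_def q_def)
    then show ?thesis using Wle[of x j] by linarith
  qed
  have "compact (d ` period_box)"
    by (intro compact_continuous_image continuous_on_subset[OF cd] compact_cbox) auto
  then obtain M where M: "\<And>x. x \<in> period_box \<Longrightarrow> \<bar>d x\<bar> \<le> M"
    using compact_imp_bounded bounded_iff by (metis imageI real_norm_def)
  have "a \<in> period_box" using a by (simp add: mem_box_cart less_imp_le)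
  then have M0: "0 \<le> M" using M[of a] by linarith
  define L where "L = cbox (a - (\<chi> j. r)) (a + (\<chi> j. r))"
  have L: "\<bar>x $ j - a $ j\<bar> \<le> r" if "x \<in> L" for x j
    using that by (auto simp: L_def mem_box_cart abs_le_iff algebra_simps)
  have LQ: "L \<subseteq> period_box"
  proof
    fix x assume "x \<in> L"
    then have "x \<in> box 0 (\<chi> j. 2 * pi)" using \<delta>(2)[of x] L r(2) order_trans by blast
    then show "x \<in> period_box" using box_subset_cbox by blast
  qed
  \<comment> \<open>The added constant \<open>M q^N\<close> makes the integrand nonnegative on the
    whole box, so its integral over \<open>L\<close> bounds the total from below; the total is the
    integral of that constant, since \<open>d W^N\<close> integrates to 0.\<close>
  have key: "\<eta> * p ^ N * measure lborel L \<le> M * q ^ N * measure lborel (period_box :: (real ^ 'm) set)" for N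
  proof -
    let ?g = "\<lambda>x. d x * W x ^ N + M * q ^ N"
    have Mq: "0 \<le> M * q ^ N" using M0 q by simp
    have cg: "continuous_on UNIV ?g" by (intro continuous_intros cd cW)
    have ig: "?g integrable_on cbox u v" for u v
      by (intro integrable_continuous continuous_on_subset[OF cg]) auto
    have "(?g has_integral 0 + measure lborel (period_box :: (real ^ 'm) set) *\<^sub>R (M * q ^ N)) period_box"
      by (intro has_integral_add int0 has_integral_const)
    then have I: "integral period_box ?g = M * q ^ N * measure lborel (period_box :: (real ^ 'm) set)"
      by (simp add: integral_unique mult.commute)
    have nn: "0 \<le> ?g x" if x: "x \<in> period_box" for x
    proof (cases "\<forall>j. \<bar>x $ j - a $ j\<bar> \<le> \<delta>")
      case True
      then have "0 \<le> d x" using \<delta>(2)[of x] \<eta> by auto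
      then show ?thesis using W0[of x] Mq by simp
    next
      case False
      then obtain j where "\<delta> < \<bar>x $ j - a $ j\<bar>" by (auto simp: not_le)
      then have "W x ^ N \<le> q ^ N" using outside[OF x] W0 by (intro power_mono) auto
      then have "\<bar>d x\<bar> * W x ^ N \<le> M * q ^ N"
        using M[OF x] M0 W0[of x] by (intro mult_mono) auto
      moreover have "- (\<bar>d x\<bar> * W x ^ N) \<le> d x * W x ^ N"
        using W0[of x] by (metis abs_ge_minus_self abs_ge_self minus_le_iff mult_minus_left mult_right_mono zero_le_power)
      ultimately show ?thesis by linarith
    qed
    have lower: "\<eta> * p ^ N \<le> ?g x" if "x \<in> L" for x
    proof -
      have "\<forall>j. \<bar>x $ j - a $ j\<bar> \<le> \<delta>" "\<forall>j. \<bar>x $ j - a $ j\<bar> \<le> \<delta>'"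
        using L[OF that] r order_trans by blast+
      then have "\<eta> < d x" "p < W x" using \<delta>(2)[of x] \<delta>'(2)[of x] by auto
      then have "\<eta> * p ^ N \<le> d x * W x ^ N"
        using \<eta> p q by (intro mult_mono power_mono) auto
      then show ?thesis using Mq by linarith
    qed
    have "\<eta> * p ^ N * measure lborel L = integral L (\<lambda>x. \<eta> * p ^ N)"
      unfolding L_def by (simp add: mult.commute)
    also have "\<dots> \<le> integral L ?g"
      unfolding L_def by (rule integral_le) (use lower ig L_def in auto)
    also have "\<dots> \<le> integral period_box ?g"
      using LQ nn ig by (intro integral_subset_le) (auto simp: L_def)
    finally show ?thesis unfolding I .
  qed
  have mL: "0 < measure lborel L"
  proof -
    have "a \<in> L" using r by (simp add: L_def mem_box_cart)
    then show ?thesis using r unfolding L_def by (subst content_cbox_cart) (auto intro!: prod_pos)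
  qed
  have "(\<lambda>N. M * measure lborel (period_box :: (real ^ 'm) set) * (q / p) ^ N) \<longlonglongrightarrow> M * measure lborel (period_box :: (real ^ 'm) set) * 0"
    by (intro tendsto_mult tendsto_const LIMSEQ_power_zero) (use p q in auto)
  then have "\<eta> * measure lborel L \<le> M * measure lborel (period_box :: (real ^ 'm) set) * 0"
  proof (rule LIMSEQ_le_const)
    have "\<eta> * measure lborel L \<le> M * measure lborel (period_box :: (real ^ 'm) set) * (q / p) ^ N" for N
      using key[of N] p q by (simp add: power_divide field_simps)
    then show "\<exists>n. \<forall>N\<ge>n. \<eta> * measure lborel L \<le> M * measure lborel (period_box :: (real ^ 'm) set) * (q / p) ^ N" by blast
  qed
  then show False using \<eta> mL by (simp add: mult_le_0_iff)
qed

text \<open>The peak argument needs room on all sides, so interior points come first; the faces of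
  the box follow by continuity, all other points by periodicity.\<close>

lemma fourier_unique:
  fixes E :: "real ^ 'm \<Rightarrow> complex"
  assumes cont: "continuous_on UNIV E" and per: "\<And>x i. E (x + axis i (2 * pi)) = E x"
    and zero: "\<And>k. fourier k E = 0"
  shows "E x = 0"
proof -
  have "(\<chi> i. pi) \<in> box 0 (\<chi> i. 2 * pi :: real ^ 'm)" by (simp add: mem_box_cart)
  then have ne: "box 0 (\<chi> i. 2 * pi :: real ^ 'm) \<noteq> {}" by blast
  obtain x' k where x': "x' \<in> period_box" "x = x' + (\<chi> i. 2 * pi * of_int (k i))"
    using periodic_reduce[of x] by metis
  have "E x = E x'" unfolding x'(2) by (rule lattice_periodic[OF per])
  also have "E x' = 0"
  proof (rule continuous_constant_on_closure[where S = "box 0 (\<chi> i. 2 * pi)"])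
    show "E y = 0" if "y \<in> box 0 (\<chi> i. 2 * pi)" for y
      using that by (intro fourier_unique_interior[OF cont zero]) (auto simp: mem_box_cart)
    show "continuous_on (closure (box 0 (\<chi> i. 2 * pi))) E"
      by (rule continuous_on_subset[OF cont]) simp
    show "x' \<in> closure (box 0 (\<chi> i. 2 * pi))" using x'(1) closure_box[OF ne] by simp
  qed
  finally show ?thesis .
qed

lemma fourier_diff:
  fixes g h :: "real ^ 'm \<Rightarrow> complex"
  assumes "continuous_on UNIV g" "continuous_on UNIV h"
  shows "fourier k (\<lambda>x. g x - h x) = fourier k g - fourier k h"
proof -
  have "(\<lambda>x. f x * cis (- int_inner k x)) integrable_on period_box" if "continuous_on UNIV f" for f
    by (intro integrable_continuous continuous_intros continuous_on_subset[OF that]) auto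
  from integral_diff[OF this[OF assms(1)] this[OF assms(2)]]
  show ?thesis by (simp add: fourier_def left_diff_distrib diff_divide_distrib)
qed

section \<open>Quasi-periodic analytic functions as Fourier--Taylor series\<close>

text \<open>Decay of the Fourier coefficients of \<open>B n\<close>, with constant
  \<open>2 C / t^n\<close>, makes the double series converge on half the radius. For fixed
  \<open>r\<close> its sum and \<open>F\<close> are continuous on the torus with equal Fourier
  coefficients, hence equal; restriction to the line of multiples of \<open>\<omega>\<close> gives
  \<open>f\<close>.\<close>

lemma quasi_periodic_near0_cls:
  fixes \<omega> :: "real ^ 'm"
  assumes "quasi_periodic_near0 \<omega> f"
  shows "cls \<omega> 0 f"
proof -
  obtain F :: "(real ^ 'm) \<times> real \<Rightarrow> real" and \<rho> where \<rho>: "\<rho> > 0"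
    and an: "real_analytic_on F (UNIV \<times> {-\<rho><..<\<rho>})"
    and per: "\<And>x i r. \<bar>r\<bar> < \<rho> \<Longrightarrow> F (x + axis i (2 * pi), r) = F (x, r)"
    and fF: "\<And>\<theta> r. \<bar>r\<bar> < \<rho> \<Longrightarrow> f (\<theta>, r) = F (\<theta> *\<^sub>R \<omega>, r)"
    using assms unfolding quasi_periodic_near0_def by blast
  obtain t C B A where t: "0 < t" "t < \<rho>"
    and cF: "\<And>r. \<bar>r\<bar> \<le> t \<Longrightarrow> continuous_on UNIV (\<lambda>x. F (x, r))"
    and BF: "\<And>x r. \<bar>r\<bar> \<le> t \<Longrightarrow> ((\<lambda>n. B n x * r ^ n) has_sum F (x, r)) UNIV"
    and Bb: "\<And>n x. \<bar>B n x\<bar> * t ^ n \<le> C" and Bp: "\<And>n x i. B n (x + axis i (2 * pi)) = B n x"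
    and Ab: "\<And>i l n x. \<bar>A i l n x\<bar> * (t ^ l * t ^ n) \<le> C"
    and AB: "\<And>i n x \<tau>. \<bar>\<tau>\<bar> \<le> t \<Longrightarrow> ((\<lambda>l. A i l n x * \<tau> ^ l) has_sum B n (x + axis i \<tau>)) UNIV"
    using periodic_analytic_expansion[OF \<rho> an per] by blast
  have cB: "continuous_on UNIV (B n)" for n
    by (rule powser_coeff_continuous[OF t(1) Bb, where G = "\<lambda>r x. F (x, r)"]) (use cF BF in auto)
  define c where "c z = fourier (fst z) (\<lambda>x. complex_of_real (B (snd z) x))" for z
  \<comment> \<open>Half of the decay rate becomes the width, the other half pays for summability
    over the lattice.\<close>
  define s where "s = t / (4 * CARD('m))"
  have s: "0 < s" using t by (simp add: s_def)
  have C: "0 \<le> C" using Bb[of 0 undefined] by simp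
  have dec: "norm (c z) * wt s (t / 2) z \<le> (2 * C) * (exp (- s * l1_norm (fst z)) * (1 / 2) ^ snd z)" for z
  proof -
    obtain k n where z: "z = (k, n)" by fastforce
    have "norm (c z) * exp (t / (2 * CARD('m)) * l1_norm k) \<le> 2 * (C / t ^ n)"
      unfolding c_def z fst_conv snd_conv
    proof (rule fourier_decay[OF t(1) cB Bp, where A = "\<lambda>i l. A i l n"])
      show "\<bar>A i l n x\<bar> * t ^ l \<le> C / t ^ n" for i l x using Ab[of i l n x] t by (simp add: field_simps)
    qed (rule AB)
    also have "t / (2 * CARD('m)) * l1_norm k = s * l1_norm k + s * l1_norm k" by (simp add: s_def field_simps)
    finally have "norm (c z) * exp (s * l1_norm k) * exp (s * l1_norm k) \<le> 2 * C / t ^ n"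
      unfolding exp_add by (simp only: mult.assoc times_divide_eq_right)
    then have "norm (c z) * exp (s * l1_norm k) * exp (s * l1_norm k) * exp (- s * l1_norm k)
        \<le> 2 * C / t ^ n * exp (- s * l1_norm k)" by (rule mult_right_mono) simp
    moreover have "exp (s * l1_norm k) * exp (- s * l1_norm k) = 1" by (simp add: exp_minus)
    ultimately have "norm (c z) * exp (s * l1_norm k) \<le> 2 * C / t ^ n * exp (- s * l1_norm k)"
      by (simp only: mult.assoc mult_1_right)
    then have "norm (c z) * exp (s * l1_norm k) * (t / 2) ^ n \<le> 2 * C / t ^ n * exp (- s * l1_norm k) * (t / 2) ^ n"
      using t by (intro mult_right_mono) auto
    also have "\<dots> = (2 * C) * (exp (- s * l1_norm k) * (1 / 2) ^ n)" using t by (simp add: power_divide)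
    finally show ?thesis by (simp add: wt_def z mult.assoc)
  qed
  have half: "(\<lambda>n. (1 / 2 :: real) ^ n) summable_on (UNIV :: nat set)"
    using has_sum_half_powers has_sum_imp_summable by blast
  have sm: "(\<lambda>z. norm (c z) * wt s (t / 2) z) summable_on UNIV"
  proof -
    have e: "(\<lambda>k :: int ^ 'm. exp (- s * l1_norm k)) summable_on UNIV" by (rule summable_exp_l1_norm[OF s])
    have "((\<lambda>(k :: int ^ 'm, n). exp (- s * l1_norm k) * (1 / 2 :: real) ^ n) has_sum
        infsum (\<lambda>k :: int ^ 'm. exp (- s * l1_norm k)) UNIV * 2) (UNIV \<times> (UNIV :: nat set))"
      by (rule has_sum_times) (use e half has_sum_half_powers in auto)
    then have "(\<lambda>z. exp (- s * l1_norm (fst z :: int ^ 'm)) * (1 / 2 :: real) ^ snd z) summable_on UNIV"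
      by (simp add: case_prod_beta' has_sum_imp_summable)
    then have "(\<lambda>z. (2 * C) * (exp (- s * l1_norm (fst z :: int ^ 'm)) * (1 / 2 :: real) ^ snd z)) summable_on UNIV"
      by (rule summable_on_cmult_right)
    then show ?thesis
      by (rule summable_on_comparison_test) (use dec t in \<open>auto simp: wt_def\<close>)
  qed
  have main: "((\<lambda>z. c z * torus_chi z (x, r)) has_sum complex_of_real (F (x, r))) UNIV" if r: "\<bar>r\<bar> \<le> t / 2" for x r
  proof -
    have rt: "\<bar>r\<bar> \<le> t" using r by linarith
    define D where "D x = (\<Sum>\<^sub>\<infinity>z. c z * torus_chi z (x, r))" for x
    have nb: "norm (c z * torus_chi z (x, r)) \<le> norm (c z) * wt s (t / 2) z" for z x
      unfolding norm_mult by (intro mult_left_mono norm_torus_chi_le) (use s r in auto)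
    have D: "((\<lambda>z. c z * torus_chi z (x, r)) has_sum D x) UNIV" for x
    proof -
      have "(\<lambda>z. norm (c z * torus_chi z (x, r))) summable_on UNIV"
        by (rule summable_on_comparison_test[OF sm]) (use nb in auto)
      then show ?thesis unfolding D_def by (rule has_sum_infsum[OF abs_summable_summable])
    qed
    have cchi: "continuous_on UNIV (\<lambda>x. c z * torus_chi z (x, r))" for z
      unfolding torus_chi_def fst_conv snd_conv by (intro continuous_intros)
    have cD: "continuous_on UNIV D" by (rule continuous_on_has_sum[OF nb sm cchi D])
    have coeff: "fourier k (\<lambda>x. complex_of_real (F (x, r))) = fourier k D" for k
    proof -
      have "((\<lambda>n. fourier k (\<lambda>x. complex_of_real (B n x * r ^ n))) has_sum
          fourier k (\<lambda>x. complex_of_real (F (x, r)))) UNIV"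
      proof (rule fourier_has_sum)
        show "norm (complex_of_real (B n x * r ^ n)) \<le> C * (1 / 2) ^ n" for n x
        proof -
          have "norm (complex_of_real (B n x * r ^ n)) = \<bar>B n x\<bar> * \<bar>r\<bar> ^ n"
            by (simp only: norm_of_real abs_mult power_abs)
          also have "\<dots> \<le> \<bar>B n x\<bar> * (t / 2) ^ n" using r by (intro mult_left_mono power_mono) auto
          also have "\<dots> = (\<bar>B n x\<bar> * t ^ n) * (1 / 2) ^ n" by (simp add: power_divide)
          also have "\<dots> \<le> C * (1 / 2) ^ n" by (intro mult_right_mono Bb) auto
          finally show ?thesis .
        qed
        show "(\<lambda>n. C * (1 / 2) ^ n) summable_on (UNIV :: nat set)" by (rule summable_on_cmult_right[OF half])
        show "continuous_on UNIV (\<lambda>x. complex_of_real (B n x * r ^ n))" for n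
          by (intro continuous_intros cB)
        show "((\<lambda>n. complex_of_real (B n x * r ^ n)) has_sum complex_of_real (F (x, r))) UNIV" for x
          by (rule has_sum_of_real[OF BF[OF rt]])
      qed
      moreover have "fourier k (\<lambda>x. complex_of_real (B n x * r ^ n)) = c (k, n) * of_real (r ^ n)" for n
        using fourier_cmult[of k "complex_of_real (r ^ n)" "\<lambda>x. complex_of_real (B n x)"]
        unfolding c_def fst_conv snd_conv by (simp only: of_real_mult mult.commute)
      ultimately have 1: "((\<lambda>n. c (k, n) * of_real (r ^ n)) has_sum fourier k (\<lambda>x. complex_of_real (F (x, r)))) UNIV"
        by simp
      have "((\<lambda>z. fourier k (\<lambda>x. c z * torus_chi z (x, r))) has_sum fourier k D) UNIV"
        by (rule fourier_has_sum[OF nb sm cchi D])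
      moreover have "fourier k (\<lambda>x. c z * torus_chi z (x, r)) = (if fst z = k then c z * of_real (r ^ snd z) else 0)" for z
      proof -
        have "c z * torus_chi z (x, r) = (c z * of_real (r ^ snd z)) * cis (int_inner (fst z) x)" for x
          by (simp add: torus_chi_def)
        then show ?thesis by (simp only: fourier_cmult fourier_cis) auto
      qed
      ultimately have "((\<lambda>z. if fst z = k then c z * of_real (r ^ snd z) else 0) has_sum fourier k D) UNIV"
        by simp
      moreover have "((\<lambda>z. if fst z = k then c z * of_real (r ^ snd z) else 0) has_sum fourier k D) UNIV \<longleftrightarrow>
          ((\<lambda>z. c z * of_real (r ^ snd z)) has_sum fourier k D) (Pair k ` UNIV)"
        by (rule has_sum_cong_neutral) auto
      ultimately have "((\<lambda>n. c (k, n) * of_real (r ^ n)) has_sum fourier k D) UNIV"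
        by (simp add: has_sum_reindex inj_on_def comp_def)
      with 1 show ?thesis by (rule has_sum_unique)
    qed
    have cF': "continuous_on UNIV (\<lambda>x. complex_of_real (F (x, r)))" by (intro continuous_intros cF rt)
    have "complex_of_real (F (x, r)) - D x = 0"
    proof (rule fourier_unique[of "\<lambda>x. complex_of_real (F (x, r)) - D x"])
      show "continuous_on UNIV (\<lambda>x. complex_of_real (F (x, r)) - D x)" by (intro continuous_intros cF' cD)
      have "D (x + axis i (2 * pi)) = D x" for x i unfolding D_def torus_chi_periodic ..
      then show "complex_of_real (F (x + axis i (2 * pi), r)) - D (x + axis i (2 * pi)) =
          complex_of_real (F (x, r)) - D x" for x i
        using per[of r x i] rt t by simp
      show "fourier k (\<lambda>x. complex_of_real (F (x, r)) - D x) = 0" for k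
        by (simp add: fourier_diff[OF cF' cD] coeff)
    qed
    then show ?thesis using D[of x] by simp
  qed
  define S where "S = infsum (\<lambda>z. norm (c z) * wt s (t / 2) z) UNIV"
  have "brep \<omega> s (t / 2) 0 c (\<lambda>p. complex_of_real (f p)) S"
    unfolding brep_def
  proof (intro conjI allI impI)
    show "0 \<le> s" "0 < t / 2" using s t by auto
    show "\<exists>S'\<le>S. ((\<lambda>z. norm (c z) * wt s (t / 2) z) has_sum S') UNIV"
      using has_sum_infsum[OF sm] unfolding S_def by blast
    show "((\<lambda>z. c z * chi \<omega> z p) has_sum complex_of_real (f p)) UNIV" if "\<bar>snd p\<bar> \<le> t / 2" for p
    proof -
      obtain \<theta> r where p: "p = (\<theta>, r)" by fastforce
      have "\<bar>r\<bar> < \<rho>" using that t by (simp add: p)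
      then show ?thesis using main[of r "\<theta> *\<^sub>R \<omega>"] that by (simp add: p torus_chi_scaleR fF)
    qed
  qed simp
  then show ?thesis unfolding cls_def bnd_def using s by blast
qed

text \<open>A function of the angle is treated as a function of \<open>(\<theta>, r)\<close>
  constant in \<open>r\<close>; its Taylor coefficient of degree 0 is the function itself.\<close>

lemma quasi_periodic_qp:
  fixes \<omega> :: "real ^ 'm"
  assumes "quasi_periodic \<omega> \<phi>"
  shows "qp \<omega> \<phi>"
proof -
  obtain \<Phi> :: "real ^ 'm \<Rightarrow> real" where \<Phi>: "real_analytic_on \<Phi> UNIV"
    "\<And>x i. \<Phi> (x + axis i (2 * pi)) = \<Phi> x" "\<And>\<theta>. \<phi> \<theta> = \<Phi> (\<theta> *\<^sub>R \<omega>)"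
    using assms unfolding quasi_periodic_def by blast
  let ?f = "\<lambda>p :: real \<times> real. \<phi> (fst p)"
  have "quasi_periodic_near0 \<omega> ?f"
    unfolding quasi_periodic_near0_def
  proof (intro exI[of _ "\<lambda>q. \<Phi> (fst q)"] exI[of _ 1] conjI allI impI)
    show "real_analytic_on (\<lambda>q. \<Phi> (fst q)) (UNIV \<times> {-1<..<1 :: real})"
      unfolding real_analytic_on_def
      by (intro ballI real_analytic_at_fst) (use \<Phi>(1) in \<open>simp add: real_analytic_on_def\<close>)
  qed (simp_all add: \<Phi>)
  then have "cls \<omega> 0 ?f" by (rule quasi_periodic_near0_cls)
  from taylor_r_cls(1)[OF this, of 0] taylor_r_cls(3)[OF this] show ?thesis by simp
qed

lemma cls_vanishing:
  fixes \<omega> :: "real ^ 'm"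
  assumes "quasi_periodic_near0 \<omega> f" "\<And>\<theta>. f (\<theta>, 0) = 0" "nonres \<omega> \<gamma>"
  shows "cls \<omega> 1 f"
proof -
  have f: "cls \<omega> 0 f" by (rule quasi_periodic_near0_cls[OF assms(1)])
  have "small 1 f"
    using taylor_r_cls(2)[OF f, of 1] by (simp add: taylor_r_cls(3)[OF f] assms(2))
  then show ?thesis by (rule cls_order[OF f assms(3)])
qed

lemma formal_quasi_periodic_nice:
  fixes \<omega> :: "real ^ 'm"
  assumes "formal_quasi_periodic \<omega> u"
  shows "nice \<omega> u" "fps_nth (u \<xi>) 0 = 0"
proof -
  have u: "\<And>\<xi>. fps_nth (u \<xi>) 0 = 0" "\<And>k. k \<ge> 1 \<Longrightarrow> quasi_periodic \<omega> (\<lambda>\<xi>. fps_nth (u \<xi>) k)"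
    using assms unfolding formal_quasi_periodic_def by blast+
  have "qp \<omega> (\<lambda>\<xi>. fps_nth (u \<xi>) k)" for k
  proof (cases "k = 0")
    case True
    then show ?thesis using qp_const[of \<omega> 0] by (simp add: u(1))
  qed (simp add: quasi_periodic_qp u(2))
  then show "nice \<omega> u" by (simp add: nice_def)
  show "fps_nth (u \<xi>) 0 = 0" by (rule u(1))
qed

lemma formal_near_id_nice:
  fixes \<omega> :: "real ^ 'm"
  assumes "formal_near_id \<omega> U"
  shows "\<exists>u v. U = (u, \<lambda>\<xi>. fps_X + v \<xi>) \<and> nice \<omega> u \<and> nice \<omega> v \<and>
    (\<forall>\<xi>. fps_nth (u \<xi>) 0 = 0) \<and> (\<forall>\<xi>. fps_nth (v \<xi>) 0 = 0)"
proof -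
  obtain u v where uv: "U = (u, \<lambda>\<xi>. fps_X + v \<xi>)" "formal_quasi_periodic \<omega> u" "formal_quasi_periodic \<omega> v"
    using assms unfolding formal_near_id_def by blast
  show ?thesis
    by (intro exI[of _ u] exI[of _ v] conjI allI formal_quasi_periodic_nice[OF uv(2)]
        formal_quasi_periodic_nice[OF uv(3)] uv(1))
qed

lemma amap_analytic_near_id:
  fixes \<omega> :: "real ^ 'm"
  assumes "amap \<omega> 0 1 T"
  shows "analytic_near_id \<omega> T"
proof -
  obtain u v where T: "T = perturbed_rotation 0 u v" "cls \<omega> 1 u" "cls \<omega> 1 v" using assms by (rule amapE)
  have "h (\<xi>, 0) = 0" if h: "cls \<omega> 1 h" for h \<xi>
  proof -
    obtain K \<rho> where "0 < \<rho>" "\<And>p. \<bar>snd p\<bar> \<le> \<rho> \<Longrightarrow> norm (h p) \<le> K * \<bar>snd p\<bar> ^ 1"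
      using cls_small[OF h] unfolding small_def by blast
    from this(2)[of "(\<xi>, 0)"] this(1) show ?thesis by simp
  qed
  then show ?thesis unfolding analytic_near_id_def
    using T cls_quasi_periodic_near0 by blast
qed

theorem theorem1p1:
  fixes \<omega> :: "real ^ 'm" and \<gamma>0 c0 \<sigma> :: real
    and f g :: "real \<times> real \<Rightarrow> real" and M :: planar_map
  assumes M: "M = perturbed_rotation \<gamma>0 f g"
    and "quasi_periodic_near0 \<omega> f" and "quasi_periodic_near0 \<omega> g"
    and "\<And>\<theta>. f (\<theta>, 0) = 0" and "\<And>\<theta>. g (\<theta>, 0) = 0"
    and "reversible involution_G M"
    and "c0 > 0" and "\<sigma> > 0" and "diophantine \<omega> \<gamma>0 c0 \<sigma>"
    and "\<exists>U V. formal_change \<omega> U V \<and>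
           formal_comp V (formal_comp (formal_perturbed_rotation \<gamma>0 f g) U)
             = formal_rotation \<gamma>0"
  shows "\<exists>T W. analytic_change \<omega> T W \<and>
           eq_near0 (W \<circ> M \<circ> T) (rotation \<gamma>0) \<and>
           eq_near0 (involution_G \<circ> T) (T \<circ> involution_G)"
proof -
  interpret diophantine_rotation \<omega> \<gamma>0 c0 \<sigma> by unfold_locales (use assms in auto)
  have f: "cls \<omega> 1 f" by (rule cls_vanishing[OF assms(2,4) nonres])
  have g: "cls \<omega> 1 g" by (rule cls_vanishing[OF assms(3,5) nonres])
  obtain U V where UV: "formal_near_id \<omega> U" "formal_near_id \<omega> V"
    "formal_comp U V = formal_id" "formal_comp V U = formal_id"
    "formal_comp V (formal_comp (formal_perturbed_rotation \<gamma>0 f g) U) = formal_rotation \<gamma>0"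
    using assms(10) unfolding formal_change_def by blast
  obtain u v where U: "U = (u, \<lambda>\<xi>. fps_X + v \<xi>)" "nice \<omega> u" "nice \<omega> v"
    "\<And>\<xi>. fps_nth (u \<xi>) 0 = 0" "\<And>\<xi>. fps_nth (v \<xi>) 0 = 0"
    using formal_near_id_nice[OF UV(1)] by blast
  obtain u2 v2 where V: "V = (u2, \<lambda>\<xi>. fps_X + v2 \<xi>)" "nice \<omega> u2" "nice \<omega> v2"
    "\<And>\<xi>. fps_nth (u2 \<xi>) 0 = 0" "\<And>\<xi>. fps_nth (v2 \<xi>) 0 = 0"
    using formal_near_id_nice[OF UV(2)] by blast
  \<comment> \<open>From here on the formal change is represented by its analytic
    truncations.\<close>
  have "fconj M" unfolding M by (rule fconj_of_formal[OF f g U V UV(3-5)])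
  moreover have "amap \<omega> \<gamma>0 1 M" unfolding M by (rule amapI[OF f g])
  ultimately obtain T W where T: "amap \<omega> 0 1 T" and W: "amap \<omega> 0 1 W"
    and TW: "eq_near0 (T \<circ> W) id" "eq_near0 (W \<circ> T) id"
    and MT: "eq_near0 (M \<circ> T) (T \<circ> rotation \<gamma>0)"
    and GT: "eq_near0 (involution_G \<circ> T) (T \<circ> involution_G)"
    using reversible_linearization assms(6) by blast
  have "eq_near0 (W \<circ> (M \<circ> T)) (W \<circ> (T \<circ> rotation \<gamma>0))" by (rule eq_near0_comp_left[OF MT])
  moreover have "eq_near0 ((W \<circ> T) \<circ> rotation \<gamma>0) (id \<circ> rotation \<gamma>0)"
    by (rule eq_near0_comp_right[OF TW(2) amap_tame[OF amap_rotation]])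
  ultimately have "eq_near0 (W \<circ> M \<circ> T) (rotation \<gamma>0)"
    unfolding comp_assoc id_comp by (rule eq_near0_trans)
  moreover have "analytic_change \<omega> T W"
    unfolding analytic_change_def inverse_near0_def
    using amap_analytic_near_id[OF T] amap_analytic_near_id[OF W] TW by blast
  ultimately show ?thesis using GT by blast
qed

end
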